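(* Let $N\ge 2$ and let $\Omega\subset\mathbb{R}^N$ be a bounded domain with smooth boundary $\partial\Omega$. Let $p\in(1,\infty)$, $q\in(2,\infty)$ with $p\neq q$. Let $a\in L^\infty(\Omega)$ and $b\in L^\infty(\partial\Omega)$ be nonnegative functions satisfying $$\int_\Omega a\,dx+\int_{\partial\Omega} b\,d\sigma>0 .$$ Put $W:=W^{1,\max\{p,q\}}(\Omega)$, $$\mathcal{C}:=\Big\{u\in W:\ \int_\Omega a|u|^{q-2}u\,dx+\int_{\partial\Omega} b|u|^{q-2}u\,d\sigma=0\Big\},$$ $$\lambda_1:=\inf_{w\in\mathcal{C}\setminus\{0\}}\ \frac{\int_\Omega|\nabla w|^q\,dx}{\int_\Omega a|w|^q\,dx+\int_{\partial\Omega} b|w|^q\,d\sigma},$$ where the quotient is taken to be $+\infty$ whenever its denominator is $0$. Then $\lambda_1$ is a positive constant, and the set of eigenvalues of the problem $$-\Delta_p u-\Delta_q u=\lambda a(x)|u|^{q-2}u\ \text{ in }\Omega,\qquad \big(|\nabla u|^{p-2}+|\nabla u|^{q-2}\big)\frac{\partial u}{\partial\nu}=\lambda b(x)|u|^{q-2}u\ \text{ on }\partial\Omega,$$ is exactly $\{0\}\cup(\lambda_1,\infty)$.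
   Context: For $r>1$, $\Delta_r u=\operatorname{div}(|\nabla u|^{r-2}\nabla u)$ is the $r$-Laplacian; $\nu$ is the unit outward normal to $\partial\Omega$; $d\sigma$ is the surface measure on $\partial\Omega$; values of Sobolev functions on $\partial\Omega$ are understood in the sense of traces. Expressions $|\xi|^{r-2}\xi$ are read as $0$ when $\xi=0$. Definition of eigenvalue: a number $\lambda\in\mathbb{R}$ is an eigenvalue of the problem if there exists $u_\lambda\in W\setminus\{0\}$, with $W=W^{1,\max\{p,q\}}(\Omega)$, such that for all $v\in W$ $$\int_\Omega\big(|\nabla u_\lambda|^{p-2}+|\nabla u_\lambda|^{q-2}\big)\nabla u_\lambda\cdot\nabla v\,dx=\lambda\Big(\int_\Omega a|u_\lambda|^{q-2}u_\lambda v\,dx+\int_{\partial\Omega} b|u_\lambda|^{q-2}u_\lambda v\,d\sigma\Big).$$ All functions are real-valued. *)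

theory Defs
  imports "HOL-Analysis.Analysis"
begin

section \<open>Smooth functions and domains with smooth boundary\<close>

text \<open>Intended for open \<open>S\<close>; in the application below \<open>S\<close> is the whole space.\<close>

fun Ck_on :: "nat \<Rightarrow> 'a::euclidean_space set \<Rightarrow> ('a \<Rightarrow> real) \<Rightarrow> bool" where
  "Ck_on 0 S f \<longleftrightarrow> continuous_on S f"
| "Ck_on (Suc k) S f \<longleftrightarrow>
     (\<forall>x\<in>S. f differentiable (at x)) \<and>
     (\<forall>i\<in>Basis. Ck_on k S (\<lambda>x. frechet_derivative f (at x) i))"

definition smooth :: "('a::euclidean_space \<Rightarrow> real) \<Rightarrow> bool" where
  "smooth f \<longleftrightarrow> (\<forall>k. Ck_on k UNIV f)"

definition grad :: "('a::euclidean_space \<Rightarrow> real) \<Rightarrow> 'a \<Rightarrow> 'a" where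
  "grad f x = (\<Sum>i\<in>Basis. frechet_derivative f (at x) i *\<^sub>R i)"

text \<open>
  Near each boundary point, after relabelling and reorienting the coordinate axes, the set is
  the strict epigraph of a smooth function of the remaining \<open>N - 1\<close> coordinates. The distinguished
  oriented axis is \<open>e\<close>; a function of the other coordinates is encoded as a function \<open>\<gamma>\<close> on the
  whole space that is invariant under translations along \<open>e\<close>.
\<close>

definition smooth_boundary :: "'a::euclidean_space set \<Rightarrow> bool" where
  "smooth_boundary \<Omega> \<longleftrightarrow>
     (\<forall>x\<in>frontier \<Omega>. \<exists>r>0. \<exists>e\<in>Basis \<union> uminus ` Basis. \<exists>\<gamma>.
        smooth \<gamma> \<and> (\<forall>y t. \<gamma> (y + t *\<^sub>R e) = \<gamma> y) \<and>
        \<Omega> \<inter> ball x r = {y \<in> ball x r. \<gamma> y < y \<bullet> e})"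

definition bounded_smooth_domain :: "'a::euclidean_space set \<Rightarrow> bool" where
  "bounded_smooth_domain \<Omega> \<longleftrightarrow>
     open \<Omega> \<and> connected \<Omega> \<and> \<Omega> \<noteq> {} \<and> bounded \<Omega> \<and> smooth_boundary \<Omega>"

section \<open>Surface measure\<close>

text \<open>
  The \<open>k\<close>-dimensional Hausdorff outer measure, normalised to agree with Lebesgue measure in
  dimension \<open>k\<close>. Boundedness of the covering sets is required explicitly because
  \<^const>\<open>diameter\<close> carries no information on unbounded sets.
\<close>

definition hausdorff_pre :: "nat \<Rightarrow> real \<Rightarrow> 'a::euclidean_space set \<Rightarrow> ennreal" where
  "hausdorff_pre k \<delta> A =
     (INF E \<in> {E :: nat \<Rightarrow> 'a set. A \<subseteq> (\<Union>n. E n) \<and> (\<forall>n. bounded (E n) \<and> diameter (E n) \<le> \<delta>)}.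
        \<Sum>n. ennreal (if E n = {} then 0 else unit_ball_vol (real k) * (diameter (E n) / 2) ^ k))"

definition hausdorff_outer :: "nat \<Rightarrow> 'a::euclidean_space set \<Rightarrow> ennreal" where
  "hausdorff_outer k A = (SUP \<delta>\<in>{0<..}. hausdorff_pre k \<delta> A)"

definition hausdorff_measure :: "nat \<Rightarrow> 'a::euclidean_space measure" where
  "hausdorff_measure k = measure_of UNIV (sets borel) (hausdorff_outer k)"

text \<open>Completed, as the counterpart of Lebesgue (rather than Borel) measure on the domain.\<close>

definition surface_measure :: "'a::euclidean_space set \<Rightarrow> 'a measure" where
  "surface_measure \<Omega> =
     completion (restrict_space (hausdorff_measure (DIM('a) - 1)) (frontier \<Omega>))"

section \<open>Lebesgue and Sobolev spaces\<close>

text \<open>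
  Elements of these spaces are represented by functions; two representatives that agree almost
  everywhere denote the same element.
\<close>

definition Lp :: "'a measure \<Rightarrow> real \<Rightarrow> ('a \<Rightarrow> 'b::euclidean_space) set" where
  "Lp M s = {f \<in> borel_measurable M. integrable M (\<lambda>x. norm (f x) powr s)}"

definition Linf :: "'a measure \<Rightarrow> ('a \<Rightarrow> real) set" where
  "Linf M = {f \<in> borel_measurable M. \<exists>C. AE x in M. \<bar>f x\<bar> \<le> C}"

definition test_function :: "'a::euclidean_space set \<Rightarrow> ('a \<Rightarrow> real) \<Rightarrow> bool" where
  "test_function \<Omega> \<phi> \<longleftrightarrow>
     smooth \<phi> \<and> compact (closure {x. \<phi> x \<noteq> 0}) \<and> closure {x. \<phi> x \<noteq> 0} \<subseteq> \<Omega>"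

definition locally_integrable ::
  "'a::euclidean_space set \<Rightarrow> ('a \<Rightarrow> 'b::euclidean_space) \<Rightarrow> bool" where
  "locally_integrable \<Omega> f \<longleftrightarrow> (\<forall>K. compact K \<and> K \<subseteq> \<Omega> \<longrightarrow> integrable (lebesgue_on K) f)"

definition weak_gradient ::
  "'a::euclidean_space set \<Rightarrow> ('a \<Rightarrow> real) \<Rightarrow> ('a \<Rightarrow> 'a) \<Rightarrow> bool" where
  "weak_gradient \<Omega> u g \<longleftrightarrow>
     locally_integrable \<Omega> u \<and> locally_integrable \<Omega> g \<and>
     (\<forall>\<phi>. test_function \<Omega> \<phi> \<longrightarrow>
        (\<forall>i\<in>Basis. (LINT x|lebesgue_on \<Omega>. u x * (grad \<phi> x \<bullet> i))
                   = - (LINT x|lebesgue_on \<Omega>. (g x \<bullet> i) * \<phi> x)))"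

text \<open>A weak gradient is determined only almost everywhere; this picks a representative.\<close>

definition wgrad :: "'a::euclidean_space set \<Rightarrow> ('a \<Rightarrow> real) \<Rightarrow> 'a \<Rightarrow> 'a" where
  "wgrad \<Omega> u = (SOME g. weak_gradient \<Omega> u g)"

definition Sobolev :: "'a::euclidean_space set \<Rightarrow> real \<Rightarrow> ('a \<Rightarrow> real) set" where
  "Sobolev \<Omega> s = {u \<in> Lp (lebesgue_on \<Omega>) s. \<exists>g \<in> Lp (lebesgue_on \<Omega>) s. weak_gradient \<Omega> u g}"

definition ae_zero_on :: "'a::euclidean_space set \<Rightarrow> ('a \<Rightarrow> real) \<Rightarrow> bool" where
  "ae_zero_on \<Omega> u \<longleftrightarrow> (AE x in lebesgue_on \<Omega>. u x = 0)"

text \<open>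
  The trace operator on \<open>W\<^sup>1\<^sup>,\<^sup>s\<close>, the continuous extension of the restriction map
  from functions smooth up to the boundary: \<open>t\<close> is the limit in \<open>L\<^sup>s\<close> on the
  boundary of the restrictions of some smooth \<open>\<phi> n\<close> that converge to \<open>u\<close> in the Sobolev norm.
\<close>

definition is_trace ::
  "'a::euclidean_space set \<Rightarrow> real \<Rightarrow> ('a \<Rightarrow> real) \<Rightarrow> ('a \<Rightarrow> real) \<Rightarrow> bool" where
  "is_trace \<Omega> s u t \<longleftrightarrow>
     u \<in> Sobolev \<Omega> s \<and> t \<in> Lp (surface_measure \<Omega>) s \<and>
     (\<exists>\<phi> :: nat \<Rightarrow> 'a \<Rightarrow> real. (\<forall>n. smooth (\<phi> n)) \<and>
        (\<lambda>n. LINT x|lebesgue_on \<Omega>. \<bar>\<phi> n x - u x\<bar> powr s) \<longlonglongrightarrow> 0 \<and>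
        (\<lambda>n. LINT x|lebesgue_on \<Omega>. norm (grad (\<phi> n) x - wgrad \<Omega> u x) powr s) \<longlonglongrightarrow> 0 \<and>
        (\<lambda>n. LINT x|surface_measure \<Omega>. \<bar>\<phi> n x - t x\<bar> powr s) \<longlonglongrightarrow> 0)"

definition boundary_trace :: "'a::euclidean_space set \<Rightarrow> real \<Rightarrow> ('a \<Rightarrow> real) \<Rightarrow> 'a \<Rightarrow> real" where
  "boundary_trace \<Omega> s u = (SOME t. is_trace \<Omega> s u t)"

section \<open>The eigenvalue problem\<close>

abbreviation Wspace :: "'a::euclidean_space set \<Rightarrow> real \<Rightarrow> real \<Rightarrow> ('a \<Rightarrow> real) set" where
  "Wspace \<Omega> p q \<equiv> Sobolev \<Omega> (max p q)"

abbreviation tr :: "'a::euclidean_space set \<Rightarrow> real \<Rightarrow> real \<Rightarrow> ('a \<Rightarrow> real) \<Rightarrow> 'a \<Rightarrow> real" where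
  "tr \<Omega> p q \<equiv> boundary_trace \<Omega> (max p q)"

text \<open>
  \<open>|\<xi>|\<^sup>r\<^sup>-\<^sup>2 \<xi>\<close> is rendered with \<open>powr\<close>; since \<open>0 powr s = 0\<close>, it vanishes at \<open>\<xi> = 0\<close> for every \<open>r\<close>.
\<close>

definition eigenvalue ::
  "'a::euclidean_space set \<Rightarrow> real \<Rightarrow> real \<Rightarrow> ('a \<Rightarrow> real) \<Rightarrow> ('a \<Rightarrow> real) \<Rightarrow> real \<Rightarrow> bool" where
  "eigenvalue \<Omega> p q a b \<mu> \<longleftrightarrow>
     (\<exists>u \<in> Wspace \<Omega> p q. \<not> ae_zero_on \<Omega> u \<and>
       (\<forall>v \<in> Wspace \<Omega> p q.
          (LINT x|lebesgue_on \<Omega>.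
             (norm (wgrad \<Omega> u x) powr (p - 2) + norm (wgrad \<Omega> u x) powr (q - 2))
               * (wgrad \<Omega> u x \<bullet> wgrad \<Omega> v x))
          = \<mu> * ((LINT x|lebesgue_on \<Omega>. a x * \<bar>u x\<bar> powr (q - 2) * u x * v x)
               + (LINT x|surface_measure \<Omega>.
                    b x * \<bar>tr \<Omega> p q u x\<bar> powr (q - 2) * tr \<Omega> p q u x * tr \<Omega> p q v x))))"

definition constraint_set ::
  "'a::euclidean_space set \<Rightarrow> real \<Rightarrow> real \<Rightarrow> ('a \<Rightarrow> real) \<Rightarrow> ('a \<Rightarrow> real) \<Rightarrow> ('a \<Rightarrow> real) set" where
  "constraint_set \<Omega> p q a b =
     {u \<in> Wspace \<Omega> p q.
        (LINT x|lebesgue_on \<Omega>. a x * \<bar>u x\<bar> powr (q - 2) * u x)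
        + (LINT x|surface_measure \<Omega>. b x * \<bar>tr \<Omega> p q u x\<bar> powr (q - 2) * tr \<Omega> p q u x) = 0}"

definition weighted_mass ::
  "'a::euclidean_space set \<Rightarrow> real \<Rightarrow> real \<Rightarrow> ('a \<Rightarrow> real) \<Rightarrow> ('a \<Rightarrow> real) \<Rightarrow> ('a \<Rightarrow> real) \<Rightarrow> real" where
  "weighted_mass \<Omega> p q a b w =
     (LINT x|lebesgue_on \<Omega>. a x * \<bar>w x\<bar> powr q)
     + (LINT x|surface_measure \<Omega>. b x * \<bar>tr \<Omega> p q w x\<bar> powr q)"

definition rayleigh_quotient ::
  "'a::euclidean_space set \<Rightarrow> real \<Rightarrow> real \<Rightarrow> ('a \<Rightarrow> real) \<Rightarrow> ('a \<Rightarrow> real) \<Rightarrow> ('a \<Rightarrow> real) \<Rightarrow> ereal" where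
  "rayleigh_quotient \<Omega> p q a b w =
     (if weighted_mass \<Omega> p q a b w = 0 then \<infinity>
      else ereal ((LINT x|lebesgue_on \<Omega>. norm (wgrad \<Omega> w x) powr q) / weighted_mass \<Omega> p q a b w))"

definition lambda1 ::
  "'a::euclidean_space set \<Rightarrow> real \<Rightarrow> real \<Rightarrow> ('a \<Rightarrow> real) \<Rightarrow> ('a \<Rightarrow> real) \<Rightarrow> ereal" where
  "lambda1 \<Omega> p q a b =
     (INF w \<in> {w \<in> constraint_set \<Omega> p q a b. \<not> ae_zero_on \<Omega> w}. rayleigh_quotient \<Omega> p q a b w)"

end

theory Submission
  imports Defs
begin

text \<open>
  Let \<open>N\<close> be the \<open>q\<close>-th root of the weighted mass. It is a seminorm, and a function satisfies the
  constraint exactly when it minimises \<open>N\<close> among its translates by constants. The constraint can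
  therefore be dropped: if \<open>m u\<close> is the \<open>N\<close>-distance of \<open>u\<close> to the constants and \<open>E r\<close> is the integral of
  the \<open>r\<close>-th power of the gradient, then \<open>lambda1\<close> is the infimum of \<open>E q / m powr q\<close>. It is positive by
  a Poincare inequality that includes the boundary values, and finite because the coordinate
  functions are not all constant almost everywhere for the weights. Testing the equation with \<open>1\<close> and
  with \<open>u\<close> excludes the nonzero numbers up to \<open>lambda1\<close>.

  For \<open>\<mu>\<close> above \<open>lambda1\<close> the function \<open>F = \<mu> * m powr q - E q\<close> is positive somewhere, and \<open>E p\<close> is
  minimised over the smooth functions with \<open>F \<ge> 1\<close>. An Ehrling inequality bounds the gradients, both
  for \<open>p < q\<close> and for \<open>p > q\<close>; a Rellich argument gives convergence in the domain and on its boundary;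
  and Clarkson's inequality for the larger exponent, applied to midpoints of the minimising
  sequence, makes the gradients converge strongly, so that weak compactness is not needed. A multiple
  of the limit is an eigenfunction.

  The inequalities for smooth functions come from integration along a direction transversal to the
  boundary. The surface measure enters only through the fact that sweeping it in such a direction
  gives at most a multiple of Lebesgue measure.
\<close>

section \<open>Power inequalities\<close>

text \<open>The sum of the two energies is not homogeneous, so no Rayleigh quotient describes the
  full problem. Minimising the energy of one exponent under a constraint homogeneous of the other
  degree restores scaling: the minimal value \<open>P0\<close> enters the equation as a factor
  between terms of degrees \<open>p - 1\<close> and \<open>q - 1\<close>, and because
  \<open>p \<noteq> q\<close> a dilation turns it into \<open>1\<close>. One argument thus serves
  both orders of the exponents; as \<open>q > 2\<close>, the larger of them exceeds
  \<open>2\<close>, as Clarkson's inequality requires. The side condition is nonlinear and would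
  bring a second multiplier; the minimum over added constants absorbs it. The weights may vanish on
  large sets or live on the boundary alone, so the weighted seminorm does not control a function,
  and the additive constant is fixed by an average over a convex body inside \<Omega>. The value
  \<open>lambda1\<close> itself is not an eigenvalue because the equation tested with
  \<open>u\<close> contains the extra energy \<open>E p\<close>, which would have to vanish. Since
  traces are defined as limits of restrictions, a function, its gradient and its trace are carried
  through the proof as three limits of one smooth sequence.\<close>

definition dual_pow :: "real \<Rightarrow> 'a::real_inner \<Rightarrow> 'a" where
 "dual_pow p x = norm x powr (p - 2) *\<^sub>R x"

lemma dual_pow_0 [simp]: "dual_pow p 0 = 0"
 by (simp add: dual_pow_def)

lemma dual_pow_inner_self: "dual_pow p x \<bullet> x = norm x powr p"
proof (cases "x = 0")
 case False
 then have "norm x powr (p - 2) * (norm x * norm x) = norm x powr p"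
  by (simp add: powr_diff power2_eq_square)
 then show ?thesis
  by (simp add: dual_pow_def dot_square_norm power2_eq_square)
qed simp

lemma norm_dual_pow: "norm (dual_pow p x) = (if x = 0 then 0 else norm x powr (p - 1))"
proof (cases "x = 0")
 case False
 then show ?thesis
  by (simp add: dual_pow_def powr_diff power2_eq_square)
qed simp

lemma norm_dual_pow_le: "norm (dual_pow p x) \<le> norm x powr (p - 1)"
 by (simp add: norm_dual_pow)

lemma dual_pow_scaleR:
 assumes "0 < t" shows "dual_pow p (t *\<^sub>R x) = t powr (p - 1) *\<^sub>R dual_pow p x"
proof -
 have "t powr (p - 2) * t = t powr (p - 1)"
  using assms by (simp add: powr_diff power2_eq_square)
 then show ?thesis
  using assms by (simp add: dual_pow_def powr_mult mult.assoc mult.commute[of _ t])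
qed

text \<open>Young's inequality with weights \<open>(p - 1) / p\<close> and \<open>1 / p\<close>,
  applied after Cauchy-Schwarz, places the convex function \<open>norm x powr p\<close> above its
  tangents. Convexity, Jensen's inequality, the derivative of the power integrals and the tangent
  bound for \<open>Mass\<close> all come from it.\<close>

lemma powr_ge_tangent:
 fixes x y :: "'a::real_inner"
 assumes "1 \<le> p"
 shows "norm x powr p + p * (dual_pow p x \<bullet> (y - x)) \<le> norm y powr p"
proof -
 have *: "p * (dual_pow p x \<bullet> y) \<le> (p - 1) * norm x powr p + norm y powr p"
 proof (cases "x = 0 \<or> y = 0")
  case False
  have "dual_pow p x \<bullet> y \<le> norm x powr (p - 1) * norm y"
   using norm_cauchy_schwarz[of "dual_pow p x" y] False by (simp add: norm_dual_pow)
  also have "norm x powr (p - 1) * norm y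
    = (norm x powr p) powr ((p - 1) / p) * (norm y powr p) powr (1 / p)"
   using assms by (simp add: powr_powr)
  also have "\<dots> \<le> ((p - 1) / p) * norm x powr p + (1 / p) * norm y powr p"
   using assms False by (intro Youngs_inequality_0) (auto simp: field_simps)
  finally have "p * (dual_pow p x \<bullet> y)
    \<le> p * (((p - 1) / p) * norm x powr p + (1 / p) * norm y powr p)"
   using assms by (intro mult_left_mono) auto
  then show ?thesis using assms by (simp add: distrib_left)
 qed (use assms in auto)
 then show ?thesis
  by (simp add: inner_diff_right dual_pow_inner_self algebra_simps)
qed

text \<open>The tangent inequalities at the point \<open>m\<close> between \<open>x\<close> and
  \<open>y\<close> are averaged; their linear terms cancel.\<close>

lemma powr_norm_convex:
 fixes x y :: "'a::real_inner"
 assumes "1 \<le> p" "0 \<le> t" "t \<le> 1"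
 shows "norm ((1 - t) *\<^sub>R x + t *\<^sub>R y) powr p \<le> (1 - t) * norm x powr p + t * norm y powr p"
proof -
 define m where "m = (1 - t) *\<^sub>R x + t *\<^sub>R y"
 have "(1 - t) * (norm m powr p + p * (dual_pow p m \<bullet> (x - m)))
   + t * (norm m powr p + p * (dual_pow p m \<bullet> (y - m)))
   \<le> (1 - t) * norm x powr p + t * norm y powr p"
  using assms by (intro add_mono mult_left_mono powr_ge_tangent) auto
 moreover have "(1 - t) * (dual_pow p m \<bullet> (x - m)) + t * (dual_pow p m \<bullet> (y - m)) = 0"
 proof -
  have "(1 - t) * (dual_pow p m \<bullet> (x - m)) + t * (dual_pow p m \<bullet> (y - m))
    = dual_pow p m \<bullet> ((1 - t) *\<^sub>R (x - m) + t *\<^sub>R (y - m))"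
   by (simp add: inner_add_right)
  also have "(1 - t) *\<^sub>R (x - m) + t *\<^sub>R (y - m) = 0"
   by (simp add: m_def algebra_simps)
  finally show ?thesis by simp
 qed
 moreover have "(1 - t) * (n + p * X) + t * (n + p * Y) = n + p * ((1 - t) * X + t * Y)" for n X Y :: real
  by (simp add: algebra_simps)
 ultimately show ?thesis
  unfolding m_def[symmetric] by simp
qed

lemma powr_norm_midpoint:
 fixes x y :: "'a::real_inner"
 assumes "1 \<le> p"
 shows "norm ((1/2) *\<^sub>R (x + y)) powr p \<le> (norm x powr p + norm y powr p) / 2"
 using powr_norm_convex[of p "1/2" x y] assms by (simp add: scaleR_add_right field_simps)

lemma powr_norm_add_le:
 fixes x y :: "'a::real_inner"
 assumes "1 \<le> p"
 shows "norm (x + y) powr p \<le> 2 powr (p - 1) * (norm x powr p + norm y powr p)"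
proof -
 have "norm (x + y) powr p = 2 powr p * norm ((1/2) *\<^sub>R (x + y)) powr p"
  by (simp add: powr_mult powr_divide)
 also have "\<dots> \<le> 2 powr p * ((norm x powr p + norm y powr p) / 2)"
  by (intro mult_left_mono powr_norm_midpoint assms) auto
 finally show ?thesis by (simp add: powr_diff)
qed

text \<open>A number in \<open>[0, 1]\<close> is at least its \<open>r\<close>-th power; this is
  applied to the shares \<open>a / (a + b)\<close> and \<open>b / (a + b)\<close>.\<close>

lemma powr_add_superadditive:
 fixes a b r :: real
 assumes "0 \<le> a" "0 \<le> b" "1 \<le> r"
 shows "a powr r + b powr r \<le> (a + b) powr r"
proof (cases "a + b = 0")
 case False
 then have s: "0 < a + b" using assms by auto
 have *: "c powr r \<le> (c / (a + b)) * (a + b) powr r" if "0 \<le> c" "c \<le> a + b" for c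
 proof -
  have "(c / (a + b)) powr r \<le> c / (a + b)"
   using powr_mono'[of 1 r "c / (a + b)"] that s assms by (auto simp: field_simps)
  then have "(c / (a + b)) powr r * (a + b) powr r \<le> (c / (a + b)) * (a + b) powr r"
   by (intro mult_right_mono) auto
  then show ?thesis using that s by (simp add: powr_divide)
 qed
 have "a powr r + b powr r \<le> (a / (a + b)) * (a + b) powr r + (b / (a + b)) * (a + b) powr r"
  using assms by (intro add_mono *) auto
 also have "\<dots> = (a + b) powr r"
  using s by (simp flip: distrib_right add_divide_distrib)
 finally show ?thesis .
next
 case True
 then have "a = 0" "b = 0" using assms by auto
 then show ?thesis by simp
qed

text \<open>By the parallelogram law the squared norms of the half sum and the half difference add
  up to the mean of the two squared norms. Raising to the power \<open>q / 2 \<ge> 1\<close> is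
  superadditive for the former sum and convex for the latter mean.\<close>

lemma clarkson:
 fixes x y :: "'a::real_inner"
 assumes "2 \<le> q"
 shows "norm ((1/2) *\<^sub>R (x + y)) powr q + norm ((1/2) *\<^sub>R (x - y)) powr q
     \<le> (norm x powr q + norm y powr q) / 2"
proof -
 have sq: "norm z powr q = (norm z ^ 2) powr (q / 2)" for z :: 'a
  using powr_powr[of "norm z" 2 "q / 2"] by simp
 let ?a = "norm ((1/2) *\<^sub>R (x + y)) ^ 2" and ?b = "norm ((1/2) *\<^sub>R (x - y)) ^ 2"
 have "norm ((1/2) *\<^sub>R (x + y)) powr q + norm ((1/2) *\<^sub>R (x - y)) powr q
   = ?a powr (q/2) + ?b powr (q/2)"
  by (simp only: sq)
 also have "\<dots> \<le> (?a + ?b) powr (q/2)"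
  using assms by (intro powr_add_superadditive) auto
 also have "?a + ?b = (1/2) *\<^sub>R (norm x ^ 2 + norm y ^ 2)"
  unfolding power2_norm_eq_inner
  by (simp add: inner_add_left inner_add_right inner_diff_left inner_diff_right inner_commute algebra_simps)
 also have "((1/2) *\<^sub>R (norm x ^ 2 + norm y ^ 2)) powr (q/2)
   \<le> ((norm x ^ 2) powr (q/2) + (norm y ^ 2) powr (q/2)) / 2"
  using powr_norm_midpoint[of "q/2" "norm x ^ 2" "norm y ^ 2"] assms by auto
 finally show ?thesis by (simp only: sq[symmetric])
qed

section \<open>Lebesgue spaces\<close>

text \<open>The tangent inequality at the mean is integrated; its linear term drops out because the
  measure has mass \<open>1\<close>. The right side is an extended integral, so the estimate can be
  used before integrability is known.\<close>

lemma jensen_powr: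
 fixes f :: "'a \<Rightarrow> 'b::euclidean_space"
 assumes M: "emeasure M (space M) = 1" and s: "1 \<le> s"
 shows "ennreal (norm (LINT x|M. f x) powr s) \<le> (\<integral>\<^sup>+x. ennreal (norm (f x) powr s) \<partial>M)"
proof (cases "integrable M f \<and> (\<integral>\<^sup>+x. ennreal (norm (f x) powr s) \<partial>M) < \<infinity>")
 case True
 interpret finite_measure M by standard (use M in auto)
 define m where "m = (LINT x|M. f x)"
 have f [measurable]: "f \<in> borel_measurable M" and i: "integrable M f"
  using True by auto
 have i2: "integrable M (\<lambda>x. norm (f x) powr s)"
  using True by (intro integrableI_nonneg) auto
 have "norm m powr s = (LINT x|M. norm m powr s + s * (dual_pow s m \<bullet> (f x - m)))"
  using i M by (simp add: measure_def inner_diff_right m_def integral_diff)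
 also have "\<dots> \<le> (LINT x|M. norm (f x) powr s)"
  using i i2 powr_ge_tangent[OF s] by (intro integral_mono) (auto simp: inner_diff_right)
 finally show ?thesis
  using i2 unfolding m_def[symmetric]
  by (subst nn_integral_eq_integral) auto
next
 \<comment> \<open>Either the right side is infinite, or \<open>f\<close> is not integrable and its
   integral has the default value \<open>0\<close>.\<close>
 case False
 then show ?thesis
  using s not_integrable_integral_eq[of M f] by (cases "integrable M f") (auto simp: not_less top_unique)
qed

definition Lnorm :: "'a measure \<Rightarrow> real \<Rightarrow> ('a \<Rightarrow> 'b::euclidean_space) \<Rightarrow> real" where
 "Lnorm M s f = (LINT x|M. norm (f x) powr s) powr (1 / s)"

abbreviation absint :: "'a measure \<Rightarrow> real \<Rightarrow> ('a \<Rightarrow> real) \<Rightarrow> real" where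
 "absint M s f \<equiv> LINT x|M. \<bar>f x\<bar> powr s"

abbreviation Lp_tendsto :: "'a measure \<Rightarrow> real \<Rightarrow> (nat \<Rightarrow> 'a \<Rightarrow> 'b::euclidean_space) \<Rightarrow> ('a \<Rightarrow> 'b) \<Rightarrow> bool" where
 "Lp_tendsto M s f g \<equiv> (\<lambda>n. Lnorm M s (\<lambda>x. f n x - g x)) \<longlonglongrightarrow> 0"

lemma Lnorm_nonneg [simp]: "0 \<le> Lnorm M s f"
 by (simp add: Lnorm_def)

lemma Lnorm_powr:
 assumes "0 < s" shows "Lnorm M s f powr s = (LINT x|M. norm (f x) powr s)"
 using assms by (simp add: Lnorm_def powr_powr)

lemma Lnorm_le_iff:
 assumes "0 < s" "0 \<le> A"
 shows "Lnorm M s f \<le> A \<longleftrightarrow> (LINT x|M. norm (f x) powr s) \<le> A powr s"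
 using assms Lnorm_powr[OF assms(1), of M f]
 by (metis Lnorm_nonneg powr_le_cancel_iff powr_less_mono2 not_le powr_mono2 less_imp_le)

lemma LpD: "f \<in> Lp M s \<Longrightarrow> f \<in> borel_measurable M" "f \<in> Lp M s \<Longrightarrow> integrable M (\<lambda>x. norm (f x) powr s)"
 by (auto simp: Lp_def)

lemma LpI:
 assumes "f \<in> borel_measurable M" "integrable M (\<lambda>x. norm (f x) powr s)"
 shows "f \<in> Lp M s"
 using assms by (auto simp: Lp_def)

lemma Lp_scaleR:
 assumes "f \<in> Lp M s" shows "(\<lambda>x. c *\<^sub>R f x) \<in> Lp M s"
 using LpD[OF assms] by (intro LpI) (auto simp: powr_mult)

lemma Lp_add:
 assumes "f \<in> Lp M s" "g \<in> Lp M s" "1 \<le> s" shows "(\<lambda>x. f x + g x) \<in> Lp M s"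
proof (rule LpI)
 have [measurable]: "f \<in> borel_measurable M" "g \<in> borel_measurable M"
  using assms by (auto dest: LpD)
 show "(\<lambda>x. f x + g x) \<in> borel_measurable M" by measurable
 show "integrable M (\<lambda>x. norm (f x + g x) powr s)"
 proof (rule Bochner_Integration.integrable_bound)
  show "integrable M (\<lambda>x. 2 powr (s - 1) * (norm (f x) powr s + norm (g x) powr s))"
   using assms by (auto dest: LpD)
 qed (use powr_norm_add_le[OF assms(3)] in auto)
qed

lemma Lp_uminus: "f \<in> Lp M s \<Longrightarrow> (\<lambda>x. - f x) \<in> Lp M s"
 using Lp_scaleR[of f M s "-1"] by simp

lemma Lp_diff:
 assumes "f \<in> Lp M s" "g \<in> Lp M s" "1 \<le> s" shows "(\<lambda>x. f x - g x) \<in> Lp M s"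
 using Lp_add[OF assms(1) Lp_uminus[OF assms(2)] assms(3)] by simp

lemma Lp_cmult:
 fixes f :: "'a \<Rightarrow> real"
 shows "f \<in> Lp M s \<Longrightarrow> (\<lambda>x. c * f x) \<in> Lp M s"
 using Lp_scaleR[of f M s c] by simp

lemma Lp_cong_AE:
 assumes "f \<in> Lp M s" "g \<in> borel_measurable M" "AE x in M. f x = g x"
 shows "g \<in> Lp M s"
proof (rule LpI)
 have [measurable]: "f \<in> borel_measurable M" "g \<in> borel_measurable M"
  using assms by (auto dest: LpD)
 show "integrable M (\<lambda>x. norm (g x) powr s)"
  by (rule Bochner_Integration.integrable_cong_AE_imp[OF LpD(2)[OF assms(1)]]) (use assms(3) in auto)
qed fact

lemma Lnorm_cong_AE:
 assumes "f \<in> borel_measurable M" "g \<in> borel_measurable M" "AE x in M. f x = g x"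
 shows "Lnorm M s f = Lnorm M s g"
proof -
 have "(LINT x|M. norm (f x) powr s) = (LINT x|M. norm (g x) powr s)"
  using assms by (intro integral_cong_AE) (auto elim!: AE_mp)
 then show ?thesis by (simp add: Lnorm_def)
qed

lemma Lnorm_scaleR:
 assumes "1 \<le> s" shows "Lnorm M s (\<lambda>x. c *\<^sub>R f x) = \<bar>c\<bar> * Lnorm M s f"
 using assms by (simp add: Lnorm_def powr_mult powr_powr)

lemma Lnorm_minus: "Lnorm M s (\<lambda>x. - f x) = Lnorm M s f"
 by (simp add: Lnorm_def)

lemma Lnorm_minus_commute: "Lnorm M s (\<lambda>x. f x - g x) = Lnorm M s (\<lambda>x. g x - f x)"
 by (simp add: Lnorm_def norm_minus_commute)

lemma Lnorm_0 [simp]: "0 < s \<Longrightarrow> Lnorm M s (\<lambda>x. 0) = 0"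
 by (simp add: Lnorm_def)

text \<open>Minkowski's inequality from convexity: \<open>f + g\<close> is a convex combination of
  \<open>f / (1 - t)\<close> and \<open>g / t\<close> with \<open>t = B / (A + B)\<close>, where
  \<open>A\<close> and \<open>B\<close> are slightly larger than the two norms.\<close>

lemma Lnorm_triangle:
 assumes f: "f \<in> Lp M s" and g: "g \<in> Lp M s" and s: "1 \<le> s"
 shows "Lnorm M s (\<lambda>x. f x + g x) \<le> Lnorm M s f + Lnorm M s g"
proof (rule field_le_epsilon)
 fix e :: real assume e: "0 < e"
 \<comment> \<open>The surplus \<open>e / 2\<close> keeps both numbers positive when a norm
   vanishes.\<close>
 define A B where "A = Lnorm M s f + e / 2" and "B = Lnorm M s g + e / 2"
 have AB: "0 < A" "0 < B"
  using e Lnorm_nonneg[of M s f] Lnorm_nonneg[of M s g] unfolding A_def B_def by linarith+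
 have A: "(LINT x|M. norm (f x) powr s) \<le> A powr s" and B: "(LINT x|M. norm (g x) powr s) \<le> B powr s"
  using AB e s by (subst Lnorm_le_iff[symmetric]; simp add: A_def B_def)+
 define t where "t = B / (A + B)"
 have t: "0 < t" "t < 1" and t': "1 - t = A / (A + B)"
  using AB by (auto simp: t_def field_simps)
 have pt: "norm (f x + g x) powr s \<le> (A + B) powr s * ((1 - t) / A powr s) * norm (f x) powr s
   + (A + B) powr s * (t / B powr s) * norm (g x) powr s" for x
 proof -
  have "f x + g x = (1 - t) *\<^sub>R ((1 / (1 - t)) *\<^sub>R f x) + t *\<^sub>R ((1 / t) *\<^sub>R g x)"
   using t by simp
  then have "norm (f x + g x) powr s
    \<le> (1 - t) * norm ((1 / (1 - t)) *\<^sub>R f x) powr s + t * norm ((1 / t) *\<^sub>R g x) powr s"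
   using powr_norm_convex[OF s, of t "(1 / (1 - t)) *\<^sub>R f x" "(1 / t) *\<^sub>R g x"] t by simp
  also have "norm ((1 / (1 - t)) *\<^sub>R f x) powr s = (A + B) powr s / A powr s * norm (f x) powr s"
   unfolding t' using AB by (simp add: powr_mult powr_divide)
  also have "norm ((1 / t) *\<^sub>R g x) powr s = (A + B) powr s / B powr s * norm (g x) powr s"
   unfolding t_def using AB by (simp add: powr_mult powr_divide)
  finally show ?thesis by (simp add: field_simps)
 qed
 have "(LINT x|M. norm (f x + g x) powr s)
   \<le> (LINT x|M. (A + B) powr s * ((1 - t) / A powr s) * norm (f x) powr s
     + (A + B) powr s * (t / B powr s) * norm (g x) powr s)"
  using LpD(2)[OF f] LpD(2)[OF g] LpD(2)[OF Lp_add[OF f g s]] pt by (intro integral_mono) auto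
 also have "\<dots> = (A + B) powr s * ((1 - t) / A powr s) * (LINT x|M. norm (f x) powr s)
   + (A + B) powr s * (t / B powr s) * (LINT x|M. norm (g x) powr s)"
  using LpD(2)[OF f] LpD(2)[OF g] by simp
 also have "\<dots> \<le> (A + B) powr s * ((1 - t) / A powr s) * A powr s
   + (A + B) powr s * (t / B powr s) * B powr s"
  using A B t AB by (intro add_mono mult_left_mono) auto
 also have "\<dots> = (A + B) powr s"
  using AB by (simp add: field_simps)
 finally have "Lnorm M s (\<lambda>x. f x + g x) \<le> A + B"
  using s AB by (subst Lnorm_le_iff) auto
 then show "Lnorm M s (\<lambda>x. f x + g x) \<le> Lnorm M s f + Lnorm M s g + e"
  by (simp add: A_def B_def)
qed

lemma Lnorm_triangle_diff:
 assumes "f \<in> Lp M s" "g \<in> Lp M s" "1 \<le> s"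
 shows "Lnorm M s (\<lambda>x. f x - g x) \<le> Lnorm M s f + Lnorm M s g"
 using Lnorm_triangle[OF assms(1) Lp_uminus[OF assms(2)] assms(3)] by (simp add: Lnorm_minus)

lemma Lnorm_triangle_via:
 assumes "f \<in> Lp M s" "g \<in> Lp M s" "h \<in> Lp M s" "1 \<le> s"
 shows "Lnorm M s (\<lambda>x. f x - h x) \<le> Lnorm M s (\<lambda>x. f x - g x) + Lnorm M s (\<lambda>x. g x - h x)"
 using Lnorm_triangle[OF Lp_diff[OF assms(1,2,4)] Lp_diff[OF assms(2,3,4)] assms(4)] by simp

lemma Lnorm_diff_abs_le:
 assumes "f \<in> Lp M s" "g \<in> Lp M s" "1 \<le> s"
 shows "\<bar>Lnorm M s f - Lnorm M s g\<bar> \<le> Lnorm M s (\<lambda>x. f x - g x)"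
 using Lnorm_triangle[OF Lp_diff[OF assms] assms(2,3)]
  Lnorm_triangle[OF Lp_diff[OF assms(2,1,3)] assms(1,3)] Lnorm_minus_commute[of M s f g] by simp

lemma Lnorm_eq_0:
 assumes "f \<in> Lp M s" "0 < s" "Lnorm M s f = 0" shows "AE x in M. f x = 0"
proof -
 have "(LINT x|M. norm (f x) powr s) = 0"
  using assms Lnorm_powr[of s M f] by simp
 then have "AE x in M. norm (f x) powr s = 0"
  using LpD(2)[OF assms(1)] by (subst (asm) integral_nonneg_eq_0_iff_AE) auto
 then show ?thesis by auto
qed

lemma tendsto_Lnorm_iff:
 assumes "0 < s"
 shows "((\<lambda>n. Lnorm M s (f n)) \<longlonglongrightarrow> 0) \<longleftrightarrow> ((\<lambda>n. LINT x|M. norm (f n x) powr s) \<longlonglongrightarrow> 0)"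
proof
 assume "(\<lambda>n. Lnorm M s (f n)) \<longlonglongrightarrow> 0"
 then have "(\<lambda>n. Lnorm M s (f n) powr s) \<longlonglongrightarrow> 0 powr s"
  using assms by (intro tendsto_powr2) auto
 then show "(\<lambda>n. LINT x|M. norm (f n x) powr s) \<longlonglongrightarrow> 0"
  using assms by (simp add: Lnorm_powr)
next
 assume "(\<lambda>n. LINT x|M. norm (f n x) powr s) \<longlonglongrightarrow> 0"
 then have "(\<lambda>n. (LINT x|M. norm (f n x) powr s) powr (1/s)) \<longlonglongrightarrow> 0 powr (1/s)"
  using assms by (intro tendsto_powr2) auto
 then show "(\<lambda>n. Lnorm M s (f n)) \<longlonglongrightarrow> 0"
  using assms by (simp add: Lnorm_def)
qed

lemma tendsto_Lnorm:
 assumes "\<And>n. f n \<in> Lp M s" "g \<in> Lp M s" "1 \<le> s" "Lp_tendsto M s f g"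
 shows "(\<lambda>n. Lnorm M s (f n)) \<longlonglongrightarrow> Lnorm M s g"
proof -
 have "(\<lambda>n. Lnorm M s (f n) - Lnorm M s g) \<longlonglongrightarrow> 0"
  by (rule Lim_null_comparison[OF _ assms(4)])
   (use Lnorm_diff_abs_le[OF assms(1,2,3)] in auto)
 then show ?thesis by (simp add: LIM_zero_iff)
qed

text \<open>Riesz-Fischer: a fast subsequence converges almost everywhere, and Fatou's lemma turns
  the Cauchy bound into convergence of the whole sequence to that limit.\<close>

lemma Lp_complete:
 assumes f: "\<And>n. f n \<in> Lp M s" and s: "1 \<le> s"
  and Cauchy: "\<And>e. 0 < e \<Longrightarrow> \<exists>K. \<forall>m\<ge>K. \<forall>n\<ge>K. Lnorm M s (\<lambda>x. f m x - f n x) \<le> e"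
 obtains g where "g \<in> Lp M s" "Lp_tendsto M s f g"
proof -
 have [measurable]: "f n \<in> borel_measurable M" for n
  using f LpD by blast
 have "\<forall>k. \<exists>K. \<forall>m\<ge>K. \<forall>n\<ge>K. Lnorm M s (\<lambda>x. f m x - f n x) \<le> (1/4) ^ k"
  by (intro allI Cauchy) simp
 then obtain N where N: "\<And>k m n. N k \<le> m \<Longrightarrow> N k \<le> n \<Longrightarrow> Lnorm M s (\<lambda>x. f m x - f n x) \<le> (1/4) ^ k"
  by metis
 \<comment> \<open>The maximum with \<open>Suc j\<close> makes the choice strictly increasing while
   keeping \<open>N k \<le> r k\<close>.\<close>
 define r where "r = rec_nat (N 0) (\<lambda>k j. max (N (Suc k)) (Suc j))"
 have r_Suc: "r (Suc k) = max (N (Suc k)) (Suc (r k))" for k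
  by (simp add: r_def)
 have rN: "N k \<le> r k" for k
  by (cases k) (simp_all add: r_def)
 have r: "strict_mono r"
  by (auto simp: strict_mono_Suc_iff r_Suc)
 \<comment> \<open>The differences have norm at most \<open>(1/4) ^ k\<close>, so the factor
   \<open>2 ^ k\<close> still leaves a summable series of integrals. Where the series of
   \<open>d k x\<close> is finite, its terms eventually lie below \<open>1\<close>, which is a
   geometric bound on the differences.\<close>
 define d where "d k x = (2 ^ k * norm (f (r (Suc k)) x - f (r k) x)) powr s" for k x
 have "(\<integral>\<^sup>+x. (\<Sum>k. ennreal (d k x)) \<partial>M) = (\<Sum>k. \<integral>\<^sup>+x. ennreal (d k x) \<partial>M)"
  unfolding d_def by (intro nn_integral_suminf) auto
 also have "\<dots> \<le> (\<Sum>k. ennreal ((1/2) ^ k))"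
 proof (intro suminf_le allI)
  fix k
  have le: "Lnorm M s (\<lambda>x. f (r (Suc k)) x - f (r k) x) \<le> (1/4) ^ k"
   using rN[of k] r by (intro N) (auto simp: r_Suc)
  have "(\<integral>\<^sup>+x. ennreal (d k x) \<partial>M) = ennreal (LINT x|M. d k x)"
   unfolding d_def using LpD(2)[OF Lp_diff[OF f f s]]
   by (intro nn_integral_eq_integral) (auto simp: powr_mult)
  also have "(LINT x|M. d k x) = (2 ^ k * Lnorm M s (\<lambda>x. f (r (Suc k)) x - f (r k) x)) powr s"
   using s by (simp add: d_def powr_mult Lnorm_powr)
  also have "\<dots> \<le> (2 ^ k * (1/4) ^ k) powr s"
   using le s by (intro powr_mono2 mult_left_mono) auto
  also have "2 ^ k * (1/4) ^ k = ((1/2) ^ k :: real)"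
   by (simp flip: power_mult_distrib)
  also have "((1/2) ^ k :: real) powr s \<le> (1/2) ^ k"
   using powr_mono'[of 1 s "(1/2) ^ k"] s by (simp add: power_le_one)
  finally show "(\<integral>\<^sup>+x. ennreal (d k x) \<partial>M) \<le> ennreal ((1/2) ^ k)"
   by (simp add: ennreal_leI)
 qed auto
 also have "\<dots> < \<infinity>"
  by (subst suminf_ennreal2) (auto simp: summable_geometric)
 finally have "AE x in M. (\<Sum>k. ennreal (d k x)) \<noteq> \<infinity>"
  unfolding d_def by (intro nn_integral_PInf_AE) auto
 then have conv: "AE x in M. convergent (\<lambda>k. f (r k) x)"
 proof eventually_elim
  case (elim x)
  then have "summable (\<lambda>k. d k x)"
   by (intro summable_suminf_not_top) (simp_all add: d_def)
  then have "\<forall>\<^sub>F k in sequentially. d k x < 1"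
   using order_tendstoD(2)[OF summable_LIMSEQ_zero, of "\<lambda>k. d k x" 1] by simp
  then have "\<forall>\<^sub>F k in sequentially. norm (f (r (Suc k)) x - f (r k) x) \<le> (1/2) ^ k"
  proof eventually_elim
   case (elim k)
   have "2 ^ k * norm (f (r (Suc k)) x - f (r k) x) \<le> 1"
   proof (rule ccontr)
    assume "\<not> ?thesis"
    then have "1 powr s \<le> (2 ^ k * norm (f (r (Suc k)) x - f (r k) x)) powr s"
     using s by (intro powr_mono2) auto
    then show False using elim by (simp add: d_def)
   qed
   then show ?case by (simp add: power_one_over field_simps)
  qed
  then have "summable (\<lambda>k. f (r (Suc k)) x - f (r k) x)"
   by (rule summable_comparison_test_ev) (simp add: summable_geometric)
  then have "convergent (\<lambda>n. (\<Sum>k<n. f (r (Suc k)) x - f (r k) x))"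
   by (simp add: summable_iff_convergent)
  then have "convergent (\<lambda>n. f (r n) x - f (r 0) x)"
   by (simp add: sum_lessThan_telescope[where f="\<lambda>k. f (r k) x"])
  then show ?case
   using convergent_add[OF _ convergent_const[of "f (r 0) x"]] by fastforce
 qed
 define g where "g x = lim (\<lambda>k. f (r k) x)" for x
 have [measurable]: "g \<in> borel_measurable M"
  unfolding g_def by (rule borel_measurable_lim_metric) simp
 have g: "AE x in M. (\<lambda>k. f (r k) x) \<longlonglongrightarrow> g x"
  using conv by eventually_elim (simp add: g_def convergent_LIMSEQ_iff)
 have bnd: "(\<lambda>x. f n x - g x) \<in> Lp M s \<and> Lnorm M s (\<lambda>x. f n x - g x) \<le> e"
  if e: "0 < e" and K: "\<forall>m\<ge>K. \<forall>n\<ge>K. Lnorm M s (\<lambda>x. f m x - f n x) \<le> e" and n: "K \<le> n" for e K n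
 proof -
  \<comment> \<open>Fatou's lemma along the subsequence \<open>r\<close>, whose limit is
    \<open>g\<close>, with \<open>n\<close> fixed.\<close>
  have le: "(\<integral>\<^sup>+x. ennreal (norm (f n x - g x) powr s) \<partial>M) \<le> ennreal (e powr s)"
  proof -
   have "(\<integral>\<^sup>+x. ennreal (norm (f n x - g x) powr s) \<partial>M)
     = (\<integral>\<^sup>+x. liminf (\<lambda>k. ennreal (norm (f n x - f (r k) x) powr s)) \<partial>M)"
   proof (rule nn_integral_cong_AE)
    show "AE x in M. ennreal (norm (f n x - g x) powr s)
      = liminf (\<lambda>k. ennreal (norm (f n x - f (r k) x) powr s))"
     using g
    proof eventually_elim
     case (elim x)
     have "(\<lambda>k. ennreal (norm (f n x - f (r k) x) powr s)) \<longlonglongrightarrow> ennreal (norm (f n x - g x) powr s)"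
      using elim s by (intro tendsto_ennrealI tendsto_powr2 tendsto_intros) auto
     then show ?case
      by (rule lim_imp_Liminf[OF sequentially_bot, symmetric])
    qed
   qed
   also have "\<dots> \<le> liminf (\<lambda>k. \<integral>\<^sup>+x. ennreal (norm (f n x - f (r k) x) powr s) \<partial>M)"
    by (intro nn_integral_liminf) auto
   also have "\<dots> \<le> limsup (\<lambda>k. \<integral>\<^sup>+x. ennreal (norm (f n x - f (r k) x) powr s) \<partial>M)"
    by (intro Liminf_le_Limsup) auto
   also have "\<dots> \<le> ennreal (e powr s)"
   proof (rule Limsup_bounded)
    have "\<forall>\<^sub>F k in sequentially. K \<le> r k"
     using r by (meson eventually_sequentiallyI le_trans seq_suble)
    then show "\<forall>\<^sub>F k in sequentially.
      (\<integral>\<^sup>+x. ennreal (norm (f n x - f (r k) x) powr s) \<partial>M) \<le> ennreal (e powr s)"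
    proof eventually_elim
     case (elim k)
     have "(\<integral>\<^sup>+x. ennreal (norm (f n x - f (r k) x) powr s) \<partial>M)
       = ennreal (LINT x|M. norm (f n x - f (r k) x) powr s)"
      using LpD(2)[OF Lp_diff[OF f f s]] by (intro nn_integral_eq_integral) auto
     also have "\<dots> \<le> ennreal (e powr s)"
      using K n elim s e by (intro ennreal_leI, subst Lnorm_le_iff[symmetric]) auto
     finally show ?case .
    qed
   qed
   finally show ?thesis .
  qed
  then have int: "integrable M (\<lambda>x. norm (f n x - g x) powr s)"
   by (intro integrableI_nonneg) (auto simp: le_less_trans[OF _ ennreal_less_top])
  then have "(LINT x|M. norm (f n x - g x) powr s) \<le> e powr s"
   using le by (subst (asm) nn_integral_eq_integral) auto
  then show ?thesis
   using int s e by (auto simp: Lnorm_le_iff intro!: LpI)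
 qed
 show thesis
 proof
  obtain K where K: "\<forall>m\<ge>K. \<forall>n\<ge>K. Lnorm M s (\<lambda>x. f m x - f n x) \<le> 1"
   using Cauchy[of 1] by auto
  from Lp_diff[OF f[of K] conjunct1[OF bnd[OF zero_less_one K order_refl]] s] show "g \<in> Lp M s"
   by simp
  show "Lp_tendsto M s f g"
  proof (rule LIMSEQ_I)
   fix e :: real assume e: "0 < e"
   then obtain K where "\<forall>m\<ge>K. \<forall>n\<ge>K. Lnorm M s (\<lambda>x. f m x - f n x) \<le> e / 2"
    using Cauchy[of "e/2"] by auto
   then have "\<forall>n\<ge>K. Lnorm M s (\<lambda>x. f n x - g x) \<le> e / 2"
    using bnd[of "e/2" K] e by auto
   then show "\<exists>K. \<forall>n\<ge>K. norm (Lnorm M s (\<lambda>x. f n x - g x) - 0) < e"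
    using e by (intro exI[of _ K]) fastforce
  qed
 qed
qed

section \<open>Finite measures and comparison of exponents\<close>

lemma Lp_bounded:
 assumes "finite_measure M" "f \<in> borel_measurable M" "AE x in M. norm (f x) \<le> B" "0 \<le> s"
 shows "f \<in> Lp M s"
proof (rule LpI)
 interpret finite_measure M by fact
 show "integrable M (\<lambda>x. norm (f x) powr s)"
  by (rule integrable_const_bound[where B="\<bar>B\<bar> powr s"])
   (use assms in \<open>auto elim!: eventually_mono intro!: powr_mono2\<close>)
qed fact

lemma Lp_mono_exponent:
 assumes M: "finite_measure M" and f: "f \<in> Lp M s" and rs: "1 \<le> r" "r \<le> s"
 shows "f \<in> Lp M r"
  and "(LINT x|M. norm (f x) powr r) \<le> measure M (space M) + (LINT x|M. norm (f x) powr s)"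
proof -
 interpret finite_measure M by fact
 have [measurable]: "f \<in> borel_measurable M"
  using f LpD by blast
 have b: "norm (f x) powr r \<le> 1 + norm (f x) powr s" for x
 proof (cases "norm (f x) \<le> 1")
  case True
  then have "norm (f x) powr r \<le> 1" using rs powr_mono2[of r "norm (f x)" 1] by simp
  then show ?thesis by (smt (verit) powr_ge_zero)
 next
  case False
  then have "norm (f x) powr r \<le> norm (f x) powr s" using rs by (intro powr_mono) auto
  then show ?thesis by simp
 qed
 have i: "integrable M (\<lambda>x. norm (f x) powr r)"
  by (rule Bochner_Integration.integrable_bound[of M "\<lambda>x. 1 + norm (f x) powr s"])
   (use LpD(2)[OF f] b in auto)
 show "f \<in> Lp M r" by (intro LpI i) simp
 have "(LINT x|M. norm (f x) powr r) \<le> (LINT x|M. 1 + norm (f x) powr s)"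
  using i LpD(2)[OF f] b by (intro integral_mono) auto
 then show "(LINT x|M. norm (f x) powr r) \<le> measure M (space M) + (LINT x|M. norm (f x) powr s)"
  using LpD(2)[OF f] by (simp add: measure_def)
qed

text \<open>The bound of \<open>t powr r\<close> by \<open>1 + t powr s\<close> is applied to
  \<open>f\<close> scaled to norm \<open>1\<close>, which makes it homogeneous; the constant is that
  of this elementary bound and not the sharp one of Hoelder.\<close>

lemma Lnorm_mono_exponent:
 assumes M: "finite_measure M" and f: "f \<in> Lp M s" and rs: "1 \<le> r" "r \<le> s"
 shows "Lnorm M r f \<le> (measure M (space M) + 1) powr (1 / r) * Lnorm M s f"
proof (cases "Lnorm M s f = 0")
 case True
 have [measurable]: "f \<in> borel_measurable M"
  using f LpD by blast
 have "AE x in M. f x = 0" using Lnorm_eq_0[OF f] True rs by auto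
 then have "Lnorm M r f = Lnorm M r (\<lambda>x. 0 :: 'b)"
  by (intro Lnorm_cong_AE) auto
 then show ?thesis using rs by simp
next
 case False
 define A where "A = Lnorm M s f"
 have A: "0 < A" using False Lnorm_nonneg[of M s f] unfolding A_def by linarith
 have "Lnorm M s (\<lambda>x. (1 / A) *\<^sub>R f x) = 1"
  using rs A by (simp add: Lnorm_scaleR A_def)
 then have one: "(LINT x|M. norm ((1 / A) *\<^sub>R f x) powr s) = 1"
  using Lnorm_powr[of s M "\<lambda>x. (1 / A) *\<^sub>R f x", symmetric] rs by (simp only:) simp
 have "Lnorm M r (\<lambda>x. (1 / A) *\<^sub>R f x) = (LINT x|M. norm ((1 / A) *\<^sub>R f x) powr r) powr (1 / r)"
  by (simp only: Lnorm_def)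
 also have "\<dots> \<le> (measure M (space M) + 1) powr (1 / r)"
  using Lp_mono_exponent(2)[OF M Lp_scaleR[OF f] rs, of "1/A"] one rs
  by (intro powr_mono2) auto
 finally show ?thesis
  using rs A by (simp add: Lnorm_scaleR A_def[symmetric] field_simps)
qed

lemma Lnorm_lin_tendsto:
 assumes "\<And>n. f n \<in> Lp M s" "\<And>n. f' n \<in> Lp M s" "g \<in> Lp M s" "g' \<in> Lp M s" "1 \<le> s"
  "Lp_tendsto M s f g" "Lp_tendsto M s f' g'"
 shows "(\<lambda>n. Lnorm M s (\<lambda>x. (f n x + k *\<^sub>R f' n x) - (g x + k *\<^sub>R g' x))) \<longlonglongrightarrow> 0"
proof (rule tendsto_sandwich[OF _ _ tendsto_const])
 show "(\<lambda>n. Lnorm M s (\<lambda>x. f n x - g x) + \<bar>k\<bar> * Lnorm M s (\<lambda>x. f' n x - g' x)) \<longlonglongrightarrow> 0"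
  using tendsto_add[OF assms(6) tendsto_mult_left[OF assms(7), of "\<bar>k\<bar>"]] by simp
 have "Lnorm M s (\<lambda>x. (f n x + k *\<^sub>R f' n x) - (g x + k *\<^sub>R g' x)) \<le> Lnorm M s (\<lambda>x. f n x - g x) + \<bar>k\<bar> * Lnorm M s (\<lambda>x. f' n x - g' x)" for n
  using Lnorm_triangle[OF Lp_diff[OF assms(1,3,5)] Lp_scaleR[OF Lp_diff[OF assms(2,4,5)]] assms(5), of n k n]
   Lnorm_scaleR[OF assms(5), of M k "\<lambda>x. f' n x - g' x"]
  by (simp add: algebra_simps)
 then show "\<forall>\<^sub>F n in sequentially. Lnorm M s (\<lambda>x. (f n x + k *\<^sub>R f' n x) - (g x + k *\<^sub>R g' x)) \<le> Lnorm M s (\<lambda>x. f n x - g x) + \<bar>k\<bar> * Lnorm M s (\<lambda>x. f' n x - g' x)"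
  by simp
qed simp

section \<open>Differentiation of power integrals\<close>

lemma tendsto_dual_pow:
 assumes "1 < p" "(f \<longlongrightarrow> l) F"
 shows "((\<lambda>x. dual_pow p (f x)) \<longlongrightarrow> dual_pow p l) F"
proof (cases "l = 0")
 case True
 have "((\<lambda>x. norm (f x) powr (p - 1)) \<longlongrightarrow> norm l powr (p - 1)) F"
  using assms by (intro tendsto_powr2 tendsto_norm) auto
 then have "((\<lambda>x. norm (f x) powr (p - 1)) \<longlongrightarrow> 0) F"
  using True by simp
 then show ?thesis
  using True by (auto intro!: Lim_null_comparison[where g="\<lambda>x. norm (f x) powr (p - 1)"] always_eventually norm_dual_pow_le)
next
 case False
 then show ?thesis
  unfolding dual_pow_def using assms by (intro tendsto_intros) auto
qed

lemma borel_measurable_dual_pow [measurable]: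
 fixes f :: "'a \<Rightarrow> 'b::euclidean_space"
 shows "f \<in> borel_measurable M \<Longrightarrow> (\<lambda>x. dual_pow p (f x)) \<in> borel_measurable M"
 unfolding dual_pow_def by measurable

text \<open>Both factors are at most a power of the larger of the two norms. This crude form of
  Hoelder's inequality gives integrability of the pairing and a dominating function for it.\<close>

lemma dual_pow_inner_le:
 fixes x y :: "'a::euclidean_space"
 assumes "1 \<le> s"
 shows "\<bar>dual_pow s x \<bullet> y\<bar> \<le> norm x powr s + norm y powr s"
proof -
 have "\<bar>dual_pow s x \<bullet> y\<bar> \<le> norm x powr (s - 1) * norm y"
  using Cauchy_Schwarz_ineq2[of "dual_pow s x" y] norm_dual_pow_le[of s x]
  by (meson mult_right_mono norm_ge_zero order_trans)
 also have "\<dots> \<le> max (norm x) (norm y) powr (s - 1) * max (norm x) (norm y)"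
  using assms by (intro mult_mono powr_mono2) auto
 also have "\<dots> = max (norm x) (norm y) powr s"
  by (cases "max (norm x) (norm y) = 0") (auto simp: powr_diff max_def)
 also have "\<dots> \<le> norm x powr s + norm y powr s"
  by (auto simp: max_def)
 finally show ?thesis .
qed

lemma integrable_dual_pow_inner:
 assumes "f \<in> Lp M s" "g \<in> Lp M s" "1 \<le> s"
 shows "integrable M (\<lambda>x. dual_pow s (f x) \<bullet> g x)"
proof -
 have [measurable]: "f \<in> borel_measurable M" "g \<in> borel_measurable M"
  using assms LpD by blast+
 show ?thesis
  by (rule Bochner_Integration.integrable_bound[of M "\<lambda>x. norm (f x) powr s + norm (g x) powr s"])
   (use LpD(2)[OF assms(1)] LpD(2)[OF assms(2)] dual_pow_inner_le[OF assms(3)] in auto)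
qed

text \<open>Tangent inequalities at \<open>0\<close> and at \<open>t\<close> trap the difference
  quotient between \<open>s * D 0\<close> and \<open>s * D t\<close>. Differentiability thus reduces
  to continuity of \<open>D\<close> at \<open>0\<close>, which is dominated convergence. This covers
  exponents below \<open>2\<close>, where \<open>dual_pow\<close> itself is not differentiable at
  the origin.\<close>

lemma has_derivative_integral_norm_powr:
 assumes f: "f \<in> Lp M s" and g: "g \<in> Lp M s" and s: "1 < s"
 shows "((\<lambda>t. LINT x|M. norm (f x + t *\<^sub>R g x) powr s)
   has_real_derivative s * (LINT x|M. dual_pow s (f x) \<bullet> g x)) (at 0)"
proof -
 define P where "P t = (LINT x|M. norm (f x + t *\<^sub>R g x) powr s)" for t
 define D where "D t = (LINT x|M. dual_pow s (f x + t *\<^sub>R g x) \<bullet> g x)" for t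
 have [measurable]: "f \<in> borel_measurable M" "g \<in> borel_measurable M"
  using assms LpD by blast+
 have s1: "1 \<le> s" using s by simp
 have L: "(\<lambda>x. f x + t *\<^sub>R g x) \<in> Lp M s" for t
  by (intro Lp_add Lp_scaleR f g s1)
 have tang: "P t + s * ((u - t) * D t) \<le> P u" for t u
 proof -
  have "P t + s * ((u - t) * D t) = (LINT x|M. norm (f x + t *\<^sub>R g x) powr s
    + s * (dual_pow s (f x + t *\<^sub>R g x) \<bullet> ((f x + u *\<^sub>R g x) - (f x + t *\<^sub>R g x))))"
   unfolding P_def D_def
   using LpD(2)[OF L] integrable_dual_pow_inner[OF L g s1]
   by (simp add: scaleR_diff_left[symmetric])
  also have "\<dots> \<le> P u"
   unfolding P_def
   by (intro integral_mono powr_ge_tangent s1 Bochner_Integration.integrable_add integrable_mult_right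
     integrable_dual_pow_inner Lp_diff L LpD(2)[OF L])
  finally show ?thesis .
 qed
 have D: "(D \<longlongrightarrow> D 0) (at 0)"
  unfolding tendsto_at_iff_sequentially
 proof (intro allI impI)
  fix X :: "nat \<Rightarrow> real" assume X: "\<forall>i. X i \<in> UNIV - {0}" "X \<longlonglongrightarrow> 0"
  \<comment> \<open>A common bound for the parameters gives one dominating function for the whole
    sequence.\<close>
  then have "Bseq X" by (intro convergent_imp_Bseq) (auto simp: convergent_def)
  then obtain B where B: "0 < B" "\<And>n. \<bar>X n\<bar> \<le> B"
   by (auto elim!: BseqE)
  show "(D \<circ> X) \<longlonglongrightarrow> D 0"
   unfolding D_def comp_def
  proof (rule integral_dominated_convergence[where w="\<lambda>x. 2 powr (s - 1) * (norm (f x) powr s + norm (B *\<^sub>R g x) powr s) + norm (g x) powr s"])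
   show "AE x in M. (\<lambda>n. dual_pow s (f x + X n *\<^sub>R g x) \<bullet> g x) \<longlonglongrightarrow> dual_pow s (f x + 0 *\<^sub>R g x) \<bullet> g x"
    by (intro AE_I2 tendsto_intros tendsto_dual_pow s X)
   show "integrable M (\<lambda>x. 2 powr (s - 1) * (norm (f x) powr s + norm (B *\<^sub>R g x) powr s) + norm (g x) powr s)"
    using LpD(2)[OF f] LpD(2)[OF Lp_scaleR[OF g]] LpD(2)[OF g] by simp
   fix n
   show "AE x in M. norm (dual_pow s (f x + X n *\<^sub>R g x) \<bullet> g x)
     \<le> 2 powr (s - 1) * (norm (f x) powr s + norm (B *\<^sub>R g x) powr s) + norm (g x) powr s"
   proof (rule AE_I2)
    fix x
    have "norm (dual_pow s (f x + X n *\<^sub>R g x) \<bullet> g x) \<le> norm (f x + X n *\<^sub>R g x) powr s + norm (g x) powr s"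
     using dual_pow_inner_le[OF s1] by simp
    also have "norm (f x + X n *\<^sub>R g x) powr s \<le> 2 powr (s - 1) * (norm (f x) powr s + norm (X n *\<^sub>R g x) powr s)"
     by (rule powr_norm_add_le[OF s1])
    also have "\<dots> \<le> 2 powr (s - 1) * (norm (f x) powr s + norm (B *\<^sub>R g x) powr s)"
     using B s by (intro mult_left_mono add_mono powr_mono2) (auto intro!: mult_right_mono)
    finally show "norm (dual_pow s (f x + X n *\<^sub>R g x) \<bullet> g x)
     \<le> 2 powr (s - 1) * (norm (f x) powr s + norm (B *\<^sub>R g x) powr s) + norm (g x) powr s"
     by simp
   qed
  qed auto
 qed
 have q: "\<bar>(P t - P 0) / t - s * D 0\<bar> \<le> s * \<bar>D t - D 0\<bar>" if "t \<noteq> 0" for t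
 proof -
  have "\<bar>P t - P 0 - s * (t * D 0)\<bar> \<le> \<bar>s * (t * (D t - D 0))\<bar>"
   using tang[of 0 t] tang[of t 0] by (simp add: algebra_simps abs_le_iff)
  also have "\<dots> = \<bar>t\<bar> * (s * \<bar>D t - D 0\<bar>)"
   using s by (simp add: abs_mult)
  finally have "\<bar>P t - P 0 - s * (t * D 0)\<bar> / \<bar>t\<bar> \<le> s * \<bar>D t - D 0\<bar>"
   using that by (simp add: field_simps)
  then show ?thesis
   using that by (simp add: field_simps flip: abs_divide)
 qed
 have "((\<lambda>t. (P t - P 0) / t - s * D 0) \<longlongrightarrow> 0) (at 0)"
 proof (rule Lim_null_comparison)
  show "\<forall>\<^sub>F t in at 0. norm ((P t - P 0) / t - s * D 0) \<le> s * \<bar>D t - D 0\<bar>"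
   using q by (auto simp: eventually_at_filter)
  show "((\<lambda>t. s * \<bar>D t - D 0\<bar>) \<longlongrightarrow> 0) (at 0)"
   using D by (auto intro!: tendsto_eq_intros)
 qed
 then have "((\<lambda>t. (P t - P 0) / t) \<longlongrightarrow> s * D 0) (at 0)"
  by (simp add: LIM_zero_iff)
 then show ?thesis
  unfolding has_field_derivative_iff P_def D_def by simp
qed

section \<open>Smooth functions\<close>

definition pd :: "'a::euclidean_space \<Rightarrow> ('a \<Rightarrow> real) \<Rightarrow> 'a \<Rightarrow> real" where
 "pd i f x = frechet_derivative f (at x) i"

lemma pd_eqI: "(f has_derivative f') (at x) \<Longrightarrow> pd i f x = f' i"
 using frechet_derivative_at by (fastforce simp: pd_def)

lemma Ck_Suc: "Ck_on (Suc k) UNIV f \<longleftrightarrow> (\<forall>x. f differentiable at x) \<and> (\<forall>i\<in>Basis. Ck_on k UNIV (pd i f))"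
 by (simp add: pd_def[abs_def])

lemma Ck_mono: "Ck_on (Suc k) UNIV f \<Longrightarrow> Ck_on k UNIV f"
proof (induction k arbitrary: f)
 case 0
 then show ?case
  by (auto simp: continuous_on_eq_continuous_at differentiable_imp_continuous_within)
next
 case (Suc k)
 then show ?case
  unfolding Ck_Suc[of "Suc k"] Ck_Suc[of k] by blast
qed

lemma smooth_differentiable: "smooth f \<Longrightarrow> f differentiable at x"
 unfolding smooth_def by (metis Ck_Suc)

lemma smooth_pd: "smooth f \<Longrightarrow> i \<in> Basis \<Longrightarrow> smooth (pd i f)"
 unfolding smooth_def by (metis Ck_Suc)

lemma smooth_continuous: "smooth f \<Longrightarrow> continuous_on S f"
 unfolding smooth_def by (metis Ck_on.simps(1) continuous_on_subset subset_UNIV)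

lemma smooth_borel [measurable_dest]: "smooth f \<Longrightarrow> f \<in> borel_measurable borel"
 by (intro borel_measurable_continuous_onI smooth_continuous)

lemma Ck_const: "Ck_on k UNIV (\<lambda>x. c)"
proof (induction k arbitrary: c)
 case (Suc k)
 have "pd i (\<lambda>x. c) = (\<lambda>x. 0)" for i :: 'a
  by (rule ext) (auto intro!: pd_eqI derivative_eq_intros)
 then show ?case unfolding Ck_Suc using Suc by auto
qed auto

lemma Ck_add: "Ck_on k UNIV f \<Longrightarrow> Ck_on k UNIV g \<Longrightarrow> Ck_on k UNIV (\<lambda>x. f x + g x)"
proof (induction k arbitrary: f g)
 case (Suc k)
 have "pd i (\<lambda>x. f x + g x) = (\<lambda>x. pd i f x + pd i g x)" for i
  using Suc.prems unfolding Ck_Suc pd_def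
  by (intro ext) (auto simp: frechet_derivative_works intro!: pd_eqI[unfolded pd_def] derivative_eq_intros)
 then show ?case using Suc unfolding Ck_Suc by auto
qed (auto intro!: continuous_intros)

lemma Ck_mult: "Ck_on k UNIV f \<Longrightarrow> Ck_on k UNIV g \<Longrightarrow> Ck_on k UNIV (\<lambda>x. f x * g x)"
proof (induction k arbitrary: f g)
 case (Suc k)
 have "pd i (\<lambda>x. f x * g x) = (\<lambda>x. f x * pd i g x + pd i f x * g x)" for i
  using Suc.prems unfolding Ck_Suc pd_def
  by (intro ext) (auto simp: frechet_derivative_works intro!: pd_eqI[unfolded pd_def] derivative_eq_intros)
 moreover have "Ck_on k UNIV f" "Ck_on k UNIV g"
  using Suc.prems by (auto intro: Ck_mono)
 ultimately show ?case using Suc unfolding Ck_Suc by (auto intro!: Ck_add)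
qed (auto intro!: continuous_intros)

lemma pd_compose:
 fixes h :: "real \<Rightarrow> real"
 assumes "h differentiable at (f x)" "f differentiable at x"
 shows "pd i (\<lambda>x. h (f x)) x = pd 1 h (f x) * pd i f x"
proof -
 have f: "(f has_derivative frechet_derivative f (at x)) (at x)"
  using assms by (simp add: frechet_derivative_works)
 have h: "(h has_derivative frechet_derivative h (at (f x))) (at (f x))"
  using assms by (simp add: frechet_derivative_works)
 have "pd i (\<lambda>x. h (f x)) x = frechet_derivative h (at (f x)) (pd i f x)"
  using pd_eqI[OF has_derivative_compose[OF f h], of i] by (simp add: pd_def)
 also have "\<dots> = pd i f x *\<^sub>R frechet_derivative h (at (f x)) 1"
  using linear_frechet_derivative[OF assms(1)] by (metis linear_scale mult.right_neutral real_scaleR_def)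
 finally show ?thesis by (simp add: pd_def)
qed

lemma Ck_compose:
 fixes h :: "real \<Rightarrow> real"
 shows "Ck_on k UNIV h \<Longrightarrow> Ck_on k UNIV f \<Longrightarrow> Ck_on k UNIV (\<lambda>x. h (f x))"
proof (induction k arbitrary: f h)
 case 0
 then show ?case using continuous_on_compose2[of UNIV h UNIV f] by auto
next
 case (Suc k)
 have "pd i (\<lambda>x. h (f x)) = (\<lambda>x. pd 1 h (f x) * pd i f x)" for i
  using Suc.prems unfolding Ck_Suc by (intro ext pd_compose) auto
 moreover have "Ck_on k UNIV f" using Suc.prems by (auto intro: Ck_mono)
 moreover have "(\<lambda>x. h (f x)) differentiable at x" for x
  using Suc.prems differentiable_chain_at[of f x h] unfolding Ck_Suc by (simp add: comp_def)
 ultimately show ?case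
  using Suc unfolding Ck_Suc by (auto intro!: Ck_mult)
qed

lemma smooth_const [simp, intro]: "smooth (\<lambda>x. c)"
 and smooth_add: "smooth f \<Longrightarrow> smooth g \<Longrightarrow> smooth (\<lambda>x. f x + g x)"
 and smooth_mult: "smooth f \<Longrightarrow> smooth g \<Longrightarrow> smooth (\<lambda>x. f x * g x)"
 and smooth_compose: "smooth h \<Longrightarrow> smooth f \<Longrightarrow> smooth (\<lambda>x. h (f x))" for h :: "real \<Rightarrow> real"
 by (auto simp: smooth_def intro: Ck_const Ck_add Ck_mult Ck_compose)

lemma smooth_cmult: "smooth f \<Longrightarrow> smooth (\<lambda>x. c * f x)"
 by (intro smooth_mult smooth_const)

lemma smooth_uminus: "smooth f \<Longrightarrow> smooth (\<lambda>x. - f x)"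
 using smooth_cmult[of f "-1"] by simp

lemma smooth_diff: "smooth f \<Longrightarrow> smooth g \<Longrightarrow> smooth (\<lambda>x. f x - g x)"
 using smooth_add[OF _ smooth_uminus] by fastforce

lemma smooth_sum: "(\<And>j. j \<in> J \<Longrightarrow> smooth (f j)) \<Longrightarrow> smooth (\<lambda>x. \<Sum>j\<in>J. f j x)"
 by (induction J rule: infinite_finite_induct) (auto intro: smooth_add)

lemma smooth_inner: "smooth (\<lambda>x. x \<bullet> e)"
 unfolding smooth_def
proof
 fix k show "Ck_on k UNIV (\<lambda>x. x \<bullet> e)"
 proof (cases k)
  case (Suc m)
  have "pd i (\<lambda>x. x \<bullet> e) = (\<lambda>x. i \<bullet> e)" for i
   by (rule ext) (auto intro!: pd_eqI derivative_eq_intros)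
  moreover have "(\<lambda>x. x \<bullet> e) differentiable at x" for x
   by (intro bounded_linear_imp_differentiable bounded_linear_inner_left)
  ultimately show ?thesis unfolding Suc Ck_Suc by (auto intro: Ck_const)
 qed (auto intro!: continuous_intros)
qed

lemma smooth_norm_sq: "smooth (\<lambda>x. (norm (x - c))\<^sup>2)"
proof -
 have "smooth (\<lambda>x. \<Sum>i\<in>Basis. (x \<bullet> i - c \<bullet> i) * (x \<bullet> i - c \<bullet> i))"
  by (intro smooth_sum smooth_mult smooth_diff smooth_inner smooth_const)
 moreover have "(\<Sum>i\<in>Basis. (x \<bullet> i - c \<bullet> i) * (x \<bullet> i - c \<bullet> i)) = (norm (x - c))\<^sup>2" for x
  unfolding power2_norm_eq_inner by (subst euclidean_inner) (simp add: inner_diff_left)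
 ultimately show ?thesis by simp
qed

lemma pd_affine:
 assumes "f differentiable at (c + s *\<^sub>R x)"
 shows "pd i (\<lambda>x. f (c + s *\<^sub>R x)) x = s * pd i f (c + s *\<^sub>R x)"
proof -
 let ?F = "frechet_derivative f (at (c + s *\<^sub>R x))"
 have f: "(f has_derivative ?F) (at (c + s *\<^sub>R x))"
  using assms by (simp add: frechet_derivative_works)
 have a: "((\<lambda>x. c + s *\<^sub>R x) has_derivative (\<lambda>h. s *\<^sub>R h)) (at x)"
  by (auto intro!: derivative_eq_intros)
 have "pd i (\<lambda>x. f (c + s *\<^sub>R x)) x = ?F (s *\<^sub>R i)"
  using has_derivative_compose[OF a f] by (simp add: pd_eqI)
 also have "\<dots> = s *\<^sub>R ?F i"
  using linear_frechet_derivative[OF assms] by (rule linear_scale)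
 finally show ?thesis by (simp add: pd_def)
qed

lemma smooth_affine: "smooth f \<Longrightarrow> smooth (\<lambda>x. f (c + s *\<^sub>R x))"
proof -
 have "Ck_on k UNIV f \<Longrightarrow> Ck_on k UNIV (\<lambda>x. f (c + s *\<^sub>R x))" for k
 proof (induction k arbitrary: f)
  case 0
  then show ?case by (auto intro!: continuous_on_compose2[of UNIV f] continuous_intros)
 next
  case (Suc k)
  have d: "f differentiable at x" for x using Suc.prems unfolding Ck_Suc by auto
  have "pd i (\<lambda>x. f (c + s *\<^sub>R x)) = (\<lambda>x. s * pd i f (c + s *\<^sub>R x))" for i
   by (intro ext pd_affine d)
  moreover have "(\<lambda>x. f (c + s *\<^sub>R x)) differentiable at x" for x
   using differentiable_chain_at[of "\<lambda>x. c + s *\<^sub>R x" x f] d by (simp add: comp_def)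
  ultimately show ?case
   using Suc unfolding Ck_Suc by (auto intro!: Ck_mult Ck_const)
 qed
 then show "smooth f \<Longrightarrow> smooth (\<lambda>x. f (c + s *\<^sub>R x))"
  by (simp add: smooth_def)
qed

section \<open>Rules for gradients\<close>

lemma grad_inner_Basis: "i \<in> Basis \<Longrightarrow> grad f x \<bullet> i = pd i f x"
 by (simp add: grad_def pd_def inner_sum_left inner_Basis if_distrib cong: if_cong)

lemma has_derivative_grad:
 assumes "f differentiable at x" shows "(f has_derivative (\<lambda>h. grad f x \<bullet> h)) (at x)"
proof -
 let ?F = "frechet_derivative f (at x)"
 have "?F h = grad f x \<bullet> h" for h
 proof -
  have "?F h = ?F (\<Sum>i\<in>Basis. (h \<bullet> i) *\<^sub>R i)" by (simp add: euclidean_representation)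
  also have "\<dots> = (\<Sum>i\<in>Basis. (h \<bullet> i) *\<^sub>R ?F i)"
   using linear_frechet_derivative[OF assms] by (simp add: linear_sum linear_scale)
  also have "\<dots> = grad f x \<bullet> h"
   unfolding grad_def inner_sum_left inner_scaleR_left by (simp add: inner_commute mult.commute)
  finally show ?thesis .
 qed
 then have "?F = (\<lambda>h. grad f x \<bullet> h)" by auto
 then show ?thesis using assms by (simp add: frechet_derivative_works)
qed

lemmas smooth_has_derivative = has_derivative_grad[OF smooth_differentiable]

lemma grad_eqI:
 assumes "\<And>i. i \<in> Basis \<Longrightarrow> pd i f x = g \<bullet> i" shows "grad f x = g"
 by (rule euclidean_eqI) (simp add: grad_inner_Basis assms)

lemma grad_eqI_derivative: "(f has_derivative (\<lambda>h. g \<bullet> h)) (at x) \<Longrightarrow> grad f x = g"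
 by (rule grad_eqI) (simp add: pd_eqI)

lemma grad_add: "smooth f \<Longrightarrow> smooth g \<Longrightarrow> grad (\<lambda>x. f x + g x) x = grad f x + grad g x"
 by (rule grad_eqI_derivative, rule has_derivative_eq_rhs[OF has_derivative_add[OF smooth_has_derivative smooth_has_derivative]])
  (auto simp: inner_add_left inner_diff_left)

lemma grad_cmult: "smooth f \<Longrightarrow> grad (\<lambda>x. c * f x) x = c *\<^sub>R grad f x"
 by (rule grad_eqI_derivative, rule has_derivative_eq_rhs[OF has_derivative_mult_right[OF smooth_has_derivative]])
  (auto simp: inner_add_left inner_diff_left)

lemma grad_const [simp]: "grad (\<lambda>x. c) x = 0"
 by (rule grad_eqI_derivative) (auto intro!: derivative_eq_intros)

lemma grad_diff: "smooth f \<Longrightarrow> smooth g \<Longrightarrow> grad (\<lambda>x. f x - g x) x = grad f x - grad g x"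
 by (rule grad_eqI_derivative, rule has_derivative_eq_rhs[OF has_derivative_diff[OF smooth_has_derivative smooth_has_derivative]])
  (auto simp: inner_add_left inner_diff_left)

lemma grad_mult: "smooth f \<Longrightarrow> smooth g \<Longrightarrow> grad (\<lambda>x. f x * g x) x = f x *\<^sub>R grad g x + g x *\<^sub>R grad f x"
 by (rule grad_eqI_derivative, rule has_derivative_eq_rhs[OF has_derivative_mult[OF smooth_has_derivative smooth_has_derivative]])
  (auto simp: inner_add_left inner_diff_left)

lemma grad_sum: "finite J \<Longrightarrow> (\<And>j. j \<in> J \<Longrightarrow> smooth (f j)) \<Longrightarrow> grad (\<lambda>x. \<Sum>j\<in>J. f j x) x = (\<Sum>j\<in>J. grad (f j) x)"
 by (induction J rule: finite_induct) (simp_all add: grad_add smooth_sum)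

lemma grad_inner [simp]: "grad (\<lambda>x. x \<bullet> e) x = e"
 by (rule grad_eqI_derivative) (auto intro!: derivative_eq_intros simp: inner_commute)

lemma continuous_on_grad: "smooth f \<Longrightarrow> continuous_on S (grad f)"
proof -
 assume f: "smooth f"
 have "grad f = (\<lambda>x. \<Sum>i\<in>Basis. pd i f x *\<^sub>R i)" by (simp add: fun_eq_iff grad_def pd_def)
 then show ?thesis using f by (auto intro!: continuous_intros smooth_continuous smooth_pd)
qed

lemma borel_measurable_grad [measurable_dest]: "smooth f \<Longrightarrow> grad f \<in> borel_measurable borel"
 by (intro borel_measurable_continuous_onI continuous_on_grad)

section \<open>A smooth step and cut-off functions\<close>

definition exp_inv :: "nat \<Rightarrow> real \<Rightarrow> real" where
 "exp_inv n t = (if 0 < t then (1 / t) ^ n * exp (- (1 / t)) else 0)"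

lemma exp_inv_tendsto_0: "(exp_inv n \<longlongrightarrow> 0) (at 0)"
proof -
 have "((\<lambda>x::real. x ^ n / exp x) \<longlongrightarrow> 0) at_top" by (rule tendsto_power_div_exp_0)
 from filterlim_compose[OF this filterlim_inverse_at_top_right]
 have "((\<lambda>t. inverse t ^ n / exp (inverse t)) \<longlongrightarrow> 0) (at_right (0::real))" .
 then have r: "(exp_inv n \<longlongrightarrow> 0) (at_right 0)"
  by (rule Lim_transform_eventually)
   (auto simp: eventually_at_filter exp_inv_def exp_minus divide_inverse)
 have l: "(exp_inv n \<longlongrightarrow> 0) (at_left 0)"
  by (rule Lim_transform_eventually[OF tendsto_const]) (auto simp: eventually_at_filter exp_inv_def)
 show ?thesis using filterlim_split_at[OF l r] .
qed

text \<open>The functions \<open>exp_inv n\<close> are closed under differentiation up to linear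
  combinations, which is why the power \<open>n\<close> is carried along: one induction makes all of
  them smooth. At \<open>t = 0\<close> the difference quotient of \<open>exp_inv n\<close> is
  \<open>exp_inv (Suc n)\<close>, which tends to \<open>0\<close>.\<close>

lemma DERIV_exp_inv:
 "(exp_inv n has_real_derivative (- real n * exp_inv (Suc n) t + exp_inv (n + 2) t)) (at t)"
proof -
 consider "0 < t" | "t < 0" | "t = 0" by linarith
 then show ?thesis
 proof cases
  case 1
  have v: "((\<lambda>t. 1 / t) has_real_derivative - ((1 / t)\<^sup>2)) (at t)"
   using 1 by (auto intro!: derivative_eq_intros simp: power2_eq_square)
  have "((\<lambda>t. (1 / t) ^ n * exp (- (1 / t))) has_real_derivative
    (1 / t) ^ n * (exp (- (1 / t)) * - (- ((1 / t)\<^sup>2)))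
    + real n * (- ((1 / t)\<^sup>2) * (1 / t) ^ (n - Suc 0)) * exp (- (1 / t))) (at t)"
   using v by (intro DERIV_mult' DERIV_chain2[OF DERIV_exp] DERIV_power DERIV_minus)
  also have "(1 / t) ^ n * (exp (- (1 / t)) * - (- ((1 / t)\<^sup>2)))
    + real n * (- ((1 / t)\<^sup>2) * (1 / t) ^ (n - Suc 0)) * exp (- (1 / t))
    = - real n * exp_inv (Suc n) t + exp_inv (n + 2) t"
   using 1 by (cases n) (simp_all add: exp_inv_def power_add power2_eq_square algebra_simps
     flip: add_divide_distrib diff_divide_distrib)
  finally have "((\<lambda>t. (1 / t) ^ n * exp (- (1 / t))) has_real_derivative
    (- real n * exp_inv (Suc n) t + exp_inv (n + 2) t)) (at t)" .
  then show ?thesis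
   by (rule has_field_derivative_transform_within_open[where S="{0<..}"]) (use 1 in \<open>auto simp: exp_inv_def\<close>)
 next
  case 2
  have "((\<lambda>t. 0) has_real_derivative (- real n * exp_inv (Suc n) t + exp_inv (n + 2) t)) (at t)"
   using 2 by (auto simp: exp_inv_def)
  then show ?thesis
   by (rule has_field_derivative_transform_within_open[where S="{..<0}"]) (use 2 in \<open>auto simp: exp_inv_def\<close>)
 next
  case 3
  have "((\<lambda>x. (exp_inv n x - exp_inv n 0) / (x - 0)) \<longlongrightarrow> 0) (at 0)"
   using exp_inv_tendsto_0[of "Suc n"]
   by (rule Lim_transform_eventually) (auto simp: eventually_at_filter exp_inv_def)
  then show ?thesis using 3 by (auto simp: has_field_derivative_iff exp_inv_def)
 qed
qed

lemma pd_real: "(f has_real_derivative d) (at t) \<Longrightarrow> pd 1 f t = d"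
 using pd_eqI[of f "(*) d" t 1] by (simp add: has_field_derivative_def)

lemma smooth_exp_inv: "smooth (exp_inv n)"
proof -
 have "Ck_on k UNIV (exp_inv n)" for k
 proof (induction k arbitrary: n)
  case 0
  have "isCont (exp_inv n) t" for t using DERIV_isCont[OF DERIV_exp_inv] .
  then show ?case by (simp add: continuous_at_imp_continuous_on)
 next
  case (Suc k)
  have "pd 1 (exp_inv n) = (\<lambda>t. - real n * exp_inv (Suc n) t + exp_inv (n + 2) t)"
   by (intro ext pd_real DERIV_exp_inv)
  moreover have "exp_inv n differentiable at t" for t
   using DERIV_exp_inv real_differentiable_def by blast
  ultimately show ?case
   unfolding Ck_Suc using Suc Ck_add[OF Ck_mult[OF Ck_const[of k "- real n"] Suc] Suc] by simp
 qed
 then show ?thesis by (simp add: smooth_def)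
qed

text \<open>The step is the normalised primitive of \<open>b\<close>, a product of two one-sided
  flat functions that is positive exactly between \<open>0\<close> and \<open>1\<close>.\<close>

lemma smooth_step:
 "\<exists>S :: real \<Rightarrow> real. smooth S \<and> (\<forall>t\<le>0. S t = 0) \<and> (\<forall>t\<ge>1. S t = 1)"
proof -
 define b where "b t = exp_inv 0 t * exp_inv 0 (1 + (-1) *\<^sub>R t)" for t
 have sb: "smooth b" unfolding b_def by (intro smooth_mult smooth_affine smooth_exp_inv)
 \<comment> \<open>Starting the integral at \<open>-1\<close> makes every point of
   \<open>[0, 1]\<close> interior to the range in which the fundamental theorem applies.\<close>
 define G where "G t = integral {-1..t} b" for t
 have bc: "continuous_on A b" for A by (intro smooth_continuous sb)
 have b0: "b t = 0" if "t \<le> 0 \<or> 1 \<le> t" for t using that by (auto simp: b_def exp_inv_def)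
 have G0: "G t = 0" if "t \<le> 0" for t
 proof -
  have "G t = integral {-1..t} (\<lambda>_. 0)" unfolding G_def using that b0 by (intro integral_cong) auto
  then show ?thesis by simp
 qed
 have DG: "(G has_real_derivative b t) (at t)" for t
 proof (cases "-1 < t")
  case True
  have "(G has_real_derivative b t) (at t within {-1..t+1})"
   unfolding G_def using True by (intro integral_has_real_derivative bc) auto
  then show ?thesis using True by (subst (asm) at_within_interior) auto
 next
  case False
  have "((\<lambda>t. 0) has_real_derivative b t) (at t)" using False b0 by auto
  then show ?thesis
   by (rule has_field_derivative_transform_within_open[where S="{..<0}"]) (use False G0 in auto)
 qed
 have "G 0 < G 1"
 proof (rule DERIV_pos_imp_increasing_open[where f=G])
  show "\<exists>y. (G has_real_derivative y) (at x) \<and> 0 < y" if "0 < x" "x < 1" for x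
   using that DG[of x] by (intro exI[of _ "b x"]) (auto simp: b_def exp_inv_def)
  show "continuous_on {0..1} G"
   by (intro continuous_at_imp_continuous_on ballI DERIV_isCont[OF DG])
 qed simp
 then have G1: "0 < G 1" using G0 by simp
 have Gc: "G t = G 1" if "1 \<le> t" for t
 proof (cases "t = 1")
  case False
  have "G t = G 1"
  proof (rule DERIV_isconst_end[where f=G])
   show "1 < t" using that False by simp
   show "continuous_on {1..t} G"
    by (intro continuous_at_imp_continuous_on ballI DERIV_isCont[OF DG])
   show "(G has_real_derivative 0) (at x)" if "1 < x" "x < t" for x
    using DG[of x] b0[of x] that by simp
  qed
  then show ?thesis .
 qed simp
 have pG: "pd 1 G = b" by (intro ext pd_real DG)
 have "Ck_on k UNIV G" for k
 proof (cases k)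
  case 0
  then show ?thesis by (auto intro!: continuous_at_imp_continuous_on DERIV_isCont[OF DG])
 next
  case (Suc m)
  have "G differentiable at t" for t using DG real_differentiable_def by blast
  then show ?thesis unfolding Suc Ck_Suc using sb pG by (auto simp: smooth_def)
 qed
 then have "smooth (\<lambda>t. (1 / G 1) * G t)" by (intro smooth_cmult) (simp add: smooth_def)
 moreover have "(1 / G 1) * G t = 1" if "1 \<le> t" for t
  unfolding Gc[OF that] using G1 by simp
 moreover have "(1 / G 1) * G t = 0" if "t \<le> 0" for t
  using G0[OF that] by simp
 ultimately show ?thesis by blast
qed

text \<open>The step is composed with an affine function of the squared distance, which is smooth at
  the centre as well.\<close>

lemma smooth_cutoff:
 fixes x0 :: "'a::euclidean_space"
 assumes "0 \<le> r" "r < R"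
 obtains \<psi> where "smooth \<psi>" "\<And>x. dist x x0 \<le> r \<Longrightarrow> \<psi> x = 1" "\<And>x. R \<le> dist x x0 \<Longrightarrow> \<psi> x = 0"
proof -
 obtain S :: "real \<Rightarrow> real" where S: "smooth S" "\<And>t. t \<le> 0 \<Longrightarrow> S t = 0" "\<And>t. 1 \<le> t \<Longrightarrow> S t = 1"
  using smooth_step by blast
 have d: "0 < R\<^sup>2 - r\<^sup>2" using assms by (simp add: power_strict_mono)
 define \<psi> where "\<psi> x = S (1 / (R\<^sup>2 - r\<^sup>2) * (R\<^sup>2 - (norm (x - x0))\<^sup>2))" for x
 show thesis
 proof
  show "smooth \<psi>" unfolding \<psi>_def
   by (intro smooth_compose[OF S(1)] smooth_cmult smooth_diff smooth_const smooth_norm_sq)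
  show "\<psi> x = 1" if "dist x x0 \<le> r" for x
  proof -
   have "(norm (x - x0))\<^sup>2 \<le> r\<^sup>2" using that by (intro power_mono) (auto simp: dist_norm)
   then show ?thesis unfolding \<psi>_def using d by (intro S(3)) (simp add: field_simps)
  qed
  show "\<psi> x = 0" if "R \<le> dist x x0" for x
  proof -
   have "R\<^sup>2 \<le> (norm (x - x0))\<^sup>2" using that assms by (intro power_mono) (auto simp: dist_norm)
   then show ?thesis unfolding \<psi>_def using d by (intro S(2)) (simp add: field_simps)
  qed
 qed
qed

section \<open>Functions with compact support and integration by parts\<close>

lemma pd_0_open:
 assumes "open U" "x \<in> U" "\<And>y. y \<in> U \<Longrightarrow> f y = 0"
 shows "pd i f x = 0"
proof -
 have "(f has_derivative (\<lambda>h. 0)) (at x)"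
  by (rule has_derivative_transform_within_open[OF has_derivative_const[of 0] assms(1,2)])
   (simp add: assms(3))
 then show ?thesis by (rule pd_eqI)
qed

lemma pd_0_outside:
 assumes "\<And>x. R < norm x \<Longrightarrow> f x = 0" "R < norm x"
 shows "pd i f x = 0"
 by (rule pd_0_open[of "- cball 0 R"]) (use assms in auto)

lemma grad_0_outside:
 assumes "\<And>x. R < norm x \<Longrightarrow> f x = 0" "R < norm x"
 shows "grad f x = 0"
 using pd_0_outside[of R f x] assms by (simp add: grad_def pd_def)

lemma bounded_of_compact_support:
 fixes f :: "'a::euclidean_space \<Rightarrow> 'b::real_normed_vector"
 assumes "continuous_on UNIV f" "\<And>x. R < norm x \<Longrightarrow> f x = 0"
 obtains B where "0 \<le> B" "\<And>x. norm (f x) \<le> B"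
proof -
 have "compact (f ` cball 0 R)"
  using assms(1) by (intro compact_continuous_image) (auto intro: continuous_on_subset)
 then obtain B where "\<forall>y\<in>f ` cball 0 R. norm y \<le> B"
  using compact_imp_bounded bounded_iff by blast
 then have "norm (f x) \<le> \<bar>B\<bar>" for x
 proof (cases "R < norm x")
  case False
  then have "norm (f x) \<le> B" using \<open>\<forall>y\<in>_. _\<close> by simp
  then show ?thesis by simp
 qed (use assms(2) in simp)
 then show thesis using that[of "\<bar>B\<bar>"] by auto
qed

lemma integrable_compact_support:
 fixes f :: "'a::euclidean_space \<Rightarrow> 'b::euclidean_space"
 assumes "continuous_on UNIV f" "\<And>x. R < norm x \<Longrightarrow> f x = 0"
 shows "integrable lborel f"
proof -
 have "integrable lborel (\<lambda>x. indicator (cball 0 R) x *\<^sub>R f x)"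
  by (intro borel_integrable_compact continuous_on_subset[OF assms(1)]) auto
 moreover have "(\<lambda>x. indicator (cball 0 R) x *\<^sub>R f x) = f"
  using assms(2) by (force simp: indicator_def)
 ultimately show ?thesis by simp
qed

text \<open>The gradient is continuous with compact support, hence uniformly continuous, and the
  mean value theorem transfers this to the first-order error. Uniformity in \<open>y\<close> is what
  allows differentiation under an integral.\<close>

lemma uniform_differentiable:
 fixes f :: "'a::euclidean_space \<Rightarrow> real"
 assumes f: "smooth f" and R: "\<And>x. R < norm x \<Longrightarrow> f x = 0" and e: "0 < e"
 obtains d where "0 < d" "\<And>y h. norm h < d \<Longrightarrow> \<bar>f (y + h) - f y - grad f y \<bullet> h\<bar> \<le> e * norm h"
proof -
 \<comment> \<open>The radius \<open>\<bar>R\<bar> + 2\<close> leaves room for a step shorter than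
   \<open>1\<close> from any point within \<open>\<bar>R\<bar> + 1\<close>; farther out both
   gradients vanish.\<close>
 have "uniformly_continuous_on (cball 0 (\<bar>R\<bar> + 2)) (grad f)"
  by (intro compact_uniformly_continuous continuous_on_grad f) auto
 then obtain d0 where d0: "0 < d0" "\<And>x y. x \<in> cball 0 (\<bar>R\<bar> + 2) \<Longrightarrow> y \<in> cball 0 (\<bar>R\<bar> + 2)
   \<Longrightarrow> dist y x < d0 \<Longrightarrow> dist (grad f y) (grad f x) < e"
  using e unfolding uniformly_continuous_on_def by metis
 define d where "d = min d0 1"
 have gd: "norm (grad f (y + k) - grad f y) \<le> e" if k: "norm k < d" for y k
 proof (cases "norm y \<le> \<bar>R\<bar> + 1")
  case True
  have "norm (y + k) \<le> \<bar>R\<bar> + 2"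
   using True k norm_triangle_ineq[of y k] by (simp add: d_def)
  then have "dist (grad f (y + k)) (grad f y) < e"
   using True k by (intro d0(2)) (simp_all add: d_def dist_norm[of "y + k"])
  then show ?thesis by (simp add: dist_norm)
 next
  case False
  moreover have "norm y \<le> norm (y + k) + norm k"
   using norm_triangle_ineq4[of "y + k" k] by simp
  ultimately have "R < norm y" "R < norm (y + k)"
   using k by (auto simp: d_def)
  then show ?thesis using grad_0_outside[of R f, OF R] e by simp
 qed
 show thesis
 proof
  show "0 < d" using d0 by (simp add: d_def)
  fix y h :: 'a assume h: "norm h < d"
  have "((\<lambda>x. f (y + x *\<^sub>R h)) has_derivative (\<lambda>k. grad f (y + x *\<^sub>R h) \<bullet> (k *\<^sub>R h))) (at x)" for x
   by (rule has_derivative_compose[OF _ smooth_has_derivative[OF f], of "\<lambda>x. y + x *\<^sub>R h" "\<lambda>k. k *\<^sub>R h", unfolded comp_def])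
    (auto intro!: derivative_eq_intros)
  then have "\<exists>t\<in>{0<..<1}. f (y + 1 *\<^sub>R h) - f (y + 0 *\<^sub>R h) = grad f (y + t *\<^sub>R h) \<bullet> ((1 - 0) *\<^sub>R h)"
   by (rule mvt_simple[OF zero_less_one has_derivative_at_withinI])
  then obtain t where t: "t \<in> {0<..<1}" "f (y + 1 *\<^sub>R h) - f (y + 0 *\<^sub>R h) = grad f (y + t *\<^sub>R h) \<bullet> ((1 - 0) *\<^sub>R h)"
   by blast
  have "\<bar>t\<bar> * norm h \<le> 1 * norm h" using t by (intro mult_right_mono) auto
  then have "norm (t *\<^sub>R h) < d" using h by simp
  have "\<bar>f (y + h) - f y - grad f y \<bullet> h\<bar> = \<bar>(grad f (y + t *\<^sub>R h) - grad f y) \<bullet> h\<bar>"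
   using t by (simp add: inner_diff_left)
  also have "\<dots> \<le> norm (grad f (y + t *\<^sub>R h) - grad f y) * norm h"
   by (rule Cauchy_Schwarz_ineq2)
  also have "\<dots> \<le> e * norm h"
   by (intro mult_right_mono gd \<open>norm (t *\<^sub>R h) < d\<close>) auto
  finally show "\<bar>f (y + h) - f y - grad f y \<bullet> h\<bar> \<le> e * norm h" .
 qed
qed

lemma lborel_translate:
 fixes f :: "'a::euclidean_space \<Rightarrow> 'b::euclidean_space"
 shows integrable_lborel_translate: "integrable lborel f \<Longrightarrow> integrable lborel (\<lambda>x. f (x + h))"
  and integral_lborel_translate: "f \<in> borel_measurable borel \<Longrightarrow> (LINT x|lborel. f (x + h)) = (LINT x|lborel. f x)"
proof -
 have eq: "distr lborel borel (\<lambda>x. x + h) = lborel"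
  using lborel_distr_plus[of h] by (simp add: add.commute[of _ h] cong: distr_cong)
 show "integrable lborel f \<Longrightarrow> integrable lborel (\<lambda>x. f (x + h))"
  using integrable_distr[of "\<lambda>x. x + h" lborel borel f] eq by simp
 show "f \<in> borel_measurable borel \<Longrightarrow> (LINT x|lborel. f (x + h)) = (LINT x|lborel. f x)"
  using integral_distr[of "\<lambda>x. x + h" lborel borel f] eq by simp
qed

lemma nn_integral_lborel_translate:
 fixes f :: "'a::euclidean_space \<Rightarrow> ennreal"
 assumes "f \<in> borel_measurable borel"
 shows "(\<integral>\<^sup>+x. f (x + h) \<partial>lborel) = (\<integral>\<^sup>+x. f x \<partial>lborel)"
proof -
 have eq: "distr lborel borel (\<lambda>x. x + h) = lborel"
  using lborel_distr_plus[of h] by (simp add: add.commute[of _ h] cong: distr_cong)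
 show ?thesis
  using nn_integral_distr[of "\<lambda>x. x + h" lborel borel f] eq assms by simp
qed

text \<open>Integrals over the whole space are translation invariant, so the difference quotient has
  integral \<open>0\<close>; inside a fixed ball it converges uniformly to the partial
  derivative.\<close>

lemma integral_pd_eq_0:
 fixes f :: "'a::euclidean_space \<Rightarrow> real"
 assumes f: "smooth f" and R: "\<And>x. R < norm x \<Longrightarrow> f x = 0" and i: "i \<in> Basis"
 shows "(LINT x|lborel. pd i f x) = 0"
proof -
 define V where "V = measure lborel (cball (0::'a) (\<bar>R\<bar> + 1))"
 have intf: "integrable lborel f" by (rule integrable_compact_support[OF smooth_continuous[OF f] R])
 have intp: "integrable lborel (pd i f)"
  by (rule integrable_compact_support[OF smooth_continuous[OF smooth_pd[OF f i]] pd_0_outside[of R f, OF R]])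
 have [measurable]: "f \<in> borel_measurable borel" using f by (rule smooth_borel)
 have "\<bar>LINT x|lborel. pd i f x\<bar> \<le> 0 + e" if e: "0 < e" for e
 proof -
  have V: "0 \<le> V" by (simp add: V_def)
  define e' where "e' = e / (V + 1)"
  have e': "0 < e'" using e V by (simp add: e'_def)
  obtain d where d: "0 < d" "\<And>y h. norm h < d \<Longrightarrow> \<bar>f (y + h) - f y - grad f y \<bullet> h\<bar> \<le> e' * norm h"
   using uniform_differentiable[OF f R e'] by blast
  define t where "t = min (d / 2) 1"
  have t: "0 < t" "t < d" "t \<le> 1" using d by (auto simp: t_def)
  let ?g = "\<lambda>y. f (y + t *\<^sub>R i) - f y - t * pd i f y"
  have g: "\<bar>?g y\<bar> \<le> e' * t * indicator (cball 0 (\<bar>R\<bar> + 1)) y" for y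
  proof (cases "norm y \<le> \<bar>R\<bar> + 1")
   case True
   then show ?thesis
    using d(2)[of "t *\<^sub>R i" y] t i by (simp add: grad_inner_Basis)
  next
   case False
   moreover have "norm y \<le> norm (y + t *\<^sub>R i) + norm (t *\<^sub>R i)"
    using norm_triangle_ineq4[of "y + t *\<^sub>R i" "t *\<^sub>R i"] by simp
   ultimately have "R < norm y" "R < norm (y + t *\<^sub>R i)" using t i by auto
   then show ?thesis using R e' t pd_0_outside[of R f y i, OF R] by simp
  qed
  have int_g: "integrable lborel ?g"
   using intf intp integrable_lborel_translate[OF intf] by simp
  have "t * \<bar>LINT x|lborel. pd i f x\<bar> = \<bar>LINT y|lborel. ?g y\<bar>"
   using intf intp integrable_lborel_translate[OF intf] t
   by (simp add: integral_lborel_translate abs_mult)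
  also have "\<dots> \<le> (LINT y|lborel. \<bar>?g y\<bar>)"
   using integral_norm_bound[of lborel ?g] by simp
  also have "\<dots> \<le> (LINT y|lborel. e' * t * indicator (cball (0::'a) (\<bar>R\<bar> + 1)) y)"
  proof (rule integral_mono)
   show "integrable lborel (\<lambda>y. \<bar>?g y\<bar>)" using int_g by (rule integrable_abs)
   show "integrable lborel (\<lambda>y. e' * t * indicat_real (cball (0::'a) (\<bar>R\<bar> + 1)) y)"
    using emeasure_lborel_cball_finite[of "0::'a" "\<bar>R\<bar> + 1"]
    by (intro integrable_mult_right integrable_real_indicator) (auto simp: less_top)
  qed (rule g)
  also have "\<dots> = t * (e' * V)"
   by (simp add: V_def)
  finally have "\<bar>LINT x|lborel. pd i f x\<bar> \<le> e' * V" using t by simp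
  also have "\<dots> \<le> e" using e V by (simp add: e'_def field_simps)
  finally show ?thesis by simp
 qed
 then have "\<bar>LINT x|lborel. pd i f x\<bar> \<le> 0" by (rule field_le_epsilon)
 then show ?thesis by simp
qed

section \<open>Convolution and mollifiers\<close>

lemma integrable_conv:
 fixes w :: "'a::euclidean_space \<Rightarrow> 'b::euclidean_space" and f :: "'a \<Rightarrow> real"
 assumes w: "integrable lborel w" and f: "continuous_on UNIV f" "\<And>x. R < norm x \<Longrightarrow> f x = 0"
 shows "integrable lborel (\<lambda>z. f (x - z) *\<^sub>R w z)"
proof -
 obtain B where B: "0 \<le> B" "\<And>x. norm (f x) \<le> B"
  using bounded_of_compact_support[OF f] by blast
 have [measurable]: "f \<in> borel_measurable borel" using f by (intro borel_measurable_continuous_onI)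
 have [measurable]: "w \<in> borel_measurable borel" using w by auto
 show ?thesis
  by (rule Bochner_Integration.integrable_bound[of _ "\<lambda>z. B *\<^sub>R w z"])
   (use w B in \<open>auto intro!: mult_right_mono\<close>)
qed

text \<open>The first-order error of \<open>f\<close> is at most \<open>e' * norm h\<close>
  uniformly, so integrating it against \<open>w\<close> costs only the integral of
  \<open>\<bar>w\<bar>\<close>.\<close>

lemma has_derivative_conv:
 fixes w :: "'a::euclidean_space \<Rightarrow> real"
 assumes w: "integrable lborel w" and f: "smooth f" and R: "\<And>x. R < norm x \<Longrightarrow> f x = 0"
 shows "((\<lambda>x. LINT z|lborel. f (x - z) * w z) has_derivative
  (\<lambda>h. (LINT z|lborel. w z *\<^sub>R grad f (x - z)) \<bullet> h)) (at x)"
proof -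
 let ?G = "LINT z|lborel. w z *\<^sub>R grad f (x - z)"
 have ig: "integrable lborel (\<lambda>z. (grad f (x - z) \<bullet> h) * w z)" for h
 proof (rule integrable_conv[OF w, of "\<lambda>y. grad f y \<bullet> h" R, unfolded real_scaleR_def])
  show "continuous_on UNIV (\<lambda>y. grad f y \<bullet> h)"
   by (intro continuous_intros continuous_on_grad f)
 qed (use grad_0_outside[of R f, OF R] in auto)
 have if': "integrable lborel (\<lambda>z. f (x - z) * w z)" for x
  using integrable_conv[OF w smooth_continuous[OF f] R] by simp
 have inn: "?G \<bullet> h = (LINT z|lborel. (grad f (x - z) \<bullet> h) * w z)" for h
 proof -
  have "integrable lborel (\<lambda>z. w z *\<^sub>R grad f (x - z))"
  proof -
   have "integrable lborel (\<lambda>z. \<Sum>i\<in>Basis. ((grad f (x - z) \<bullet> i) * w z) *\<^sub>R i)"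
    using ig by (intro Bochner_Integration.integrable_sum) simp
   also have "(\<lambda>z. \<Sum>i\<in>Basis. ((grad f (x - z) \<bullet> i) * w z) *\<^sub>R i) = (\<lambda>z. w z *\<^sub>R grad f (x - z))"
    by (rule ext, rule euclidean_eqI) (simp add: inner_sum_left inner_Basis if_distrib cong: if_cong)
   finally show ?thesis .
  qed
  then show ?thesis by (simp add: mult.commute flip: integral_inner_left)
 qed
 define I where "I = (LINT z|lborel. \<bar>w z\<bar>)"
 have I: "0 \<le> I" by (simp add: I_def)
 show ?thesis
  unfolding has_derivative_at_alt
 proof (intro conjI allI impI)
  show "bounded_linear (\<lambda>h. ?G \<bullet> h)"
   by (rule bounded_linear_inner_right)
  fix e :: real assume e: "0 < e"
  define e' where "e' = e / (I + 1)"
  have e': "0 < e'" using e I by (simp add: e'_def)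
  obtain d where d: "0 < d" "\<And>y h. norm h < d \<Longrightarrow> \<bar>f (y + h) - f y - grad f y \<bullet> h\<bar> \<le> e' * norm h"
   using uniform_differentiable[OF f R e'] by blast
  show "\<exists>d>0. \<forall>y. norm (y - x) < d \<longrightarrow>
    norm ((LINT z|lborel. f (y - z) * w z) - (LINT z|lborel. f (x - z) * w z)
     - ?G \<bullet> (y - x)) \<le> e * norm (y - x)"
  proof (intro exI[of _ d] conjI allI impI d(1))
   fix y assume y: "norm (y - x) < d"
   let ?g = "\<lambda>z. (f (y - z) - f (x - z) - grad f (x - z) \<bullet> (y - x)) * w z"
   have g: "integrable lborel ?g"
    using if' ig by (simp add: left_diff_distrib)
   have eq: "(LINT z|lborel. f (y - z) * w z) - (LINT z|lborel. f (x - z) * w z)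
     - ?G \<bullet> (y - x) = (LINT z|lborel. ?g z)"
    unfolding inn using if' ig by (simp add: left_diff_distrib)
   have "norm (LINT z|lborel. ?g z) \<le> (LINT z|lborel. norm (?g z))"
    by (rule integral_norm_bound)
   also have "\<dots> \<le> (LINT z|lborel. (e' * norm (y - x)) * \<bar>w z\<bar>)"
   proof (rule integral_mono[OF integrable_norm[OF g]])
    fix z
    have "\<bar>f ((x - z) + (y - x)) - f (x - z) - grad f (x - z) \<bullet> (y - x)\<bar> \<le> e' * norm (y - x)"
     by (rule d(2)[OF y])
    then show "norm (?g z) \<le> e' * norm (y - x) * \<bar>w z\<bar>"
     by (auto simp: abs_mult intro!: mult_right_mono)
   qed (use w in auto)
   also have "\<dots> = e' * I * norm (y - x)" by (simp add: I_def)
   also have "\<dots> \<le> e * norm (y - x)"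
    using e I by (intro mult_right_mono) (simp_all add: e'_def field_simps)
   finally show "norm ((LINT z|lborel. f (y - z) * w z) - (LINT z|lborel. f (x - z) * w z)
     - ?G \<bullet> (y - x)) \<le> e * norm (y - x)"
    unfolding eq .
  qed
 qed
qed

lemma pd_conv:
 fixes w :: "'a::euclidean_space \<Rightarrow> real"
 assumes w: "integrable lborel w" and f: "smooth f" and R: "\<And>x. R < norm x \<Longrightarrow> f x = 0" and i: "i \<in> Basis"
 shows "pd i (\<lambda>x. LINT z|lborel. f (x - z) * w z) x = (LINT z|lborel. pd i f (x - z) * w z)"
proof -
 have "integrable lborel (\<lambda>z. w z *\<^sub>R grad f (x - z))"
 proof -
  have "integrable lborel (\<lambda>z. \<Sum>i\<in>Basis. (pd i f (x - z) * w z) *\<^sub>R i)"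
   using integrable_conv[OF w smooth_continuous[OF smooth_pd[OF f]] pd_0_outside[of R f, OF R]]
   by (intro Bochner_Integration.integrable_sum) simp
  also have "(\<lambda>z. \<Sum>i\<in>Basis. (pd i f (x - z) * w z) *\<^sub>R i) = (\<lambda>z. w z *\<^sub>R grad f (x - z))"
   by (rule ext, rule euclidean_eqI) (simp add: inner_sum_left inner_Basis grad_inner_Basis if_distrib cong: if_cong)
  finally show ?thesis .
 qed
 then show ?thesis
  using pd_eqI[OF has_derivative_conv[OF w f R], where x=x and i=i] i
  by (simp add: grad_inner_Basis mult.commute flip: integral_inner_left)
qed

text \<open>Every derivative falls on the kernel \<open>f\<close>, whose partial derivatives keep
  the same bound on the support; the induction therefore runs over all kernels at once.\<close>

lemma smooth_conv:
 fixes w :: "'a::euclidean_space \<Rightarrow> real"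
 assumes w: "integrable lborel w" and f: "smooth f" and R: "\<And>x. R < norm x \<Longrightarrow> f x = 0"
 shows "smooth (\<lambda>x. LINT z|lborel. f (x - z) * w z)"
proof -
 have diff: "(\<lambda>x. LINT z|lborel. f (x - z) * w z) differentiable at x"
  if "smooth f" "\<And>x. R < norm x \<Longrightarrow> f x = 0" for f :: "'a \<Rightarrow> real" and x
  using has_derivative_conv[OF w that] unfolding differentiable_def by blast
 have "Ck_on k UNIV (\<lambda>x. LINT z|lborel. f (x - z) * w z)"
  if "smooth f" "\<And>x. R < norm x \<Longrightarrow> f x = 0" for k and f :: "'a \<Rightarrow> real"
  using that
 proof (induction k arbitrary: f)
  case 0
  then show ?case
   using diff[OF 0] by (auto intro!: continuous_at_imp_continuous_on differentiable_imp_continuous_within)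
 next
  case (Suc k)
  show ?case
   unfolding Ck_Suc
  proof (intro conjI allI ballI)
   fix i :: 'a assume i: "i \<in> Basis"
   have "pd i (\<lambda>x. LINT z|lborel. f (x - z) * w z) = (\<lambda>x. LINT z|lborel. pd i f (x - z) * w z)"
    by (rule ext, rule pd_conv[OF w Suc.prems i])
   then show "Ck_on k UNIV (pd i (\<lambda>x. LINT z|lborel. f (x - z) * w z))"
    using Suc.IH[OF smooth_pd[OF Suc.prems(1) i] pd_0_outside[of R f, OF Suc.prems(2)]] by simp
  qed (rule diff[OF Suc.prems])
 qed
 then show ?thesis using f R by (simp add: smooth_def)
qed

text \<open>The scale is the support radius inside the predicate, so a kernel is chosen afresh for
  each radius instead of being rescaled from a fixed one.\<close>

definition mollifier :: "real \<Rightarrow> ('a::euclidean_space \<Rightarrow> real) \<Rightarrow> bool" where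
 "mollifier \<epsilon> \<eta> \<longleftrightarrow> smooth \<eta> \<and> (\<forall>x. 0 \<le> \<eta> x) \<and> (\<forall>x. \<epsilon> \<le> norm x \<longrightarrow> \<eta> x = 0) \<and> (LINT x|lborel. \<eta> x) = 1"

lemma mollifier_exists:
 assumes "0 < e" shows "\<exists>\<eta> :: 'a::euclidean_space \<Rightarrow> real. mollifier e \<eta>"
proof -
 define b where "b x = exp_inv 0 (e\<^sup>2 - (norm (x - 0))\<^sup>2)" for x :: 'a
 have b: "smooth b" unfolding b_def
  by (intro smooth_compose[OF smooth_exp_inv] smooth_diff smooth_const smooth_norm_sq)
 have b0: "0 \<le> b x" for x by (simp add: b_def exp_inv_def)
 have bz: "b x = 0" if "e \<le> norm x" for x
 proof -
  have "\<not> 0 < e\<^sup>2 - (norm (x - 0))\<^sup>2"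
   using power_mono[OF that, of 2] assms by (simp only: diff_zero) linarith
  then show ?thesis by (simp only: b_def exp_inv_def if_False)
 qed
 have int: "integrable lborel b"
  by (rule integrable_compact_support[OF smooth_continuous[OF b], of e]) (simp add: bz)
 have "(LINT x|lborel. b x) \<noteq> 0"
 proof
  assume "(LINT x|lborel. b x) = 0"
  then have "AE x in lborel. b x = 0"
   using integral_nonneg_eq_0_iff_AE[OF int] b0 by simp
  moreover have "b x \<noteq> 0" if "x \<in> ball 0 e" for x
  proof -
   have "(norm x)\<^sup>2 < e\<^sup>2" using that assms by (intro power_strict_mono) auto
   then show ?thesis by (simp add: b_def exp_inv_def)
  qed
  ultimately have "AE x in lborel. x \<notin> ball (0::'a) e" by (auto elim!: eventually_mono)
  then have "ball (0::'a) e \<in> null_sets lborel"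
   by (subst AE_iff_null_sets) auto
  then show False
   using emeasure_lborel_ball_finite[of "0::'a" e] unit_ball_vol_pos[of "real DIM('a)"] assms
   by (auto simp: null_sets_def emeasure_ball)
 qed
 moreover have "0 \<le> (LINT x|lborel. b x)" using b0 by simp
 ultimately have pos: "0 < (LINT x|lborel. b x)" by linarith
 have "mollifier e (\<lambda>x. (1 / (LINT x|lborel. b x)) * b x)"
  unfolding mollifier_def using b0 bz pos by (intro conjI smooth_cmult[OF b]) auto
 then show ?thesis by blast
qed

lemma mollifierD:
 assumes "mollifier e \<eta>"
 shows "smooth \<eta>" "0 \<le> \<eta> x" "e \<le> norm x \<Longrightarrow> \<eta> x = 0" "(LINT x|lborel. \<eta> x) = 1" "integrable lborel \<eta>"
 using assms integrable_compact_support[OF smooth_continuous[of \<eta>], of e] by (auto simp: mollifier_def)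

section \<open>Translation and mollification in Lebesgue spaces\<close>

lemma Lp_translate:
 assumes "f \<in> Lp lborel s"
 shows "(\<lambda>x. f (x + h)) \<in> Lp lborel s" "Lnorm lborel s (\<lambda>x. f (x + h)) = Lnorm lborel s f"
proof -
 have [measurable]: "f \<in> borel_measurable borel" and i: "integrable lborel (\<lambda>x. norm (f x) powr s)"
  using assms by (auto simp: Lp_def)
 show "(\<lambda>x. f (x + h)) \<in> Lp lborel s"
  using integrable_lborel_translate[OF i, of h] by (auto simp: Lp_def)
 show "Lnorm lborel s (\<lambda>x. f (x + h)) = Lnorm lborel s f"
  using integral_lborel_translate[of "\<lambda>x. norm (f x) powr s" h] by (simp add: Lnorm_def)
qed

text \<open>The class is closed under sums and under limits in the norm, so continuity of
  translations climbs from indicators of open sets to Borel sets, simple functions and all of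
  \<open>Lp\<close>.\<close>

definition translation_continuous :: "real \<Rightarrow> ('a::euclidean_space \<Rightarrow> 'b::euclidean_space) \<Rightarrow> bool" where
 "translation_continuous s f \<longleftrightarrow> f \<in> Lp lborel s \<and>
   (\<forall>h. h \<longlonglongrightarrow> 0 \<longrightarrow> (\<lambda>n. Lnorm lborel s (\<lambda>x. f (x + h n) - f x)) \<longlonglongrightarrow> 0)"

lemma translation_continuous_add:
 assumes f: "translation_continuous s f" and g: "translation_continuous s g" and s: "1 \<le> s"
 shows "translation_continuous s (\<lambda>x. f x + g x)"
 unfolding translation_continuous_def
proof (intro conjI allI impI)
 have fL: "f \<in> Lp lborel s" and gL: "g \<in> Lp lborel s"
  using f g by (auto simp: translation_continuous_def)
 show "(\<lambda>x. f x + g x) \<in> Lp lborel s" by (intro Lp_add fL gL s)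
 fix h :: "nat \<Rightarrow> 'a" assume h: "h \<longlonglongrightarrow> 0"
 have "(\<lambda>n. Lnorm lborel s (\<lambda>x. f (x + h n) - f x) + Lnorm lborel s (\<lambda>x. g (x + h n) - g x)) \<longlonglongrightarrow> 0 + 0"
  using f g h unfolding translation_continuous_def by (intro tendsto_add) auto
 then have z: "(\<lambda>n. Lnorm lborel s (\<lambda>x. f (x + h n) - f x) + Lnorm lborel s (\<lambda>x. g (x + h n) - g x)) \<longlonglongrightarrow> 0"
  by simp
 show "(\<lambda>n. Lnorm lborel s (\<lambda>x. f (x + h n) + g (x + h n) - (f x + g x))) \<longlonglongrightarrow> 0"
 proof (rule Lim_null_comparison[OF always_eventually z], rule allI)
  fix n
  have "Lnorm lborel s (\<lambda>x. (f (x + h n) - f x) + (g (x + h n) - g x))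
    \<le> Lnorm lborel s (\<lambda>x. f (x + h n) - f x) + Lnorm lborel s (\<lambda>x. g (x + h n) - g x)"
   by (intro Lnorm_triangle Lp_diff Lp_translate fL gL s)
  then show "norm (Lnorm lborel s (\<lambda>x. f (x + h n) + g (x + h n) - (f x + g x)))
    \<le> Lnorm lborel s (\<lambda>x. f (x + h n) - f x) + Lnorm lborel s (\<lambda>x. g (x + h n) - g x)"
   by (simp add: algebra_simps)
 qed
qed

lemma translation_continuous_0: "1 \<le> s \<Longrightarrow> translation_continuous s (\<lambda>x. 0)"
 by (simp add: translation_continuous_def Lp_def)

lemma translation_continuous_sum:
 fixes f :: "'i \<Rightarrow> 'a::euclidean_space \<Rightarrow> 'b::euclidean_space"
 assumes "1 \<le> s" "\<And>i. i \<in> I \<Longrightarrow> translation_continuous s (f i)"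
 shows "translation_continuous s (\<lambda>x. \<Sum>i\<in>I. f i x)"
 using assms(2)
 by (induction I rule: infinite_finite_induct)
  (simp_all add: translation_continuous_0 translation_continuous_add assms(1))

lemma translation_continuous_limit:
 fixes f :: "'a::euclidean_space \<Rightarrow> 'b::euclidean_space"
 assumes s: "1 \<le> s" and fL: "f \<in> Lp lborel s"
  and approx: "\<And>e. 0 < e \<Longrightarrow> \<exists>g. translation_continuous s g \<and> Lnorm lborel s (\<lambda>x. f x - g x) < e"
 shows "translation_continuous s f"
 unfolding translation_continuous_def
proof (intro conjI allI impI fL)
 fix h :: "nat \<Rightarrow> 'a" assume h: "h \<longlonglongrightarrow> 0"
 show "(\<lambda>n. Lnorm lborel s (\<lambda>x. f (x + h n) - f x)) \<longlonglongrightarrow> 0"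
 proof (rule LIMSEQ_I)
  fix e :: real assume "0 < e"
  then obtain g where g: "translation_continuous s g" and fg: "Lnorm lborel s (\<lambda>x. f x - g x) < e / 3"
   using approx[of "e/3"] by auto
  have gL: "g \<in> Lp lborel s" and gh: "(\<lambda>n. Lnorm lborel s (\<lambda>x. g (x + h n) - g x)) \<longlonglongrightarrow> 0"
   using g h by (auto simp: translation_continuous_def)
  have "\<forall>\<^sub>F n in sequentially. Lnorm lborel s (\<lambda>x. g (x + h n) - g x) < e / 3"
   using order_tendstoD(2)[OF gh, of "e/3"] \<open>0 < e\<close> by simp
  then obtain N where N: "\<And>n. N \<le> n \<Longrightarrow> Lnorm lborel s (\<lambda>x. g (x + h n) - g x) < e / 3"
   by (auto simp: eventually_sequentially)
  show "\<exists>N. \<forall>n\<ge>N. norm (Lnorm lborel s (\<lambda>x. f (x + h n) - f x) - 0) < e"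
  proof (intro exI[of _ N] allI impI)
   fix n assume n: "N \<le> n"
   have "Lnorm lborel s (\<lambda>x. f (x + h n) - f x)
     \<le> Lnorm lborel s (\<lambda>x. f (x + h n) - g (x + h n)) + Lnorm lborel s (\<lambda>x. g (x + h n) - f x)"
    by (intro Lnorm_triangle_via Lp_translate fL gL s)
   also have "Lnorm lborel s (\<lambda>x. g (x + h n) - f x)
     \<le> Lnorm lborel s (\<lambda>x. g (x + h n) - g x) + Lnorm lborel s (\<lambda>x. g x - f x)"
    by (intro Lnorm_triangle_via Lp_translate fL gL s)
   also have "Lnorm lborel s (\<lambda>x. f (x + h n) - g (x + h n)) = Lnorm lborel s (\<lambda>x. f x - g x)"
    using Lp_translate(2)[OF Lp_diff[OF fL gL s], of "h n"] by simp
   also have "Lnorm lborel s (\<lambda>x. g x - f x) = Lnorm lborel s (\<lambda>x. f x - g x)"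
    by (rule Lnorm_minus_commute)
   finally show "norm (Lnorm lborel s (\<lambda>x. f (x + h n) - f x) - 0) < e"
    using fg N[OF n] by simp
  qed
 qed
qed

text \<open>From a point of the open set small translations do not leave it, so the loss, the
  positive part of the difference, tends to \<open>0\<close> below the dominating indicator. By
  translation invariance the gain has the same integral as the loss, hence the factor
  \<open>2\<close>.\<close>

lemma translation_continuous_indicator_open:
 fixes c :: "'b::euclidean_space" and U :: "'a::euclidean_space set"
 assumes U: "open U" "emeasure lborel U < \<infinity>" and s: "1 \<le> s"
 shows "translation_continuous s (\<lambda>x. indicator U x *\<^sub>R c)"
 unfolding translation_continuous_def
proof (intro conjI allI impI)
 have [measurable]: "U \<in> sets borel" using U by auto
 have pow: "norm (indicator U x *\<^sub>R c) powr s = norm c powr s * indicator U x" for x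
  by (simp add: indicator_def)
 have iU: "integrable lborel (indicator U :: 'a \<Rightarrow> real)"
  using U by (intro integrable_real_indicator) auto
 show "(\<lambda>x. indicator U x *\<^sub>R c) \<in> Lp lborel s"
  by (rule LpI, measurable, unfold pow) (intro integrable_mult_right iU)
 fix h :: "nat \<Rightarrow> 'a" assume h: "h \<longlonglongrightarrow> 0"
 let ?I = "indicator U :: 'a \<Rightarrow> real"
 have iUh: "integrable lborel (\<lambda>x. ?I (x + h n))" for n
  by (rule integrable_lborel_translate[OF iU])
 have "(\<lambda>n. LINT x|lborel. max 0 (?I x - ?I (x + h n))) \<longlonglongrightarrow> (LINT x|(lborel::'a measure). 0)"
 proof (rule integral_dominated_convergence[where w="?I"])
  show "AE x in lborel. (\<lambda>n. max 0 (?I x - ?I (x + h n))) \<longlonglongrightarrow> 0"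
  proof (rule AE_I2)
   fix x :: 'a
   show "(\<lambda>n. max 0 (?I x - ?I (x + h n))) \<longlonglongrightarrow> 0"
   proof (cases "x \<in> U")
    case True
    have "(\<lambda>n. x + h n) \<longlonglongrightarrow> x + 0" using h by (intro tendsto_intros)
    then have "\<forall>\<^sub>F n in sequentially. x + h n \<in> U"
     using topological_tendstoD[OF _ U(1)] True by fastforce
    then have "\<forall>\<^sub>F n in sequentially. 0 = max 0 (?I x - ?I (x + h n))"
     by eventually_elim (use True in simp)
    then show ?thesis by (rule Lim_transform_eventually[OF tendsto_const])
   qed (simp add: indicator_def)
  qed
 qed (use iU in \<open>auto simp: indicator_def\<close>)
 then have lim: "(\<lambda>n. 2 * (LINT x|lborel. max 0 (?I x - ?I (x + h n)))) \<longlonglongrightarrow> 0"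
  by (auto intro!: tendsto_eq_intros)
 have eq: "(LINT x|lborel. norm (indicator U (x + h n) *\<^sub>R c - indicator U x *\<^sub>R c) powr s)
   = norm c powr s * (2 * (LINT x|lborel. max 0 (?I x - ?I (x + h n))))" for n
 proof -
  have "norm (indicator U (x + h n) *\<^sub>R c - indicator U x *\<^sub>R c) powr s
    = norm c powr s * (2 * max 0 (?I x - ?I (x + h n)) + ?I (x + h n) - ?I x)" for x
   by (auto simp: indicator_def)
  moreover have "(LINT x|lborel. 2 * max 0 (?I x - ?I (x + h n)) + ?I (x + h n) - ?I x)
    = 2 * (LINT x|lborel. max 0 (?I x - ?I (x + h n)))"
   using iU iUh by (simp add: integral_lborel_translate)
  ultimately show ?thesis by simp
 qed
 show "(\<lambda>n. Lnorm lborel s (\<lambda>x. indicator U (x + h n) *\<^sub>R c - indicator U x *\<^sub>R c)) \<longlonglongrightarrow> 0"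
  using s lim by (subst tendsto_Lnorm_iff) (auto simp: eq intro!: tendsto_mult_right_zero)
qed

lemma translation_continuous_indicator:
 fixes c :: "'b::euclidean_space" and A :: "'a::euclidean_space set"
 assumes A: "A \<in> sets borel" "emeasure lborel A < \<infinity>" and s: "1 \<le> s"
 shows "translation_continuous s (\<lambda>x. indicator A x *\<^sub>R c)"
proof (rule translation_continuous_limit[OF s])
 have [measurable]: "A \<in> sets borel" by fact
 have "integrable lborel (indicator A :: 'a \<Rightarrow> real)"
  using A by (intro integrable_real_indicator) auto
 moreover have "norm (indicator A x *\<^sub>R c) powr s = norm c powr s * indicator A x" for x
  by (simp add: indicator_def)
 ultimately show "(\<lambda>x. indicator A x *\<^sub>R c) \<in> Lp lborel s"
  by (intro LpI) (simp_all only:, simp_all)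
 fix e :: real assume e: "0 < e"
 \<comment> \<open>Chosen so that \<open>norm c powr s * d\<close> is the \<open>s\<close>-th power
   of a number below \<open>e\<close>; the \<open>+ 1\<close> covers \<open>c = 0\<close>.\<close>
 define d where "d = (e / (norm c + 1)) powr s"
 have d: "0 < d" using e by (simp add: d_def add_nonneg_eq_0_iff)
 obtain U where U: "open U" "A \<subseteq> U" "emeasure lborel (U - A) < d"
  using outer_regular_lborel[OF A(1) d] .
 have [measurable]: "U \<in> sets borel" using U by auto
 have "emeasure lborel U \<le> emeasure lborel A + emeasure lborel (U - A)"
  using emeasure_subadditive[of A lborel "U - A"] U(2) by (simp add: Un_absorb1)
 then have Ufin: "emeasure lborel U < \<infinity>"
  using A(2) U(3) by (metis ennreal_add_less_top infinity_ennreal_def order_le_less_trans order_less_trans ennreal_less_top)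
 have "norm (indicator A x *\<^sub>R c - indicator U x *\<^sub>R c) powr s = norm c powr s * indicator (U - A) x" for x
  using U(2) by (auto simp: indicator_def)
 then have "(LINT x|lborel. norm (indicator A x *\<^sub>R c - indicator U x *\<^sub>R c) powr s) = norm c powr s * measure lborel (U - A)"
  by simp
 also have "\<dots> \<le> norm c powr s * d"
  using U(3) d by (intro mult_left_mono) (auto simp: measure_def enn2real_leI less_imp_le)
 also have "\<dots> = (norm c * (e / (norm c + 1))) powr s"
  using e by (subst powr_mult) (auto simp: d_def)
 finally have "Lnorm lborel s (\<lambda>x. indicator A x *\<^sub>R c - indicator U x *\<^sub>R c) \<le> norm c * (e / (norm c + 1))"
  using s e by (subst Lnorm_le_iff) auto
 also have "\<dots> < e"
  using e norm_ge_zero[of c] by (simp add: divide_less_eq add_nonneg_pos algebra_simps not_less)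
 finally show "\<exists>g. translation_continuous s g \<and> Lnorm lborel s (\<lambda>x. indicator A x *\<^sub>R c - g x) < e"
  using translation_continuous_indicator_open[OF U(1) Ufin s, of c] by blast
qed

lemma translation_continuous_simple:
 assumes f: "f \<in> Lp lborel s" "simple_function lborel f" and s: "1 \<le> s"
 shows "translation_continuous s f"
proof -
 have [measurable]: "f \<in> borel_measurable borel" using LpD(1)[OF f(1)] by simp
 have eq: "f = (\<lambda>x. \<Sum>y\<in>range f. indicator (f -` {y}) x *\<^sub>R y)"
  using simple_function_indicator_representation_banach[OF f(2)]
  by (intro ext) (simp only: space_lborel space_borel Int_UNIV_right UNIV_I)
 have "translation_continuous s (\<lambda>x. indicator (f -` {y}) x *\<^sub>R y)" for y
 proof (cases "y = 0")
  case True
  then show ?thesis using translation_continuous_0[OF s] by simp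
 next
  case False
  have meas: "f -` {y} \<in> sets borel"
   using measurable_sets_borel[of f borel "{y}"] by simp
  have "ennreal (norm y powr s) * emeasure lborel (f -` {y}) = (\<integral>\<^sup>+x. ennreal (norm y powr s) * indicator (f -` {y}) x \<partial>lborel)"
   using meas by (simp add: nn_integral_cmult_indicator)
  also have "\<dots> \<le> (\<integral>\<^sup>+x. ennreal (norm (f x) powr s) \<partial>lborel)"
   by (intro nn_integral_mono) (auto simp: indicator_def)
  also have "\<dots> < \<infinity>"
   using LpD(2)[OF f(1)] by (simp add: integrable_iff_bounded)
  finally have "emeasure lborel (f -` {y}) < \<infinity>"
   using False by (auto simp: ennreal_mult_less_top)
  then show ?thesis by (intro translation_continuous_indicator meas s)
 qed
 then show ?thesis
  by (subst eq) (rule translation_continuous_sum[OF s])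
qed

text \<open>Simple functions dominated by \<open>2 * norm (f x)\<close> converge pointwise to
  \<open>f\<close>. The domination puts them into \<open>Lp\<close> and yields convergence in the
  norm.\<close>

lemma translation_continuous_Lp:
 assumes f: "f \<in> Lp lborel s" and s: "1 \<le> s"
 shows "translation_continuous s f"
proof (rule translation_continuous_limit[OF s f])
 fix e :: real assume e: "0 < e"
 have [measurable]: "f \<in> borel_measurable borel" using LpD(1)[OF f] by simp
 obtain F where F: "\<And>i. simple_function lborel (F i)" "\<And>x. (\<lambda>i. F i x) \<longlonglongrightarrow> f x"
   "\<And>i x. norm (F i x) \<le> 2 * norm (f x)"
  using borel_measurable_implies_sequence_metric[of f lborel 0] by (auto simp: dist_norm)
 have [measurable]: "F i \<in> borel_measurable borel" for i
  using borel_measurable_simple_function[OF F(1)] by simp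
 have bd: "norm (F i x) powr s \<le> 2 powr s * norm (f x) powr s" for i x
  using F(3)[of i x] s powr_mono2[of s "norm (F i x)" "2 * norm (f x)"] by (simp add: powr_mult)
 have FL: "F i \<in> Lp lborel s" for i
 proof (rule LpI)
  show "integrable lborel (\<lambda>x. norm (F i x) powr s)"
   by (rule Bochner_Integration.integrable_bound[of _ "\<lambda>x. 2 powr s * norm (f x) powr s"])
    (use LpD(2)[OF f] bd in auto)
 qed simp
 have "(\<lambda>i. LINT x|lborel. norm (f x - F i x) powr s) \<longlonglongrightarrow> (LINT x|(lborel::'a measure). 0)"
 proof (rule integral_dominated_convergence[where w="\<lambda>x. 2 powr (s - 1) * (norm (f x) powr s + 2 powr s * norm (f x) powr s)"])
  show "AE x in lborel. (\<lambda>i. norm (f x - F i x) powr s) \<longlonglongrightarrow> 0"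
  proof (rule AE_I2)
   fix x
   have "(\<lambda>i. norm (f x - F i x) powr s) \<longlonglongrightarrow> norm (f x - f x) powr s"
    using s by (intro tendsto_powr2 tendsto_intros F) auto
   then show "(\<lambda>i. norm (f x - F i x) powr s) \<longlonglongrightarrow> 0" by simp
  qed
  show "AE x in lborel. norm (norm (f x - F i x) powr s)
    \<le> 2 powr (s - 1) * (norm (f x) powr s + 2 powr s * norm (f x) powr s)" for i
  proof (rule AE_I2)
   fix x
   have "norm (f x + (- F i x)) powr s \<le> 2 powr (s - 1) * (norm (f x) powr s + norm (- F i x) powr s)"
    by (rule powr_norm_add_le[OF s])
   also have "\<dots> \<le> 2 powr (s - 1) * (norm (f x) powr s + 2 powr s * norm (f x) powr s)"
    using bd[of i x] by (intro mult_left_mono add_left_mono) auto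
   finally show "norm (norm (f x - F i x) powr s)
     \<le> 2 powr (s - 1) * (norm (f x) powr s + 2 powr s * norm (f x) powr s)" by simp
  qed
 qed (use LpD(2)[OF f] in auto)
 then have "(\<lambda>i. Lnorm lborel s (\<lambda>x. f x - F i x)) \<longlonglongrightarrow> 0"
  using s by (subst tendsto_Lnorm_iff) auto
 then have "\<forall>\<^sub>F i in sequentially. Lnorm lborel s (\<lambda>x. f x - F i x) < e"
  using e by (rule order_tendstoD)
 then obtain i where "Lnorm lborel s (\<lambda>x. f x - F i x) < e"
  using eventually_happens'[OF sequentially_bot] by blast
 then show "\<exists>g. translation_continuous s g \<and> Lnorm lborel s (\<lambda>x. f x - g x) < e"
  using translation_continuous_simple[OF FL F(1) s] by blast
qed

lemma Lnorm_translate_small: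
 assumes f: "f \<in> Lp lborel s" and s: "1 \<le> s" and e: "0 < e"
 obtains d where "0 < d" "\<And>h. norm h < d \<Longrightarrow> Lnorm lborel s (\<lambda>x. f (x + h) - f x) < e"
proof -
 have "\<exists>d>0. \<forall>h. norm h < d \<longrightarrow> Lnorm lborel s (\<lambda>x. f (x + h) - f x) < e"
 proof (rule ccontr)
  assume "\<not> ?thesis"
  then have "\<forall>n. \<exists>h. norm h < inverse (real (Suc n)) \<and> \<not> Lnorm lborel s (\<lambda>x. f (x + h) - f x) < e"
   by (metis inverse_positive_iff_positive of_nat_0_less_iff zero_less_Suc)
  then obtain h where h: "\<And>n. norm (h n) < inverse (real (Suc n))"
    "\<And>n. \<not> Lnorm lborel s (\<lambda>x. f (x + h n) - f x) < e" by metis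
  have "h \<longlonglongrightarrow> 0"
   using h(1) by (intro Lim_null_comparison[OF _ LIMSEQ_inverse_real_of_nat]) (auto intro!: always_eventually less_imp_le)
  then have "(\<lambda>n. Lnorm lborel s (\<lambda>x. f (x + h n) - f x)) \<longlonglongrightarrow> 0"
   using translation_continuous_Lp[OF f s] by (auto simp: translation_continuous_def)
  then have "\<forall>\<^sub>F n in sequentially. Lnorm lborel s (\<lambda>x. f (x + h n) - f x) < e"
   using e by (rule order_tendstoD)
  then show False
   using h(2) eventually_happens'[OF sequentially_bot] by blast
 qed
 then show thesis using that by blast
qed

text \<open>Jensen's inequality for the probability density \<eta> and Fubini bound the error by an
  average of translation errors for shifts of size at most \<open>\<epsilon> * (norm v + 1)\<close>.
  The displacement along \<open>v\<close> is built in because near the boundary the averages have to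
  be taken over balls pushed into the domain.\<close>

lemma mollify_converges:
 fixes w :: "'a::euclidean_space \<Rightarrow> 'b::euclidean_space"
 assumes wL: "w \<in> Lp lborel s" and wi: "integrable lborel w" and s: "1 \<le> s"
  and \<eta>: "\<And>n. mollifier (\<epsilon> n) (\<eta> n)" and \<epsilon>: "\<epsilon> \<longlonglongrightarrow> 0" "\<And>n. 0 < \<epsilon> n"
 shows "(\<lambda>x. LINT z|lborel. \<eta> n (x + \<epsilon> n *\<^sub>R v - z) *\<^sub>R w z) \<in> Lp lborel s"
  and "(\<lambda>n. Lnorm lborel s (\<lambda>x. (LINT z|lborel. \<eta> n (x + \<epsilon> n *\<^sub>R v - z) *\<^sub>R w z) - w x)) \<longlonglongrightarrow> 0"
proof -
 have w [measurable]: "w \<in> borel_measurable borel" using wi by auto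
 have \<eta>m [measurable]: "\<eta> n \<in> borel_measurable borel" for n
  using mollifierD(1)[OF \<eta>] by (rule smooth_borel)
 define G where "G n x = (LINT z|lborel. \<eta> n (x + \<epsilon> n *\<^sub>R v - z) *\<^sub>R w z)" for n x
 have [measurable]: "G n \<in> borel_measurable borel" for n
  unfolding G_def by measurable
 let ?w = "\<lambda>n y x. w (x + (\<epsilon> n *\<^sub>R v - y)) - w x" and ?G = "\<lambda>n. \<integral>\<^sup>+x. ennreal (norm (G n x - w x) powr s) \<partial>lborel"
 \<comment> \<open>\<open>e\<close> is any bound for the translation errors. It is used with a crude
   value for membership in \<open>Lp\<close> and with a small one for convergence.\<close>
 have key: "?G n \<le> ennreal (e powr s)"
  if e: "0 \<le> e" and small: "\<And>y. norm y < \<epsilon> n \<Longrightarrow> Lnorm lborel s (?w n y) \<le> e" for n e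
 proof -
  let ?y = "\<lambda>x z. w (x + (\<epsilon> n *\<^sub>R v - z)) - w x"
  have e1: "emeasure (density lborel (\<eta> n)) (space (density lborel (\<eta> n))) = 1"
   using mollifierD(4,5)[OF \<eta>] mollifierD(2)[OF \<eta>]
   by (simp add: emeasure_density nn_integral_eq_integral)
  have pt: "ennreal (norm (G n x - w x) powr s) \<le> (\<integral>\<^sup>+z. ennreal (\<eta> n z) * ennreal (norm (?y x z) powr s) \<partial>lborel)" for x
  proof -
   have i: "integrable lborel (\<lambda>z. \<eta> n ((x + \<epsilon> n *\<^sub>R v) - z) *\<^sub>R w z)"
    by (rule integrable_conv[OF wi smooth_continuous[OF mollifierD(1)[OF \<eta>]], of "\<epsilon> n"])
     (use mollifierD(3)[OF \<eta>] in auto)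
   \<comment> \<open>The reflection about the displaced centre preserves Lebesgue measure; it moves
     the variable of integration into the argument of the kernel.\<close>
   have d: "distr lborel borel (\<lambda>z. (x + \<epsilon> n *\<^sub>R v) - z) = lborel"
    by (subst lborel_affine[of "-1" "x + \<epsilon> n *\<^sub>R v"]) (auto simp: density_1)
   have "G n x = (LINT z|distr lborel borel (\<lambda>z. (x + \<epsilon> n *\<^sub>R v) - z). \<eta> n ((x + \<epsilon> n *\<^sub>R v) - z) *\<^sub>R w z)"
    unfolding d G_def ..
   also have "\<dots> = (LINT z|lborel. \<eta> n z *\<^sub>R w (x + (\<epsilon> n *\<^sub>R v - z)))"
    by (subst integral_distr) (auto simp: algebra_simps)
   finally have G1: "G n x = (LINT z|lborel. \<eta> n z *\<^sub>R w (x + (\<epsilon> n *\<^sub>R v - z)))" .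
   have "integrable (distr lborel borel (\<lambda>z. (x + \<epsilon> n *\<^sub>R v) - z)) (\<lambda>z. \<eta> n ((x + \<epsilon> n *\<^sub>R v) - z) *\<^sub>R w z)"
    unfolding d by (rule i)
   then have i2: "integrable lborel (\<lambda>z. \<eta> n z *\<^sub>R w (x + (\<epsilon> n *\<^sub>R v - z)))"
    by (subst (asm) integrable_distr_eq) (auto simp: algebra_simps)
   have "G n x - w x = (LINT z|lborel. \<eta> n z *\<^sub>R ?y x z)"
    unfolding G1 using i2 mollifierD(4,5)[OF \<eta>] by (simp add: scaleR_diff_right)
   also have "\<dots> = (LINT z|density lborel (\<eta> n). ?y x z)"
    using mollifierD(2)[OF \<eta>] by (subst integral_density) auto
   finally have "ennreal (norm (G n x - w x) powr s) \<le> (\<integral>\<^sup>+z. ennreal (norm (?y x z) powr s) \<partial>density lborel (\<eta> n))"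
    using jensen_powr[OF e1 s, of "?y x"] by simp
   then show ?thesis by (subst (asm) nn_integral_density) auto
  qed
  have "?G n
    \<le> (\<integral>\<^sup>+x. \<integral>\<^sup>+z. ennreal (\<eta> n z) * ennreal (norm (?y x z) powr s) \<partial>lborel \<partial>lborel)"
   by (intro nn_integral_mono pt)
  also have "\<dots> = (\<integral>\<^sup>+z. \<integral>\<^sup>+x. ennreal (\<eta> n z) * ennreal (norm (?y x z) powr s) \<partial>lborel \<partial>lborel)"
   by (rule lborel_pair.Fubini'[symmetric]) measurable
  also have "\<dots> = (\<integral>\<^sup>+z. ennreal (\<eta> n z) * (\<integral>\<^sup>+x. ennreal (norm (?y x z) powr s) \<partial>lborel) \<partial>lborel)"
   by (intro nn_integral_cong nn_integral_cmult) auto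
  also have "\<dots> \<le> (\<integral>\<^sup>+z. ennreal (\<eta> n z) * ennreal (e powr s) \<partial>lborel)"
  proof (intro nn_integral_mono)
   fix z
   show "ennreal (\<eta> n z) * (\<integral>\<^sup>+x. ennreal (norm (?y x z) powr s) \<partial>lborel) \<le> ennreal (\<eta> n z) * ennreal (e powr s)"
   proof (cases "norm z < \<epsilon> n")
    case True
    have "(\<integral>\<^sup>+x. ennreal (norm (?y x z) powr s) \<partial>lborel) = ennreal (LINT x|lborel. norm (?y x z) powr s)"
     using LpD(2)[OF Lp_diff[OF Lp_translate(1)[OF wL] wL s]] by (intro nn_integral_eq_integral) auto
    also have "\<dots> \<le> ennreal (e powr s)"
     using small[OF True] e s by (intro ennreal_leI, subst Lnorm_le_iff[symmetric]) auto
    finally show ?thesis by (intro mult_left_mono) auto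
   qed (use mollifierD(3)[OF \<eta>] in simp)
  qed
  also have "\<dots> = ennreal (e powr s)"
   using mollifierD(2,4,5)[OF \<eta>] by (simp add: nn_integral_multc nn_integral_eq_integral)
  finally show ?thesis .
 qed
 have L: "(\<lambda>x. G n x - w x) \<in> Lp lborel s \<and> Lnorm lborel s (\<lambda>x. G n x - w x) \<le> e"
  if e: "0 \<le> e" and small: "\<And>y. norm y < \<epsilon> n \<Longrightarrow> Lnorm lborel s (?w n y) \<le> e" for n e
 proof -
  have k: "?G n \<le> ennreal (e powr s)"
   by (rule key[OF e small])
  have i: "integrable lborel (\<lambda>x. norm (G n x - w x) powr s)"
   using k by (intro integrableI_nonneg) (auto simp: le_less_trans[OF _ ennreal_less_top])
  then have "(LINT x|lborel. norm (G n x - w x) powr s) \<le> e powr s"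
   using k by (subst (asm) nn_integral_eq_integral) auto
  then show ?thesis using i s e by (auto simp: Lnorm_le_iff intro!: LpI)
 qed
 have GL: "G n \<in> Lp lborel s" for n
 proof -
  have "(\<lambda>x. G n x - w x) \<in> Lp lborel s"
  proof (rule conjunct1[OF L])
   fix y :: 'a
   have "Lnorm lborel s (?w n y) \<le> Lnorm lborel s (\<lambda>x. w (x + (\<epsilon> n *\<^sub>R v - y))) + Lnorm lborel s w"
    by (intro Lnorm_triangle_diff Lp_translate wL s)
   then show "Lnorm lborel s (?w n y) \<le> Lnorm lborel s w + Lnorm lborel s w"
    using Lp_translate(2)[OF wL] by simp
  qed simp
  from Lp_add[OF this wL s] show ?thesis by simp
 qed
 then show "(\<lambda>x. LINT z|lborel. \<eta> n (x + \<epsilon> n *\<^sub>R v - z) *\<^sub>R w z) \<in> Lp lborel s"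
  by (simp add: G_def[abs_def])
 have "Lp_tendsto lborel s G w"
 proof (rule LIMSEQ_I)
  fix e :: real assume e: "0 < e"
  obtain d where d: "0 < d" "\<And>h. norm h < d \<Longrightarrow> Lnorm lborel s (\<lambda>x. w (x + h) - w x) < e / 2"
   using Lnorm_translate_small[OF wL s, of "e/2"] e by auto
  have "(\<lambda>n. \<epsilon> n * (norm v + 1)) \<longlonglongrightarrow> 0" using \<epsilon>(1) by (auto intro!: tendsto_eq_intros)
  then have "\<forall>\<^sub>F n in sequentially. \<epsilon> n * (norm v + 1) < d" using d(1) by (rule order_tendstoD)
  then obtain N where N: "\<And>n. N \<le> n \<Longrightarrow> \<epsilon> n * (norm v + 1) < d" by (auto simp: eventually_sequentially)
  show "\<exists>N. \<forall>n\<ge>N. norm (Lnorm lborel s (\<lambda>x. G n x - w x) - 0) < e"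
  proof (intro exI[of _ N] allI impI)
   fix n assume n: "N \<le> n"
   have "Lnorm lborel s (\<lambda>x. G n x - w x) \<le> e / 2"
   proof (rule conjunct2[OF L])
    fix y :: 'a assume y: "norm y < \<epsilon> n"
    have "norm (\<epsilon> n *\<^sub>R v - y) \<le> \<epsilon> n * norm v + norm y"
     using norm_triangle_ineq4[of "\<epsilon> n *\<^sub>R v" y] \<epsilon>(2)[of n] by simp
    also have "\<dots> < d" using y N[OF n] by (simp add: algebra_simps)
    finally show "Lnorm lborel s (?w n y) \<le> e / 2"
     using d(2) by (intro less_imp_le)
   qed (use e in simp)
   then show "norm (Lnorm lborel s (\<lambda>x. G n x - w x) - 0) < e" using e by simp
  qed
 qed
 then show "(\<lambda>n. Lnorm lborel s (\<lambda>x. (LINT z|lborel. \<eta> n (x + \<epsilon> n *\<^sub>R v - z) *\<^sub>R w z) - w x)) \<longlonglongrightarrow> 0"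
  by (simp add: G_def)
qed

section \<open>Functions on a domain and weak gradients\<close>

lemma AE_lebesgue_on_iff:
 assumes "S \<in> sets borel"
 shows "(AE x in lebesgue_on S. P x) \<longleftrightarrow> (AE x in lborel. x \<in> S \<longrightarrow> P x)"
 using assms by (subst AE_restrict_space_iff) (auto simp: AE_completion_iff)

lemma borel_measurable_lebesgue_onI: "f \<in> borel_measurable borel \<Longrightarrow> f \<in> borel_measurable (lebesgue_on S)"
 by (intro measurable_restrict_space1 measurable_completion) simp

lemma LINT_lebesgue_on:
 fixes f :: "'a::euclidean_space \<Rightarrow> 'b::euclidean_space"
 assumes "f \<in> borel_measurable borel" "S \<in> sets borel"
 shows "(LINT x|lebesgue_on S. f x) = (LINT x|lborel. indicator S x *\<^sub>R f x)"
  and "integrable (lebesgue_on S) f \<longleftrightarrow> integrable lborel (\<lambda>x. indicator S x *\<^sub>R f x)"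
 using assms
 by (simp_all add: integral_restrict_space integrable_restrict_space integral_completion integrable_completion)

lemma Lp_lebesgue_on_iff:
 fixes f :: "'a::euclidean_space \<Rightarrow> 'b::euclidean_space"
 assumes f: "f \<in> borel_measurable borel" and S: "S \<in> sets borel"
 shows "f \<in> Lp (lebesgue_on S) s \<longleftrightarrow> (\<lambda>x. indicator S x *\<^sub>R f x) \<in> Lp lborel s"
  and "Lnorm (lebesgue_on S) s f = Lnorm lborel s (\<lambda>x. indicator S x *\<^sub>R f x)"
proof -
 have eq: "norm (indicator S x *\<^sub>R f x) powr s = indicator S x *\<^sub>R norm (f x) powr s" for x
  by (simp add: indicator_def)
 have m: "(\<lambda>x. norm (f x) powr s) \<in> borel_measurable borel" using f by measurable
 show "f \<in> Lp (lebesgue_on S) s \<longleftrightarrow> (\<lambda>x. indicator S x *\<^sub>R f x) \<in> Lp lborel s"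
  unfolding Lp_def using f S borel_measurable_lebesgue_onI[OF f, of S]
  by (simp add: LINT_lebesgue_on(2)[OF m S] eq del: norm_scaleR)
 show "Lnorm (lebesgue_on S) s f = Lnorm lborel s (\<lambda>x. indicator S x *\<^sub>R f x)"
  by (simp add: Lnorm_def LINT_lebesgue_on(1)[OF m S] eq del: norm_scaleR)
qed

text \<open>Sobolev functions are Lebesgue measurable on the domain only, whereas the convolution
  lemmas concern Borel functions on the whole space; the version built here is extended by
  \<open>0\<close>.\<close>

lemma lebesgue_on_borel_version:
 fixes f :: "'a::euclidean_space \<Rightarrow> 'b::euclidean_space"
 assumes f: "f \<in> borel_measurable (lebesgue_on S)" and S: "S \<in> sets borel"
 obtains g where "g \<in> borel_measurable borel" "\<And>x. x \<notin> S \<Longrightarrow> g x = 0" "AE x in lebesgue_on S. f x = g x"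
proof -
 let ?f = "\<lambda>x. indicator S x *\<^sub>R f x"
 have "?f \<in> borel_measurable lebesgue"
  using f S by (subst (asm) borel_measurable_restrict_space_iff) auto
 then have "\<exists>g. g \<in> borel_measurable borel \<and> (AE x in lborel. ?f x \<bullet> i = g x)" for i
  using completion_ex_borel_measurable_real[OF borel_measurable_inner[OF _ borel_measurable_const], of ?f lborel i]
  by auto
 then obtain h where h: "\<And>i. h i \<in> borel_measurable borel" "\<And>i. AE x in lborel. ?f x \<bullet> i = h i x"
  by metis
 define g where "g x = indicator S x *\<^sub>R (\<Sum>i\<in>Basis. h i x *\<^sub>R i)" for x
 show thesis
 proof
  show "g \<in> borel_measurable borel" unfolding g_def using h(1) S by measurable
  have "AE x in lborel. \<forall>i\<in>Basis. ?f x \<bullet> i = h i x"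
   using h(2) by (intro AE_finite_allI) auto
  then have "AE x in lborel. x \<in> S \<longrightarrow> f x = g x"
  proof eventually_elim
   case (elim x)
   show ?case
   proof
    assume "x \<in> S"
    then have "f x = (\<Sum>i\<in>Basis. (?f x \<bullet> i) *\<^sub>R i)" by (simp add: euclidean_representation)
    also have "\<dots> = g x" using elim \<open>x \<in> S\<close> by (simp add: g_def)
    finally show "f x = g x" .
   qed
  qed
  then show "AE x in lebesgue_on S. f x = g x" by (simp add: AE_lebesgue_on_iff[OF S])
 qed (simp add: g_def)
qed

lemma integrable_mult_bounded:
 fixes f :: "'a \<Rightarrow> 'b::euclidean_space" and \<psi> :: "'a \<Rightarrow> real"
 assumes M: "finite_measure M" and f: "f \<in> Lp M s" "1 \<le> s"
  and \<psi>: "\<psi> \<in> borel_measurable M" "\<And>x. \<bar>\<psi> x\<bar> \<le> B"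
 shows "integrable M (\<lambda>x. \<psi> x *\<^sub>R f x)" "norm (LINT x|M. \<psi> x *\<^sub>R f x) \<le> B * Lnorm M 1 f"
proof -
 have f1: "f \<in> Lp M 1" using Lp_mono_exponent(1)[OF M f(1), of 1] f(2) by simp
 have B: "0 \<le> B" using \<psi>(2)[of undefined] by linarith
 have [measurable]: "f \<in> borel_measurable M" "\<psi> \<in> borel_measurable M" using LpD(1)[OF f1] \<psi> by auto
 have nf: "integrable M (\<lambda>x. norm (f x))" using LpD(2)[OF f1] by simp
 show i: "integrable M (\<lambda>x. \<psi> x *\<^sub>R f x)"
  by (rule Bochner_Integration.integrable_bound[of M "\<lambda>x. B * norm (f x)"])
   (use nf \<psi>(2) B in \<open>auto intro!: mult_right_mono simp: abs_mult\<close>)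
 have "norm (LINT x|M. \<psi> x *\<^sub>R f x) \<le> (LINT x|M. norm (\<psi> x *\<^sub>R f x))"
  by (rule integral_norm_bound)
 also have "\<dots> \<le> (LINT x|M. B * norm (f x))"
  using \<psi>(2) by (intro integral_mono integrable_norm i integrable_mult_right nf) (auto intro!: mult_right_mono)
 also have "\<dots> = B * Lnorm M 1 f" by (simp add: Lnorm_def)
 finally show "norm (LINT x|M. \<psi> x *\<^sub>R f x) \<le> B * Lnorm M 1 f" .
qed

lemma tendsto_integral_mult_bounded:
 fixes f :: "nat \<Rightarrow> 'a \<Rightarrow> 'b::euclidean_space" and \<psi> :: "'a \<Rightarrow> real"
 assumes M: "finite_measure M" and f: "\<And>n. f n \<in> Lp M s" "g \<in> Lp M s" "1 \<le> s"
  and lim: "Lp_tendsto M s f g"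
  and \<psi>: "\<psi> \<in> borel_measurable M" "\<And>x. \<bar>\<psi> x\<bar> \<le> B"
 shows "(\<lambda>n. LINT x|M. \<psi> x *\<^sub>R f n x) \<longlonglongrightarrow> (LINT x|M. \<psi> x *\<^sub>R g x)"
proof -
 have B: "0 \<le> B" using \<psi>(2)[of undefined] by linarith
 let ?C = "B * (measure M (space M) + 1) powr 1"
 have z: "(\<lambda>n. ?C * Lnorm M s (\<lambda>x. f n x - g x)) \<longlonglongrightarrow> 0"
  using lim by (rule tendsto_mult_right_zero)
 have "(\<lambda>n. (LINT x|M. \<psi> x *\<^sub>R f n x) - (LINT x|M. \<psi> x *\<^sub>R g x)) \<longlonglongrightarrow> 0"
 proof (rule Lim_null_comparison[OF always_eventually z], rule allI)
  fix n
  have d: "(\<lambda>x. f n x - g x) \<in> Lp M s" by (intro Lp_diff f)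
  have "(LINT x|M. \<psi> x *\<^sub>R f n x) - (LINT x|M. \<psi> x *\<^sub>R g x) = (LINT x|M. \<psi> x *\<^sub>R (f n x - g x))"
   using integrable_mult_bounded(1)[OF M f(1) f(3) \<psi>, of n] integrable_mult_bounded(1)[OF M f(2,3) \<psi>]
   by (simp add: scaleR_diff_right)
  also have "norm \<dots> \<le> B * Lnorm M 1 (\<lambda>x. f n x - g x)"
   by (rule integrable_mult_bounded(2)[OF M d f(3) \<psi>])
  also have "\<dots> \<le> ?C * Lnorm M s (\<lambda>x. f n x - g x)"
   using mult_left_mono[OF Lnorm_mono_exponent[OF M d, of 1] B] f(3) by (simp add: mult.assoc)
  finally show "norm ((LINT x|M. \<psi> x *\<^sub>R f n x) - (LINT x|M. \<psi> x *\<^sub>R g x)) \<le> ?C * Lnorm M s (\<lambda>x. f n x - g x)" .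
 qed
 then show ?thesis by (simp add: LIM_zero_iff)
qed

section \<open>Test functions and uniqueness of weak gradients\<close>

lemma test_functionI:
 assumes "smooth \<phi>" "compact K" "K \<subseteq> \<Omega>" "\<And>x. x \<notin> K \<Longrightarrow> \<phi> x = 0"
 shows "test_function \<Omega> \<phi>"
proof -
 have "closure {x. \<phi> x \<noteq> 0} \<subseteq> K"
  using assms compact_imp_closed by (intro closure_minimal) auto
 then show ?thesis
  using assms unfolding test_function_def
  by (meson closed_closure compact_Int_closed compact_closure bounded_subset compact_imp_bounded order_trans closure_subset)
qed

lemma test_functionD:
 assumes "test_function \<Omega> \<phi>"
 shows "smooth \<phi>"
  and "\<exists>K. compact K \<and> K \<subseteq> \<Omega> \<and> (\<forall>x. x \<notin> K \<longrightarrow> \<phi> x = 0 \<and> grad \<phi> x = 0)"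
  and "\<exists>R. \<forall>x. R < norm x \<longrightarrow> \<phi> x = 0"
proof -
 have s: "smooth \<phi>" using assms by (auto simp: test_function_def)
 then show "smooth \<phi>" .
 obtain K where K: "compact K" "K \<subseteq> \<Omega>" and z: "\<And>x. x \<notin> K \<Longrightarrow> \<phi> x = 0"
  using assms closure_subset[of "{x. \<phi> x \<noteq> 0}"] unfolding test_function_def by blast
 have "grad \<phi> x = 0" if "x \<notin> K" for x
 proof (rule grad_eqI)
  fix i :: 'a assume "i \<in> Basis"
  have "pd i \<phi> x = 0"
   by (rule pd_0_open[of "- K"]) (use that z compact_imp_closed[OF K(1)] in auto)
  then show "pd i \<phi> x = 0 \<bullet> i" by simp
 qed
 then show "\<exists>K. compact K \<and> K \<subseteq> \<Omega> \<and> (\<forall>x. x \<notin> K \<longrightarrow> \<phi> x = 0 \<and> grad \<phi> x = 0)"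
  using K z by blast
 obtain R where "\<And>x. x \<in> K \<Longrightarrow> norm x \<le> R"
  using compact_imp_bounded[OF K(1)] bounded_iff by blast
 then show "\<exists>R. \<forall>x. R < norm x \<longrightarrow> \<phi> x = 0" using z by (metis not_less)
qed

lemma test_function_bounded:
 fixes \<phi> :: "'a::euclidean_space \<Rightarrow> real"
 assumes "test_function \<Omega> \<phi>" "i \<in> Basis"
 shows "\<exists>B. (\<forall>x. \<bar>\<phi> x\<bar> \<le> B) \<and> (\<forall>x. \<bar>grad \<phi> x \<bullet> i\<bar> \<le> B)"
proof -
 note s = test_functionD(1)[OF assms(1)]
 obtain R where R: "\<And>x. R < norm x \<Longrightarrow> \<phi> x = 0" using test_functionD(3)[OF assms(1)] by blast
 obtain B1 where "\<And>x. norm (\<phi> x) \<le> B1"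
  using bounded_of_compact_support[OF smooth_continuous[OF s], of R] R by blast
 moreover obtain B2 where "\<And>x. norm (pd i \<phi> x) \<le> B2"
  using bounded_of_compact_support[OF smooth_continuous[OF smooth_pd[OF s assms(2)]] pd_0_outside[of R \<phi>, OF R]] by blast
 ultimately show ?thesis
  using assms(2) by (intro exI[of _ "max B1 B2"]) (simp add: grad_inner_Basis le_max_iff_disj)
qed

lemma Lp_locally_integrable:
 fixes f :: "'a::euclidean_space \<Rightarrow> 'b::euclidean_space"
 assumes "open \<Omega>" "bounded \<Omega>" "f \<in> Lp (lebesgue_on \<Omega>) s" "1 \<le> s"
 shows "locally_integrable \<Omega> f"
 unfolding locally_integrable_def
proof (intro allI impI)
 fix K assume K: "compact K \<and> K \<subseteq> \<Omega>"
 then have Kb: "K \<in> sets borel" by (intro borel_closed compact_imp_closed) auto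
 have fin: "finite_measure (lebesgue_on \<Omega>)"
  using assms by (intro finite_measure_lebesgue_on) (simp add: lmeasurable_open)
 have \<Omega>b: "\<Omega> \<in> sets borel" using assms by auto
 have "integrable (lebesgue_on \<Omega>) f"
  using integrable_mult_bounded(1)[OF fin assms(3,4), of "\<lambda>_. 1" 1] by simp
 then have i: "integrable lebesgue (\<lambda>x. indicator \<Omega> x *\<^sub>R f x)"
  using \<Omega>b by (subst (asm) integrable_restrict_space) auto
 have "integrable lebesgue (\<lambda>x. indicator K x *\<^sub>R (indicator \<Omega> x *\<^sub>R f x))"
  using Kb by (intro integrable_mult_indicator[OF _ i]) auto
 also have "(\<lambda>x. indicator K x *\<^sub>R (indicator \<Omega> x *\<^sub>R f x)) = (\<lambda>x. indicator K x *\<^sub>R f x)"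
  using K by (auto simp: indicator_def subset_iff fun_eq_iff)
 finally show "integrable (lebesgue_on K) f"
  using Kb by (subst integrable_restrict_space) auto
qed

text \<open>A mollifying kernel centred in a small ball is a test function, so the mollifications of
  the localised function vanish there, while they converge to it in the mean.\<close>

lemma test_integral_0_imp_AE_0:
 fixes f :: "'a::euclidean_space \<Rightarrow> real"
 assumes \<Omega>: "open \<Omega>" and f: "locally_integrable \<Omega> f"
  and z: "\<And>\<phi>. test_function \<Omega> \<phi> \<Longrightarrow> (LINT x|lebesgue_on \<Omega>. f x * \<phi> x) = 0"
 shows "AE x in lebesgue_on \<Omega>. f x = 0"
proof -
 have local: "\<exists>r>0. AE y in lborel. y \<in> ball x r \<longrightarrow> f y = 0" if x: "x \<in> \<Omega>" for x
 proof -
  obtain r0 where r0: "0 < r0" "cball x r0 \<subseteq> \<Omega>" using \<Omega> x open_contains_cball by blast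
  define r where "r = r0 / 2"
  have r: "0 < r" "cball x (2 * r) \<subseteq> \<Omega>" using r0 by (auto simp: r_def)
  let ?K = "cball x (2 * r)"
  have fK: "integrable (lebesgue_on ?K) f"
   using f r by (auto simp: locally_integrable_def)
  obtain w where w: "w \<in> borel_measurable borel" "\<And>y. y \<notin> ?K \<Longrightarrow> w y = 0" "AE y in lebesgue_on ?K. f y = w y"
   using lebesgue_on_borel_version[OF borel_measurable_integrable[OF fK] borel_closed[OF closed_cball]] by blast
  have "integrable (lebesgue_on ?K) w"
   by (rule Bochner_Integration.integrable_cong_AE_imp[OF fK borel_measurable_lebesgue_onI[OF w(1)]])
    (use w(3) in \<open>auto simp: eq_commute\<close>)
  then have "integrable lborel (\<lambda>y. indicator ?K y *\<^sub>R w y)"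
   using w by (subst (asm) LINT_lebesgue_on(2)) auto
  also have "(\<lambda>y. indicator ?K y *\<^sub>R w y) = w" using w(2) by (force simp: indicator_def)
  finally have wi: "integrable lborel w" .
  have wL: "w \<in> Lp lborel 1" using wi w by (auto simp: Lp_def)
  let ?I = "LINT y|lborel. indicator (ball x r) y * \<bar>w y\<bar>"
  \<comment> \<open>The radii stay at most \<open>r\<close>, so kernels centred in the ball of
    radius \<open>r\<close> have support in the ball of radius \<open>2 * r\<close>, which lies in
    \<Omega>.\<close>
  define e where "e n = r * inverse (real (Suc n))" for n
  have e0: "e \<longlonglongrightarrow> 0"
   unfolding e_def by (rule tendsto_mult_right_zero[OF LIMSEQ_inverse_real_of_nat])
  have epos: "0 < e n" for n using r by (simp add: e_def)
  have eler: "e n \<le> r" for n using r by (simp add: e_def field_simps)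
  obtain \<eta> where \<eta>: "\<And>n. mollifier (e n) (\<eta> n :: 'a \<Rightarrow> real)" using mollifier_exists[OF epos] by metis
  have conv0: "(LINT z|lborel. \<eta> n (y - z) * w z) = 0" if y: "y \<in> ball x r" for y n
  proof -
   let ?\<phi> = "\<lambda>z. \<eta> n (y + (-1) *\<^sub>R z)"
   have sup: "?\<phi> z = 0" if "z \<notin> cball y (e n)" for z
    using that by (intro mollifierD(3)[OF \<eta>]) (auto simp: dist_norm)
   have sub: "cball y (e n) \<subseteq> ?K"
   proof
    fix z assume "z \<in> cball y (e n)"
    then show "z \<in> ?K" using y eler[of n] dist_triangle[of x z y] by simp
   qed
   have t: "test_function \<Omega> ?\<phi>"
    by (rule test_functionI[OF smooth_affine[OF mollifierD(1)[OF \<eta>]], of "cball y (e n)"])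
     (use sup sub r in auto)
   have \<phi>b [measurable]: "?\<phi> \<in> borel_measurable borel" by (rule smooth_borel[OF test_functionD(1)[OF t]])
   have Ob: "\<Omega> \<in> sets borel" using \<Omega> by auto
   have "(LINT z|lebesgue_on \<Omega>. f z * ?\<phi> z) = (LINT z|lebesgue. indicator \<Omega> z *\<^sub>R (f z * ?\<phi> z))"
    using Ob by (subst integral_restrict_space) auto
   also have "\<dots> = (LINT z|lebesgue. indicator ?K z *\<^sub>R (f z * ?\<phi> z))"
    using sup sub r(2) by (intro Bochner_Integration.integral_cong) (auto simp: indicator_def subset_iff)
   also have "\<dots> = (LINT z|lebesgue_on ?K. f z * ?\<phi> z)"
    by (subst integral_restrict_space) auto
   also have "\<dots> = (LINT z|lebesgue_on ?K. w z * ?\<phi> z)"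
   proof (rule integral_cong_AE)
    have \<phi>m: "?\<phi> \<in> borel_measurable (lebesgue_on ?K)"
     by (rule borel_measurable_lebesgue_onI[OF \<phi>b])
    show "(\<lambda>z. f z * ?\<phi> z) \<in> borel_measurable (lebesgue_on ?K)"
     by (intro borel_measurable_times \<phi>m borel_measurable_integrable[OF fK])
    show "(\<lambda>z. w z * ?\<phi> z) \<in> borel_measurable (lebesgue_on ?K)"
     by (intro borel_measurable_times \<phi>m borel_measurable_lebesgue_onI[OF w(1)])
   qed (use w(3) in \<open>auto elim: eventually_mono\<close>)
   also have "\<dots> = (LINT z|lborel. indicator ?K z *\<^sub>R (w z * ?\<phi> z))"
    by (rule LINT_lebesgue_on(1)[OF borel_measurable_times[OF w(1) \<phi>b]]) simp
   also have "\<dots> = (LINT z|lborel. \<eta> n (y - z) * w z)"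
    using w(2) by (intro Bochner_Integration.integral_cong) (auto simp: indicator_def)
   finally show ?thesis using z[OF t] by simp
  qed
  let ?G = "\<lambda>n y. LINT z|lborel. \<eta> n (y + e n *\<^sub>R 0 - z) *\<^sub>R w z"
  have GL: "?G n \<in> Lp lborel 1" for n
   by (rule mollify_converges(1)[OF wL wi order_refl \<eta> e0 epos])
  have lim: "(\<lambda>n. Lnorm lborel 1 (\<lambda>y. ?G n y - w y)) \<longlonglongrightarrow> 0"
   by (rule mollify_converges(2)[OF wL wi order_refl \<eta> e0 epos])
  have "?I \<le> Lnorm lborel 1 (\<lambda>y. ?G n y - w y)" for n
  proof -
   have "?I \<le> (LINT y|lborel. \<bar>?G n y - w y\<bar>)"
   proof (rule integral_mono)
    show "integrable lborel (\<lambda>y. indicator (ball x r) y * \<bar>w y\<bar>)"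
     using integrable_mult_indicator[of "ball x r" lborel "\<lambda>y. \<bar>w y\<bar>"] wi by auto
    show "integrable lborel (\<lambda>y. \<bar>?G n y - w y\<bar>)"
     using LpD(2)[OF Lp_diff[OF GL wL order_refl]] by simp
    show "indicator (ball x r) y * \<bar>w y\<bar> \<le> \<bar>?G n y - w y\<bar>" for y
     using conv0[of y n] by (cases "y \<in> ball x r") auto
   qed
   then show ?thesis by (simp add: Lnorm_def)
  qed
  then have "?I \<le> 0"
   by (intro LIMSEQ_le_const[OF lim]) auto
  moreover have "0 \<le> ?I" by simp
  ultimately have "?I = 0" by linarith
  moreover have "integrable lborel (\<lambda>y. indicator (ball x r) y * \<bar>w y\<bar>)"
   using integrable_mult_indicator[of "ball x r" lborel "\<lambda>y. \<bar>w y\<bar>"] wi by auto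
  ultimately have "AE y in lborel. indicator (ball x r) y * \<bar>w y\<bar> = 0"
   by (subst (asm) integral_nonneg_eq_0_iff_AE) auto
  moreover have "AE y in lborel. y \<in> ?K \<longrightarrow> f y = w y"
   using w(3) by (subst (asm) AE_lebesgue_on_iff) auto
  ultimately have "AE y in lborel. y \<in> ball x r \<longrightarrow> f y = 0"
   by eventually_elim (use r in auto)
  then show ?thesis using r by blast
 qed
 obtain r where r: "\<And>x. x \<in> \<Omega> \<Longrightarrow> 0 < r x" "\<And>x. x \<in> \<Omega> \<Longrightarrow> AE y in lborel. y \<in> ball x (r x) \<longrightarrow> f y = 0"
  using local by metis
 \<comment> \<open>A countable subcover keeps the union of the exceptional null sets null.\<close>
 obtain F where F: "F \<subseteq> (\<lambda>x. ball x (r x)) ` \<Omega>" "countable F" "\<Union>F = (\<Union>x\<in>\<Omega>. ball x (r x))"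
  using Lindelof[of "(\<lambda>x. ball x (r x)) ` \<Omega>"] by auto
 have "AE y in lborel. \<forall>B\<in>F. y \<in> B \<longrightarrow> f y = 0"
  using F r by (subst AE_ball_countable) auto
 then have "AE y in lborel. y \<in> \<Omega> \<longrightarrow> f y = 0"
 proof eventually_elim
  case (elim y)
  show ?case
  proof
   assume "y \<in> \<Omega>"
   then have "y \<in> \<Union>F" unfolding F(3) using r(1) by (auto intro: bexI[of _ y])
   then show "f y = 0" using elim by blast
  qed
 qed
 then show ?thesis using \<Omega> by (subst AE_lebesgue_on_iff) auto
qed

lemma integrable_locally_mult:
 fixes f :: "'a::euclidean_space \<Rightarrow> 'b::euclidean_space"
 assumes f: "locally_integrable \<Omega> f" and \<Omega>: "open \<Omega>" and K: "compact K" "K \<subseteq> \<Omega>"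
  and \<psi>: "\<psi> \<in> borel_measurable borel" "\<And>x. \<bar>\<psi> x\<bar> \<le> B" "\<And>x. x \<notin> K \<Longrightarrow> \<psi> x = 0"
 shows "integrable (lebesgue_on \<Omega>) (\<lambda>x. \<psi> x *\<^sub>R f x)"
proof -
 have Kb: "K \<in> sets borel" by (intro borel_closed compact_imp_closed K)
 have Ob: "\<Omega> \<in> sets borel" using \<Omega> by auto
 have B: "0 \<le> B" using \<psi>(2)[of undefined] by linarith
 have "integrable (lebesgue_on K) f" using f K by (auto simp: locally_integrable_def)
 then have i: "integrable lebesgue (\<lambda>x. indicator K x *\<^sub>R f x)"
  using Kb by (subst (asm) integrable_restrict_space) auto
 have "integrable lebesgue (\<lambda>x. \<psi> x *\<^sub>R (indicator K x *\<^sub>R f x))"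
 proof (rule Bochner_Integration.integrable_bound)
  show "integrable lebesgue (\<lambda>x. B *\<^sub>R (indicator K x *\<^sub>R f x))" by (intro integrable_scaleR_right i)
  show "(\<lambda>x. \<psi> x *\<^sub>R (indicator K x *\<^sub>R f x)) \<in> borel_measurable lebesgue"
   using \<psi>(1) by (intro borel_measurable_scaleR borel_measurable_integrable[OF i] measurable_completion) simp
  have "\<bar>\<psi> x\<bar> * norm (indicator K x *\<^sub>R f x) \<le> B * norm (indicator K x *\<^sub>R f x)" for x
   using \<psi>(2) by (intro mult_right_mono) auto
  then show "AE x in lebesgue. norm (\<psi> x *\<^sub>R (indicator K x *\<^sub>R f x)) \<le> norm (B *\<^sub>R (indicator K x *\<^sub>R f x))"
   using B by (auto simp: abs_mult mult.assoc)
 qed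
 also have "(\<lambda>x. \<psi> x *\<^sub>R (indicator K x *\<^sub>R f x)) = (\<lambda>x. indicator \<Omega> x *\<^sub>R (\<psi> x *\<^sub>R f x))"
  using K(2) \<psi>(3) by (auto simp: indicator_def fun_eq_iff)
 finally show ?thesis using Ob by (subst integrable_restrict_space) auto
qed

lemma locally_integrable_inner: "locally_integrable \<Omega> g \<Longrightarrow> locally_integrable \<Omega> (\<lambda>x. g x \<bullet> i)"
 by (auto simp: locally_integrable_def)

lemma integrable_test:
 assumes f: "locally_integrable \<Omega> f" and \<Omega>: "open \<Omega>" and t: "test_function \<Omega> \<phi>"
 shows "integrable (lebesgue_on \<Omega>) (\<lambda>x. f x * \<phi> x)"
  and "i \<in> Basis \<Longrightarrow> integrable (lebesgue_on \<Omega>) (\<lambda>x. f x * (grad \<phi> x \<bullet> i))"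
proof -
 obtain K where K: "compact K" "K \<subseteq> \<Omega>" "\<And>x. x \<notin> K \<Longrightarrow> \<phi> x = 0 \<and> grad \<phi> x = 0"
  using test_functionD(2)[OF t] by blast
 have m: "\<phi> \<in> borel_measurable borel" "(\<lambda>x. grad \<phi> x \<bullet> i) \<in> borel_measurable borel" for i
  by (intro smooth_borel borel_measurable_inner borel_measurable_grad borel_measurable_const test_functionD(1)[OF t])+
 show "integrable (lebesgue_on \<Omega>) (\<lambda>x. f x * (grad \<phi> x \<bullet> i))" if i: "i \<in> Basis"
 proof -
  obtain B where B: "\<And>x. \<bar>grad \<phi> x \<bullet> i\<bar> \<le> B" using test_function_bounded[OF t i] by blast
  have "integrable (lebesgue_on \<Omega>) (\<lambda>x. (grad \<phi> x \<bullet> i) *\<^sub>R f x)"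
   by (rule integrable_locally_mult[OF f \<Omega> K(1,2) m(2) B]) (simp add: K(3))
  then show ?thesis by (simp add: mult.commute)
 qed
 obtain i :: 'a where "i \<in> Basis" using nonempty_Basis by blast
 then obtain B where B: "\<And>x. \<bar>\<phi> x\<bar> \<le> B" using test_function_bounded[OF t] by blast
 have "integrable (lebesgue_on \<Omega>) (\<lambda>x. \<phi> x *\<^sub>R f x)"
  by (rule integrable_locally_mult[OF f \<Omega> K(1,2) m(1) B]) (simp add: K(3))
 then show "integrable (lebesgue_on \<Omega>) (\<lambda>x. f x * \<phi> x)" by (simp add: mult.commute)
qed

lemma weak_gradient_unique:
 assumes \<Omega>: "open \<Omega>" and g: "weak_gradient \<Omega> u g" "weak_gradient \<Omega> u h"
 shows "AE x in lebesgue_on \<Omega>. g x = h x"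
proof -
 have lg: "locally_integrable \<Omega> g" and lh: "locally_integrable \<Omega> h"
  using g by (auto simp: weak_gradient_def)
 have "AE x in lebesgue_on \<Omega>. g x \<bullet> i - h x \<bullet> i = 0" if i: "i \<in> Basis" for i
 proof (rule test_integral_0_imp_AE_0[OF \<Omega>])
  show "locally_integrable \<Omega> (\<lambda>x. g x \<bullet> i - h x \<bullet> i)"
   using lg lh by (auto simp: locally_integrable_def)
  fix \<phi> assume t: "test_function \<Omega> \<phi>"
  have "(LINT x|lebesgue_on \<Omega>. (g x \<bullet> i) * \<phi> x) = (LINT x|lebesgue_on \<Omega>. (h x \<bullet> i) * \<phi> x)"
   using g t i by (auto simp: weak_gradient_def)
  then show "(LINT x|lebesgue_on \<Omega>. (g x \<bullet> i - h x \<bullet> i) * \<phi> x) = 0"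
   using integrable_test(1)[OF locally_integrable_inner[OF lg] \<Omega> t, of i]
    integrable_test(1)[OF locally_integrable_inner[OF lh] \<Omega> t, of i]
   by (simp add: left_diff_distrib)
 qed
 then have "AE x in lebesgue_on \<Omega>. \<forall>i\<in>Basis. g x \<bullet> i - h x \<bullet> i = 0"
  by (intro AE_finite_allI) auto
 then show ?thesis by eventually_elim (auto intro: euclidean_eqI)
qed

section \<open>Sobolev functions on a bounded open set\<close>

locale bounded_open =
 fixes \<Omega> :: "'a::euclidean_space set"
 assumes open_\<Omega>: "open \<Omega>" and bounded_\<Omega>: "bounded \<Omega>"
begin

abbreviation "L\<Omega> \<equiv> lebesgue_on \<Omega>"

lemma \<Omega>_borel [measurable, simp]: "\<Omega> \<in> sets borel"
 using open_\<Omega> by auto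

lemma finite_L\<Omega>: "finite_measure L\<Omega>"
 using open_\<Omega> bounded_\<Omega> by (intro finite_measure_lebesgue_on) (simp add: lmeasurable_open)

lemma weak_gradient_LpI:
 assumes "u \<in> Lp L\<Omega> s" "g \<in> Lp L\<Omega> s" "1 \<le> s"
  and "\<And>\<phi> i. test_function \<Omega> \<phi> \<Longrightarrow> i \<in> Basis \<Longrightarrow>
   (LINT x|L\<Omega>. u x * (grad \<phi> x \<bullet> i)) = - (LINT x|L\<Omega>. (g x \<bullet> i) * \<phi> x)"
 shows "weak_gradient \<Omega> u g"
 using assms Lp_locally_integrable[OF open_\<Omega> bounded_\<Omega> assms(1,3)]
  Lp_locally_integrable[OF open_\<Omega> bounded_\<Omega> assms(2,3)] by (auto simp: weak_gradient_def)

lemma SobolevI: "u \<in> Lp L\<Omega> s \<Longrightarrow> g \<in> Lp L\<Omega> s \<Longrightarrow> weak_gradient \<Omega> u g \<Longrightarrow> u \<in> Sobolev \<Omega> s"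
 by (auto simp: Sobolev_def)

lemma Sobolev_Lp: "u \<in> Sobolev \<Omega> s \<Longrightarrow> u \<in> Lp L\<Omega> s"
 by (auto simp: Sobolev_def)

text \<open>By definition a weak gradient is integrable on compact subsets only; an exhaustion by
  such sets yields measurability on \<Omega>. This applies in particular to the arbitrary
  representative \<open>wgrad\<close>.\<close>

lemma weak_gradient_measurable: "weak_gradient \<Omega> u g \<Longrightarrow> g \<in> borel_measurable L\<Omega>"
proof -
 assume "weak_gradient \<Omega> u g"
 then have l: "locally_integrable \<Omega> g" by (simp add: weak_gradient_def)
 obtain F :: "nat \<Rightarrow> 'a set" where F: "\<And>n. compact (F n)" "\<And>n. F n \<subseteq> \<Omega>" "\<Union>(range F) = \<Omega>" "\<And>n. F n \<subseteq> interior (F (Suc n))"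
  using open_Union_compact_subsets[OF open_\<Omega>] by metis
 have Fb: "F n \<in> sets borel" for n by (intro borel_closed compact_imp_closed F)
 have "(\<lambda>x. indicator (F n) x *\<^sub>R g x) \<in> borel_measurable lebesgue" for n
 proof -
  have "integrable (lebesgue_on (F n)) g" using l F by (auto simp: locally_integrable_def)
  then show ?thesis
   using Fb by (subst (asm) integrable_restrict_space) auto
 qed
 then have "(\<lambda>x. indicator \<Omega> x *\<^sub>R g x) \<in> borel_measurable lebesgue"
 proof (rule borel_measurable_LIMSEQ_metric)
  fix x
  show "(\<lambda>n. indicator (F n) x *\<^sub>R g x) \<longlonglongrightarrow> indicator \<Omega> x *\<^sub>R g x"
  proof (cases "x \<in> \<Omega>")
   case True
   then obtain N where "x \<in> F N" using F(3) by blast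
   moreover have "F N \<subseteq> F n" if "N \<le> n" for n using lift_Suc_mono_le[of F, OF order_trans[OF F(4) interior_subset] that] .
   ultimately have "\<forall>n\<ge>N. indicator (F n) x *\<^sub>R g x = indicator \<Omega> x *\<^sub>R g x"
    using True by (auto simp: indicator_def)
   then show ?thesis by (intro tendsto_eventually) (auto simp: eventually_sequentially)
  next
   case False
   then have "x \<notin> F n" for n using F(2) by blast
   then show ?thesis using False by simp
  qed
 qed
 then show ?thesis by (subst borel_measurable_restrict_space_iff) auto
qed

text \<open>\<open>wgrad\<close> picks some weak gradient, possibly different from the one in
  \<open>Lp\<close> that membership provides; uniqueness almost everywhere carries the integrability
  over.\<close>

lemma Sobolev_wgrad:
 assumes u: "u \<in> Sobolev \<Omega> s"
 shows "weak_gradient \<Omega> u (wgrad \<Omega> u)" "wgrad \<Omega> u \<in> Lp L\<Omega> s"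
proof -
 obtain g where g: "g \<in> Lp L\<Omega> s" "weak_gradient \<Omega> u g" using u by (auto simp: Sobolev_def)
 show w: "weak_gradient \<Omega> u (wgrad \<Omega> u)"
  unfolding wgrad_def by (rule someI[of "weak_gradient \<Omega> u", OF g(2)])
 show "wgrad \<Omega> u \<in> Lp L\<Omega> s"
  using Lp_cong_AE[OF g(1) weak_gradient_measurable[OF w] weak_gradient_unique[OF open_\<Omega> g(2) w]] .
qed

lemma wgrad_AE_eq:
 assumes "u \<in> Sobolev \<Omega> s" "weak_gradient \<Omega> u g"
 shows "AE x in L\<Omega>. wgrad \<Omega> u x = g x"
 by (rule weak_gradient_unique[OF open_\<Omega> Sobolev_wgrad(1)[OF assms(1)] assms(2)])

lemma continuous_Lp:
 fixes f :: "'a \<Rightarrow> 'b::euclidean_space"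
 assumes "continuous_on UNIV f" "0 \<le> s" shows "f \<in> Lp L\<Omega> s"
proof -
 have "compact (f ` closure \<Omega>)"
  using assms bounded_\<Omega> by (intro compact_continuous_image) (auto intro: continuous_on_subset)
 then obtain B where "\<forall>y\<in>f ` closure \<Omega>. norm y \<le> B" using compact_imp_bounded bounded_iff by blast
 then have B: "norm (f x) \<le> B" if "x \<in> \<Omega>" for x using that closure_subset by blast
 show ?thesis
  by (rule Lp_bounded[OF finite_L\<Omega> borel_measurable_lebesgue_onI[OF borel_measurable_continuous_onI[OF assms(1)]], of B])
   (use B assms(2) in auto)
qed

text \<open>The partial derivatives of the compactly supported product of \<open>f\<close> and
  \<phi> integrate to \<open>0\<close>, which is integration by parts.\<close>

lemma smooth_weak_gradient:
 assumes f: "smooth f" shows "weak_gradient \<Omega> f (grad f)"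
proof (rule weak_gradient_LpI[of f 1])
 show "f \<in> Lp L\<Omega> 1" "grad f \<in> Lp L\<Omega> 1"
  using f by (intro continuous_Lp smooth_continuous continuous_on_grad; simp)+
 fix \<phi> :: "'a \<Rightarrow> real" and i :: 'a assume t: "test_function \<Omega> \<phi>" and i: "i \<in> Basis"
 have K: "\<phi> x = 0" "grad \<phi> x = 0" if "x \<notin> \<Omega>" for x
  using test_functionD(2)[OF t] that by blast+
 obtain R where R: "\<And>x. R < norm x \<Longrightarrow> \<phi> x = 0" using test_functionD(3)[OF t] by blast
 note s = test_functionD(1)[OF t]
 have z: "(LINT x|lborel. pd i (\<lambda>x. f x * \<phi> x) x) = 0"
  by (rule integral_pd_eq_0[OF smooth_mult[OF f s] _ i, of R]) (simp add: R)
 have pd: "pd i (\<lambda>x. f x * \<phi> x) x = f x * (grad \<phi> x \<bullet> i) + (grad f x \<bullet> i) * \<phi> x" for x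
  using grad_mult[OF f s, of x] i by (simp add: inner_add_left flip: grad_inner_Basis)
 have c: "continuous_on UNIV (\<lambda>x. f x * (grad \<phi> x \<bullet> i))" "continuous_on UNIV (\<lambda>x. (grad f x \<bullet> i) * \<phi> x)"
  by (intro continuous_intros smooth_continuous[OF f] smooth_continuous[OF s]
    continuous_on_grad[OF f] continuous_on_grad[OF s])+
 have int: "integrable lborel (\<lambda>x. f x * (grad \<phi> x \<bullet> i))" "integrable lborel (\<lambda>x. (grad f x \<bullet> i) * \<phi> x)"
  using R grad_0_outside[of R \<phi>, OF R] by (intro integrable_compact_support[OF c(1), of R] integrable_compact_support[OF c(2), of R]; simp)+
 have b: "(\<lambda>x. f x * (grad \<phi> x \<bullet> i)) \<in> borel_measurable borel" "(\<lambda>x. (grad f x \<bullet> i) * \<phi> x) \<in> borel_measurable borel"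
  using c by (auto intro: borel_measurable_continuous_onI)
 have e1: "(LINT x|L\<Omega>. f x * (grad \<phi> x \<bullet> i)) = (LINT x|lborel. f x * (grad \<phi> x \<bullet> i))"
  using K unfolding LINT_lebesgue_on(1)[OF b(1) \<Omega>_borel]
  by (intro Bochner_Integration.integral_cong) (auto simp: indicator_def)
 have e2: "(LINT x|L\<Omega>. (grad f x \<bullet> i) * \<phi> x) = (LINT x|lborel. (grad f x \<bullet> i) * \<phi> x)"
  using K unfolding LINT_lebesgue_on(1)[OF b(2) \<Omega>_borel]
  by (intro Bochner_Integration.integral_cong) (auto simp: indicator_def)
 show "(LINT x|L\<Omega>. f x * (grad \<phi> x \<bullet> i)) = - (LINT x|L\<Omega>. (grad f x \<bullet> i) * \<phi> x)"
  using z int unfolding e1 e2 pd by simp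
qed simp

text \<open>A test function and its partial derivatives are bounded, so both sides of the defining
  identity converge when functions and gradients converge in the norm.\<close>

lemma weak_gradient_limit:
 assumes w: "\<And>n. weak_gradient \<Omega> (u n) (g n)" and L: "\<And>n. u n \<in> Lp L\<Omega> s" "\<And>n. g n \<in> Lp L\<Omega> s"
  and vh: "v \<in> Lp L\<Omega> s" "h \<in> Lp L\<Omega> s" and s: "1 \<le> s"
  and lim: "Lp_tendsto L\<Omega> s u v" "Lp_tendsto L\<Omega> s g h"
 shows "weak_gradient \<Omega> v h"
proof (rule weak_gradient_LpI[OF vh s])
 fix \<phi> :: "'a \<Rightarrow> real" and i :: 'a assume t: "test_function \<Omega> \<phi>" and i: "i \<in> Basis"
 note sm = test_functionD(1)[OF t]
 obtain B where B: "\<And>x. \<bar>\<phi> x\<bar> \<le> B" "\<And>x. \<bar>grad \<phi> x \<bullet> i\<bar> \<le> B"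
  using test_function_bounded[OF t i] by blast
 have m: "\<phi> \<in> borel_measurable L\<Omega>" "(\<lambda>x. grad \<phi> x \<bullet> i) \<in> borel_measurable L\<Omega>"
  using smooth_borel[OF sm] borel_measurable_grad[OF sm] by (auto intro!: borel_measurable_lebesgue_onI)
 have l1: "(\<lambda>n. LINT x|L\<Omega>. (grad \<phi> x \<bullet> i) *\<^sub>R u n x) \<longlonglongrightarrow> (LINT x|L\<Omega>. (grad \<phi> x \<bullet> i) *\<^sub>R v x)"
  by (rule tendsto_integral_mult_bounded[OF finite_L\<Omega> L(1) vh(1) s lim(1) m(2) B(2)])
 have l2: "(\<lambda>n. (LINT x|L\<Omega>. \<phi> x *\<^sub>R g n x) \<bullet> i) \<longlonglongrightarrow> (LINT x|L\<Omega>. \<phi> x *\<^sub>R h x) \<bullet> i"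
  by (intro tendsto_inner tendsto_const tendsto_integral_mult_bounded[OF finite_L\<Omega> L(2) vh(2) s lim(2) m(1) B(1)])
 have pull: "(LINT x|L\<Omega>. \<phi> x *\<^sub>R k x) \<bullet> i = (LINT x|L\<Omega>. (k x \<bullet> i) * \<phi> x)" if "k \<in> Lp L\<Omega> s" for k
  using integrable_mult_bounded(1)[OF finite_L\<Omega> that s m(1) B(1)]
  by (simp add: mult.commute flip: integral_inner_left)
 have "(LINT x|L\<Omega>. (grad \<phi> x \<bullet> i) *\<^sub>R u n x) = - ((LINT x|L\<Omega>. \<phi> x *\<^sub>R g n x) \<bullet> i)" for n
  using w[of n] t i pull[OF L(2)] by (simp add: weak_gradient_def mult.commute)
 then have "(\<lambda>n. LINT x|L\<Omega>. (grad \<phi> x \<bullet> i) *\<^sub>R u n x) \<longlonglongrightarrow> - ((LINT x|L\<Omega>. \<phi> x *\<^sub>R h x) \<bullet> i)"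
  using tendsto_minus[OF l2] by simp
 from LIMSEQ_unique[OF l1 this]
 show "(LINT x|L\<Omega>. v x * (grad \<phi> x \<bullet> i)) = - (LINT x|L\<Omega>. (h x \<bullet> i) * \<phi> x)"
  using pull[OF vh(2)] by (simp add: mult.commute)
qed

end

section \<open>Density of smooth functions\<close>

lemma Lp_mult_bounded:
 fixes f :: "'a \<Rightarrow> 'b::euclidean_space" and \<psi> :: "'a \<Rightarrow> real"
 assumes f: "f \<in> Lp M s" and s: "0 \<le> s" and \<psi>: "\<psi> \<in> borel_measurable M" "\<And>x. \<bar>\<psi> x\<bar> \<le> B"
 shows "(\<lambda>x. \<psi> x *\<^sub>R f x) \<in> Lp M s"
proof (rule LpI)
 have B: "0 \<le> B" using \<psi>(2)[of undefined] by linarith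
 have [measurable]: "f \<in> borel_measurable M" "\<psi> \<in> borel_measurable M" using LpD(1)[OF f] \<psi> by auto
 show "(\<lambda>x. \<psi> x *\<^sub>R f x) \<in> borel_measurable M" by measurable
 show "integrable M (\<lambda>x. norm (\<psi> x *\<^sub>R f x) powr s)"
 proof (rule Bochner_Integration.integrable_bound)
  show "integrable M (\<lambda>x. B powr s * norm (f x) powr s)" using LpD(2)[OF f] by simp
  show "AE x in M. norm (norm (\<psi> x *\<^sub>R f x) powr s) \<le> norm (B powr s * norm (f x) powr s)"
  proof (rule AE_I2)
   fix x
   have "\<bar>\<psi> x\<bar> powr s \<le> B powr s" using \<psi>(2) s by (intro powr_mono2) auto
   then show "norm (norm (\<psi> x *\<^sub>R f x) powr s) \<le> norm (B powr s * norm (f x) powr s)"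
    by (simp add: powr_mult mult_right_mono)
  qed
 qed simp
qed

lemma Lp_mult_bounded_vec:
 fixes f :: "'a \<Rightarrow> real" and \<psi> :: "'a \<Rightarrow> 'b::euclidean_space"
 assumes f: "f \<in> Lp M s" and s: "0 \<le> s" and \<psi>: "\<psi> \<in> borel_measurable M" "\<And>x. norm (\<psi> x) \<le> B"
 shows "(\<lambda>x. f x *\<^sub>R \<psi> x) \<in> Lp M s"
proof (rule LpI)
 have [measurable]: "f \<in> borel_measurable M" "\<psi> \<in> borel_measurable M" using LpD(1)[OF f] \<psi> by auto
 show "(\<lambda>x. f x *\<^sub>R \<psi> x) \<in> borel_measurable M" by measurable
 have "(\<lambda>x. norm (\<psi> x) *\<^sub>R f x) \<in> Lp M s"
  by (rule Lp_mult_bounded[OF f s, of _ B]) (use \<psi> in auto)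
 then show "integrable M (\<lambda>x. norm (f x *\<^sub>R \<psi> x) powr s)"
  by (simp add: Lp_def mult.commute abs_mult)
qed

lemma Lnorm_lebesgue_on_le:
 fixes f :: "'a::euclidean_space \<Rightarrow> 'b::euclidean_space"
 assumes f: "f \<in> Lp lborel s" and S: "S \<in> sets borel" and s: "1 \<le> s"
 shows "f \<in> Lp (lebesgue_on S) s" "Lnorm (lebesgue_on S) s f \<le> Lnorm lborel s f"
proof -
 have fb: "f \<in> borel_measurable borel" using LpD(1)[OF f] by simp
 have L: "(\<lambda>x. indicator S x *\<^sub>R f x) \<in> Lp lborel s"
  using S by (intro Lp_mult_bounded[OF f, of _ 1]) (use s in \<open>auto simp: indicator_def\<close>)
 then show "f \<in> Lp (lebesgue_on S) s" by (simp add: Lp_lebesgue_on_iff(1)[OF fb S])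
 have "(LINT x|lborel. norm (indicator S x *\<^sub>R f x) powr s) \<le> (LINT x|lborel. norm (f x) powr s)"
  by (intro integral_mono LpD(2)[OF L] LpD(2)[OF f]) (auto simp: indicator_def)
 then show "Lnorm (lebesgue_on S) s f \<le> Lnorm lborel s f"
  unfolding Lp_lebesgue_on_iff(2)[OF fb S] unfolding Lnorm_def using s by (intro powr_mono2) auto
qed

section \<open>Boundary charts, inward shifts and partitions of unity\<close>

lemma smooth_lipschitz:
 fixes f :: "'a::euclidean_space \<Rightarrow> real"
 assumes f: "smooth f"
 obtains L where "0 \<le> L" "\<And>y z. y \<in> cball x r \<Longrightarrow> z \<in> cball x r \<Longrightarrow> \<bar>f y - f z\<bar> \<le> L * norm (y - z)"
proof -
 have "compact (grad f ` cball x r)"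
  by (intro compact_continuous_image continuous_on_grad f) auto
 then obtain L where L: "\<forall>v\<in>grad f ` cball x r. norm v \<le> L"
  using compact_imp_bounded bounded_iff by blast
 have "norm (f y - f z) \<le> \<bar>L\<bar> * norm (y - z)" if "y \<in> cball x r" "z \<in> cball x r" for y z
 proof (rule differentiable_bound[of "cball x r"])
  show "(f has_derivative (\<lambda>h. grad f y \<bullet> h)) (at y within cball x r)" for y
   by (rule has_derivative_at_withinI[OF smooth_has_derivative[OF f]])
  show "onorm ((\<bullet>) (grad f y)) \<le> \<bar>L\<bar>" if "y \<in> cball x r" for y
  proof (rule onorm_le)
   fix h
   have "norm (grad f y) \<le> L" using L that by blast
   then have "norm (grad f y) \<le> \<bar>L\<bar>" by simp
   then show "norm (grad f y \<bullet> h) \<le> \<bar>L\<bar> * norm h"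
    using Cauchy_Schwarz_ineq2[of "grad f y" h] by (simp add: order_trans[OF _ mult_right_mono])
  qed
 qed (use that in auto)
 then show thesis using that[of "\<bar>L\<bar>"] by auto
qed

definition boundary_chart :: "'a::euclidean_space set \<Rightarrow> 'a \<Rightarrow> real \<Rightarrow> 'a \<Rightarrow> ('a \<Rightarrow> real) \<Rightarrow> bool" where
 "boundary_chart \<Omega> x r e \<gamma> \<longleftrightarrow> 0 < r \<and> e \<in> Basis \<union> uminus ` Basis \<and> smooth \<gamma> \<and>
   (\<forall>y t. \<gamma> (y + t *\<^sub>R e) = \<gamma> y) \<and> \<Omega> \<inter> ball x r = {y \<in> ball x r. \<gamma> y < y \<bullet> e}"

lemma boundary_chartD:
 assumes "boundary_chart \<Omega> x r e \<gamma>"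
 shows "0 < r" "norm e = 1" "e \<bullet> e = 1" "smooth \<gamma>" "\<gamma> (y + t *\<^sub>R e) = \<gamma> y"
  and "y \<in> ball x r \<Longrightarrow> y \<in> \<Omega> \<longleftrightarrow> \<gamma> y < y \<bullet> e"
proof -
 show "norm e = 1" using assms by (auto simp: boundary_chart_def)
 then show "e \<bullet> e = 1" by (simp add: dot_square_norm)
 show "y \<in> ball x r \<Longrightarrow> y \<in> \<Omega> \<longleftrightarrow> \<gamma> y < y \<bullet> e"
  using assms unfolding boundary_chart_def by blast
qed (use assms in \<open>auto simp: boundary_chart_def\<close>)

text \<open>Shifting by \<open>\<epsilon> v\<close> moves the part of the domain near \<open>x\<close> into the interior, with
 enough room for mollification at scale \<open>\<epsilon>\<close>.\<close>

definition inward_shift :: "'a::euclidean_space set \<Rightarrow> 'a \<Rightarrow> real \<Rightarrow> 'a \<Rightarrow> real \<Rightarrow> bool" where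
 "inward_shift \<Omega> x r v \<epsilon>0 \<longleftrightarrow> 0 < r \<and> 0 < \<epsilon>0 \<and>
   (\<forall>\<epsilon> y. 0 < \<epsilon> \<and> \<epsilon> < \<epsilon>0 \<and> y \<in> \<Omega> \<and> cball (y + \<epsilon> *\<^sub>R v) \<epsilon> \<inter> ball x r \<noteq> {} \<longrightarrow> cball (y + \<epsilon> *\<^sub>R v) \<epsilon> \<subseteq> \<Omega>)"

lemma inward_shift_interior:
 assumes "open \<Omega>" "x \<in> \<Omega>"
 shows "\<exists>r e0. inward_shift \<Omega> x r 0 e0"
proof -
 obtain r0 where r0: "0 < r0" "ball x r0 \<subseteq> \<Omega>" using assms open_contains_ball by blast
 have "inward_shift \<Omega> x (r0/3) 0 (r0/3)"
  unfolding inward_shift_def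
 proof (intro conjI allI impI subsetI)
  fix e y z assume a: "0 < e \<and> e < r0/3 \<and> y \<in> \<Omega> \<and> cball (y + e *\<^sub>R 0) e \<inter> ball x (r0/3) \<noteq> {}"
   and z: "z \<in> cball (y + e *\<^sub>R 0) e"
  then obtain z0 where z0: "dist y z0 \<le> e" "dist x z0 < r0/3" by auto
  have "dist x z \<le> dist x z0 + dist z0 y + dist y z"
   using dist_triangle[of x z z0] dist_triangle[of z0 z y] by linarith
  also have "\<dots> < r0" using a z z0 by (simp add: dist_commute)
  finally show "z \<in> \<Omega>" using r0 by auto
 qed (use r0 in auto)
 then show ?thesis by blast
qed

text \<open>With \<open>L\<close> a Lipschitz constant of \<gamma>, moving up by
  \<open>\<epsilon> * (L + 2)\<close> beats what the graph can gain: within distance \<epsilon> it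
  rises by at most \<open>L * \<epsilon>\<close>, while a point loses at most \<epsilon> in
  height.\<close>

lemma inward_shift_boundary:
 assumes c: "boundary_chart \<Omega> x r e \<gamma>"
 shows "\<exists>r' v \<epsilon>0. inward_shift \<Omega> x r' v \<epsilon>0"
proof -
 note c = boundary_chartD[OF c]
 obtain L where L: "0 \<le> L" "\<And>y z. y \<in> cball x r \<Longrightarrow> z \<in> cball x r \<Longrightarrow> \<bar>\<gamma> y - \<gamma> z\<bar> \<le> L * norm (y - z)"
  using smooth_lipschitz[OF c(4), of x r] by blast
 \<comment> \<open>Ensures \<open>\<epsilon> * (L + 4) < r / 2\<close>, so that all points compared
   stay in the ball of the chart.\<close>
 define \<epsilon>0 where "\<epsilon>0 = r / (2 * (L + 4))"
 have "inward_shift \<Omega> x (r/2) ((L + 2) *\<^sub>R e) \<epsilon>0"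
  unfolding inward_shift_def
 proof (intro conjI allI impI subsetI)
  fix \<epsilon> y z assume a: "0 < \<epsilon> \<and> \<epsilon> < \<epsilon>0 \<and> y \<in> \<Omega> \<and> cball (y + \<epsilon> *\<^sub>R (L + 2) *\<^sub>R e) \<epsilon> \<inter> ball x (r/2) \<noteq> {}"
   and z: "z \<in> cball (y + \<epsilon> *\<^sub>R (L + 2) *\<^sub>R e) \<epsilon>"
  let ?y = "y + \<epsilon> *\<^sub>R (L + 2) *\<^sub>R e"
  have eps: "0 < \<epsilon>" "\<epsilon> * (L + 4) < r/2" using a L(1) by (auto simp: \<epsilon>0_def field_simps)
  obtain z0 where z0: "dist ?y z0 \<le> \<epsilon>" "dist x z0 < r/2" using a by auto
  have dyy: "dist ?y y = \<epsilon> * (L + 2)" using eps L(1) c(2) by (simp add: dist_norm)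
  have dxy': "dist x ?y < r/2 + \<epsilon>" using dist_triangle[of x ?y z0] z0 by (simp add: dist_commute)
  have dxy: "dist x y < r/2 + \<epsilon> + \<epsilon> * (L + 2)" using dist_triangle[of x y ?y] dxy' dyy by linarith
  define w where "w = z - ?y"
  have w: "norm w \<le> \<epsilon>" using z by (simp add: w_def dist_norm norm_minus_commute)
  have zw: "z = (y + w) + (\<epsilon> * (L + 2)) *\<^sub>R e" by (simp add: w_def)
  have "dist x (y + w) \<le> dist x y + norm w" using dist_triangle[of x "y + w" y] by (simp add: dist_norm)
  then have in1: "y + w \<in> cball x r" using dxy w eps by (simp add: algebra_simps)
  have in2: "y \<in> ball x r" using dxy eps L(1) by (simp add: algebra_simps)
  have "\<gamma> z = \<gamma> (y + w)" unfolding zw by (rule c(5))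
  also have "\<dots> \<le> \<gamma> y + L * norm w" using L(2)[OF in1, of y] in2 by (simp add: abs_le_iff)
  also have "\<dots> \<le> \<gamma> y + L * \<epsilon>" using w L(1) by (simp add: mult_left_mono)
  also have "\<dots> < y \<bullet> e + L * \<epsilon>" using c(6)[OF in2] a by simp
  also have "\<dots> \<le> z \<bullet> e"
   using Cauchy_Schwarz_ineq2[of w e] w c(2,3) eps
   by (simp add: zw inner_add_left algebra_simps abs_le_iff)
  finally have "\<gamma> z < z \<bullet> e" .
  moreover have "z \<in> ball x r"
  proof -
   have "0 \<le> \<epsilon> * L" using eps L(1) by simp
   then show ?thesis
    using dist_triangle[of x z ?y] dxy' z eps by (simp add: algebra_simps)
  qed
  ultimately show "z \<in> \<Omega>" using c(6) by blast
 qed (use c(1) L(1) in \<open>auto simp: \<epsilon>0_def\<close>)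
 then show ?thesis by blast
qed

text \<open>Adding a cut-off \<psi> multiplies the older functions by \<open>1 - \<psi>\<close>, and
  thereby also the defect \<open>1 - sum\<close>; the defect vanishes wherever one of the cut-offs
  equals \<open>1\<close>.\<close>

lemma partition_of_unity:
 fixes X :: "'a::euclidean_space set" and r :: "'a \<Rightarrow> real"
 assumes "finite X" "\<And>x. x \<in> X \<Longrightarrow> 0 < r x"
 shows "\<exists>\<zeta>. (\<forall>x\<in>X. smooth (\<zeta> x) \<and> (\<forall>z. z \<notin> cball x (r x) \<longrightarrow> \<zeta> x z = 0)) \<and>
  (\<forall>z \<in> (\<Union>x\<in>X. ball x (r x / 2)). (\<Sum>x\<in>X. \<zeta> x z) = (1::real))"
 using assms
proof (induction X rule: finite_induct)
 case (insert a X)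
 then obtain \<zeta> where \<zeta>0: "\<forall>x\<in>X. smooth (\<zeta> x) \<and> (\<forall>z. z \<notin> cball x (r x) \<longrightarrow> \<zeta> x z = 0)"
   "\<forall>z \<in> (\<Union>x\<in>X. ball x (r x / 2)). (\<Sum>x\<in>X. \<zeta> x z) = (1::real)" by blast
 then have \<zeta>: "\<And>x. x \<in> X \<Longrightarrow> smooth (\<zeta> x)" "\<And>x z. x \<in> X \<Longrightarrow> z \<notin> cball x (r x) \<Longrightarrow> \<zeta> x z = 0"
   "\<And>z. z \<in> (\<Union>x\<in>X. ball x (r x / 2)) \<Longrightarrow> (\<Sum>x\<in>X. \<zeta> x z) = (1::real)" by blast+
 obtain \<psi> where \<psi>: "smooth \<psi>" "\<And>x. dist x a \<le> r a / 2 \<Longrightarrow> \<psi> x = 1" "\<And>x. r a \<le> dist x a \<Longrightarrow> \<psi> x = 0"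
  using smooth_cutoff[of "r a / 2" "r a" a] insert.prems by auto
 define \<zeta>' where "\<zeta>' x = (if x = a then \<psi> else (\<lambda>z. (1 - \<psi> z) * \<zeta> x z))" for x
 have sum: "(\<Sum>x\<in>insert a X. \<zeta>' x z) = \<psi> z + (1 - \<psi> z) * (\<Sum>x\<in>X. \<zeta> x z)" for z
 proof -
  have "(\<Sum>x\<in>X. \<zeta>' x z) = (\<Sum>x\<in>X. (1 - \<psi> z) * \<zeta> x z)"
   using insert.hyps by (intro sum.cong) (auto simp: \<zeta>'_def)
  then show ?thesis using insert.hyps by (simp add: \<zeta>'_def sum_distrib_left)
 qed
 show ?case
 proof (intro exI[of _ \<zeta>'] conjI ballI)
  fix x assume "x \<in> insert a X"
  then show "smooth (\<zeta>' x)" using \<psi>(1) \<zeta>(1) by (auto simp: \<zeta>'_def intro!: smooth_mult smooth_diff)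
  show "\<forall>z. z \<notin> cball x (r x) \<longrightarrow> \<zeta>' x z = 0"
   using \<zeta>(2) \<psi>(3) \<open>x \<in> insert a X\<close> by (auto simp: \<zeta>'_def dist_commute)
 next
  fix z assume z: "z \<in> (\<Union>x\<in>insert a X. ball x (r x / 2))"
  show "(\<Sum>x\<in>insert a X. \<zeta>' x z) = 1"
  proof (cases "z \<in> ball a (r a / 2)")
   case True
   then have "\<psi> z = 1" by (intro \<psi>(2)) (simp add: dist_commute)
   then show ?thesis by (simp add: sum)
  next
   case False
   then show ?thesis using z \<zeta>(3) by (simp add: sum)
  qed
 qed
qed auto

section \<open>Approximation of Sobolev functions by smooth functions\<close>

context bounded_open
begin

lemma weak_gradient_cong_AE:
 assumes w: "weak_gradient \<Omega> u g" and L: "u' \<in> Lp L\<Omega> s" "g' \<in> Lp L\<Omega> s" "1 \<le> s"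
  and um: "u \<in> borel_measurable L\<Omega>"
  and ae: "AE x in L\<Omega>. u x = u' x" "AE x in L\<Omega>. g x = g' x"
 shows "weak_gradient \<Omega> u' g'"
proof (rule weak_gradient_LpI[OF L])
 fix \<phi> :: "'a \<Rightarrow> real" and i :: 'a assume t: "test_function \<Omega> \<phi>" and i: "i \<in> Basis"
 note sm = test_functionD(1)[OF t]
 have [measurable]: "u \<in> borel_measurable L\<Omega>" "g \<in> borel_measurable L\<Omega>"
   "u' \<in> borel_measurable L\<Omega>" "g' \<in> borel_measurable L\<Omega>"
  using um weak_gradient_measurable[OF w] LpD(1)[OF L(1)] LpD(1)[OF L(2)] by auto
 have m: "\<phi> \<in> borel_measurable L\<Omega>" "grad \<phi> \<in> borel_measurable L\<Omega>"
  using smooth_borel[OF sm] borel_measurable_grad[OF sm] by (auto intro!: borel_measurable_lebesgue_onI)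
 have "(LINT x|L\<Omega>. u' x * (grad \<phi> x \<bullet> i)) = (LINT x|L\<Omega>. u x * (grad \<phi> x \<bullet> i))"
  using m ae(1) by (intro integral_cong_AE) auto
 also have "\<dots> = - (LINT x|L\<Omega>. (g x \<bullet> i) * \<phi> x)"
  using w t i by (simp add: weak_gradient_def)
 also have "(LINT x|L\<Omega>. (g x \<bullet> i) * \<phi> x) = (LINT x|L\<Omega>. (g' x \<bullet> i) * \<phi> x)"
  using m ae(2) by (intro integral_cong_AE) auto
 finally show "(LINT x|L\<Omega>. u' x * (grad \<phi> x \<bullet> i)) = - (LINT x|L\<Omega>. (g' x \<bullet> i) * \<phi> x)" .
qed

lemma Lp_\<Omega>_iff:
 fixes f :: "'a \<Rightarrow> 'b::euclidean_space"
 assumes "f \<in> borel_measurable borel" "\<And>x. x \<notin> \<Omega> \<Longrightarrow> f x = 0"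
 shows "f \<in> Lp L\<Omega> s \<longleftrightarrow> f \<in> Lp lborel s"
proof -
 have "(\<lambda>x. indicator \<Omega> x *\<^sub>R f x) = f" using assms(2) by (auto simp: indicator_def fun_eq_iff)
 then show ?thesis using Lp_lebesgue_on_iff(1)[OF assms(1) \<Omega>_borel] by simp
qed

lemma Lp_\<Omega>_integrable:
 fixes f :: "'a \<Rightarrow> 'b::euclidean_space"
 assumes f: "f \<in> Lp L\<Omega> s" "1 \<le> s" and b: "f \<in> borel_measurable borel" "\<And>x. x \<notin> \<Omega> \<Longrightarrow> f x = 0"
 shows "integrable lborel f"
proof -
 have "(\<lambda>x. indicator \<Omega> x *\<^sub>R f x) = f" using b(2) by (auto simp: indicator_def fun_eq_iff)
 moreover have "integrable L\<Omega> f"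
  using integrable_mult_bounded(1)[OF finite_L\<Omega> f, of "\<lambda>_. 1" 1] by simp
 ultimately show ?thesis using LINT_lebesgue_on(2)[OF b(1) \<Omega>_borel] by simp
qed

lemma LINT_\<Omega>_eq:
 fixes f :: "'a \<Rightarrow> real"
 assumes "f \<in> borel_measurable borel" "\<And>x. x \<notin> \<Omega> \<Longrightarrow> f x = 0"
 shows "(LINT x|L\<Omega>. f x) = (LINT x|lborel. f x)"
proof -
 have "(\<lambda>x. indicator \<Omega> x *\<^sub>R f x) = f" using assms(2) by (auto simp: indicator_def fun_eq_iff)
 then show ?thesis using LINT_lebesgue_on(1)[OF assms(1) \<Omega>_borel] by simp
qed

text \<open>The gradient is a separate argument because the localised pieces come with the product
  rule as their gradient and not with \<open>wgrad\<close>.\<close>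

definition approximable :: "real \<Rightarrow> ('a \<Rightarrow> real) \<Rightarrow> ('a \<Rightarrow> 'a) \<Rightarrow> bool" where
 "approximable s u g \<longleftrightarrow> u \<in> Lp L\<Omega> s \<and> g \<in> Lp L\<Omega> s \<and> (\<exists>\<phi>. (\<forall>n::nat. smooth (\<phi> n)) \<and>
   Lp_tendsto L\<Omega> s \<phi> u \<and> Lp_tendsto L\<Omega> s (\<lambda>n. grad (\<phi> n)) g)"

lemma approximable_cong_AE:
 assumes "approximable s u g" "u' \<in> borel_measurable L\<Omega>" "g' \<in> borel_measurable L\<Omega>"
  "AE x in L\<Omega>. u x = u' x" "AE x in L\<Omega>. g x = g' x"
 shows "approximable s u' g'"
proof -
 obtain \<phi> where L: "u \<in> Lp L\<Omega> s" "g \<in> Lp L\<Omega> s" and \<phi>: "\<And>n::nat. smooth (\<phi> n)"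
  "Lp_tendsto L\<Omega> s \<phi> u" "Lp_tendsto L\<Omega> s (\<lambda>n. grad (\<phi> n)) g"
  using assms(1) by (auto simp: approximable_def)
 note [measurable] = assms(2,3) LpD(1)[OF L(1)] LpD(1)[OF L(2)]
 have [measurable]: "\<phi> n \<in> borel_measurable L\<Omega>" "grad (\<phi> n) \<in> borel_measurable L\<Omega>" for n
  by (intro borel_measurable_lebesgue_onI smooth_borel borel_measurable_grad \<phi>)+
 have "Lnorm L\<Omega> s (\<lambda>x. \<phi> n x - u x) = Lnorm L\<Omega> s (\<lambda>x. \<phi> n x - u' x)"
  "Lnorm L\<Omega> s (\<lambda>x. grad (\<phi> n) x - g x) = Lnorm L\<Omega> s (\<lambda>x. grad (\<phi> n) x - g' x)" for n
  using assms(4,5) by (intro Lnorm_cong_AE; auto)+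
 then show ?thesis
  unfolding approximable_def using \<phi> Lp_cong_AE[OF L(1) assms(2,4)] Lp_cong_AE[OF L(2) assms(3,5)] by auto
qed

lemma approximable_sum:
 assumes X: "finite X" and "\<And>x. x \<in> X \<Longrightarrow> approximable s (u x) (g x)" and s: "1 \<le> s"
 shows "approximable s (\<lambda>z. \<Sum>x\<in>X. u x z) (\<lambda>z. \<Sum>x\<in>X. g x z)"
 using assms(1,2)
proof (induction X)
 case empty
 have "grad (\<lambda>_ :: 'a. 0 :: real) = (\<lambda>_. 0)" by (rule ext) simp
 then show ?case
  using s Lp_bounded[OF finite_L\<Omega>, of "\<lambda>_. 0 :: real" 0 s] Lp_bounded[OF finite_L\<Omega>, of "\<lambda>_. 0 :: 'a" 0 s]
  by (auto simp: approximable_def smooth_const intro!: exI[of _ "\<lambda>_ _. 0"])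
next
 case (insert x X)
 obtain \<phi> where \<phi>L: "u x \<in> Lp L\<Omega> s" "g x \<in> Lp L\<Omega> s" and \<phi>: "\<And>n::nat. smooth (\<phi> n)"
  "(\<lambda>n. Lnorm L\<Omega> s (\<lambda>z. \<phi> n z - u x z)) \<longlonglongrightarrow> 0" "(\<lambda>n. Lnorm L\<Omega> s (\<lambda>z. grad (\<phi> n) z - g x z)) \<longlonglongrightarrow> 0"
  using insert.prems[of x] by (auto simp: approximable_def)
 obtain \<psi> where \<psi>L: "(\<lambda>z. \<Sum>x\<in>X. u x z) \<in> Lp L\<Omega> s" "(\<lambda>z. \<Sum>x\<in>X. g x z) \<in> Lp L\<Omega> s" and \<psi>: "\<And>n::nat. smooth (\<psi> n)"
  "(\<lambda>n. Lnorm L\<Omega> s (\<lambda>z. \<psi> n z - (\<Sum>x\<in>X. u x z))) \<longlonglongrightarrow> 0" "(\<lambda>n. Lnorm L\<Omega> s (\<lambda>z. grad (\<psi> n) z - (\<Sum>x\<in>X. g x z))) \<longlonglongrightarrow> 0"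
  using insert by (auto simp: approximable_def)
 have L: "\<phi> n \<in> Lp L\<Omega> s" "grad (\<phi> n) \<in> Lp L\<Omega> s" "\<psi> n \<in> Lp L\<Omega> s" "grad (\<psi> n) \<in> Lp L\<Omega> s" for n
  using s by (intro continuous_Lp smooth_continuous continuous_on_grad \<phi> \<psi>; simp)+
 show ?case
  unfolding approximable_def sum.insert[OF insert.hyps]
 proof (intro conjI exI[of _ "\<lambda>n z. \<phi> n z + \<psi> n z"] allI)
  show "smooth (\<lambda>z. \<phi> n z + \<psi> n z)" for n by (intro smooth_add \<phi> \<psi>)
  have "grad (\<lambda>z. \<phi> n z + \<psi> n z) z = grad (\<phi> n) z + grad (\<psi> n) z" for n z
   by (rule grad_add[OF \<phi>(1) \<psi>(1)])
  then show "(\<lambda>n. Lnorm L\<Omega> s (\<lambda>z. grad (\<lambda>z. \<phi> n z + \<psi> n z) z - (g x z + (\<Sum>x\<in>X. g x z)))) \<longlonglongrightarrow> 0"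
   using Lnorm_lin_tendsto[OF L(2,4) \<phi>L(2) \<psi>L(2) s \<phi>(3) \<psi>(3), of 1] by simp
  show "(\<lambda>n. Lnorm L\<Omega> s (\<lambda>z. \<phi> n z + \<psi> n z - (u x z + (\<Sum>x\<in>X. u x z)))) \<longlonglongrightarrow> 0"
   using Lnorm_lin_tendsto[OF L(1,3) \<phi>L(1) \<psi>L(1) s \<phi>(2) \<psi>(2), of 1] by simp
 qed (rule Lp_add[OF \<phi>L(1) \<psi>L(1) s] Lp_add[OF \<phi>L(2) \<psi>L(2) s])+
qed

text \<open>A kernel ball that meets the ball around \<open>x0\<close> lies in \<Omega> by the
  inward shift, and then \<zeta> times the kernel is a test function; for the other balls everything
  vanishes. The definition of the weak gradient therefore gives the gradient of the mollification at
  every point of \<Omega>, however close to the boundary.\<close>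

lemma local_approximation:
 assumes shift: "inward_shift \<Omega> x0 r v \<epsilon>0" and \<zeta>: "smooth \<zeta>" "\<And>z. z \<notin> cball x0 r' \<Longrightarrow> \<zeta> z = 0" and r': "r' < r"
  and u: "u \<in> Sobolev \<Omega> s" and s: "1 \<le> s"
 shows "approximable s (\<lambda>x. \<zeta> x * u x) (\<lambda>x. \<zeta> x *\<^sub>R wgrad \<Omega> u x + u x *\<^sub>R grad \<zeta> x)"
proof -
 obtain u' where u': "u' \<in> borel_measurable borel" "\<And>x. x \<notin> \<Omega> \<Longrightarrow> u' x = 0" "AE x in L\<Omega>. u x = u' x"
  using lebesgue_on_borel_version[OF LpD(1)[OF Sobolev_Lp[OF u]] \<Omega>_borel] by blast
 obtain g where g: "g \<in> borel_measurable borel" "\<And>x. x \<notin> \<Omega> \<Longrightarrow> g x = 0" "AE x in L\<Omega>. wgrad \<Omega> u x = g x"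
  using lebesgue_on_borel_version[OF LpD(1)[OF Sobolev_wgrad(2)[OF u]] \<Omega>_borel] by blast
 have u'L: "u' \<in> Lp L\<Omega> s"
  by (rule Lp_cong_AE[OF Sobolev_Lp[OF u] borel_measurable_lebesgue_onI[OF u'(1)] u'(3)])
 have gL: "g \<in> Lp L\<Omega> s"
  by (rule Lp_cong_AE[OF Sobolev_wgrad(2)[OF u] borel_measurable_lebesgue_onI[OF g(1)] g(3)])
 have wg: "weak_gradient \<Omega> u' g"
  by (rule weak_gradient_cong_AE[OF Sobolev_wgrad(1)[OF u] u'L gL s LpD(1)[OF Sobolev_Lp[OF u]] u'(3) g(3)])
 have \<zeta>R: "\<zeta> z = 0" if "norm x0 + r' < norm z" for z
 proof (rule \<zeta>(2))
  show "z \<notin> cball x0 r'" using that norm_triangle_ineq2[of z x0] by (auto simp: dist_norm norm_minus_commute)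
 qed
 have g\<zeta>: "grad \<zeta> z = 0" if "z \<notin> cball x0 r'" for z
 proof (rule grad_eqI)
  fix i :: 'a
  have "pd i \<zeta> z = 0" by (rule pd_0_open[of "- cball x0 r'"]) (use that \<zeta>(2) in auto)
  then show "pd i \<zeta> z = 0 \<bullet> i" by simp
 qed
 have [measurable]: "\<zeta> \<in> borel_measurable borel" "grad \<zeta> \<in> borel_measurable borel" "u' \<in> borel_measurable borel" "g \<in> borel_measurable borel"
  using smooth_borel[OF \<zeta>(1)] borel_measurable_grad[OF \<zeta>(1)] u' g by auto
 obtain B1 where B1: "\<And>z. norm (\<zeta> z) \<le> B1"
  using bounded_of_compact_support[OF smooth_continuous[OF \<zeta>(1)] \<zeta>R] by blast
 obtain B2 where B2: "\<And>z. norm (grad \<zeta> z) \<le> B2"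
  using bounded_of_compact_support[OF continuous_on_grad[OF \<zeta>(1)] grad_0_outside[of "norm x0 + r'" \<zeta>, OF \<zeta>R]] by blast
 define w where "w z = \<zeta> z * u' z" for z
 define G where "G z = \<zeta> z *\<^sub>R g z + u' z *\<^sub>R grad \<zeta> z" for z
 have wb [measurable]: "w \<in> borel_measurable borel" and Gb [measurable]: "G \<in> borel_measurable borel"
  unfolding w_def G_def by measurable
 have w0: "w z = 0" and G0: "G z = 0" if "z \<notin> \<Omega>" for z using that u'(2) g(2) by (simp_all add: w_def G_def)
 have \<zeta>m: "\<zeta> \<in> borel_measurable L\<Omega>" "grad \<zeta> \<in> borel_measurable L\<Omega>" by (auto intro!: borel_measurable_lebesgue_onI)
 have wL: "w \<in> Lp L\<Omega> s"
  using Lp_mult_bounded[OF u'L _ \<zeta>m(1), of B1] B1 s by (simp add: w_def[abs_def])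
 have GL: "G \<in> Lp L\<Omega> s"
  unfolding G_def[abs_def]
  using Lp_add[OF Lp_mult_bounded[OF gL _ \<zeta>m(1), of B1] Lp_mult_bounded_vec[OF u'L _ \<zeta>m(2), of B2] s] B1 B2 s by simp
 have wLb: "w \<in> Lp lborel s" and GLb: "G \<in> Lp lborel s"
  using wL GL Lp_\<Omega>_iff[OF wb] Lp_\<Omega>_iff[OF Gb] w0 G0 by auto
 have wi: "integrable lborel w" by (rule Lp_\<Omega>_integrable[OF wL s wb w0])
 have Gi: "integrable lborel G" by (rule Lp_\<Omega>_integrable[OF GL s Gb G0])
 define \<epsilon> where "\<epsilon> n = \<epsilon>0 / 2 * inverse (real (Suc n))" for n
 have e0: "0 < \<epsilon>0" using shift by (simp add: inward_shift_def)
 have "\<epsilon> \<longlonglongrightarrow> 0"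
  unfolding \<epsilon>_def by (rule tendsto_mult_right_zero[OF LIMSEQ_inverse_real_of_nat])
 moreover have "0 < \<epsilon> n" for n using e0 by (simp add: \<epsilon>_def)
 moreover have "\<epsilon> n < \<epsilon>0" for n
 proof -
  have "inverse (real (Suc n)) \<le> 1" by (simp add: inverse_le_1_iff)
  then have "\<epsilon>0 / 2 * inverse (real (Suc n)) \<le> \<epsilon>0 / 2 * 1" using e0 by (intro mult_left_mono) auto
  then show ?thesis using e0 unfolding \<epsilon>_def by linarith
 qed
 ultimately have \<epsilon>: "\<epsilon> \<longlonglongrightarrow> 0" "\<And>n. 0 < \<epsilon> n" "\<And>n. \<epsilon> n < \<epsilon>0" by auto
 obtain \<eta> where \<eta>: "\<And>n. mollifier (\<epsilon> n) (\<eta> n :: 'a \<Rightarrow> real)" using mollifier_exists[OF \<epsilon>(2)] by metis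
 have \<eta>R: "\<eta> n z = 0" if "\<epsilon> n < norm z" for n z using mollifierD(3)[OF \<eta>, of n z] that by simp
 define \<phi> where "\<phi> n x = (LINT z|lborel. \<eta> n (x + \<epsilon> n *\<^sub>R v - z) *\<^sub>R w z)" for n x
 define \<Gamma> where "\<Gamma> n x = (LINT z|lborel. \<eta> n (x + \<epsilon> n *\<^sub>R v - z) *\<^sub>R G z)" for n x
 have \<phi>_alt: "\<phi> n = (\<lambda>x. (\<lambda>y. LINT z|lborel. \<eta> n (y - z) * w z) (\<epsilon> n *\<^sub>R v + 1 *\<^sub>R x))" for n
  by (simp add: \<phi>_def fun_eq_iff add.commute)
 have sc: "smooth (\<lambda>y. LINT z|lborel. \<eta> n (y - z) * w z)" for n
  by (rule smooth_conv[OF wi mollifierD(1)[OF \<eta>] \<eta>R])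
 have sm\<phi>: "smooth (\<phi> n)" for n unfolding \<phi>_alt by (rule smooth_affine[OF sc])
 have grad\<phi>: "grad (\<phi> n) x = \<Gamma> n x" if x: "x \<in> \<Omega>" for n x
 proof (rule grad_eqI)
  fix i :: 'a assume i: "i \<in> Basis"
  let ?y = "x + \<epsilon> n *\<^sub>R v"
  have "pd i (\<phi> n) x = pd i (\<lambda>y. LINT z|lborel. \<eta> n (y - z) * w z) ?y"
   unfolding \<phi>_alt by (subst pd_affine[OF smooth_differentiable[OF sc]]) (simp add: add.commute)
  also have "\<dots> = (LINT z|lborel. pd i (\<eta> n) (?y - z) * w z)"
   by (rule pd_conv[OF wi mollifierD(1)[OF \<eta>] \<eta>R i])
  also have "\<dots> = (LINT z|lborel. \<eta> n (?y - z) * (G z \<bullet> i))"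
  proof (cases "cball ?y (\<epsilon> n) \<inter> ball x0 r = {}")
   \<comment> \<open>The kernel ball contains no point of the support of \<zeta>, so both integrands
     vanish.\<close>
   case True
   have z1: "w z = 0" "G z = 0" if "z \<in> cball ?y (\<epsilon> n)" for z
   proof -
    have "z \<notin> cball x0 r'" using that True r' by fastforce
    then show "w z = 0" "G z = 0" using \<zeta>(2) g\<zeta> by (simp_all add: w_def G_def)
   qed
   have z2: "pd i (\<eta> n) (?y - z) * w z = 0" "\<eta> n (?y - z) * (G z \<bullet> i) = 0" for z
    using z1[of z] pd_0_outside[of "\<epsilon> n" "\<eta> n" "?y - z" i, OF \<eta>R] \<eta>R[of n "?y - z"]
    by (cases "z \<in> cball ?y (\<epsilon> n)"; simp add: dist_norm)+
   show ?thesis unfolding z2 by simp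
  next
   case False
   then have sub: "cball ?y (\<epsilon> n) \<subseteq> \<Omega>"
    using shift x \<epsilon>(2,3)[of n] unfolding inward_shift_def by blast
   let ?h = "\<lambda>z. \<eta> n (?y + (-1) *\<^sub>R z)"
   have hs: "smooth ?h" by (rule smooth_affine[OF mollifierD(1)[OF \<eta>]])
   have h0: "?h z = 0" if "z \<notin> cball ?y (\<epsilon> n)" for z using that by (intro \<eta>R) (simp add: dist_norm)
   \<comment> \<open>Testing \<open>u'\<close> with \<zeta> times the kernel produces the product
     rule for \<open>\<zeta> u'\<close> without differentiating \<open>u'\<close>.\<close>
   have t: "test_function \<Omega> (\<lambda>z. \<zeta> z * ?h z)"
    by (rule test_functionI[OF smooth_mult[OF \<zeta>(1) hs] compact_cball sub]) (metis h0 mult_zero_right)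
   have gr: "grad (\<lambda>z. \<zeta> z * ?h z) z \<bullet> i = - \<zeta> z * pd i (\<eta> n) (?y - z) + ?h z * (grad \<zeta> z \<bullet> i)" for z
    unfolding grad_mult[OF \<zeta>(1) hs] using pd_affine[where f="\<eta> n" and c="?y" and s="-1" and x=z and i=i, OF smooth_differentiable[OF mollifierD(1)[OF \<eta>]]] i
    by (simp add: inner_add_left grad_inner_Basis)
   have [measurable]: "?h \<in> borel_measurable borel" "\<eta> n \<in> borel_measurable borel" "pd i (\<eta> n) \<in> borel_measurable borel"
    using smooth_borel[OF hs] smooth_borel[OF mollifierD(1)[OF \<eta>]] smooth_borel[OF smooth_pd[OF mollifierD(1)[OF \<eta>] i]] by auto
   have "(LINT z|L\<Omega>. u' z * (grad (\<lambda>z. \<zeta> z * ?h z) z \<bullet> i)) = - (LINT z|L\<Omega>. (g z \<bullet> i) * (\<zeta> z * ?h z))"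
    using wg t i by (simp add: weak_gradient_def)
   also have "(LINT z|L\<Omega>. u' z * (grad (\<lambda>z. \<zeta> z * ?h z) z \<bullet> i))
     = (LINT z|lborel. ?h z * (u' z * (grad \<zeta> z \<bullet> i)) - pd i (\<eta> n) (?y - z) * w z)"
    unfolding gr
    by (subst LINT_\<Omega>_eq) (auto simp: u'(2) w_def algebra_simps intro!: Bochner_Integration.integral_cong)
   also have "(LINT z|L\<Omega>. (g z \<bullet> i) * (\<zeta> z * ?h z)) = (LINT z|lborel. ?h z * ((g z \<bullet> i) * \<zeta> z))"
    by (subst LINT_\<Omega>_eq) (auto simp: g(2) algebra_simps intro!: Bochner_Integration.integral_cong)
   finally have eq: "(LINT z|lborel. ?h z * (u' z * (grad \<zeta> z \<bullet> i)) - pd i (\<eta> n) (?y - z) * w z)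
     = - (LINT z|lborel. ?h z * ((g z \<bullet> i) * \<zeta> z))" .
   have fb: "(\<lambda>z. u' z * (grad \<zeta> z \<bullet> i)) \<in> borel_measurable borel" "(\<lambda>z. (g z \<bullet> i) * \<zeta> z) \<in> borel_measurable borel"
    by measurable
   have giL: "(\<lambda>x. g x \<bullet> i) \<in> Lp L\<Omega> s"
   proof (rule LpI)
    show "(\<lambda>x. g x \<bullet> i) \<in> borel_measurable L\<Omega>" by (rule borel_measurable_lebesgue_onI) measurable
    then show "integrable L\<Omega> (\<lambda>x. norm (g x \<bullet> i) powr s)"
     using Basis_le_norm[OF i] s
     by (intro Bochner_Integration.integrable_bound[OF LpD(2)[OF gL]]) (auto intro!: powr_mono2)
   qed
   have i1: "integrable lborel (\<lambda>z. u' z * (grad \<zeta> z \<bullet> i))"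
   proof (rule Lp_\<Omega>_integrable[OF _ s fb(1)])
    have "\<bar>grad \<zeta> z \<bullet> i\<bar> \<le> B2" for z using Basis_le_norm[OF i, of "grad \<zeta> z"] B2[of z] by linarith
    then have "(\<lambda>z. (grad \<zeta> z \<bullet> i) *\<^sub>R u' z) \<in> Lp L\<Omega> s"
     using s by (intro Lp_mult_bounded[OF u'L, of _ B2] borel_measurable_lebesgue_onI) auto
    then show "(\<lambda>z. u' z * (grad \<zeta> z \<bullet> i)) \<in> Lp L\<Omega> s" by (simp add: mult.commute)
   qed (simp add: u'(2))
   have i2: "integrable lborel (\<lambda>z. (g z \<bullet> i) * \<zeta> z)"
   proof (rule Lp_\<Omega>_integrable[OF _ s fb(2)])
    show "(\<lambda>z. (g z \<bullet> i) * \<zeta> z) \<in> Lp L\<Omega> s"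
     using Lp_mult_bounded[OF giL _ \<zeta>m(1), of B1] B1 s by (simp add: mult.commute)
   qed (simp add: g(2))
   have c1: "integrable lborel (\<lambda>z. ?h z * (u' z * (grad \<zeta> z \<bullet> i)))"
    using integrable_conv[where f="\<eta> n" and R="\<epsilon> n" and x="?y", OF i1 smooth_continuous[OF mollifierD(1)[OF \<eta>]] \<eta>R] by simp
   have c2: "integrable lborel (\<lambda>z. ?h z * ((g z \<bullet> i) * \<zeta> z))"
    using integrable_conv[where f="\<eta> n" and R="\<epsilon> n" and x="?y", OF i2 smooth_continuous[OF mollifierD(1)[OF \<eta>]] \<eta>R] by simp
   have c3: "integrable lborel (\<lambda>z. pd i (\<eta> n) (?y - z) * w z)"
    using integrable_conv[where f="pd i (\<eta> n)" and R="\<epsilon> n" and x="?y", OF wi smooth_continuous[OF smooth_pd[OF mollifierD(1)[OF \<eta>] i]] pd_0_outside[of "\<epsilon> n" "\<eta> n", OF \<eta>R]] by simp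
   have "(LINT z|lborel. pd i (\<eta> n) (?y - z) * w z)
     = (LINT z|lborel. ?h z * (u' z * (grad \<zeta> z \<bullet> i))) + (LINT z|lborel. ?h z * ((g z \<bullet> i) * \<zeta> z))"
    using eq c1 c3 by simp
   also have "\<dots> = (LINT z|lborel. ?h z * (u' z * (grad \<zeta> z \<bullet> i)) + ?h z * ((g z \<bullet> i) * \<zeta> z))"
    using c1 c2 by simp
   also have "\<dots> = (LINT z|lborel. \<eta> n (?y - z) * (G z \<bullet> i))"
    by (intro Bochner_Integration.integral_cong) (auto simp: G_def inner_add_left algebra_simps)
   finally show ?thesis .
  qed
  also have "\<dots> = \<Gamma> n x \<bullet> i"
   using integrable_conv[where f="\<eta> n" and R="\<epsilon> n" and x="?y", OF Gi smooth_continuous[OF mollifierD(1)[OF \<eta>]] \<eta>R]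
   by (simp add: \<Gamma>_def flip: integral_inner_left)
  finally show "pd i (\<phi> n) x = \<Gamma> n x \<bullet> i" .
 qed
 have \<phi>L: "\<phi> n \<in> Lp lborel s" for n
  unfolding \<phi>_def[abs_def] by (rule mollify_converges(1)[OF wLb wi s \<eta> \<epsilon>(1,2)])
 have \<phi>lim: "Lp_tendsto lborel s \<phi> w"
  unfolding \<phi>_def[abs_def] by (rule mollify_converges(2)[OF wLb wi s \<eta> \<epsilon>(1,2)])
 have \<Gamma>L: "\<Gamma> n \<in> Lp lborel s" for n
  unfolding \<Gamma>_def[abs_def] by (rule mollify_converges(1)[OF GLb Gi s \<eta> \<epsilon>(1,2)])
 have \<Gamma>lim: "Lp_tendsto lborel s \<Gamma> G"
  unfolding \<Gamma>_def[abs_def] by (rule mollify_converges(2)[OF GLb Gi s \<eta> \<epsilon>(1,2)])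
 have "approximable s w G"
  unfolding approximable_def
 proof (intro conjI exI[of _ \<phi>] allI wL GL sm\<phi>)
  show "Lp_tendsto L\<Omega> s \<phi> w"
   by (rule Lim_null_comparison[OF always_eventually[OF allI] \<phi>lim])
    (simp add: Lnorm_lebesgue_on_le(2)[OF Lp_diff[OF \<phi>L wLb s] \<Omega>_borel s])
  have "Lnorm L\<Omega> s (\<lambda>x. grad (\<phi> n) x - G x) = Lnorm L\<Omega> s (\<lambda>x. \<Gamma> n x - G x)" for n
   unfolding Lnorm_def by (intro arg_cong2[of _ _ _ _ "(powr)"] Bochner_Integration.integral_cong) (auto simp: grad\<phi>)
  then show "Lp_tendsto L\<Omega> s (\<lambda>n. grad (\<phi> n)) G"
   by (intro Lim_null_comparison[OF always_eventually[OF allI] \<Gamma>lim])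
    (simp add: Lnorm_lebesgue_on_le(2)[OF Lp_diff[OF \<Gamma>L GLb s] \<Omega>_borel s])
 qed
 moreover have [measurable]: "u \<in> borel_measurable L\<Omega>" "wgrad \<Omega> u \<in> borel_measurable L\<Omega>"
  using LpD(1)[OF Sobolev_Lp[OF u]] LpD(1)[OF Sobolev_wgrad(2)[OF u]] by auto
 ultimately show ?thesis
  using u'(3) g(3) \<zeta>m by (elim approximable_cong_AE) (auto simp: w_def G_def)
qed

end

locale smooth_domain = bounded_open +
 assumes connected_\<Omega>: "connected \<Omega>" and nonempty_\<Omega>: "\<Omega> \<noteq> {}" and smooth_boundary: "smooth_boundary \<Omega>"
begin

lemma chart_exists: "x \<in> frontier \<Omega> \<Longrightarrow> \<exists>r e \<gamma>. boundary_chart \<Omega> x r e \<gamma>"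
 using smooth_boundary unfolding smooth_boundary_def boundary_chart_def by meson

text \<open>The pieces cut out by a partition of unity are approximated separately. On \<Omega> the
  partition sums to \<open>1\<close>, so the gradients of its members cancel and the product-rule
  terms add up to \<open>wgrad\<close>.\<close>

theorem smooth_dense:
 assumes u: "u \<in> Sobolev \<Omega> s" and s: "1 \<le> s"
 shows "approximable s u (wgrad \<Omega> u)"
proof -
 have "\<exists>r v e0. inward_shift \<Omega> x r v e0" if "x \<in> closure \<Omega>" for x
  using inward_shift_interior[OF open_\<Omega>] inward_shift_boundary chart_exists that
  by (metis DiffI frontier_def interior_open open_\<Omega>)
 then obtain r v e0 where sh: "\<And>x. x \<in> closure \<Omega> \<Longrightarrow> inward_shift \<Omega> x (r x) (v x) (e0 x)" by metis
 then have rpos: "\<And>x. x \<in> closure \<Omega> \<Longrightarrow> 0 < r x" by (auto simp: inward_shift_def)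
 have "compact (closure \<Omega>)" using bounded_\<Omega> by auto
 \<comment> \<open>Two halvings: balls of radius \<open>r x / 4\<close> cover, and the cut-offs
   vanish outside radius \<open>r x / 2\<close>, strictly inside the radius of the inward
   shift.\<close>
 then obtain X where X: "finite X" "X \<subseteq> closure \<Omega>" "closure \<Omega> \<subseteq> (\<Union>x\<in>X. ball x (r x / 2 / 2))"
  by (rule compactE_image[of _ "closure \<Omega>" "\<lambda>x. ball x (r x / 2 / 2)"]) (use rpos in \<open>force+\<close>)
 have "0 < r x / 2" if "x \<in> X" for x using rpos X(2) that by auto
 then obtain \<zeta> where \<zeta>0: "\<forall>x\<in>X. smooth (\<zeta> x) \<and> (\<forall>z. z \<notin> cball x (r x / 2) \<longrightarrow> \<zeta> x z = 0)"
   "\<forall>z \<in> (\<Union>x\<in>X. ball x (r x / 2 / 2)). (\<Sum>x\<in>X. \<zeta> x z) = (1::real)"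
  using partition_of_unity[OF X(1), of "\<lambda>x. r x / 2"] by blast
 then have \<zeta>: "\<And>x. x \<in> X \<Longrightarrow> smooth (\<zeta> x)" "\<And>x z. x \<in> X \<Longrightarrow> z \<notin> cball x (r x / 2) \<Longrightarrow> \<zeta> x z = 0"
   "\<And>z. z \<in> (\<Union>x\<in>X. ball x (r x / 2 / 2)) \<Longrightarrow> (\<Sum>x\<in>X. \<zeta> x z) = (1::real)" by blast+
 have app: "approximable s (\<lambda>z. \<zeta> x z * u z) (\<lambda>z. \<zeta> x z *\<^sub>R wgrad \<Omega> u z + u z *\<^sub>R grad (\<zeta> x) z)" if x: "x \<in> X" for x
 proof -
  have xc: "x \<in> closure \<Omega>" using X(2) x by auto
  show ?thesis
   by (rule local_approximation[OF sh[OF xc] \<zeta>(1)[OF x], of "r x / 2", OF \<zeta>(2)[OF x] _ u s]) (use rpos[OF xc] in linarith)+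
 qed
 have sum1: "(\<Sum>x\<in>X. \<zeta> x z) = 1" if "z \<in> \<Omega>" for z using \<zeta>(3) X(3) closure_subset that by blast
 have sumg: "(\<Sum>x\<in>X. grad (\<zeta> x) z) = 0" if z: "z \<in> \<Omega>" for z
 proof -
  have sm: "smooth (\<lambda>z. \<Sum>x\<in>X. \<zeta> x z)" using \<zeta>(1) by (rule smooth_sum)
  have "grad (\<lambda>z. (\<Sum>x\<in>X. \<zeta> x z) - 1) z = 0"
  proof (rule grad_eqI)
   fix i :: 'a
   have "pd i (\<lambda>z. (\<Sum>x\<in>X. \<zeta> x z) - 1) z = 0"
    by (rule pd_0_open[OF open_\<Omega> z]) (simp add: sum1)
   then show "pd i (\<lambda>z. (\<Sum>x\<in>X. \<zeta> x z) - 1) z = 0 \<bullet> i" by simp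
  qed
  then show ?thesis using grad_diff[OF sm smooth_const, of 1 z] grad_sum[OF X(1) \<zeta>(1)] by simp
 qed
 show ?thesis
 proof (rule approximable_cong_AE[OF approximable_sum[OF X(1) app s]])
  show "u \<in> borel_measurable L\<Omega>" "wgrad \<Omega> u \<in> borel_measurable L\<Omega>"
   using LpD(1)[OF Sobolev_Lp[OF u]] LpD(1)[OF Sobolev_wgrad(2)[OF u]] .
  show "AE z in L\<Omega>. (\<Sum>x\<in>X. \<zeta> x z * u z) = u z"
   using AE_space by eventually_elim (simp add: sum1 flip: sum_distrib_right)
  show "AE z in L\<Omega>. (\<Sum>x\<in>X. \<zeta> x z *\<^sub>R wgrad \<Omega> u z + u z *\<^sub>R grad (\<zeta> x) z) = wgrad \<Omega> u z"
   using AE_space by eventually_elim (simp add: sum1 sumg sum.distrib flip: scaleR_left.sum scaleR_right.sum)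
 qed
qed

end

section \<open>Estimates along a transversal direction\<close>

text \<open>The fundamental theorem is followed by Jensen's inequality for the uniform distribution
  on \<open>[0, h]\<close>, which produces the factor \<open>h powr (s - 1)\<close>. The interval on
  the right is open because the starting point will lie on the boundary and must not be counted as a
  point of \<Omega>.\<close>

lemma line_estimate:
 fixes f f' :: "real \<Rightarrow> real"
 assumes f: "\<And>x. (f has_vector_derivative f' x) (at x)" and f': "continuous_on UNIV f'"
  and h: "0 < h" "0 \<le> t" "t \<le> h" and s: "1 \<le> s"
 shows "ennreal (\<bar>f t - f 0\<bar> powr s)
  \<le> ennreal (h powr (s - 1)) * (\<integral>\<^sup>+r. ennreal (\<bar>f' r\<bar> powr s) * indicator {0<..<h} r \<partial>lborel)"
proof -
 let ?J = "\<integral>\<^sup>+r. ennreal (\<bar>f' r\<bar> powr s) * indicator {0<..<h} r \<partial>lborel"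
 have [measurable]: "f' \<in> borel_measurable borel" using f' by (rule borel_measurable_continuous_onI)
 define \<nu> where "\<nu> = density lborel (\<lambda>r. ennreal (indicator {0..h} r / h))"
 have \<nu>1: "emeasure \<nu> (space \<nu>) = 1"
 proof -
  have "emeasure \<nu> (space \<nu>) = (\<integral>\<^sup>+r. ennreal (1 / h) * indicator {0..h} r \<partial>lborel)"
   unfolding \<nu>_def by (auto simp: emeasure_density indicator_def intro!: nn_integral_cong)
  also have "\<dots> = 1"
   using h by (subst nn_integral_cmult_indicator) (auto simp flip: ennreal_mult)
  finally show ?thesis .
 qed
 have int: "integrable lborel (\<lambda>r. indicator {0..h} r *\<^sub>R \<bar>f' r\<bar>)"
  by (intro borel_integrable_compact continuous_intros continuous_on_subset[OF f']) auto
 have int': "integrable lborel (\<lambda>r. indicator {0..t} r *\<^sub>R \<bar>f' r\<bar>)"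
  by (intro borel_integrable_compact continuous_intros continuous_on_subset[OF f']) auto
 have "f t - f 0 = (LINT r|lborel. indicator {0..t} r *\<^sub>R f' r)"
  by (rule integral_FTC_atLeastAtMost[symmetric])
   (use h f f' in \<open>auto intro: has_vector_derivative_at_within continuous_on_subset\<close>)
 then have "\<bar>f t - f 0\<bar> \<le> (LINT r|lborel. norm (indicator {0..t} r *\<^sub>R f' r))"
  using integral_norm_bound[of lborel "\<lambda>r. indicator {0..t} r *\<^sub>R f' r"] by simp
 also have "(\<lambda>r. norm (indicator {0..t} r *\<^sub>R f' r)) = (\<lambda>r. indicator {0..t} r *\<^sub>R \<bar>f' r\<bar>)"
  by (simp add: abs_mult)
 also have "(LINT r|lborel. indicator {0..t} r *\<^sub>R \<bar>f' r\<bar>) \<le> (LINT r|lborel. indicator {0..h} r *\<^sub>R \<bar>f' r\<bar>)"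
  using int int' h by (intro integral_mono) (auto simp: indicator_def)
 also have "\<dots> = h * (LINT r|\<nu>. \<bar>f' r\<bar>)"
  unfolding \<nu>_def using h by (subst integral_density) auto
 finally have "\<bar>f t - f 0\<bar> powr s \<le> (h * (LINT r|\<nu>. \<bar>f' r\<bar>)) powr s"
  using s by (intro powr_mono2) auto
 then have "ennreal (\<bar>f t - f 0\<bar> powr s) \<le> ennreal ((h * (LINT r|\<nu>. \<bar>f' r\<bar>)) powr s)"
  by (rule ennreal_leI)
 also have "\<dots> = ennreal (h powr s) * ennreal (norm (LINT r|\<nu>. \<bar>f' r\<bar>) powr s)"
  using h by (simp add: powr_mult ennreal_mult)
 also have "\<dots> \<le> ennreal (h powr s) * (\<integral>\<^sup>+r. ennreal (norm \<bar>f' r\<bar> powr s) \<partial>\<nu>)"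
  by (intro mult_left_mono jensen_powr[OF \<nu>1 s]) auto
 also have "(\<integral>\<^sup>+r. ennreal (norm \<bar>f' r\<bar> powr s) \<partial>\<nu>)
   = (\<integral>\<^sup>+r. ennreal (1 / h) * (ennreal (\<bar>f' r\<bar> powr s) * indicator {0..h} r) \<partial>lborel)"
  unfolding \<nu>_def by (subst nn_integral_density) (auto simp: indicator_def intro!: nn_integral_cong)
 also have "\<dots> = ennreal (1 / h) * (\<integral>\<^sup>+r. ennreal (\<bar>f' r\<bar> powr s) * indicator {0..h} r \<partial>lborel)"
  by (intro nn_integral_cmult) auto
 also have "(\<integral>\<^sup>+r. ennreal (\<bar>f' r\<bar> powr s) * indicator {0..h} r \<partial>lborel)
   = ?J"
 proof (rule nn_integral_cong_AE)
  have "AE r in lborel. r \<noteq> (0::real)" "AE r in lborel. r \<noteq> h" by (rule AE_lborel_singleton)+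
  then show "AE r in lborel. ennreal (\<bar>f' r\<bar> powr s) * indicator {0..h} r = ennreal (\<bar>f' r\<bar> powr s) * indicator {0<..<h} r"
   by eventually_elim (auto simp: indicator_def)
 qed
 also have "ennreal (h powr s) * (ennreal (1 / h) * ?J)
   = ennreal (h powr (s - 1)) * ?J"
  using h by (simp add: powr_diff flip: mult.assoc ennreal_mult)
 finally show ?thesis .
qed

lemma smooth_line_estimate:
 fixes \<phi> :: "'a::euclidean_space \<Rightarrow> real"
 assumes \<phi>: "smooth \<phi>" and e: "norm e = 1" and h: "0 < h" "0 \<le> t" "t \<le> h" and s: "1 \<le> s"
 shows "ennreal (\<bar>\<phi> x\<bar> powr s) \<le> ennreal (2 powr (s - 1)) * (ennreal (\<bar>\<phi> (x + t *\<^sub>R e)\<bar> powr s)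
  + ennreal (h powr (s - 1)) * (\<integral>\<^sup>+r. ennreal (norm (grad \<phi> (x + r *\<^sub>R e)) powr s) * indicator {0<..<h} r \<partial>lborel))"
proof -
 have d: "((\<lambda>r. \<phi> (x + r *\<^sub>R e)) has_vector_derivative grad \<phi> (x + r *\<^sub>R e) \<bullet> e) (at r)" for r
 proof -
  have "((\<lambda>r. x + r *\<^sub>R e) has_derivative (\<lambda>k. k *\<^sub>R e)) (at r)" by (auto intro!: derivative_eq_intros)
  from has_derivative_compose[OF this smooth_has_derivative[OF \<phi>]]
  show ?thesis by (simp add: has_vector_derivative_def)
 qed
 have c: "continuous_on UNIV (\<lambda>r. grad \<phi> (x + r *\<^sub>R e) \<bullet> e)"
  by (intro continuous_intros continuous_on_compose2[OF continuous_on_grad[OF \<phi>, of UNIV]]) auto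
 have "ennreal (\<bar>\<phi> (x + t *\<^sub>R e) - \<phi> (x + 0 *\<^sub>R e)\<bar> powr s) \<le> ennreal (h powr (s - 1)) *
   (\<integral>\<^sup>+r. ennreal (\<bar>grad \<phi> (x + r *\<^sub>R e) \<bullet> e\<bar> powr s) * indicator {0<..<h} r \<partial>lborel)"
  by (rule line_estimate[OF d c h s])
 also have "\<dots> \<le> ennreal (h powr (s - 1)) *
   (\<integral>\<^sup>+r. ennreal (norm (grad \<phi> (x + r *\<^sub>R e)) powr s) * indicator {0<..<h} r \<partial>lborel)"
 proof (intro mult_left_mono nn_integral_mono mult_right_mono ennreal_leI powr_mono2)
  fix r show "\<bar>grad \<phi> (x + r *\<^sub>R e) \<bullet> e\<bar> \<le> norm (grad \<phi> (x + r *\<^sub>R e))"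
   using Cauchy_Schwarz_ineq2[of "grad \<phi> (x + r *\<^sub>R e)" e] e by simp
 qed (use s in auto)
 finally have 1: "ennreal (\<bar>\<phi> x - \<phi> (x + t *\<^sub>R e)\<bar> powr s) \<le> \<dots>" by (simp add: abs_minus_commute)
 have "norm (\<phi> (x + t *\<^sub>R e) + (\<phi> x - \<phi> (x + t *\<^sub>R e))) powr s
   \<le> 2 powr (s - 1) * (norm (\<phi> (x + t *\<^sub>R e)) powr s + norm (\<phi> x - \<phi> (x + t *\<^sub>R e)) powr s)"
  by (rule powr_norm_add_le[OF s])
 then have "ennreal (\<bar>\<phi> x\<bar> powr s) \<le> ennreal (2 powr (s - 1) * (\<bar>\<phi> (x + t *\<^sub>R e)\<bar> powr s + \<bar>\<phi> x - \<phi> (x + t *\<^sub>R e)\<bar> powr s))"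
  by (intro ennreal_leI) simp
 also have "\<dots> = ennreal (2 powr (s - 1)) * (ennreal (\<bar>\<phi> (x + t *\<^sub>R e)\<bar> powr s) + ennreal (\<bar>\<phi> x - \<phi> (x + t *\<^sub>R e)\<bar> powr s))"
  by (simp add: ennreal_mult)
 also have "\<dots> \<le> ennreal (2 powr (s - 1)) * (ennreal (\<bar>\<phi> (x + t *\<^sub>R e)\<bar> powr s)
  + ennreal (h powr (s - 1)) * (\<integral>\<^sup>+r. ennreal (norm (grad \<phi> (x + r *\<^sub>R e)) powr s) * indicator {0<..<h} r \<partial>lborel))"
  using 1 by (intro mult_left_mono add_left_mono) auto
 finally show ?thesis .
qed

abbreviation sweep :: "'a::euclidean_space measure \<Rightarrow> 'a \<Rightarrow> real \<Rightarrow> ('a \<Rightarrow> ennreal) \<Rightarrow> ennreal" where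
 "sweep \<nu> e h F \<equiv> \<integral>\<^sup>+x. \<integral>\<^sup>+\<tau>. F (x + \<tau> *\<^sub>R e) * indicator {0<..<h} \<tau> \<partial>lborel \<partial>\<nu>"

text \<open>If sweeping \<open>\<nu>\<close> along the segments \<open>{x + \<tau> e | 0 < \<tau> < h}\<close> gives at most \<open>C\<close> times
 Lebesgue measure on \<open>\<Omega>\<close>, then \<open>\<nu>\<close> satisfies a trace inequality with the right scaling in \<open>h\<close>.\<close>

definition sweeps_into :: "'a::euclidean_space measure \<Rightarrow> 'a \<Rightarrow> real \<Rightarrow> real \<Rightarrow> 'a set \<Rightarrow> bool" where
 "sweeps_into \<nu> e h C \<Omega> \<longleftrightarrow> (\<forall>F \<in> borel_measurable borel.
   sweep \<nu> e h F
    \<le> ennreal C * (\<integral>\<^sup>+x. F x * indicator \<Omega> x \<partial>lborel))"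

text \<open>The estimate along a segment is integrated over its end parameter \<open>t\<close> and
  against \<nu>; the sweeping hypothesis converts both double integrals to integrals over \<Omega>.
  Division by the factor \<open>h\<close> on the left leaves \<open>h powr (s - 1)\<close> in front
  of the gradient.\<close>

lemma sweep_trace_estimate:
 fixes \<phi> :: "'a::euclidean_space \<Rightarrow> real"
 assumes \<nu>: "sets \<nu> = sets borel" and sweep: "sweeps_into \<nu> e h C \<Omega>"
  and \<phi>: "smooth \<phi>" and e: "norm e = 1" and h: "0 < h" and s: "1 \<le> s"
 shows "ennreal h * (\<integral>\<^sup>+x. ennreal (\<bar>\<phi> x\<bar> powr s) \<partial>\<nu>) \<le> ennreal (2 powr (s - 1) * C) *
  ((\<integral>\<^sup>+x. ennreal (\<bar>\<phi> x\<bar> powr s) * indicator \<Omega> x \<partial>lborel)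
   + ennreal (h powr s) * (\<integral>\<^sup>+x. ennreal (norm (grad \<phi> x) powr s) * indicator \<Omega> x \<partial>lborel))"
proof -
 have [measurable]: "\<phi> \<in> borel_measurable borel" "grad \<phi> \<in> borel_measurable borel"
  using smooth_borel[OF \<phi>] borel_measurable_grad[OF \<phi>] .
 note [measurable_cong] = \<nu>
 let ?A = "\<lambda>x. \<integral>\<^sup>+t. ennreal (\<bar>\<phi> (x + t *\<^sub>R e)\<bar> powr s) * indicator {0<..<h} t \<partial>lborel"
 let ?J = "\<lambda>x. \<integral>\<^sup>+r. ennreal (norm (grad \<phi> (x + r *\<^sub>R e)) powr s) * indicator {0<..<h} r \<partial>lborel"
 have pt: "ennreal h * ennreal (\<bar>\<phi> x\<bar> powr s) \<le> ennreal (2 powr (s - 1)) * (?A x + ennreal (h powr s) * ?J x)" for x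
 proof -
  have "ennreal h * ennreal (\<bar>\<phi> x\<bar> powr s) = (\<integral>\<^sup>+t. ennreal (\<bar>\<phi> x\<bar> powr s) * indicator {0<..<h} t \<partial>lborel)"
   using h by (subst nn_integral_cmult_indicator) (auto simp: mult.commute)
  also have "\<dots> \<le> (\<integral>\<^sup>+t. ennreal (2 powr (s - 1)) * (ennreal (\<bar>\<phi> (x + t *\<^sub>R e)\<bar> powr s) * indicator {0<..<h} t
    + (ennreal (h powr (s - 1)) * ?J x) * indicator {0<..<h} t) \<partial>lborel)"
  proof (rule nn_integral_mono)
   fix t :: real
   show "ennreal (\<bar>\<phi> x\<bar> powr s) * indicator {0<..<h} t \<le> ennreal (2 powr (s - 1)) * (ennreal (\<bar>\<phi> (x + t *\<^sub>R e)\<bar> powr s) * indicator {0<..<h} t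
    + (ennreal (h powr (s - 1)) * ?J x) * indicator {0<..<h} t)"
    using smooth_line_estimate[OF \<phi> e h _ _ s, of t x] by (cases "t \<in> {0<..<h}") auto
  qed
  also have "\<dots> = ennreal (2 powr (s - 1)) * (?A x + (ennreal (h powr (s - 1)) * ?J x) * ennreal h)"
   using h by (subst nn_integral_cmult; (subst nn_integral_add)?; (subst nn_integral_cmult_indicator)?; simp)
  also have "(ennreal (h powr (s - 1)) * ?J x) * ennreal h = (ennreal (h powr (s - 1)) * ennreal h) * ?J x"
   by (simp add: mult_ac)
  also have "ennreal (h powr (s - 1)) * ennreal h = ennreal (h powr s)"
   using h by (simp add: powr_diff flip: ennreal_mult)
  finally show ?thesis .
 qed
 have "ennreal h * (\<integral>\<^sup>+x. ennreal (\<bar>\<phi> x\<bar> powr s) \<partial>\<nu>) = (\<integral>\<^sup>+x. ennreal h * ennreal (\<bar>\<phi> x\<bar> powr s) \<partial>\<nu>)"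
  by (rule nn_integral_cmult[symmetric]) measurable
 also have "\<dots> \<le> (\<integral>\<^sup>+x. ennreal (2 powr (s - 1)) * (?A x + ennreal (h powr s) * ?J x) \<partial>\<nu>)"
  by (intro nn_integral_mono pt)
 also have "\<dots> = ennreal (2 powr (s - 1)) * ((\<integral>\<^sup>+x. ?A x \<partial>\<nu>) + ennreal (h powr s) * (\<integral>\<^sup>+x. ?J x \<partial>\<nu>))"
  by (subst nn_integral_cmult, measurable, subst nn_integral_add, measurable, subst nn_integral_cmult, measurable)
 also have "\<dots> \<le> ennreal (2 powr (s - 1)) * (ennreal C * (\<integral>\<^sup>+x. ennreal (\<bar>\<phi> x\<bar> powr s) * indicator \<Omega> x \<partial>lborel)
   + ennreal (h powr s) * (ennreal C * (\<integral>\<^sup>+x. ennreal (norm (grad \<phi> x) powr s) * indicator \<Omega> x \<partial>lborel)))"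
  using sweep unfolding sweeps_into_def
  by (intro mult_left_mono add_mono) (auto intro!: mult_left_mono)
 also have "\<dots> = ennreal (2 powr (s - 1) * C) *
  ((\<integral>\<^sup>+x. ennreal (\<bar>\<phi> x\<bar> powr s) * indicator \<Omega> x \<partial>lborel)
   + ennreal (h powr s) * (\<integral>\<^sup>+x. ennreal (norm (grad \<phi> x) powr s) * indicator \<Omega> x \<partial>lborel))"
  by (subst ennreal_mult') (simp_all add: distrib_left mult_ac)
 finally show ?thesis .
qed

text \<open>Because \<gamma> is constant along \<open>e\<close>, the parameters \<open>t\<close> for
  which a fixed point \<open>y\<close> is reached from the strip lie in an interval of length
  \<delta>. Fubini turns this length into the constant.\<close>

lemma strip_sweeps_into:
 assumes c: "boundary_chart \<Omega> x0 r e \<gamma>" and \<Omega> [measurable]: "\<Omega> \<in> sets borel" and \<delta>: "0 < \<delta>"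
  and S: "S = {x \<in> ball x0 (r/2). \<gamma> x < x \<bullet> e \<and> x \<bullet> e < \<gamma> x + \<delta>}" and h: "0 < h" "h \<le> r / 2"
 shows "sweeps_into (density lborel (indicator S)) e h \<delta> \<Omega>"
 unfolding sweeps_into_def
proof
 note c = boundary_chartD[OF c]
 have [measurable]: "\<gamma> \<in> borel_measurable borel" by (rule smooth_borel[OF c(4)])
 have Sm [measurable]: "S \<in> sets borel" unfolding S by measurable
 fix F :: "'a \<Rightarrow> ennreal" assume [measurable]: "F \<in> borel_measurable borel"
 have "sweep (density lborel (indicator S)) e h F
   = (\<integral>\<^sup>+x. indicator S x * (\<integral>\<^sup>+t. F (x + t *\<^sub>R e) * indicator {0<..<h} t \<partial>lborel) \<partial>lborel)"
  by (rule nn_integral_density) measurable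
 also have "\<dots> = (\<integral>\<^sup>+x. \<integral>\<^sup>+t. indicator S x * (F (x + t *\<^sub>R e) * indicator {0<..<h} t) \<partial>lborel \<partial>lborel)"
  by (intro nn_integral_cong nn_integral_cmult[symmetric]) measurable
 also have "\<dots> = (\<integral>\<^sup>+t. \<integral>\<^sup>+x. indicator S x * (F (x + t *\<^sub>R e) * indicator {0<..<h} t) \<partial>lborel \<partial>lborel)"
  by (rule lborel_pair.Fubini'[symmetric]) measurable
 also have "\<dots> = (\<integral>\<^sup>+t. \<integral>\<^sup>+y. indicator S (y + - t *\<^sub>R e) * (F y * indicator {0<..<h} t) \<partial>lborel \<partial>lborel)"
 proof (rule nn_integral_cong)
  fix t :: real
  show "(\<integral>\<^sup>+x. indicator S x * (F (x + t *\<^sub>R e) * indicator {0<..<h} t) \<partial>lborel)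
    = (\<integral>\<^sup>+y. indicator S (y + - t *\<^sub>R e) * (F y * indicator {0<..<h} t) \<partial>lborel)"
   using nn_integral_lborel_translate[of "\<lambda>y. indicator S (y + - t *\<^sub>R e) * (F y * indicator {0<..<h} t)" "t *\<^sub>R e"] by simp
 qed
 also have "\<dots> = (\<integral>\<^sup>+y. \<integral>\<^sup>+t. indicator S (y + - t *\<^sub>R e) * (F y * indicator {0<..<h} t) \<partial>lborel \<partial>lborel)"
  by (rule lborel_pair.Fubini') measurable
 also have "\<dots> \<le> (\<integral>\<^sup>+y. \<integral>\<^sup>+t. (F y * indicator \<Omega> y) * indicator {y \<bullet> e - \<gamma> y - \<delta> .. y \<bullet> e - \<gamma> y} t \<partial>lborel \<partial>lborel)"
 proof (intro nn_integral_mono)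
  fix y and t :: real
  show "indicator S (y + - t *\<^sub>R e) * (F y * indicator {0<..<h} t) \<le> (F y * indicator \<Omega> y) * indicator {y \<bullet> e - \<gamma> y - \<delta> .. y \<bullet> e - \<gamma> y} t"
  proof (cases "y + - t *\<^sub>R e \<in> S \<and> t \<in> {0<..<h}")
   case True
   then have a: "dist x0 (y + - t *\<^sub>R e) < r/2" "\<gamma> (y + - t *\<^sub>R e) < (y + - t *\<^sub>R e) \<bullet> e"
     "(y + - t *\<^sub>R e) \<bullet> e < \<gamma> (y + - t *\<^sub>R e) + \<delta>" "0 < t" "t < h"
    by (auto simp: S)
   have g: "\<gamma> (y + - t *\<^sub>R e) = \<gamma> y" by (rule c(5))
   have in1: "\<gamma> y < y \<bullet> e - t" "y \<bullet> e - t < \<gamma> y + \<delta>" using a g c(3) by (auto simp: inner_diff_left)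
   have "dist x0 y \<le> dist x0 (y + - t *\<^sub>R e) + dist (y + - t *\<^sub>R e) y" by (rule dist_triangle)
   also have "dist (y + - t *\<^sub>R e) y = t" using a c(2) by (simp add: dist_norm)
   finally have "y \<in> ball x0 r" using a h by simp
   then have "y \<in> \<Omega>" using c(6)[of y] in1 a by simp
   then show ?thesis using in1 by (simp add: indicator_def)
  qed (auto simp: indicator_def)
 qed
 also have "\<dots> = (\<integral>\<^sup>+y. ennreal \<delta> * (F y * indicator \<Omega> y) \<partial>lborel)"
  using \<delta> by (intro nn_integral_cong) (simp add: nn_integral_cmult_indicator mult.commute)
 also have "\<dots> = ennreal \<delta> * (\<integral>\<^sup>+y. F y * indicator \<Omega> y \<partial>lborel)"
  by (rule nn_integral_cmult) measurable
 finally show "sweep (density lborel (indicator S)) e h F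
   \<le> ennreal \<delta> * (\<integral>\<^sup>+y. F y * indicator \<Omega> y \<partial>lborel)" .
qed

section \<open>Hausdorff measure of the boundary\<close>

lemma sets_hausdorff [measurable_cong, simp]: "sets (hausdorff_measure k) = sets borel"
 unfolding hausdorff_measure_def using sets.sigma_sets_eq[of borel] by (simp add: sets_measure_of_conv)

lemma space_hausdorff [simp]: "space (hausdorff_measure k) = UNIV"
 unfolding hausdorff_measure_def by (simp add: space_measure_of_conv)

text \<open>\<open>measure_of\<close> assigns the outer measure, or \<open>0\<close> where this
  fails to define a measure or the set is not Borel; the bound from above holds in every
  case.\<close>

lemma emeasure_hausdorff_le: "emeasure (hausdorff_measure k) A \<le> hausdorff_outer k A"
 unfolding hausdorff_measure_def by (simp add: emeasure_measure_of_conv)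

text \<open>A finite cover is padded with empty sets, which cost nothing in
  \<open>hausdorff_pre\<close>, and every diameter is replaced by the common bound
  \<open>d\<close>.\<close>

lemma hausdorff_pre_le_finite_cover:
 fixes A :: "'a::euclidean_space set"
 assumes J: "finite J" and cover: "A \<subseteq> (\<Union>j\<in>J. E j)"
  and E: "\<And>j. j \<in> J \<Longrightarrow> bounded (E j)" "\<And>j. j \<in> J \<Longrightarrow> diameter (E j) \<le> d" and d: "0 \<le> d" "d \<le> \<delta>"
 shows "hausdorff_pre k \<delta> A \<le> ennreal (real (card J) * (unit_ball_vol (real k) * (d / 2) ^ k))"
proof -
 obtain f where f: "bij_betw f {..<card J} J"
  using ex_bij_betw_nat_finite[OF J] by (auto simp: atLeast0LessThan)
 define E' where "E' n = (if n < card J then E (f n) else {})" for n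
 let ?t = "\<lambda>n. ennreal (if E' n = {} then 0 else unit_ball_vol (real k) * (diameter (E' n) / 2) ^ k)"
 have fJ: "f n \<in> J" if "n < card J" for n using f that by (auto simp: bij_betw_def)
 have cov: "A \<subseteq> (\<Union>n. E' n)"
 proof
  fix x assume "x \<in> A"
  then obtain j where "j \<in> J" "x \<in> E j" using cover by auto
  moreover from this obtain n where "n < card J" "f n = j"
   using f unfolding bij_betw_def by (metis imageE lessThan_iff)
  ultimately show "x \<in> (\<Union>n. E' n)" by (auto simp: E'_def intro!: exI[of _ n])
 qed
 have E': "bounded (E' n) \<and> diameter (E' n) \<le> \<delta>" for n
  using E fJ d by (force simp: E'_def intro: order_trans)
 have "hausdorff_pre k \<delta> A \<le> (\<Sum>n. ?t n)"
  unfolding hausdorff_pre_def using cov E' by (intro INF_lower) auto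
 also have "\<dots> = (\<Sum>n<card J. ?t n)"
  by (rule suminf_finite) (auto simp: E'_def)
 also have "\<dots> \<le> (\<Sum>n<card J. ennreal (unit_ball_vol (real k) * (d / 2) ^ k))"
 proof (rule sum_mono)
  fix n assume n: "n \<in> {..<card J}"
  have "0 \<le> diameter (E' n)" "diameter (E' n) \<le> d"
   using E fJ n by (auto simp: E'_def intro: diameter_ge_0)
  then have "unit_ball_vol (real k) * (diameter (E' n) / 2) ^ k \<le> unit_ball_vol (real k) * (d / 2) ^ k"
   by (intro mult_left_mono power_mono) auto
  moreover have "0 \<le> unit_ball_vol (real k) * (d / 2) ^ k" using d by simp
  ultimately show "?t n \<le> ennreal (unit_ball_vol (real k) * (d / 2) ^ k)"
   by (intro ennreal_leI) auto
 qed
 also have "\<dots> = ennreal (real (card J) * (unit_ball_vol (real k) * (d / 2) ^ k))"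
  using d by (simp add: ennreal_mult ennreal_of_nat_eq_real_of_nat)
 finally show ?thesis .
qed

text \<open>Above the graph lies \<Omega>, which is open and contains no frontier point; below the
  graph is an open set that misses \<Omega>.\<close>

lemma boundary_chart_frontier:
 assumes c: "boundary_chart \<Omega> x0 r e \<gamma>" and \<Omega>: "open \<Omega>" and x: "x \<in> frontier \<Omega>" "x \<in> ball x0 r"
 shows "\<gamma> x = x \<bullet> e"
proof (rule antisym)
 note c = boundary_chartD[OF c]
 have "isCont \<gamma> x" "isCont (\<lambda>y. y \<bullet> e) x"
  using smooth_continuous[OF c(4), of UNIV] by (auto simp: continuous_on_eq_continuous_at)
 have "x \<notin> \<Omega>" using x(1) \<Omega> by (simp add: frontier_def interior_open)
 then show "x \<bullet> e \<le> \<gamma> x" using c(6)[OF x(2)] by simp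
 show "\<gamma> x \<le> x \<bullet> e"
 proof (rule ccontr)
  assume "\<not> ?thesis"
  then have pos: "x \<bullet> e < \<gamma> x" by simp
  have "open ({y. y \<bullet> e < \<gamma> y} \<inter> ball x0 r)"
   by (intro open_Int open_Collect_less continuous_intros smooth_continuous c(4)) auto
  moreover have "x \<in> {y. y \<bullet> e < \<gamma> y} \<inter> ball x0 r" using pos x by simp
  moreover have "x \<in> closure \<Omega>" using x by (simp add: frontier_def)
  ultimately obtain y where "y \<in> {y. y \<bullet> e < \<gamma> y} \<inter> ball x0 r" "y \<in> \<Omega>"
   by (meson closure_iff_nhds_not_empty disjoint_iff open_contains_ball subset_eq) 
  then show False using c(6)[of y] by auto
 qed
qed

text \<open>A cylinder along \<open>e\<close> over a cube of side \<epsilon>; within a chart the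
  boundary is a graph over such bases.\<close>

definition tall_cube :: "'a::euclidean_space \<Rightarrow> 'a \<Rightarrow> real \<Rightarrow> 'a set" where
 "tall_cube e c \<epsilon> = {x. \<forall>i\<in>Basis. i \<bullet> e = 0 \<longrightarrow> c \<bullet> i \<le> x \<bullet> i \<and> x \<bullet> i \<le> c \<bullet> i + \<epsilon>}"

lemma signed_basis_orthogonal:
 assumes "e \<in> Basis \<union> uminus ` Basis"
 obtains i0 where "i0 \<in> Basis" "e = i0 \<or> e = - i0" "{i \<in> Basis. i \<bullet> e = 0} = Basis - {i0}"
proof -
 obtain i0 where i0: "i0 \<in> Basis" "e = i0 \<or> e = - i0" using assms by auto
 then have "{i \<in> Basis. i \<bullet> e = 0} = Basis - {i0}" by (auto simp: inner_Basis split: if_splits)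
 with i0 show thesis using that by blast
qed

text \<open>The base is divided into \<open>m\<close> parts per side. Over a cube of side
  \<open>\<kappa> = \<epsilon> / m\<close> the graph has diameter at most
  \<open>D * \<kappa>\<close>, and the resulting covering sum is
  \<open>K * \<epsilon> ^ (DIM('a) - 1)\<close> for every \<open>m\<close>, so the mesh bound
  \<delta> can be as small as desired.\<close>

lemma hausdorff_graph_tall_cube:
 fixes \<Omega> :: "'a::euclidean_space set"
 assumes ch: "boundary_chart \<Omega> x0 r e \<gamma>" and \<Omega>: "open \<Omega>"
 obtains K where "0 \<le> K" "\<And>c \<epsilon>. 0 < \<epsilon> \<Longrightarrow>
  hausdorff_outer (DIM('a) - 1) (frontier \<Omega> \<inter> ball x0 r \<inter> tall_cube e c \<epsilon>) \<le> ennreal (K * \<epsilon> ^ (DIM('a) - 1))"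
proof -
 note c = boundary_chartD[OF ch]
 obtain i0 where i0: "i0 \<in> Basis" "e = i0 \<or> e = - i0" "{i \<in> Basis. i \<bullet> e = 0} = Basis - {i0}"
  using signed_basis_orthogonal ch unfolding boundary_chart_def by metis
 \<comment> \<open>The radius \<open>3 * r\<close> accommodates points of the ball moved along
   \<open>e\<close> by at most \<open>2 * r\<close>.\<close>
 obtain L where L: "0 \<le> L" "\<And>y z. y \<in> cball x0 (3 * r) \<Longrightarrow> z \<in> cball x0 (3 * r) \<Longrightarrow> \<bar>\<gamma> y - \<gamma> z\<bar> \<le> L * norm (y - z)"
  using smooth_lipschitz[OF c(4), of x0 "3 * r"] by blast
 let ?k = "DIM('a) - 1" and ?N = "real DIM('a)"
 define D where "D = ?N * (L + 1)"
 have D: "0 < D" using L(1) by (simp add: D_def)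
 define K where "K = unit_ball_vol (real ?k) * (D / 2) ^ ?k"
 have main: "hausdorff_pre ?k \<delta> (frontier \<Omega> \<inter> ball x0 r \<inter> tall_cube e c \<epsilon>) \<le> ennreal (K * \<epsilon> ^ ?k)"
  if \<epsilon>: "0 < \<epsilon>" and \<delta>: "0 < \<delta>" for c \<epsilon> \<delta>
 proof -
  obtain m :: nat where m: "D * \<epsilon> / \<delta> < real m" using reals_Archimedean2 by blast
  then have m0: "0 < real m" using D \<epsilon> \<delta> by (smt (verit) divide_pos_pos mult_pos_pos)
  define \<kappa> where "\<kappa> = \<epsilon> / real m"
  have \<kappa>: "0 < \<kappa>" "D * \<kappa> \<le> \<delta>" using m m0 \<epsilon> \<delta> by (auto simp: \<kappa>_def field_simps)
  define J where "J = PiE (Basis - {i0}) (\<lambda>_. {..<m})"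
  define E where "E j = {x \<in> frontier \<Omega> \<inter> ball x0 r. \<forall>i\<in>Basis - {i0}.
    c \<bullet> i + real (j i) * \<kappa> \<le> x \<bullet> i \<and> x \<bullet> i \<le> c \<bullet> i + (real (j i) + 1) * \<kappa>}" for j :: "'a \<Rightarrow> nat"
  have J: "finite J" "card J = m ^ ?k"
   using i0(1) by (auto simp: J_def card_PiE intro!: finite_PiE)
  have cover: "frontier \<Omega> \<inter> ball x0 r \<inter> tall_cube e c \<epsilon> \<subseteq> (\<Union>j\<in>J. E j)"
  proof
   fix x assume x: "x \<in> frontier \<Omega> \<inter> ball x0 r \<inter> tall_cube e c \<epsilon>"
   have "\<forall>i\<in>Basis - {i0}. \<exists>n<m. c \<bullet> i + real n * \<kappa> \<le> x \<bullet> i \<and> x \<bullet> i \<le> c \<bullet> i + (real n + 1) * \<kappa>"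
   proof
    fix i assume i: "i \<in> Basis - {i0}"
    define t where "t = (x \<bullet> i - c \<bullet> i) / \<kappa>"
    have "i \<in> {i \<in> Basis. i \<bullet> e = 0}" using i i0(3) by simp
    then have "c \<bullet> i \<le> x \<bullet> i" "x \<bullet> i \<le> c \<bullet> i + \<epsilon>" using x by (auto simp: tall_cube_def)
    moreover have "real m * \<kappa> = \<epsilon>" using m0 by (simp add: \<kappa>_def)
    ultimately have t: "0 \<le> t" "t \<le> real m"
     using \<kappa>(1) by (auto simp: t_def pos_divide_le_eq)
    have xt: "x \<bullet> i = c \<bullet> i + t * \<kappa>" using \<kappa> by (simp add: t_def)
    \<comment> \<open>The right end \<open>t = m\<close> is assigned to the last cell; elsewhere the
      floor gives the cell.\<close>
    define n where "n = (if t = real m then m - 1 else nat \<lfloor>t\<rfloor>)"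
    have "n < m \<and> real n \<le> t \<and> t \<le> real n + 1"
    proof (cases "t = real m")
     case True
     then show ?thesis using m0 by (auto simp: n_def of_nat_diff)
    next
     case False
     then have "\<lfloor>t\<rfloor> < int m" using t by (simp add: floor_less_iff)
     then show ?thesis using False t by (auto simp: n_def nat_less_iff)
    qed
    then show "\<exists>n<m. c \<bullet> i + real n * \<kappa> \<le> x \<bullet> i \<and> x \<bullet> i \<le> c \<bullet> i + (real n + 1) * \<kappa>"
     using \<kappa> by (intro exI[of _ n]) (auto simp: xt intro!: mult_right_mono)
   qed
   then obtain j where j: "\<forall>i\<in>Basis - {i0}. j i < m \<and> c \<bullet> i + real (j i) * \<kappa> \<le> x \<bullet> i \<and> x \<bullet> i \<le> c \<bullet> i + (real (j i) + 1) * \<kappa>"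
    by metis
   let ?j = "restrict j (Basis - {i0})"
   have "?j \<in> J" using j by (auto simp: J_def)
   moreover have "x \<in> E ?j" using j x by (auto simp: E_def)
   ultimately show "x \<in> (\<Union>j\<in>J. E j)" by blast
  qed
  have bd: "bounded (E j)" for j
   by (rule bounded_subset[OF bounded_ball[of x0 r]]) (auto simp: E_def)
  have diam: "diameter (E j) \<le> D * \<kappa>" for j
  proof (rule diameter_le)
   show "E j \<noteq> {} \<or> 0 \<le> D * \<kappa>" using D \<kappa> by simp
   fix x y assume x: "x \<in> E j" and y: "y \<in> E j"
   \<comment> \<open>\<open>x\<close> moved along \<open>e\<close> to the height of
     \<open>y\<close>: it has the same value of \<gamma> as \<open>x\<close>, and it differs from
     \<open>y\<close> only in the coordinates of the base, by at most \<kappa> in each.\<close>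
   define x' where "x' = x + (y \<bullet> e - x \<bullet> e) *\<^sub>R e"
   have x'y: "\<bar>(x' - y) \<bullet> i\<bar> \<le> \<kappa>" if i: "i \<in> Basis" for i
   proof (cases "i = i0")
    case True
    have "(x' - y) \<bullet> e = 0" using c(3) by (simp add: x'_def inner_diff_left inner_add_left)
    then have "(x' - y) \<bullet> i = 0" using True i0(2) by auto
    then show ?thesis using \<kappa> by simp
   next
    case False
    then have ie: "e \<bullet> i = 0" using i i0(3) by (metis (mono_tags, lifting) Diff_iff empty_iff inner_commute insert_iff mem_Collect_eq)
    have "c \<bullet> i + real (j i) * \<kappa> \<le> x \<bullet> i" "x \<bullet> i \<le> c \<bullet> i + (real (j i) + 1) * \<kappa>"
     "c \<bullet> i + real (j i) * \<kappa> \<le> y \<bullet> i" "y \<bullet> i \<le> c \<bullet> i + (real (j i) + 1) * \<kappa>"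
     using x y i False by (auto simp: E_def)
    then show ?thesis
     by (simp add: x'_def inner_diff_left inner_add_left ie distrib_right abs_le_iff)
   qed
   have nx'y: "norm (x' - y) \<le> ?N * \<kappa>"
   proof -
    have "norm (x' - y) \<le> (\<Sum>i\<in>Basis. \<bar>(x' - y) \<bullet> i\<bar>)" by (rule norm_le_l1)
    also have "\<dots> \<le> (\<Sum>i\<in>(Basis::'a set). \<kappa>)" by (intro sum_mono x'y)
    finally show ?thesis by simp
   qed
   have bx: "dist x0 x < r" "dist x0 y < r" using x y by (auto simp: E_def)
   have x'in: "x' \<in> cball x0 (3 * r)"
   proof -
    have "\<bar>(y - x) \<bullet> e\<bar> \<le> norm (y - x)" using Cauchy_Schwarz_ineq2[of "y - x" e] c(2) by simp
    also have "\<dots> \<le> dist x0 x + dist x0 y"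
     using dist_triangle[of x y x0] by (simp add: dist_norm norm_minus_commute)
    finally have "dist x x' \<le> 2 * r"
     using bx c(2) by (simp add: x'_def dist_norm inner_diff_left)
    then show ?thesis using dist_triangle[of x0 x' x] bx by simp
   qed
   have yin: "y \<in> cball x0 (3 * r)" using bx c(1) by simp
   have gx: "\<gamma> x = x \<bullet> e" "\<gamma> y = y \<bullet> e"
    using boundary_chart_frontier[OF ch \<Omega>] x y by (auto simp: E_def)
   have "\<gamma> x' = \<gamma> x" unfolding x'_def by (rule c(5))
   then have xe: "\<bar>x \<bullet> e - y \<bullet> e\<bar> \<le> L * (?N * \<kappa>)"
    using L(2)[OF x'in yin] mult_left_mono[OF nx'y L(1)] gx by simp
   have "norm (x - y) \<le> norm (x - x') + norm (x' - y)"
    using norm_triangle_ineq[of "x - x'" "x' - y"] by simp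
   also have "norm (x - x') = \<bar>x \<bullet> e - y \<bullet> e\<bar>" using c(2) by (simp add: x'_def abs_minus_commute)
   finally show "norm (x - y) \<le> D * \<kappa>"
    using xe nx'y by (simp add: D_def algebra_simps)
  qed
  have "hausdorff_pre ?k \<delta> (frontier \<Omega> \<inter> ball x0 r \<inter> tall_cube e c \<epsilon>)
    \<le> ennreal (real (card J) * (unit_ball_vol (real ?k) * (D * \<kappa> / 2) ^ ?k))"
   using D \<kappa> by (intro hausdorff_pre_le_finite_cover[OF J(1) cover bd diam]) auto
  also have "real (card J) * (unit_ball_vol (real ?k) * (D * \<kappa> / 2) ^ ?k) = K * (real m * \<kappa>) ^ ?k"
   by (simp add: J K_def power_mult_distrib power_divide)
  also have "real m * \<kappa> = \<epsilon>" using m0 by (simp add: \<kappa>_def)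
  finally show ?thesis .
 qed
 show thesis
 proof
  show "0 \<le> K" using D by (simp add: K_def)
  fix c :: 'a and \<epsilon> :: real assume "0 < \<epsilon>"
  then show "hausdorff_outer ?k (frontier \<Omega> \<inter> ball x0 r \<inter> tall_cube e c \<epsilon>) \<le> ennreal (K * \<epsilon> ^ ?k)"
   unfolding hausdorff_outer_def by (intro SUP_least main) auto
 qed
qed

text \<open>An open set, cut off by a large cube, is covered by countably many dyadic cubes with
  disjoint interiors inside it, so the bound on cubes adds up; outer regularity extends it to Borel
  sets. Faces may carry mass of \<mu>, so \<mu> is summed over the closed cubes by subadditivity and
  Lebesgue measure over the interiors.\<close>

lemma measure_le_of_cubes:
 fixes \<mu> :: "'a::euclidean_space measure"
 assumes \<mu> [measurable_cong]: "sets \<mu> = sets borel" and C: "0 \<le> C"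
  and cubes: "\<And>c \<epsilon>. 0 < \<epsilon> \<Longrightarrow> emeasure \<mu> (cbox c (c + \<epsilon> *\<^sub>R One)) \<le> ennreal (C * \<epsilon> ^ DIM('a))"
  and E: "E \<in> sets borel"
 shows "emeasure \<mu> E \<le> ennreal C * emeasure lborel E"
proof -
 have step1: "emeasure \<mu> (U \<inter> cbox (- real (Suc n) *\<^sub>R One) (real (Suc n) *\<^sub>R One)) \<le> ennreal C * emeasure lborel U"
  if U: "open U" for U n
 proof -
  define a b where "a = - real (Suc n) *\<^sub>R (One::'a)" and "b = real (Suc n) *\<^sub>R (One::'a)"
  have ab: "box a b \<noteq> {}" by (auto simp: box_ne_empty a_def b_def)
  \<comment> \<open>This gauge forces every cube of the covering to lie in \<open>U\<close>.\<close>
  define g where "g x = (if x \<in> U then U else UNIV)" for x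
  have g: "gauge g" using U by (auto simp: gauge_def g_def)
  obtain \<D> where D: "countable \<D>" "\<Union>\<D> \<subseteq> cbox a b"
    "\<And>K. K \<in> \<D> \<Longrightarrow> interior K \<noteq> {} \<and> (\<exists>c d. K = cbox c d)"
    "pairwise (\<lambda>A B. interior A \<inter> interior B = {}) \<D>"
    "\<And>K. K \<in> \<D> \<Longrightarrow> \<exists>x \<in> (U \<inter> cbox a b) \<inter> K. K \<subseteq> g x"
    "\<And>u v. cbox u v \<in> \<D> \<Longrightarrow> \<exists>n. \<forall>i \<in> Basis. v \<bullet> i - u \<bullet> i = (b \<bullet> i - a \<bullet> i) / 2^n"
    "U \<inter> cbox a b \<subseteq> \<Union>\<D>"
   using covering_lemma[OF Int_lower2 ab g] by metis
  define F where "F k = (if k \<in> to_nat_on \<D> ` \<D> then from_nat_into \<D> k else {})" for k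
  have F_in: "F k = {} \<or> F k \<in> \<D>" for k
   using D(1) by (auto simp: F_def)
  have UF: "(\<Union>k. F k) = \<Union>\<D>"
  proof
   show "(\<Union>k. F k) \<subseteq> \<Union>\<D>" using F_in by blast
   show "\<Union>\<D> \<subseteq> (\<Union>k. F k)"
   proof
    fix x assume "x \<in> \<Union>\<D>"
    then obtain K where "K \<in> \<D>" "x \<in> K" by blast
    then have "x \<in> F (to_nat_on \<D> K)" using D(1) by (auto simp: F_def)
    then show "x \<in> (\<Union>k. F k)" by blast
   qed
  qed
  have disj: "disjoint_family (\<lambda>k. interior (F k))"
  proof -
   have "interior (F k) \<inter> interior (F l) = {}" if "k \<noteq> l" for k l
   proof (cases "k \<in> to_nat_on \<D> ` \<D> \<and> l \<in> to_nat_on \<D> ` \<D>")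
    case True
    then obtain K L where "K \<in> \<D>" "L \<in> \<D>" "k = to_nat_on \<D> K" "l = to_nat_on \<D> L" by blast
    moreover from this have "K \<noteq> L" using that by auto
    ultimately show ?thesis using D(1,4) by (auto simp: F_def pairwise_def)
   qed (auto simp: F_def)
   then show ?thesis by (auto simp: disjoint_family_on_def)
  qed
  have cube: "F k \<in> sets borel \<and> emeasure \<mu> (F k) \<le> ennreal C * emeasure lborel (interior (F k))" for k
  proof (cases "F k = {}")
   case False
   then have K: "F k \<in> \<D>" using F_in by blast
   then obtain u v where uv: "F k = cbox u v" using D(3) by blast
   obtain j where j: "\<forall>i \<in> Basis. v \<bullet> i - u \<bullet> i = (b \<bullet> i - a \<bullet> i) / 2^j" using D(6) K uv by metis
   define \<epsilon> where "\<epsilon> = 2 * real (Suc n) / 2 ^ j"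
   have \<epsilon>: "0 < \<epsilon>" by (simp add: \<epsilon>_def)
   have v: "v = u + \<epsilon> *\<^sub>R One"
   proof (rule euclidean_eqI)
    fix i :: 'a assume i: "i \<in> Basis"
    then have "v \<bullet> i - u \<bullet> i = \<epsilon>" using j by (simp add: a_def b_def \<epsilon>_def)
    then show "v \<bullet> i = (u + \<epsilon> *\<^sub>R One) \<bullet> i" using i by (simp add: inner_add_left)
   qed
   have "emeasure lborel (interior (F k)) = ennreal (\<epsilon> ^ DIM('a))"
    using \<epsilon> unfolding uv v interior_cbox by (subst emeasure_lborel_box) (auto simp: inner_add_left)
   then show ?thesis
    using cubes[OF \<epsilon>, of u] C \<epsilon> by (simp add: uv v ennreal_mult)
  qed auto
  have "emeasure \<mu> (U \<inter> cbox a b) \<le> emeasure \<mu> (\<Union>k. F k)"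
  proof (rule emeasure_mono)
   show "U \<inter> cbox a b \<subseteq> (\<Union>k. F k)" using D(7) by (simp add: UF)
   show "(\<Union>k. F k) \<in> sets \<mu>" using cube by (auto simp: \<mu> intro!: sets.countable_UN)
  qed
  also have "\<dots> \<le> (\<Sum>k. emeasure \<mu> (F k))"
   using cube by (intro emeasure_subadditive_countably) (auto simp: \<mu>)
  also have "\<dots> \<le> (\<Sum>k. ennreal C * emeasure lborel (interior (F k)))"
   using cube by (intro suminf_le) auto
  also have "\<dots> = ennreal C * emeasure lborel (\<Union>k. interior (F k))"
   using disj by (subst ennreal_suminf_cmult, subst suminf_emeasure) auto
  also have "\<dots> \<le> ennreal C * emeasure lborel U"
  proof (intro mult_left_mono emeasure_mono)
   show "(\<Union>k. interior (F k)) \<subseteq> U"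
   proof
    fix x assume "x \<in> (\<Union>k. interior (F k))"
    then obtain k where k: "x \<in> interior (F k)" by blast
    then have "F k \<in> \<D>" using F_in by (metis empty_iff interior_empty)
    then obtain y where "y \<in> U" "F k \<subseteq> g y" using D(5) by blast
    then show "x \<in> U" using k interior_subset by (auto simp: g_def)
   qed
  qed (use U in auto)
  finally show ?thesis by (simp add: a_def b_def)
 qed
 have step2: "emeasure \<mu> U \<le> ennreal C * emeasure lborel U" if U: "open U" for U
 proof -
  let ?A = "\<lambda>n. U \<inter> cbox (- real (Suc n) *\<^sub>R One) (real (Suc n) *\<^sub>R (One::'a))"
  have UA: "(\<Union>n. ?A n) = U"
  proof -
   have "\<exists>n. x \<in> cbox (- real (Suc n) *\<^sub>R One) (real (Suc n) *\<^sub>R (One::'a))" for x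
   proof -
    obtain n where n: "norm x \<le> real n" using real_arch_simple by blast
    have "\<bar>x \<bullet> i\<bar> \<le> real n" if "i \<in> Basis" for i using Basis_le_norm[OF that, of x] n by linarith
    then show ?thesis by (intro exI[of _ n]) (force simp: mem_box abs_le_iff)
   qed
   then show ?thesis by blast
  qed
  have inc: "incseq ?A"
   by (fastforce simp: incseq_def mem_box)
  have "(SUP n. emeasure \<mu> (?A n)) = emeasure \<mu> (\<Union>n. ?A n)"
   by (rule SUP_emeasure_incseq[OF _ inc]) (use U in \<open>auto simp: \<mu>\<close>)
  then have "emeasure \<mu> U = (SUP n. emeasure \<mu> (?A n))" unfolding UA by (rule sym)
  also have "\<dots> \<le> ennreal C * emeasure lborel U" by (intro SUP_least step1 U)
  finally show ?thesis .
 qed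
 show ?thesis
 proof (rule ennreal_le_epsilon)
  fix e :: real assume e: "0 < e"
  define d where "d = e / (C + 1)"
  have d: "0 < d" using e C by (simp add: d_def)
  obtain U where U: "open U" "E \<subseteq> U" "emeasure lborel (U - E) < ennreal d" using outer_regular_lborel[OF E d] .
  have "emeasure \<mu> E \<le> emeasure \<mu> U" using U by (intro emeasure_mono) (auto simp: \<mu>)
  also have "\<dots> \<le> ennreal C * emeasure lborel U" by (rule step2[OF U(1)])
  also have "\<dots> \<le> ennreal C * (emeasure lborel E + emeasure lborel (U - E))"
   using emeasure_subadditive[of E lborel "U - E"] E U by (intro mult_left_mono) (auto simp: Un_absorb1)
  also have "\<dots> \<le> ennreal C * (emeasure lborel E + ennreal d)"
   using U(3) by (intro mult_left_mono add_left_mono) auto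
  also have "\<dots> = ennreal C * emeasure lborel E + ennreal (C * d)"
   using C d by (simp add: distrib_left ennreal_mult)
  also have "\<dots> \<le> ennreal C * emeasure lborel E + ennreal e"
   using C e by (intro add_left_mono ennreal_leI) (simp add: d_def field_simps)
  finally show "emeasure \<mu> E \<le> ennreal C * emeasure lborel E + ennreal e" .
 qed
qed

lemma closed_tall_cube: "closed (tall_cube e c \<epsilon>)"
proof -
 have "tall_cube e c \<epsilon> = (\<Inter>i\<in>{i\<in>Basis. i \<bullet> e = 0}. {x. c \<bullet> i \<le> x \<bullet> i} \<inter> {x. x \<bullet> i \<le> c \<bullet> i + \<epsilon>})"
  by (auto simp: tall_cube_def)
 also have "closed \<dots>"
  by (intro closed_INT ballI closed_Int closed_Collect_le continuous_intros)
 finally show ?thesis .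
qed

text \<open>If the swept point \<open>x + u e\<close> lies in a cube of side \<epsilon>, then
  \<open>x\<close> is in the tall cube over it and \<open>u\<close> in an interval of length
  \<epsilon>, so the swept measure of the cube is at most \<epsilon> times
  \<open>K * \<epsilon> ^ (DIM('a) - 1)\<close>. Comparison on cubes bounds it by Lebesgue measure,
  and for \<open>h \<le> r / 2\<close> the open segments run inside \<Omega>.\<close>

lemma frontier_sweeps_into:
 fixes \<Omega> :: "'a::euclidean_space set"
 assumes ch: "boundary_chart \<Omega> x0 r e \<gamma>" and \<Omega>: "open \<Omega>"
 defines "\<Gamma> \<equiv> frontier \<Omega> \<inter> ball x0 (r / 2)" and "H \<equiv> hausdorff_measure (DIM('a) - 1)"
 shows "emeasure H \<Gamma> < \<infinity>"
  and "\<exists>K\<ge>0. \<forall>h. 0 < h \<and> h \<le> r / 2 \<longrightarrow> sweeps_into (density H (indicator \<Gamma>)) e h K \<Omega>"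
proof -
 note c = boundary_chartD[OF ch]
 have \<Gamma>m [measurable]: "\<Gamma> \<in> sets borel" unfolding \<Gamma>_def by auto
 have \<Omega>m [measurable]: "\<Omega> \<in> sets borel" using \<Omega> by auto
 have Hs [measurable_cong, simp]: "sets H = sets borel" by (simp add: H_def)
 obtain K where K: "0 \<le> K" "\<And>c \<epsilon>. 0 < \<epsilon> \<Longrightarrow>
   hausdorff_outer (DIM('a) - 1) (frontier \<Omega> \<inter> ball x0 r \<inter> tall_cube e c \<epsilon>) \<le> ennreal (K * \<epsilon> ^ (DIM('a) - 1))"
  using hausdorff_graph_tall_cube[OF ch \<Omega>] by metis
 have HT: "emeasure H (\<Gamma> \<inter> tall_cube e c \<epsilon>) \<le> ennreal (K * \<epsilon> ^ (DIM('a) - 1))" if "0 < \<epsilon>" for c \<epsilon>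
 proof -
  have "emeasure H (\<Gamma> \<inter> tall_cube e c \<epsilon>) \<le> emeasure H (frontier \<Omega> \<inter> ball x0 r \<inter> tall_cube e c \<epsilon>)"
   using c(1) closed_tall_cube[of e c \<epsilon>]
   by (intro emeasure_mono) (auto simp: \<Gamma>_def intro!: sets.Int borel_closed)
  also have "\<dots> \<le> hausdorff_outer (DIM('a) - 1) (frontier \<Omega> \<inter> ball x0 r \<inter> tall_cube e c \<epsilon>)"
   unfolding H_def by (rule emeasure_hausdorff_le)
  also have "\<dots> \<le> ennreal (K * \<epsilon> ^ (DIM('a) - 1))" by (rule K(2)[OF that])
  finally show ?thesis .
 qed
 \<comment> \<open>One tall cube of side \<open>2 * r\<close> contains the whole piece, which makes
   its measure finite.\<close>
 have "\<Gamma> \<subseteq> tall_cube e (x0 - r *\<^sub>R One) (2 * r)"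
 proof
  fix x assume x: "x \<in> \<Gamma>"
  show "x \<in> tall_cube e (x0 - r *\<^sub>R One) (2 * r)"
   unfolding tall_cube_def
  proof (intro CollectI ballI impI)
   fix i :: 'a assume i: "i \<in> Basis"
   have "\<bar>(x - x0) \<bullet> i\<bar> \<le> r"
    using Basis_le_norm[OF i, of "x - x0"] x c(1) by (simp add: \<Gamma>_def dist_norm norm_minus_commute)
   then show "(x0 - r *\<^sub>R One) \<bullet> i \<le> x \<bullet> i \<and> x \<bullet> i \<le> (x0 - r *\<^sub>R One) \<bullet> i + 2 * r"
    using i by (simp add: inner_diff_left abs_le_iff)
  qed
 qed
 then have "emeasure H \<Gamma> \<le> ennreal (K * (2 * r) ^ (DIM('a) - 1))"
  using HT[of "2 * r" "x0 - r *\<^sub>R One"] c(1) by (simp add: Int_absorb2)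
 then show Hfin: "emeasure H \<Gamma> < \<infinity>" by (simp add: le_less_trans)
 obtain i0 where i0: "i0 \<in> Basis" "e = i0 \<or> e = - i0"
  using signed_basis_orthogonal ch unfolding boundary_chart_def by metis
 define \<nu> where "\<nu> = density H (indicator \<Gamma>)"
 have \<nu>s [measurable_cong, simp]: "sets \<nu> = sets borel" by (simp add: \<nu>_def)
 have \<nu>E: "emeasure \<nu> A = emeasure H (\<Gamma> \<inter> A)" if "A \<in> sets borel" for A
  unfolding \<nu>_def using that by (subst emeasure_density) (auto simp: nn_integral_indicator[symmetric] indicator_inter_arith[symmetric] simp del: nn_integral_indicator)
 have "space \<nu> = UNIV" by (simp add: \<nu>_def H_def)
 then interpret \<nu>: finite_measure \<nu>
  using Hfin by (intro finite_measureI) (simp add: \<nu>E)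
 show "\<exists>K\<ge>0. \<forall>h. 0 < h \<and> h \<le> r / 2 \<longrightarrow> sweeps_into (density H (indicator \<Gamma>)) e h K \<Omega>"
 proof (intro exI[of _ K] conjI allI impI K(1))
  fix h assume h: "0 < h \<and> h \<le> r / 2"
  define L where "L = density lborel (indicator {0<..<h} :: real \<Rightarrow> ennreal)"
  have [measurable_cong, simp]: "sets L = sets borel" by (simp add: L_def)
  have "emeasure L (space L) = ennreal h" using h by (simp add: L_def emeasure_density)
  then interpret L: finite_measure L by (intro finite_measureI) simp
  interpret pair_sigma_finite \<nu> L ..
  define \<mu> where "\<mu> = distr (\<nu> \<Otimes>\<^sub>M L) borel (\<lambda>(x, u). x + u *\<^sub>R e)"
  have \<mu>s: "sets \<mu> = sets borel" by (simp add: \<mu>_def)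
  have T: "(\<lambda>(x, u). x + u *\<^sub>R e) \<in> borel_measurable (\<nu> \<Otimes>\<^sub>M L)" by measurable
  have \<mu>I: "(\<integral>\<^sup>+x. F x \<partial>\<mu>) = sweep \<nu> e h F"
   if "F \<in> borel_measurable borel" for F
  proof -
   have [measurable]: "F \<in> borel_measurable borel" by fact
   have "(\<integral>\<^sup>+x. F x \<partial>\<mu>) = (\<integral>\<^sup>+p. F ((\<lambda>(x, u). x + u *\<^sub>R e) p) \<partial>(\<nu> \<Otimes>\<^sub>M L))"
    unfolding \<mu>_def by (rule nn_integral_distr[OF T]) simp
   also have "\<dots> = (\<integral>\<^sup>+x. \<integral>\<^sup>+u. F (x + u *\<^sub>R e) \<partial>L \<partial>\<nu>)"
    using L.nn_integral_fst[of "\<lambda>p. F ((\<lambda>(x, u). x + u *\<^sub>R e) p)"] measurable_compose[OF T that] by simp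
   also have "\<dots> = sweep \<nu> e h F"
    unfolding L_def by (intro nn_integral_cong, subst nn_integral_density) (auto simp: mult.commute)
   finally show ?thesis .
  qed
  have cube: "emeasure \<mu> (cbox c (c + \<epsilon> *\<^sub>R One)) \<le> ennreal (K * \<epsilon> ^ DIM('a))" if \<epsilon>: "0 < \<epsilon>" for c \<epsilon>
  proof -
   let ?Q = "cbox c (c + \<epsilon> *\<^sub>R One)"
   \<comment> \<open>The lower end of the interval of admissible \<open>u\<close>; it depends on
     whether \<open>e\<close> points along \<open>i0\<close> or against it.\<close>
   define t where "t x = (if e = i0 then c \<bullet> i0 - x \<bullet> i0 else x \<bullet> i0 - c \<bullet> i0 - \<epsilon>)" for x
   have "emeasure \<mu> ?Q = (\<integral>\<^sup>+x. indicator ?Q x \<partial>\<mu>)" by (simp add: \<mu>s)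
   also have "\<dots> = (\<integral>\<^sup>+x. \<integral>\<^sup>+u. indicator ?Q (x + u *\<^sub>R e) * indicator {0<..<h} u \<partial>lborel \<partial>\<nu>)"
    by (rule \<mu>I) auto
   also have "\<dots> \<le> (\<integral>\<^sup>+x. \<integral>\<^sup>+u. indicator (tall_cube e c \<epsilon>) x * indicator {t x .. t x + \<epsilon>} u \<partial>lborel \<partial>\<nu>)"
   proof (intro nn_integral_mono)
    fix x and u :: real
    show "indicator ?Q (x + u *\<^sub>R e) * indicator {0<..<h} u \<le> (indicator (tall_cube e c \<epsilon>) x * indicator {t x .. t x + \<epsilon>} u :: ennreal)"
    proof (cases "x + u *\<^sub>R e \<in> ?Q")
     case True
     then have Q: "c \<bullet> i \<le> x \<bullet> i + u * (e \<bullet> i)" "x \<bullet> i + u * (e \<bullet> i) \<le> c \<bullet> i + \<epsilon>" if "i \<in> Basis" for i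
      using that by (auto simp: mem_box inner_add_left)
     have "x \<in> tall_cube e c \<epsilon>"
      using Q by (force simp: tall_cube_def inner_commute)
     moreover have "u \<in> {t x .. t x + \<epsilon>}"
      using Q[OF i0(1)] i0 c(2) by (auto simp: t_def split: if_splits)
     ultimately show ?thesis by (simp add: indicator_def)
    qed simp
   qed
   also have "\<dots> = (\<integral>\<^sup>+x. ennreal \<epsilon> * indicator (tall_cube e c \<epsilon>) x \<partial>\<nu>)"
    using \<epsilon> by (intro nn_integral_cong) (simp add: nn_integral_cmult_indicator mult.commute)
   also have "\<dots> = ennreal \<epsilon> * emeasure \<nu> (tall_cube e c \<epsilon>)"
    using closed_tall_cube[of e c \<epsilon>] by (intro nn_integral_cmult_indicator) (auto intro: borel_closed)
   also have "\<dots> = ennreal \<epsilon> * emeasure H (\<Gamma> \<inter> tall_cube e c \<epsilon>)"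
    using closed_tall_cube[of e c \<epsilon>] by (subst \<nu>E) (auto intro: borel_closed)
   also have "\<dots> \<le> ennreal \<epsilon> * ennreal (K * \<epsilon> ^ (DIM('a) - 1))"
    by (intro mult_left_mono HT \<epsilon>) auto
   also have "\<dots> = ennreal (K * (\<epsilon> * \<epsilon> ^ (DIM('a) - 1)))"
    using \<epsilon> K(1) by (simp add: mult_ac flip: ennreal_mult)
   also have "\<epsilon> * \<epsilon> ^ (DIM('a) - 1) = \<epsilon> ^ DIM('a)"
    by (metis DIM_positive Suc_diff_1 power_Suc)
   finally show ?thesis .
  qed
  have le: "\<mu> \<le> scale_measure (ennreal K) lborel"
   using measure_le_of_cubes[OF \<mu>s K(1) cube]
   by (subst le_measure) (auto simp: \<mu>s)
  show "sweeps_into (density H (indicator \<Gamma>)) e h K \<Omega>"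
   unfolding sweeps_into_def \<nu>_def[symmetric]
  proof
   fix F :: "'a \<Rightarrow> ennreal" assume [measurable]: "F \<in> borel_measurable borel"
   \<comment> \<open>Segments starting on \<Gamma> stay in \<Omega>, so \<open>F\<close> may be cut
     off outside \<Omega> before the measures are compared.\<close>
   have "AE x in \<nu>. x \<in> \<Gamma>"
    unfolding \<nu>_def by (subst AE_density) (auto simp: indicator_def)
   then have "sweep \<nu> e h F
     = (\<integral>\<^sup>+x. \<integral>\<^sup>+u. (F (x + u *\<^sub>R e) * indicator \<Omega> (x + u *\<^sub>R e)) * indicator {0<..<h} u \<partial>lborel \<partial>\<nu>)"
   proof (intro nn_integral_cong_AE, eventually_elim)
    fix x assume x: "x \<in> \<Gamma>"
    show "(\<integral>\<^sup>+u. F (x + u *\<^sub>R e) * indicator {0<..<h} u \<partial>lborel)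
     = (\<integral>\<^sup>+u. (F (x + u *\<^sub>R e) * indicator \<Omega> (x + u *\<^sub>R e)) * indicator {0<..<h} u \<partial>lborel)"
    proof (rule nn_integral_cong)
     fix u :: real
     have "x + u *\<^sub>R e \<in> \<Omega>" if u: "u \<in> {0<..<h}"
     proof -
      have xb: "x \<in> ball x0 r" "dist x0 x < r / 2" "x \<in> frontier \<Omega>" using x c(1) by (auto simp: \<Gamma>_def)
      have "dist x0 (x + u *\<^sub>R e) \<le> dist x0 x + u"
       using dist_triangle[of x0 "x + u *\<^sub>R e" x] c(2) u by (simp add: dist_norm)
      then have "x + u *\<^sub>R e \<in> ball x0 r" using xb u h by simp
      moreover have "\<gamma> (x + u *\<^sub>R e) < (x + u *\<^sub>R e) \<bullet> e"
       using boundary_chart_frontier[OF ch \<Omega> xb(3,1)] c(3,5) u by (simp add: inner_add_left)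
      ultimately show ?thesis using c(6) by blast
     qed
     then show "F (x + u *\<^sub>R e) * indicator {0<..<h} u = (F (x + u *\<^sub>R e) * indicator \<Omega> (x + u *\<^sub>R e)) * indicator {0<..<h} u"
      by (cases "u \<in> {0<..<h}") auto
    qed
   qed
   also have "\<dots> = (\<integral>\<^sup>+x. F x * indicator \<Omega> x \<partial>\<mu>)"
    by (rule \<mu>I[symmetric]) measurable
   also have "\<dots> \<le> (\<integral>\<^sup>+x. F x * indicator \<Omega> x \<partial>scale_measure (ennreal K) lborel)"
    by (rule nn_integral_mono_measure[OF _ le]) (simp add: \<mu>s)
   also have "\<dots> = ennreal K * (\<integral>\<^sup>+x. F x * indicator \<Omega> x \<partial>lborel)"
    by (rule nn_integral_scale_measure) measurable
   finally show "sweep \<nu> e h F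
     \<le> ennreal K * (\<integral>\<^sup>+x. F x * indicator \<Omega> x \<partial>lborel)" .
  qed
 qed
qed

section \<open>Trace and boundary strip estimates\<close>

lemma (in bounded_open) integrable_continuous:
 fixes g :: "'a \<Rightarrow> 'b::euclidean_space"
 assumes g: "continuous_on UNIV g" and K: "K \<in> sets borel"
 shows "integrable L\<Omega> g" "integrable L\<Omega> (\<lambda>x. indicator K x *\<^sub>R g x)"
proof -
 have gm: "g \<in> borel_measurable borel" using g by (rule borel_measurable_continuous_onI)
 have m: "g \<in> borel_measurable L\<Omega>" by (rule borel_measurable_lebesgue_onI[OF gm])
 have m2: "indicator K \<in> borel_measurable L\<Omega>" by (rule borel_measurable_lebesgue_onI) (use K in measurable)
 show "integrable L\<Omega> g"
  using integrable_mult_bounded(1)[OF finite_L\<Omega> continuous_Lp[OF g, of 1], of "\<lambda>_. 1" 1] by simp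
 show "integrable L\<Omega> (\<lambda>x. indicator K x *\<^sub>R g x)"
  by (rule integrable_mult_bounded(1)[OF finite_L\<Omega> continuous_Lp[OF g, of 1] _ m2, of 1]) (auto simp: indicator_def)
qed

lemma (in bounded_open) nn_integral_eq_LINT:
 fixes g :: "'a \<Rightarrow> real"
 assumes g: "continuous_on UNIV g" "\<And>x. 0 \<le> g x" and K: "K \<in> sets borel" "K \<subseteq> \<Omega>"
 shows "(\<integral>\<^sup>+x. ennreal (g x) * indicator K x \<partial>lborel) = ennreal (LINT x|L\<Omega>. indicator K x * g x)"
proof -
 have [measurable]: "g \<in> borel_measurable borel" using g(1) by (rule borel_measurable_continuous_onI)
 have [measurable]: "K \<in> sets borel" by fact
 have b: "(\<lambda>x. indicator K x * g x) \<in> borel_measurable borel" by measurable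
 have i: "integrable L\<Omega> (\<lambda>x. indicator K x * g x)" using integrable_continuous(2)[OF g(1) K(1)] by simp
 have eq: "indicator \<Omega> x *\<^sub>R (indicator K x * g x) = indicator K x * g x" for x
  using K(2) by (auto simp: indicator_def)
 have "integrable lborel (\<lambda>x. indicator K x * g x)"
  using i unfolding LINT_lebesgue_on(2)[OF b \<Omega>_borel] eq .
 then have "(\<integral>\<^sup>+x. ennreal (indicator K x * g x) \<partial>lborel) = ennreal (LINT x|lborel. indicator K x * g x)"
  using g(2) by (intro nn_integral_eq_integral) auto
 moreover have "(LINT x|L\<Omega>. indicator K x * g x) = (LINT x|lborel. indicator K x * g x)"
  unfolding LINT_lebesgue_on(1)[OF b \<Omega>_borel] eq ..
 moreover have "ennreal (g x) * indicator K x = ennreal (indicator K x * g x)" for x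
  by (simp add: indicator_def)
 ultimately show ?thesis by simp
qed

lemma continuous_on_powr_norm:
 fixes f :: "'a::topological_space \<Rightarrow> 'b::real_normed_vector"
 assumes "continuous_on UNIV f" "0 < s" shows "continuous_on UNIV (\<lambda>x. norm (f x) powr s)"
 using assms by (intro continuous_on_powr' continuous_intros) auto

lemma smooth_powr_continuous:
 assumes "smooth f" "0 < s"
 shows "continuous_on UNIV (\<lambda>x. \<bar>f x\<bar> powr s)" "continuous_on UNIV (\<lambda>x. norm (grad f x) powr s)"
 using continuous_on_powr_norm[OF smooth_continuous[OF assms(1)] assms(2)]
  continuous_on_powr_norm[OF continuous_on_grad[OF assms(1)] assms(2)] by auto

context smooth_domain
begin

abbreviation "\<sigma> \<equiv> surface_measure \<Omega>"
abbreviation E :: "real \<Rightarrow> ('a \<Rightarrow> 'a) \<Rightarrow> real" where "E r g \<equiv> LINT x|L\<Omega>. norm (g x) powr r"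
abbreviation "H \<equiv> hausdorff_measure (DIM('a) - 1) :: 'a measure"

lemma space_\<sigma> [simp]: "space \<sigma> = frontier \<Omega>"
 by (simp add: surface_measure_def space_restrict_space)

lemma compact_frontier: "compact (frontier \<Omega>)"
 using bounded_\<Omega> by (simp add: compact_frontier_bounded)

lemma frontier_borel [measurable, simp]: "frontier \<Omega> \<in> sets borel"
 by auto

lemma nn_integral_\<sigma>: "(\<integral>\<^sup>+x. f x \<partial>\<sigma>) = (\<integral>\<^sup>+x. f x * indicator (frontier \<Omega>) x \<partial>H)"
 unfolding surface_measure_def by (simp add: nn_integral_completion nn_integral_restrict_space)

lemma borel_measurable_\<sigma>I: "f \<in> borel_measurable borel \<Longrightarrow> f \<in> borel_measurable \<sigma>"
 unfolding surface_measure_def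
 by (intro measurable_completion measurable_restrict_space1) (simp add: measurable_cong_sets[OF sets_hausdorff refl])

lemma emeasure_H_frontier: "emeasure H (frontier \<Omega>) < \<infinity>"
proof -
 obtain r e \<gamma> where ch: "\<And>x. x \<in> frontier \<Omega> \<Longrightarrow> boundary_chart \<Omega> x (r x) (e x) (\<gamma> x)"
  using chart_exists by metis
 obtain X where X: "finite X" "X \<subseteq> frontier \<Omega>" "frontier \<Omega> \<subseteq> (\<Union>x\<in>X. ball x (r x / 2))"
  by (rule compactE_image[OF compact_frontier, of "frontier \<Omega>" "\<lambda>x. ball x (r x / 2)"])
   (use boundary_chartD(1)[OF ch] in force)+
 have "emeasure H (frontier \<Omega>) \<le> emeasure H (\<Union>x\<in>X. frontier \<Omega> \<inter> ball x (r x / 2))"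
 proof (rule emeasure_mono)
  show "frontier \<Omega> \<subseteq> (\<Union>x\<in>X. frontier \<Omega> \<inter> ball x (r x / 2))" using X(3) by blast
  show "(\<Union>x\<in>X. frontier \<Omega> \<inter> ball x (r x / 2)) \<in> sets H"
   using X(1) by (intro sets.finite_UN) auto
 qed
 also have "\<dots> \<le> (\<Sum>x\<in>X. emeasure H (frontier \<Omega> \<inter> ball x (r x / 2)))"
  using X(1) by (intro emeasure_subadditive_finite) auto
 also have "\<dots> < \<infinity>"
  using frontier_sweeps_into(1)[OF ch open_\<Omega>] X by (simp add: subset_iff)
 finally show ?thesis .
qed

lemma finite_\<sigma>: "finite_measure \<sigma>"
proof (rule finite_measureI)
 have "emeasure \<sigma> (space \<sigma>) = (\<integral>\<^sup>+x. 1 \<partial>\<sigma>)" by simp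
 also have "\<dots> = emeasure H (frontier \<Omega>)" unfolding nn_integral_\<sigma> by simp
 finally show "emeasure \<sigma> (space \<sigma>) \<noteq> \<infinity>" using emeasure_H_frontier by simp
qed

lemma continuous_Lp_\<sigma>:
 fixes f :: "'a \<Rightarrow> 'b::euclidean_space"
 assumes "continuous_on UNIV f" "0 \<le> s" shows "f \<in> Lp \<sigma> s"
proof -
 have "compact (f ` frontier \<Omega>)"
  using assms compact_frontier by (intro compact_continuous_image) (auto intro: continuous_on_subset)
 then obtain B where "\<forall>y\<in>f ` frontier \<Omega>. norm y \<le> B" using compact_imp_bounded bounded_iff by blast
 then have B: "AE x in \<sigma>. norm (f x) \<le> B" by (intro AE_I2) auto
 show ?thesis
  by (rule Lp_bounded[OF finite_\<sigma> borel_measurable_\<sigma>I[OF borel_measurable_continuous_onI[OF assms(1)]] B assms(2)])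
qed

text \<open>Local sweeps are added over a finite cover. The measure \<open>M\<close> is left open
  because the same sum serves Hausdorff measure on the frontier and Lebesgue measure on a boundary
  strip.\<close>

lemma cover_estimate:
 fixes S :: "'a \<Rightarrow> 'a set"
 assumes X: "finite X" "A \<subseteq> (\<Union>y\<in>X. S y)" and M [measurable_cong]: "sets M = sets borel"
  and S: "\<And>y. y \<in> X \<Longrightarrow> S y \<in> sets borel" "\<And>y. y \<in> X \<Longrightarrow> sweeps_into (density M (indicator (S y))) (e y) h (K y) \<Omega>"
  and K: "\<And>y. y \<in> X \<Longrightarrow> norm (e y) = 1" "\<And>y. y \<in> X \<Longrightarrow> 0 \<le> K y" and h: "0 < h" and s: "1 \<le> s" and \<phi>: "smooth \<phi>"
  and I: "(\<integral>\<^sup>+x. ennreal (\<bar>\<phi> x\<bar> powr s) * indicator A x \<partial>M) = ennreal I" "0 \<le> I"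
 shows "h * I \<le> 2 powr (s - 1) * sum K X *
   (absint L\<Omega> s \<phi> + h powr s * E s (grad \<phi>))"
proof -
 have s0: "0 < s" using s by simp
 have [measurable]: "\<phi> \<in> borel_measurable borel" by (rule smooth_borel[OF \<phi>])
 define V where "V = absint L\<Omega> s \<phi>"
 define D where "D = E s (grad \<phi>)"
 have VD: "0 \<le> V" "0 \<le> D" by (auto simp: V_def D_def)
 have ind: "(LINT x|L\<Omega>. indicator \<Omega> x * g x) = (LINT x|L\<Omega>. g x)" for g :: "'a \<Rightarrow> real"
  by (intro Bochner_Integration.integral_cong) auto
 have V: "(\<integral>\<^sup>+x. ennreal (\<bar>\<phi> x\<bar> powr s) * indicator \<Omega> x \<partial>lborel) = ennreal V"
  unfolding V_def by (subst nn_integral_eq_LINT[OF smooth_powr_continuous(1)[OF \<phi> s0]]) (auto simp: ind)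
 have D: "(\<integral>\<^sup>+x. ennreal (norm (grad \<phi> x) powr s) * indicator \<Omega> x \<partial>lborel) = ennreal D"
  unfolding D_def by (subst nn_integral_eq_LINT[OF smooth_powr_continuous(2)[OF \<phi> s0]]) (auto simp: ind)
 let ?f = "\<lambda>x. ennreal (\<bar>\<phi> x\<bar> powr s)" and ?B = "V + h powr s * D"
 have loc: "ennreal h * (\<integral>\<^sup>+x. ?f x * indicator (S y) x \<partial>M)
   \<le> ennreal (2 powr (s - 1) * K y * ?B)" if y: "y \<in> X" for y
 proof -
  note [measurable] = S(1)[OF y]
  have "(\<integral>\<^sup>+x. ?f x * indicator (S y) x \<partial>M)
    = (\<integral>\<^sup>+x. ?f x \<partial>density M (indicator (S y)))"
   by (subst nn_integral_density) (auto simp: mult.commute)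
  then have "ennreal h * (\<integral>\<^sup>+x. ?f x * indicator (S y) x \<partial>M)
    \<le> ennreal (2 powr (s - 1) * K y) * (ennreal V + ennreal (h powr s) * ennreal D)"
   using sweep_trace_estimate[OF _ S(2)[OF y] \<phi> K(1)[OF y] h s] V D M by simp
  also have "\<dots> = ennreal (2 powr (s - 1) * K y * ?B)"
   using VD K(2)[OF y] by (simp flip: ennreal_mult ennreal_plus)
  finally show ?thesis .
 qed
 have "ennreal h * (\<integral>\<^sup>+x. ?f x * indicator A x \<partial>M)
   \<le> ennreal h * (\<integral>\<^sup>+x. (\<Sum>y\<in>X. ?f x * indicator (S y) x) \<partial>M)"
 proof (intro mult_left_mono nn_integral_mono)
  fix x
  show "?f x * indicator A x \<le> (\<Sum>y\<in>X. ?f x * indicator (S y) x)"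
  proof (cases "x \<in> A")
   case True
   then obtain y where "y \<in> X" "x \<in> S y" using X(2) by blast
   then show ?thesis
    using member_le_sum[of y X "\<lambda>y. ?f x * indicator (S y) x"] X(1) True by simp
  qed simp
 qed simp
 also have "\<dots> = (\<Sum>y\<in>X. ennreal h * (\<integral>\<^sup>+x. ?f x * indicator (S y) x \<partial>M))"
  using S(1) by (subst nn_integral_sum) (auto simp: sum_distrib_left M cong: measurable_cong_sets)
 also have "\<dots> \<le> (\<Sum>y\<in>X. ennreal (2 powr (s - 1) * K y * ?B))"
  by (intro sum_mono loc)
 also have "\<dots> = ennreal (\<Sum>y\<in>X. 2 powr (s - 1) * K y * ?B)"
  using VD K(2) by (intro sum_ennreal) auto
 also have "(\<Sum>y\<in>X. 2 powr (s - 1) * K y * ?B) = 2 powr (s - 1) * sum K X * ?B"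
  by (simp add: sum_distrib_left sum_distrib_right)
 finally have "ennreal (h * I) \<le> ennreal (2 powr (s - 1) * sum K X * ?B)"
  using h I by (simp add: ennreal_mult)
 then show ?thesis
  unfolding V_def[symmetric] D_def[symmetric] using VD K(2) by (subst (asm) ennreal_le_iff) (auto intro!: mult_nonneg_nonneg sum_nonneg)
qed

text \<open>The free parameter \<open>h\<close> is the point: after division the gradient term
  carries \<open>h powr (s - 1)\<close>, which is small for \<open>s > 1\<close>. The constants come
  from the charts alone and serve every exponent.\<close>

lemma trace_estimate:
 "\<exists>C h0. 0 \<le> C \<and> 0 < h0 \<and> (\<forall>h s \<phi>. 0 < h \<longrightarrow> h \<le> h0 \<longrightarrow> 1 \<le> s \<longrightarrow> smooth \<phi> \<longrightarrow>
  h * absint \<sigma> s \<phi> \<le> 2 powr (s - 1) * C *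
   (absint L\<Omega> s \<phi> + h powr s * E s (grad \<phi>)))"
proof -
 obtain r e \<gamma> where ch: "\<And>x. x \<in> frontier \<Omega> \<Longrightarrow> boundary_chart \<Omega> x (r x) (e x) (\<gamma> x)"
  using chart_exists by metis
 obtain X where X: "finite X" "X \<subseteq> frontier \<Omega>" "frontier \<Omega> \<subseteq> (\<Union>x\<in>X. ball x (r x / 2))"
  by (rule compactE_image[OF compact_frontier, of "frontier \<Omega>" "\<lambda>x. ball x (r x / 2)"])
   (use boundary_chartD(1)[OF ch] in force)+
 let ?\<Gamma> = "\<lambda>x. frontier \<Omega> \<inter> ball x (r x / 2)"
 have "\<forall>x\<in>X. \<exists>K\<ge>0. \<forall>h. 0 < h \<and> h \<le> r x / 2 \<longrightarrow> sweeps_into (density H (indicator (?\<Gamma> x))) (e x) h K \<Omega>"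
  using frontier_sweeps_into(2)[OF ch open_\<Omega>] X(2) by blast
 from bchoice[OF this] obtain K where K: "\<And>x. x \<in> X \<Longrightarrow> 0 \<le> K x"
  "\<And>x h. x \<in> X \<Longrightarrow> 0 < h \<Longrightarrow> h \<le> r x / 2 \<Longrightarrow> sweeps_into (density H (indicator (?\<Gamma> x))) (e x) h (K x) \<Omega>"
  by blast
 define h0 where "h0 = Min (insert 1 ((\<lambda>x. r x / 2) ` X))"
 have "0 < h0" using X boundary_chartD(1)[OF ch] by (auto simp: h0_def subset_iff)
 moreover have "h0 \<le> r x / 2" if "x \<in> X" for x unfolding h0_def using X(1) that by (intro Min_le) auto
 ultimately have h0: "0 < h0" "\<And>x. x \<in> X \<Longrightarrow> h0 \<le> r x / 2" by auto
 show ?thesis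
 proof (intro exI conjI allI impI)
  show "0 \<le> sum K X" by (intro sum_nonneg K)
  show "0 < h0" by fact
  fix h s :: real and \<phi> :: "'a \<Rightarrow> real" assume h: "0 < h" "h \<le> h0" and s: "1 \<le> s" and \<phi>: "smooth \<phi>"
  show "h * absint \<sigma> s \<phi> \<le> 2 powr (s - 1) * sum K X *
   (absint L\<Omega> s \<phi> + h powr s * E s (grad \<phi>))"
  proof (rule cover_estimate[OF X(1) _ sets_hausdorff, where A = "frontier \<Omega>" and S = ?\<Gamma> and e = e])
   show "(\<integral>\<^sup>+x. ennreal (\<bar>\<phi> x\<bar> powr s) * indicator (frontier \<Omega>) x \<partial>H) = ennreal (absint \<sigma> s \<phi>)"
    unfolding nn_integral_\<sigma>[symmetric]
    using LpD(2)[OF continuous_Lp_\<sigma>[OF smooth_continuous[OF \<phi>], of s]] s by (intro nn_integral_eq_integral) auto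
   show "sweeps_into (density H (indicator (?\<Gamma> y))) (e y) h (K y) \<Omega>" if "y \<in> X" for y
    using K(2)[OF that h(1)] h0(2)[OF that] h(2) by simp
  qed (use X(2,3) h s \<phi> K(1) boundary_chartD(2)[OF ch] in auto)
 qed
qed

definition near_boundary :: "real \<Rightarrow> 'a set" where
 "near_boundary \<delta> = {x \<in> \<Omega>. \<exists>z\<in>frontier \<Omega>. dist z x < \<delta>}"

lemma near_boundary_borel [measurable, simp]: "near_boundary \<delta> \<in> sets borel"
proof -
 have "near_boundary \<delta> = \<Omega> \<inter> (\<Union>z\<in>frontier \<Omega>. ball z \<delta>)" by (auto simp: near_boundary_def)
 moreover have "open (\<Omega> \<inter> (\<Union>z\<in>frontier \<Omega>. ball z \<delta>))" using open_\<Omega> by auto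
 ultimately show ?thesis by simp
qed

text \<open>Here \<open>h\<close> is fixed and the strip is thin; the factor \<delta> shows that
  only a small share of the Sobolev norm can sit near the frontier.\<close>

lemma strip_estimate:
 "\<exists>C h \<delta>0. 0 \<le> C \<and> 0 < h \<and> 0 < \<delta>0 \<and> (\<forall>\<delta> s \<phi>. 0 < \<delta> \<longrightarrow> \<delta> \<le> \<delta>0 \<longrightarrow> 1 \<le> s \<longrightarrow> smooth \<phi> \<longrightarrow>
  h * (LINT x|L\<Omega>. indicator (near_boundary \<delta>) x * \<bar>\<phi> x\<bar> powr s) \<le> 2 powr (s - 1) * (C * \<delta>) *
   (absint L\<Omega> s \<phi> + h powr s * E s (grad \<phi>)))"
proof -
 obtain r e \<gamma> where ch: "\<And>x. x \<in> frontier \<Omega> \<Longrightarrow> boundary_chart \<Omega> x (r x) (e x) (\<gamma> x)"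
  using chart_exists by metis
 \<comment> \<open>The cover uses radius \<open>r x / 4\<close>, so that points within
   \<open>\<delta>0 \<le> r x / 4\<close> of a covered frontier point remain in the half
   ball.\<close>
 obtain X where X: "finite X" "X \<subseteq> frontier \<Omega>" "frontier \<Omega> \<subseteq> (\<Union>x\<in>X. ball x (r x / 4))"
  by (rule compactE_image[OF compact_frontier, of "frontier \<Omega>" "\<lambda>x. ball x (r x / 4)"])
   (use boundary_chartD(1)[OF ch] in force)+
 have "\<forall>x\<in>X. \<exists>L\<ge>0. \<forall>y\<in>cball x (r x). \<forall>z\<in>cball x (r x). \<bar>\<gamma> x y - \<gamma> x z\<bar> \<le> L * norm (y - z)"
  using smooth_lipschitz[OF boundary_chartD(4)[OF ch]] X(2) by (metis subsetD)
 from bchoice[OF this] obtain L where L: "\<And>x. x \<in> X \<Longrightarrow> 0 \<le> L x"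
  "\<And>x y z. x \<in> X \<Longrightarrow> y \<in> cball x (r x) \<Longrightarrow> z \<in> cball x (r x) \<Longrightarrow> \<bar>\<gamma> x y - \<gamma> x z\<bar> \<le> L x * norm (y - z)"
  by blast
 define h where "h = Min (insert 1 ((\<lambda>x. r x / 2) ` X))"
 define \<delta>0 where "\<delta>0 = Min (insert 1 ((\<lambda>x. r x / 4) ` X))"
 have "0 < h" "0 < \<delta>0" using X boundary_chartD(1)[OF ch] by (auto simp: h_def \<delta>0_def subset_iff)
 moreover have "h \<le> r x / 2" if "x \<in> X" for x unfolding h_def using X(1) that by (intro Min_le) auto
 moreover have "\<delta>0 \<le> r x / 4" if "x \<in> X" for x unfolding \<delta>0_def using X(1) that by (intro Min_le) auto
 ultimately have h: "0 < h" "\<And>x. x \<in> X \<Longrightarrow> h \<le> r x / 2" and \<delta>0: "0 < \<delta>0" "\<And>x. x \<in> X \<Longrightarrow> \<delta>0 \<le> r x / 4"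
  by auto
 show ?thesis
 proof (intro exI conjI allI impI)
  show "0 \<le> (\<Sum>x\<in>X. L x + 2)" by (intro sum_nonneg) (use L in fastforce)
  show "0 < h" "0 < \<delta>0" by fact+
  fix \<delta> s :: real and \<phi> :: "'a \<Rightarrow> real" assume \<delta>: "0 < \<delta>" "\<delta> \<le> \<delta>0" and s: "1 \<le> s" and \<phi>: "smooth \<phi>"
  have s0: "0 < s" using s by simp
  \<comment> \<open>A point of the half ball within \<delta> of the frontier exceeds the graph by
    less than \<open>(L x + 1) * \<delta>\<close>, since its height changes by less than \<delta>
    and \<gamma> by at most \<open>L x * \<delta>\<close>.\<close>
  define S where "S x = {y \<in> ball x (r x / 2). \<gamma> x y < y \<bullet> e x \<and> y \<bullet> e x < \<gamma> x y + (L x + 2) * \<delta>}" for x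
  have Sm: "S x \<in> sets borel" if "x \<in> X" for x
  proof -
   have [measurable]: "\<gamma> x \<in> borel_measurable borel"
    using boundary_chartD(4)[OF ch] X(2) that by (intro smooth_borel) auto
   show ?thesis unfolding S_def by measurable
  qed
  have cover: "\<exists>y\<in>X. x \<in> S y" if x: "x \<in> near_boundary \<delta>" for x
  proof -
   obtain z where z: "z \<in> frontier \<Omega>" "dist z x < \<delta>" and x\<Omega>: "x \<in> \<Omega>" using x by (auto simp: near_boundary_def)
   obtain y where y: "y \<in> X" "dist y z < r y / 4" using z X(3) by auto
   then have yf: "y \<in> frontier \<Omega>" using X by auto
   note c = boundary_chartD[OF ch[OF yf]]
   have d1: "dist y x < r y / 2" using dist_triangle[of y x z] z y \<delta> \<delta>0(2)[OF y(1)] by simp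
   have zb: "z \<in> ball y (r y)" and xb: "x \<in> ball y (r y)" using y d1 c(1) by auto
   have gz: "\<gamma> y z = z \<bullet> e y" by (rule boundary_chart_frontier[OF ch[OF yf] open_\<Omega> z(1) zb])
   have gx: "\<gamma> y x < x \<bullet> e y" using c(6)[OF xb] x\<Omega> by simp
   have "\<bar>(x - z) \<bullet> e y\<bar> \<le> norm (x - z)" using Cauchy_Schwarz_ineq2[of "x - z" "e y"] c(2) by simp
   moreover have "\<bar>\<gamma> y z - \<gamma> y x\<bar> \<le> L y * norm (z - x)" using zb xb by (intro L(2) y(1)) auto
   moreover have "norm (x - z) < \<delta>" "norm (z - x) < \<delta>" using z by (auto simp: dist_norm norm_minus_commute)
   moreover have "L y * norm (z - x) \<le> L y * \<delta>" using L(1)[OF y(1)] z by (intro mult_left_mono) (auto simp: dist_norm)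
   ultimately have "x \<bullet> e y < \<gamma> y x + (L y + 2) * \<delta>"
    using gz \<delta> by (simp add: inner_diff_left distrib_right abs_le_iff)
   then have "x \<in> S y" using d1 gx by (simp add: S_def)
   then show ?thesis using y by blast
  qed
  let ?n = "LINT x|L\<Omega>. indicator (near_boundary \<delta>) x * \<bar>\<phi> x\<bar> powr s" and ?r = "absint L\<Omega> s \<phi> + h powr s * E s (grad \<phi>)"
  have "h * ?n \<le> 2 powr (s - 1) * (\<Sum>y\<in>X. (L y + 2) * \<delta>) *
   ?r"
  proof (rule cover_estimate[OF X(1) _ sets_lborel Sm, where A = "near_boundary \<delta>" and e = e])
   show "(\<integral>\<^sup>+x. ennreal (\<bar>\<phi> x\<bar> powr s) * indicator (near_boundary \<delta>) x \<partial>lborel)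
     = ennreal ?n"
    by (rule nn_integral_eq_LINT[OF smooth_powr_continuous(1)[OF \<phi> s0] _ near_boundary_borel]) (auto simp: near_boundary_def)
   fix y assume y: "y \<in> X"
   then have yf: "y \<in> frontier \<Omega>" using X by auto
   have Lp: "0 < (L y + 2) * \<delta>" using L(1)[OF y] \<delta> by simp
   then show "0 \<le> (L y + 2) * \<delta>" by simp
   show "norm (e y) = 1" by (rule boundary_chartD(2)[OF ch[OF yf]])
   show "sweeps_into (density lborel (indicator (S y))) (e y) h ((L y + 2) * \<delta>) \<Omega>"
    by (rule strip_sweeps_into[OF ch[OF yf] \<Omega>_borel Lp S_def h(1) h(2)[OF y]])
  qed (use cover h s \<phi> in auto)
  then show "h * ?n \<le> 2 powr (s - 1) * ((\<Sum>x\<in>X. L x + 2) * \<delta>) *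
   ?r"
   by (simp add: sum_distrib_right)
 qed
qed

end

section \<open>Poincare inequalities\<close>

definition avg :: "'a::euclidean_space set \<Rightarrow> ('a \<Rightarrow> real) \<Rightarrow> real" where
 "avg K f = (LINT x|lborel. indicator K x * f x) / measure lborel K"

lemma nn_integral_affine_le:
 fixes f :: "'a::euclidean_space \<Rightarrow> ennreal"
 assumes [measurable]: "f \<in> borel_measurable borel" and t: "1 / 2 \<le> \<bar>t\<bar>"
 shows "(\<integral>\<^sup>+x. f (c + t *\<^sub>R x) \<partial>lborel) \<le> ennreal (2 ^ DIM('a)) * (\<integral>\<^sup>+x. f x \<partial>lborel)"
proof -
 have t0: "t \<noteq> 0" using t by auto
 have "(\<integral>\<^sup>+x. f x \<partial>lborel) = (\<integral>\<^sup>+x. f x \<partial>density (distr lborel borel (\<lambda>x. c + t *\<^sub>R x)) (\<lambda>_. \<bar>t\<bar> ^ DIM('a)))"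
  by (subst lborel_affine[OF t0, of c]) simp
 also have "\<dots> = (\<integral>\<^sup>+x. ennreal (\<bar>t\<bar> ^ DIM('a)) * f (c + t *\<^sub>R x) \<partial>lborel)"
  by (subst nn_integral_density) (simp_all add: nn_integral_distr)
 also have "\<dots> = ennreal (\<bar>t\<bar> ^ DIM('a)) * (\<integral>\<^sup>+x. f (c + t *\<^sub>R x) \<partial>lborel)"
  by (rule nn_integral_cmult) measurable
 finally have eq: "(\<integral>\<^sup>+x. f x \<partial>lborel) = ennreal (\<bar>t\<bar> ^ DIM('a)) * (\<integral>\<^sup>+x. f (c + t *\<^sub>R x) \<partial>lborel)" .
 have "1 \<le> 2 ^ DIM('a) * \<bar>t\<bar> ^ DIM('a)"
  using t one_le_power[of "2 * \<bar>t\<bar>" "DIM('a)"] by (simp add: power_mult_distrib)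
 then have "1 \<le> ennreal (2 ^ DIM('a) * \<bar>t\<bar> ^ DIM('a))" using ennreal_leI by fastforce
 then have "1 * (\<integral>\<^sup>+x. f (c + t *\<^sub>R x) \<partial>lborel) \<le> ennreal (2 ^ DIM('a) * \<bar>t\<bar> ^ DIM('a)) * (\<integral>\<^sup>+x. f (c + t *\<^sub>R x) \<partial>lborel)"
  by (rule mult_right_mono) simp
 also have "\<dots> = ennreal (2 ^ DIM('a)) * (\<integral>\<^sup>+x. f x \<partial>lborel)"
  unfolding eq by (subst ennreal_mult) (auto simp: mult.assoc)
 finally show ?thesis by simp
qed

text \<open>Points of \<open>K\<close> are joined by segments in \<open>K\<close>, and the gradient
  at the point of parameter \<open>t\<close> is integrated over both ends. For each \<open>t\<close>
  one end has coefficient at least \<open>1 / 2\<close>; substituting in that variable costs at most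
  \<open>2 ^ DIM('a)\<close>.\<close>

lemma convex_double_poincare:
 fixes \<phi> :: "'a::euclidean_space \<Rightarrow> real"
 assumes K: "K \<in> sets borel" "convex K" "\<And>x y. x \<in> K \<Longrightarrow> y \<in> K \<Longrightarrow> dist x y \<le> d" and d: "0 \<le> d"
  and \<phi>: "smooth \<phi>" and s: "1 \<le> s"
 shows "(\<integral>\<^sup>+x. \<integral>\<^sup>+y. indicator K x * (indicator K y * ennreal (\<bar>\<phi> x - \<phi> y\<bar> powr s)) \<partial>lborel \<partial>lborel)
  \<le> ennreal (2 ^ DIM('a) * d powr s) * (emeasure lborel K * (\<integral>\<^sup>+x. ennreal (norm (grad \<phi> x) powr s) * indicator K x \<partial>lborel))"
proof -
 have [measurable]: "\<phi> \<in> borel_measurable borel" "grad \<phi> \<in> borel_measurable borel" "K \<in> sets borel"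
  using smooth_borel[OF \<phi>] borel_measurable_grad[OF \<phi>] K(1) by auto
 define G where "G z = ennreal (norm (grad \<phi> z) powr s) * indicator K z" for z
 have Gm [measurable]: "G \<in> borel_measurable borel" unfolding G_def by measurable
 define I where "I = (\<integral>\<^sup>+x. G x \<partial>lborel)"
 let ?H = "\<lambda>x y t. indicator K x * (indicator K y * (G ((1 - t) *\<^sub>R y + t *\<^sub>R x) * indicator {0<..<1} t))"
 let ?D = "\<lambda>x y. indicator K x * (indicator K y * ennreal (\<bar>\<phi> x - \<phi> y\<bar> powr s)) :: ennreal"
 let ?T = "\<integral>\<^sup>+x. \<integral>\<^sup>+y. \<integral>\<^sup>+t. ?H x y t \<partial>lborel \<partial>lborel \<partial>lborel"
 have pt: "?D x y
   \<le> ennreal (d powr s) * (\<integral>\<^sup>+t. ?H x y t \<partial>lborel)" for x y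
 proof (cases "x \<in> K \<and> y \<in> K")
  case True
  have "((\<lambda>t. \<phi> (y + t *\<^sub>R (x - y))) has_vector_derivative grad \<phi> (y + t *\<^sub>R (x - y)) \<bullet> (x - y)) (at t)" for t
  proof -
   have "((\<lambda>t. y + t *\<^sub>R (x - y)) has_derivative (\<lambda>k. k *\<^sub>R (x - y))) (at t)" by (auto intro!: derivative_eq_intros)
   from has_derivative_compose[OF this smooth_has_derivative[OF \<phi>]]
   show ?thesis by (simp add: has_vector_derivative_def)
  qed
  moreover have "continuous_on UNIV (\<lambda>t. grad \<phi> (y + t *\<^sub>R (x - y)) \<bullet> (x - y))"
   by (intro continuous_intros continuous_on_compose2[OF continuous_on_grad[OF \<phi>, of UNIV]]) auto
  ultimately have "ennreal (\<bar>\<phi> (y + 1 *\<^sub>R (x - y)) - \<phi> (y + 0 *\<^sub>R (x - y))\<bar> powr s)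
    \<le> ennreal (1 powr (s - 1)) * (\<integral>\<^sup>+t. ennreal (\<bar>grad \<phi> (y + t *\<^sub>R (x - y)) \<bullet> (x - y)\<bar> powr s) * indicator {0<..<1} t \<partial>lborel)"
   by (rule line_estimate) (use s in auto)
  then have "ennreal (\<bar>\<phi> x - \<phi> y\<bar> powr s)
    \<le> (\<integral>\<^sup>+t. ennreal (\<bar>grad \<phi> (y + t *\<^sub>R (x - y)) \<bullet> (x - y)\<bar> powr s) * indicator {0<..<1} t \<partial>lborel)"
   by simp
  also have "\<dots> \<le> (\<integral>\<^sup>+t. ennreal (d powr s) * (?H x y t) \<partial>lborel)"
  proof (rule nn_integral_mono)
   fix t :: real
   show "ennreal (\<bar>grad \<phi> (y + t *\<^sub>R (x - y)) \<bullet> (x - y)\<bar> powr s) * indicator {0<..<1} t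
    \<le> ennreal (d powr s) * (?H x y t)"
   proof (cases "t \<in> {0<..<1}")
    case t: True
    have eq: "y + t *\<^sub>R (x - y) = (1 - t) *\<^sub>R y + t *\<^sub>R x" by (simp add: algebra_simps)
    have inK: "(1 - t) *\<^sub>R y + t *\<^sub>R x \<in> K" using K(2) True t by (intro convexD) auto
    have "\<bar>grad \<phi> (y + t *\<^sub>R (x - y)) \<bullet> (x - y)\<bar> \<le> norm (grad \<phi> (y + t *\<^sub>R (x - y))) * norm (x - y)"
     by (rule Cauchy_Schwarz_ineq2)
    also have "\<dots> \<le> norm (grad \<phi> (y + t *\<^sub>R (x - y))) * d"
     using K(3) True by (intro mult_left_mono) (auto simp: dist_norm)
    finally have "\<bar>grad \<phi> (y + t *\<^sub>R (x - y)) \<bullet> (x - y)\<bar> powr s \<le> (norm (grad \<phi> (y + t *\<^sub>R (x - y))) * d) powr s"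
     using s by (intro powr_mono2) auto
    also have "\<dots> = d powr s * norm (grad \<phi> ((1 - t) *\<^sub>R y + t *\<^sub>R x)) powr s"
     using d by (simp add: powr_mult eq)
    finally show ?thesis
     using True t inK by (simp add: G_def flip: ennreal_mult)
   qed simp
  qed
  also have "\<dots> = ennreal (d powr s) * (\<integral>\<^sup>+t. ?H x y t \<partial>lborel)"
   by (rule nn_integral_cmult) measurable
  finally show ?thesis using True by simp
 qed auto
 define W where "W t = (\<integral>\<^sup>+x. \<integral>\<^sup>+y. indicator K x * (indicator K y * G ((1 - t) *\<^sub>R y + t *\<^sub>R x)) \<partial>lborel \<partial>lborel)" for t
 have W: "W t \<le> ennreal (2 ^ DIM('a)) * (emeasure lborel K * I)" for t
 proof (cases "1 / 2 \<le> t")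
  case True
  have "W t = (\<integral>\<^sup>+y. \<integral>\<^sup>+x. indicator K x * (indicator K y * G ((1 - t) *\<^sub>R y + t *\<^sub>R x)) \<partial>lborel \<partial>lborel)"
   unfolding W_def by (rule lborel_pair.Fubini'[symmetric]) measurable
  also have "\<dots> \<le> (\<integral>\<^sup>+y. indicator K y * (\<integral>\<^sup>+x. G ((1 - t) *\<^sub>R y + t *\<^sub>R x) \<partial>lborel) \<partial>lborel)"
   by (intro nn_integral_mono) (auto simp: indicator_def intro!: nn_integral_mono)
  also have "\<dots> \<le> (\<integral>\<^sup>+y. indicator K y * (ennreal (2 ^ DIM('a)) * I) \<partial>lborel)"
   unfolding I_def using True by (intro nn_integral_mono mult_left_mono nn_integral_affine_le) auto
  also have "\<dots> = ennreal (2 ^ DIM('a)) * (emeasure lborel K * I)"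
   by (subst nn_integral_multc) (auto simp: mult_ac)
  finally show ?thesis .
 next
  case False
  have "W t \<le> (\<integral>\<^sup>+x. indicator K x * (\<integral>\<^sup>+y. G (t *\<^sub>R x + (1 - t) *\<^sub>R y) \<partial>lborel) \<partial>lborel)"
   unfolding W_def by (intro nn_integral_mono) (auto simp: indicator_def add.commute intro!: nn_integral_mono)
  also have "\<dots> \<le> (\<integral>\<^sup>+x. indicator K x * (ennreal (2 ^ DIM('a)) * I) \<partial>lborel)"
   unfolding I_def using False by (intro nn_integral_mono mult_left_mono nn_integral_affine_le) auto
  also have "\<dots> = ennreal (2 ^ DIM('a)) * (emeasure lborel K * I)"
   by (subst nn_integral_multc) (auto simp: mult_ac)
  finally show ?thesis .
 qed
 have "(\<integral>\<^sup>+x. \<integral>\<^sup>+y. ?D x y \<partial>lborel \<partial>lborel)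
   \<le> (\<integral>\<^sup>+x. \<integral>\<^sup>+y. ennreal (d powr s) * (\<integral>\<^sup>+t. ?H x y t \<partial>lborel) \<partial>lborel \<partial>lborel)"
  by (intro nn_integral_mono pt)
 also have "\<dots> = ennreal (d powr s) * ?T"
  by (simp add: nn_integral_cmult)
 finally have A: "(\<integral>\<^sup>+x. \<integral>\<^sup>+y. ?D x y \<partial>lborel \<partial>lborel)
   \<le> ennreal (d powr s) * ?T" .
 have "?T
   = (\<integral>\<^sup>+x. \<integral>\<^sup>+t. \<integral>\<^sup>+y. ?H x y t \<partial>lborel \<partial>lborel \<partial>lborel)"
  by (intro nn_integral_cong lborel_pair.Fubini') measurable
 also have "\<dots> = (\<integral>\<^sup>+t. \<integral>\<^sup>+x. \<integral>\<^sup>+y. ?H x y t \<partial>lborel \<partial>lborel \<partial>lborel)"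
  by (rule lborel_pair.Fubini') measurable
 also have "\<dots> = (\<integral>\<^sup>+t. W t * indicator {0<..<1} t \<partial>lborel)"
  unfolding W_def by (intro nn_integral_cong) (simp add: nn_integral_multc flip: mult.assoc)
 also have "\<dots> \<le> (\<integral>\<^sup>+t. (ennreal (2 ^ DIM('a)) * (emeasure lborel K * I)) * indicator {0<..<1::real} t \<partial>lborel)"
  by (intro nn_integral_mono mult_right_mono W) auto
 also have "\<dots> = ennreal (2 ^ DIM('a)) * (emeasure lborel K * I)"
  by (subst nn_integral_cmult_indicator) auto
 finally have "ennreal (d powr s) * ?T
   \<le> ennreal (d powr s) * (ennreal (2 ^ DIM('a)) * (emeasure lborel K * I))"
  by (rule mult_left_mono) simp
 from order_trans[OF A this] show ?thesis
  using d by (simp add: I_def G_def ennreal_mult mult_ac)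
qed

text \<open>The average is an expectation for the uniform distribution on \<open>K\<close>, so
  Jensen's inequality reduces the claim to the double integral.\<close>

lemma convex_poincare:
 fixes \<phi> :: "'a::euclidean_space \<Rightarrow> real"
 assumes K: "K \<in> sets borel" "convex K" "\<And>x y. x \<in> K \<Longrightarrow> y \<in> K \<Longrightarrow> dist x y \<le> d" and d: "0 \<le> d"
  and pos: "0 < measure lborel K" and bd: "bounded K" and \<phi>: "smooth \<phi>" and s: "1 \<le> s"
 shows "(\<integral>\<^sup>+x. ennreal (\<bar>\<phi> x - avg K \<phi>\<bar> powr s) * indicator K x \<partial>lborel)
  \<le> ennreal (2 ^ DIM('a) * d powr s) * (\<integral>\<^sup>+x. ennreal (norm (grad \<phi> x) powr s) * indicator K x \<partial>lborel)"
proof -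
 have [measurable]: "\<phi> \<in> borel_measurable borel" "K \<in> sets borel" using smooth_borel[OF \<phi>] K(1) by auto
 define m where "m = measure lborel K"
 have m: "0 < m" using pos by (simp add: m_def)
 have Kfin: "emeasure lborel K < \<infinity>" using bd by (rule emeasure_bounded_finite)
 then have em: "emeasure lborel K = ennreal m" by (simp add: m_def emeasure_eq_ennreal_measure)
 define \<nu> where "\<nu> = density lborel (\<lambda>y. ennreal (indicator K y / m))"
 have den: "ennreal (indicator K y / m) = ennreal (1 / m) * indicator K y" for y by (simp add: indicator_def)
 have \<nu>1: "emeasure \<nu> (space \<nu>) = 1"
  unfolding \<nu>_def using m by (simp add: emeasure_density den nn_integral_cmult_indicator em flip: ennreal_mult)
 have iK: "integrable lborel (\<lambda>x. indicator K x * \<phi> x)"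
 proof -
  obtain R where R: "K \<subseteq> cball 0 R" using bounded_subset_ballD[OF bd, of 0] ball_subset_cball by (meson order_trans)
  have "integrable lborel (\<lambda>x. indicator K x *\<^sub>R (indicator (cball 0 R) x *\<^sub>R \<phi> x))"
   by (rule integrable_mult_indicator[OF _ borel_integrable_compact[OF compact_cball smooth_continuous[OF \<phi>]]]) simp
  also have "(\<lambda>x. indicator K x *\<^sub>R (indicator (cball 0 R) x *\<^sub>R \<phi> x)) = (\<lambda>x. indicator K x * \<phi> x)"
  proof
   fix x show "indicator K x *\<^sub>R (indicator (cball 0 R) x *\<^sub>R \<phi> x) = indicator K x * \<phi> x"
    by (cases "x \<in> K") (use R in auto)
  qed
  finally show ?thesis .
 qed
 have iK1: "integrable lborel (indicator K :: 'a \<Rightarrow> real)" using Kfin by (intro integrable_real_indicator) auto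
 have pt: "ennreal (\<bar>\<phi> x - avg K \<phi>\<bar> powr s) \<le> ennreal (1 / m) * (\<integral>\<^sup>+y. indicator K y * ennreal (\<bar>\<phi> x - \<phi> y\<bar> powr s) \<partial>lborel)" for x
 proof -
  have "(LINT y|\<nu>. \<phi> x - \<phi> y) = (LINT y|lborel. (indicator K y / m) *\<^sub>R (\<phi> x - \<phi> y))"
   unfolding \<nu>_def using m by (subst integral_density) auto
  also have "\<dots> = (LINT y|lborel. (indicator K y * \<phi> x - indicator K y * \<phi> y) / m)"
   by (intro Bochner_Integration.integral_cong) (auto simp: right_diff_distrib diff_divide_distrib)
  also have "\<dots> = (\<phi> x * m - (LINT y|lborel. indicator K y * \<phi> y)) / m"
   using iK iK1 by (simp add: m_def)
  also have "\<dots> = \<phi> x - avg K \<phi>" using m by (simp add: avg_def m_def[symmetric] field_simps)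
  finally have "ennreal (\<bar>\<phi> x - avg K \<phi>\<bar> powr s) \<le> (\<integral>\<^sup>+y. ennreal (\<bar>\<phi> x - \<phi> y\<bar> powr s) \<partial>\<nu>)"
   using jensen_powr[OF \<nu>1 s, of "\<lambda>y. \<phi> x - \<phi> y"] by simp
  also have "\<dots> = (\<integral>\<^sup>+y. ennreal (1 / m) * (indicator K y * ennreal (\<bar>\<phi> x - \<phi> y\<bar> powr s)) \<partial>lborel)"
   unfolding \<nu>_def by (subst nn_integral_density) (auto simp: den mult.assoc)
  also have "\<dots> = ennreal (1 / m) * (\<integral>\<^sup>+y. indicator K y * ennreal (\<bar>\<phi> x - \<phi> y\<bar> powr s) \<partial>lborel)"
   by (rule nn_integral_cmult) measurable
  finally show ?thesis .
 qed
 let ?D = "\<integral>\<^sup>+x. ennreal (norm (grad \<phi> x) powr s) * indicator K x \<partial>lborel"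
 have "(\<integral>\<^sup>+x. ennreal (\<bar>\<phi> x - avg K \<phi>\<bar> powr s) * indicator K x \<partial>lborel)
   \<le> (\<integral>\<^sup>+x. (ennreal (1 / m) * (\<integral>\<^sup>+y. indicator K y * ennreal (\<bar>\<phi> x - \<phi> y\<bar> powr s) \<partial>lborel)) * indicator K x \<partial>lborel)"
  by (intro nn_integral_mono mult_right_mono pt) auto
 also have "\<dots> = (\<integral>\<^sup>+x. ennreal (1 / m) * (\<integral>\<^sup>+y. indicator K x * (indicator K y * ennreal (\<bar>\<phi> x - \<phi> y\<bar> powr s)) \<partial>lborel) \<partial>lborel)"
  by (intro nn_integral_cong, subst nn_integral_cmult) (auto simp: mult_ac)
 also have "\<dots> = ennreal (1 / m) * (\<integral>\<^sup>+x. \<integral>\<^sup>+y. indicator K x * (indicator K y * ennreal (\<bar>\<phi> x - \<phi> y\<bar> powr s)) \<partial>lborel \<partial>lborel)"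
  by (rule nn_integral_cmult) measurable
 also have "\<dots> \<le> ennreal (1 / m) * (ennreal (2 ^ DIM('a) * d powr s) * (emeasure lborel K * ?D))"
  by (intro mult_left_mono convex_double_poincare[OF K d \<phi> s]) auto
 also have "\<dots> = (ennreal (1 / m) * ennreal m) * (ennreal (2 ^ DIM('a) * d powr s) * ?D)"
  unfolding em by (simp only: mult_ac)
 also have "ennreal (1 / m) * ennreal m = 1" using m by (simp flip: ennreal_mult)
 finally show ?thesis by simp
qed

section \<open>Averages over convex bodies in a connected domain\<close>

context smooth_domain
begin

definition convex_body :: "'a set \<Rightarrow> bool" where
 "convex_body K \<longleftrightarrow> K \<in> sets borel \<and> convex K \<and> K \<subseteq> \<Omega> \<and> interior K \<noteq> {}"

lemma measure_pos_interior:
 assumes "K \<in> sets borel" "bounded K" "interior K \<noteq> {}" shows "0 < measure lborel K"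
proof -
 obtain x r where x: "0 < r" "ball x r \<subseteq> K"
  using assms(3) by (metis ex_in_conv mem_interior)
 have "emeasure lborel K < \<infinity>" using assms(2) by (rule emeasure_bounded_finite)
 then have "measure lborel (ball x r) \<le> measure lborel K"
  using x(2) assms(1) by (intro measure_mono_fmeasurable) (auto simp: fmeasurable_def)
 moreover have "0 < measure lborel (ball x r)"
  using content_ball_pos[OF x(1), of x] by (simp add: measure_completion)
 ultimately show ?thesis by linarith
qed

lemma convex_bodyD:
 assumes "convex_body K"
 shows "K \<in> sets borel" "convex K" "K \<subseteq> \<Omega>" "bounded K" "0 < measure lborel K" "interior K \<noteq> {}"
proof -
 show "bounded K" using assms bounded_\<Omega> bounded_subset by (auto simp: convex_body_def)
 then show "0 < measure lborel K" using assms by (auto simp: convex_body_def intro: measure_pos_interior)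
qed (use assms in \<open>auto simp: convex_body_def\<close>)

lemma body_poincare:
 assumes K: "convex_body K" "\<And>x y. x \<in> K \<Longrightarrow> y \<in> K \<Longrightarrow> dist x y \<le> d" and d: "0 \<le> d" and \<phi>: "smooth \<phi>" and s: "1 \<le> s"
 shows "(LINT x|L\<Omega>. indicator K x * \<bar>\<phi> x - avg K \<phi>\<bar> powr s)
  \<le> 2 ^ DIM('a) * d powr s * (LINT x|L\<Omega>. indicator K x * norm (grad \<phi> x) powr s)"
proof -
 note k = convex_bodyD[OF K(1)]
 have s0: "0 < s" using s by simp
 have sm: "smooth (\<lambda>x. \<phi> x - avg K \<phi>)" by (intro smooth_diff \<phi> smooth_const)
 have "ennreal (LINT x|L\<Omega>. indicator K x * \<bar>\<phi> x - avg K \<phi>\<bar> powr s)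
   \<le> ennreal (2 ^ DIM('a) * d powr s) * ennreal (LINT x|L\<Omega>. indicator K x * norm (grad \<phi> x) powr s)"
  using convex_poincare[OF k(1,2) K(2) d k(5,4) \<phi> s]
   nn_integral_eq_LINT[OF smooth_powr_continuous(1)[OF sm s0] _ k(1,3)]
   nn_integral_eq_LINT[OF smooth_powr_continuous(2)[OF \<phi> s0] _ k(1,3)] by simp
 also have "\<dots> = ennreal (2 ^ DIM('a) * d powr s * (LINT x|L\<Omega>. indicator K x * norm (grad \<phi> x) powr s))"
  by (simp add: ennreal_mult)
 finally show ?thesis by (subst (asm) ennreal_le_iff) auto
qed

text \<open>Comparability of averages up to a gradient term is symmetric and transitive, so
  connectedness of \<Omega> can link any two bodies through overlapping balls. The constant may
  depend on the pair.\<close>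

definition linked :: "real \<Rightarrow> 'a set \<Rightarrow> 'a set \<Rightarrow> bool" where
 "linked s K K' \<longleftrightarrow> (\<exists>C\<ge>0. \<forall>\<phi>. smooth \<phi> \<longrightarrow>
   \<bar>avg K \<phi> - avg K' \<phi>\<bar> powr s \<le> C * E s (grad \<phi>))"

lemma linked_sym: "linked s K K' \<Longrightarrow> linked s K' K"
 by (simp add: linked_def abs_minus_commute)

lemma linked_trans:
 assumes "linked s K1 K2" "linked s K2 K3" and s: "1 \<le> s"
 shows "linked s K1 K3"
proof -
 obtain C where C: "0 \<le> C" "\<And>\<phi>. smooth \<phi> \<Longrightarrow> \<bar>avg K1 \<phi> - avg K2 \<phi>\<bar> powr s \<le> C * E s (grad \<phi>)"
  using assms by (auto simp: linked_def)
 obtain C' where C': "0 \<le> C'" "\<And>\<phi>. smooth \<phi> \<Longrightarrow> \<bar>avg K2 \<phi> - avg K3 \<phi>\<bar> powr s \<le> C' * E s (grad \<phi>)"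
  using assms by (auto simp: linked_def)
 have "\<bar>avg K1 \<phi> - avg K3 \<phi>\<bar> powr s \<le> 2 powr (s - 1) * (C + C') * E s (grad \<phi>)" if \<phi>: "smooth \<phi>" for \<phi>
 proof -
  have "\<bar>avg K1 \<phi> - avg K3 \<phi>\<bar> powr s \<le> 2 powr (s - 1) * (\<bar>avg K1 \<phi> - avg K2 \<phi>\<bar> powr s + \<bar>avg K2 \<phi> - avg K3 \<phi>\<bar> powr s)"
   using powr_norm_add_le[OF s, of "avg K1 \<phi> - avg K2 \<phi>" "avg K2 \<phi> - avg K3 \<phi>"] by simp
  also have "\<dots> \<le> 2 powr (s - 1) * (C * E s (grad \<phi>) + C' * E s (grad \<phi>))"
   by (intro mult_left_mono add_mono C C' \<phi>) auto
  finally show ?thesis by (simp add: algebra_simps)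
 qed
 then show ?thesis unfolding linked_def using C C' by (intro exI[of _ "2 powr (s - 1) * (C + C')"]) auto
qed

text \<open>On the intersection, which has positive measure, both averages are compared with the
  same values of \<phi>.\<close>

lemma linked_overlapping:
 assumes K: "convex_body K" "convex_body K'" "interior K \<inter> interior K' \<noteq> {}" and s: "1 \<le> s"
 shows "linked s K K'"
proof -
 note k = convex_bodyD[OF K(1)] and k' = convex_bodyD[OF K(2)]
 have s0: "0 < s" using s by simp
 define V where "V = measure lborel (K \<inter> K')"
 have V: "0 < V" unfolding V_def
  by (rule measure_pos_interior) (use k k' K(3) in \<open>auto simp: interior_Int bounded_Int\<close>)
 obtain d where d: "\<And>x y. x \<in> \<Omega> \<Longrightarrow> y \<in> \<Omega> \<Longrightarrow> dist x y \<le> d"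
  using bounded_\<Omega> unfolding bounded_two_points by blast
 have d0: "0 \<le> d" using d nonempty_\<Omega> by (metis ex_in_conv zero_le_dist order_trans)
 have dK: "dist x y \<le> d" if "x \<in> K \<and> y \<in> K \<or> x \<in> K' \<and> y \<in> K'" for x y
  using that k(3) k'(3) by (intro d) auto
 let ?C = "2 ^ DIM('a) * d powr s"
 have "\<bar>avg K \<phi> - avg K' \<phi>\<bar> powr s \<le> (2 powr (s - 1) * (2 * ?C) / V) * E s (grad \<phi>)" if \<phi>: "smooth \<phi>" for \<phi>
 proof -
  let ?a = "avg K \<phi>" and ?a' = "avg K' \<phi>"
  have sm: "smooth (\<lambda>x. \<phi> x - ?a)" "smooth (\<lambda>x. \<phi> x - ?a')" by (intro smooth_diff \<phi> smooth_const)+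
  let ?h = "\<lambda>x. indicator K x * \<bar>\<phi> x - ?a\<bar> powr s + indicator K' x * \<bar>\<phi> x - ?a'\<bar> powr s"
  have B: "(LINT x|L\<Omega>. indicator A x * norm (grad \<phi> x) powr s) \<le> E s (grad \<phi>)" if "A \<in> sets borel" for A
   using integrable_continuous[OF smooth_powr_continuous(2)[OF \<phi> s0] that] by (intro integral_mono) (auto simp: indicator_def)
  have "V * \<bar>?a - ?a'\<bar> powr s = (LINT x|L\<Omega>. indicator (K \<inter> K') x * \<bar>?a - ?a'\<bar> powr s)"
  proof -
   have m: "indicator (K \<inter> K') \<in> borel_measurable (borel :: 'a measure)" "K \<inter> K' \<in> sets borel" using k k' by auto
   have "(LINT x|L\<Omega>. indicator (K \<inter> K') x) = (LINT x|lborel. indicator \<Omega> x *\<^sub>R (indicator (K \<inter> K') x :: real))"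
    by (rule LINT_lebesgue_on(1)[OF m(1) \<Omega>_borel])
   also have "(\<lambda>x. indicator \<Omega> x *\<^sub>R (indicator (K \<inter> K') x :: real)) = indicator (K \<inter> K')"
    using k(3) by (auto simp: indicator_def fun_eq_iff)
   finally show ?thesis using m(2) by (simp add: V_def)
  qed
  also have "\<dots> \<le> (LINT x|L\<Omega>. 2 powr (s - 1) * ?h x)"
  proof (rule integral_mono)
   show "integrable L\<Omega> (\<lambda>x. indicator (K \<inter> K') x * \<bar>?a - ?a'\<bar> powr s)"
    using integrable_continuous(2)[of "\<lambda>x. \<bar>?a - ?a'\<bar> powr s" "K \<inter> K'"] k k' by simp
   show "integrable L\<Omega> (\<lambda>x. 2 powr (s - 1) * ?h x)"
    using integrable_continuous(2)[OF smooth_powr_continuous(1)[OF sm(1) s0] k(1)]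
     integrable_continuous(2)[OF smooth_powr_continuous(1)[OF sm(2) s0] k'(1)] by simp
   fix x
   show "indicator (K \<inter> K') x * \<bar>?a - ?a'\<bar> powr s \<le> 2 powr (s - 1) * ?h x"
    using powr_norm_add_le[OF s, of "?a - \<phi> x" "\<phi> x - ?a'"] by (auto simp: indicator_def abs_minus_commute)
  qed
  also have "\<dots> = 2 powr (s - 1) * ((LINT x|L\<Omega>. indicator K x * \<bar>\<phi> x - ?a\<bar> powr s) + (LINT x|L\<Omega>. indicator K' x * \<bar>\<phi> x - ?a'\<bar> powr s))"
   using integrable_continuous(2)[OF smooth_powr_continuous(1)[OF sm(1) s0] k(1)]
     integrable_continuous(2)[OF smooth_powr_continuous(1)[OF sm(2) s0] k'(1)] by simp
  also have "\<dots> \<le> 2 powr (s - 1) * (?C * (LINT x|L\<Omega>. indicator K x * norm (grad \<phi> x) powr s) + ?C * (LINT x|L\<Omega>. indicator K' x * norm (grad \<phi> x) powr s))"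
   by (intro mult_left_mono add_mono body_poincare K d0 \<phi> s) (use dK in auto)
  also have "\<dots> \<le> 2 powr (s - 1) * (?C * E s (grad \<phi>) + ?C * E s (grad \<phi>))"
   by (intro mult_left_mono add_mono B k k') auto
  finally show ?thesis using V by (simp add: field_simps)
 qed
 then show ?thesis unfolding linked_def using V by (intro exI[of _ "2 powr (s - 1) * (2 * ?C) / V"]) auto
qed

lemma convex_body_ball: "0 < r \<Longrightarrow> ball x r \<subseteq> \<Omega> \<Longrightarrow> convex_body (ball x r)"
 by (auto simp: convex_body_def)

text \<open>Each point of \<Omega> is given a ball inside \<Omega>. Every body overlaps one of these
  balls, and the balls of sufficiently close points overlap, so the relation is locally constant on
  a connected set.\<close>

lemma linked_bodies:
 assumes K: "convex_body K" "convex_body K'" and s: "1 \<le> s"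
 shows "linked s K K'"
proof -
 obtain r where r: "\<And>x. x \<in> \<Omega> \<Longrightarrow> 0 < r x" "\<And>x. x \<in> \<Omega> \<Longrightarrow> ball x (r x) \<subseteq> \<Omega>"
  using open_\<Omega> open_contains_ball by metis
 note b = convex_body_ball[OF r]
 have inter: "\<exists>x. x \<in> \<Omega> \<and> linked s K (ball x (r x))" if K: "convex_body K" for K
 proof -
  obtain x where x: "x \<in> interior K" using convex_bodyD(6)[OF K] by blast
  then have x\<Omega>: "x \<in> \<Omega>" using convex_bodyD(3)[OF K] interior_subset by blast
  have "linked s K (ball x (r x))"
   by (rule linked_overlapping[OF K b[OF x\<Omega> x\<Omega>] _ s]) (use x r(1)[OF x\<Omega>] in \<open>auto simp: interior_open\<close>)
  then show ?thesis using x\<Omega> by blast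
 qed
 obtain x y where x: "x \<in> \<Omega>" "linked s K (ball x (r x))" and y: "y \<in> \<Omega>" "linked s K' (ball y (r y))"
  using inter[OF K(1)] inter[OF K(2)] by blast
 have "linked s (ball x (r x)) (ball y (r y))"
 proof (rule connected_equivalence_relation[OF connected_\<Omega> x(1) y(1)])
  show "linked s (ball x (r x)) (ball y (r y)) \<Longrightarrow> linked s (ball y (r y)) (ball x (r x))" for x y by (rule linked_sym)
  show "linked s (ball x (r x)) (ball y (r y)) \<Longrightarrow> linked s (ball y (r y)) (ball z (r z)) \<Longrightarrow> linked s (ball x (r x)) (ball z (r z))" for x y z
   by (rule linked_trans[OF _ _ s])
  fix a assume a: "a \<in> \<Omega>"
  show "\<exists>T. openin (top_of_set \<Omega>) T \<and> a \<in> T \<and> (\<forall>x\<in>T. linked s (ball a (r a)) (ball x (r x)))"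
  proof (intro exI[of _ "ball a (r a)"] conjI ballI)
   show "openin (top_of_set \<Omega>) (ball a (r a))" using r(2)[OF a] by (simp add: openin_open_eq open_\<Omega>)
   show "a \<in> ball a (r a)" using r(1)[OF a] by simp
   fix x assume xa: "x \<in> ball a (r a)"
   then have x: "x \<in> \<Omega>" using r(2)[OF a] by blast
   show "linked s (ball a (r a)) (ball x (r x))"
    by (rule linked_overlapping[OF b[OF a a] b[OF x x] _ s]) (use xa r(1)[OF x] in \<open>auto simp: interior_open\<close>)
  qed
 qed
 then show ?thesis using linked_trans[OF linked_trans[OF x(2) _ s] linked_sym[OF y(2)] s] by blast
qed

text \<open>Half-open cells of a lattice are convex and disjoint. A cell that meets \<Omega> and
  leaves it is connected, hence meets the frontier, and its points in \<Omega> are within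
  \<open>d < \<delta>\<close> of it.\<close>

lemma grid:
 assumes d: "0 < d" and \<delta>: "d < \<delta>"
 obtains \<K> where "finite \<K>" "\<And>K. K \<in> \<K> \<Longrightarrow> convex_body K" "pairwise disjnt \<K>"
  "\<And>K x y. K \<in> \<K> \<Longrightarrow> x \<in> K \<Longrightarrow> y \<in> K \<Longrightarrow> dist x y \<le> d" "\<Omega> \<subseteq> near_boundary \<delta> \<union> \<Union>\<K>"
proof -
 \<comment> \<open>The side length for which the coordinate differences add up to at most
   \<open>d\<close>.\<close>
 define \<rho> where "\<rho> = d / real DIM('a)"
 have \<rho>: "0 < \<rho>" using d by (simp add: \<rho>_def)
 define cell :: "('a \<Rightarrow> int) \<Rightarrow> 'a set" where
  "cell k = (\<Inter>i\<in>Basis. {x. real_of_int (k i) * \<rho> \<le> i \<bullet> x} \<inter> {x. i \<bullet> x < (real_of_int (k i) + 1) * \<rho>})" for k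
 define \<kappa> where "\<kappa> x = restrict (\<lambda>i. \<lfloor>(i \<bullet> x) / \<rho>\<rfloor>) Basis" for x :: 'a
 have cell_iff: "y \<in> cell (\<kappa> x) \<longleftrightarrow> \<kappa> y = \<kappa> x" for x y
 proof -
  have "y \<in> cell (\<kappa> x) \<longleftrightarrow> (\<forall>i\<in>Basis. \<lfloor>(i \<bullet> y) / \<rho>\<rfloor> = \<lfloor>(i \<bullet> x) / \<rho>\<rfloor>)"
   using \<rho> unfolding cell_def \<kappa>_def
   by (auto simp: floor_eq_iff pos_le_divide_eq pos_divide_less_eq)
  also have "\<dots> \<longleftrightarrow> \<kappa> y = \<kappa> x" unfolding \<kappa>_def by (auto simp: fun_eq_iff restrict_def)
  finally show ?thesis .
 qed
 have cell_diam: "dist x y \<le> d" if "x \<in> cell k" "y \<in> cell k" for x y k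
 proof -
  have "dist x y \<le> (\<Sum>i\<in>Basis. \<bar>(x - y) \<bullet> i\<bar>)" unfolding dist_norm by (rule norm_le_l1)
  also have "\<dots> \<le> (\<Sum>i\<in>(Basis::'a set). \<rho>)"
  proof (rule sum_mono)
   fix i :: 'a assume "i \<in> Basis"
   then have "real_of_int (k i) * \<rho> \<le> i \<bullet> x" "i \<bullet> x < (real_of_int (k i) + 1) * \<rho>"
    "real_of_int (k i) * \<rho> \<le> i \<bullet> y" "i \<bullet> y < (real_of_int (k i) + 1) * \<rho>"
    using that by (auto simp: cell_def)
   moreover have "(x - y) \<bullet> i = i \<bullet> x - i \<bullet> y" by (metis inner_commute inner_diff_right)
   ultimately show "\<bar>(x - y) \<bullet> i\<bar> \<le> \<rho>" by (simp add: distrib_right abs_le_iff)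
  qed
  finally show ?thesis by (simp add: \<rho>_def)
 qed
 have cell_borel: "cell k \<in> sets borel" for k
 proof -
  have "{x. real_of_int (k i) * \<rho> \<le> i \<bullet> x} \<inter> {x. i \<bullet> x < (real_of_int (k i) + 1) * \<rho>} \<in> sets borel" for i :: 'a
   by measurable
  then show ?thesis unfolding cell_def by (intro sets.finite_INT) auto
 qed
 have cell_convex: "convex (cell k)" for k
  unfolding cell_def by (intro convex_INT convex_Int convex_halfspace_ge convex_halfspace_lt)
 have cell_interior: "interior (cell k) \<noteq> {}" for k
 proof -
  define a where "a = (\<Sum>i\<in>Basis. (real_of_int (k i) * \<rho>) *\<^sub>R i)"
  define b where "b = (\<Sum>i\<in>Basis. ((real_of_int (k i) + 1) * \<rho>) *\<^sub>R (i::'a))"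
  have ab: "a \<bullet> i = real_of_int (k i) * \<rho>" "b \<bullet> i = (real_of_int (k i) + 1) * \<rho>" if "i \<in> Basis" for i
   using that by (simp_all add: a_def b_def)
  have "box a b \<subseteq> cell k"
  proof
   fix x assume "x \<in> box a b"
   then have nb: "a \<bullet> i < x \<bullet> i \<and> x \<bullet> i < b \<bullet> i" if "i \<in> Basis" for i using that by (simp add: mem_box)
   then have "real_of_int (k i) * \<rho> < i \<bullet> x \<and> i \<bullet> x < (real_of_int (k i) + 1) * \<rho>" if "i \<in> Basis" for i
    using nb[OF that] ab[OF that] by (simp add: inner_commute[of i x])
   then show "x \<in> cell k" by (auto simp: cell_def less_imp_le)
  qed
  then have "box a b \<subseteq> interior (cell k)" by (rule interior_maximal[OF _ open_box])
  moreover have "box a b \<noteq> {}" using \<rho> by (auto simp: box_ne_empty ab)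
  ultimately show ?thesis by blast
 qed
 have fin: "finite (\<kappa> ` \<Omega>)"
 proof -
  obtain R where R: "\<And>x. x \<in> \<Omega> \<Longrightarrow> norm x \<le> R" using bounded_\<Omega> unfolding bounded_iff by blast
  have "\<kappa> ` \<Omega> \<subseteq> PiE Basis (\<lambda>_. {\<lfloor>- R / \<rho>\<rfloor> .. \<lfloor>R / \<rho>\<rfloor>})"
  proof (intro image_subsetI PiE_I)
   fix x i :: 'a assume "x \<in> \<Omega>" "i \<in> Basis"
   then have "\<bar>i \<bullet> x\<bar> \<le> R" using Basis_le_norm[of i x] R[of x] by (simp add: inner_commute)
   then have "- R / \<rho> \<le> (i \<bullet> x) / \<rho>" "(i \<bullet> x) / \<rho> \<le> R / \<rho>" using \<rho> by (intro divide_right_mono; auto)+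
   then show "\<kappa> x i \<in> {\<lfloor>- R / \<rho>\<rfloor> .. \<lfloor>R / \<rho>\<rfloor>}"
    using \<open>i \<in> Basis\<close> by (auto simp: \<kappa>_def intro!: floor_mono)
  qed (simp add: \<kappa>_def)
  then show ?thesis by (rule finite_subset) (auto intro: finite_PiE)
 qed
 define \<K> where "\<K> = {K \<in> cell ` \<kappa> ` \<Omega>. K \<subseteq> \<Omega>}"
 show thesis
 proof
  show "finite \<K>" using fin by (simp add: \<K>_def)
  show "convex_body K" if "K \<in> \<K>" for K
   using that cell_borel cell_convex cell_interior by (auto simp: \<K>_def convex_body_def)
  show "pairwise disjnt \<K>"
  proof (rule pairwiseI)
   fix K K' assume K: "K \<in> \<K>" "K' \<in> \<K>" "K \<noteq> K'"
   then obtain x x' where "K = cell (\<kappa> x)" "K' = cell (\<kappa> x')" by (auto simp: \<K>_def)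
   then show "disjnt K K'" using K(3) cell_iff by (auto simp: disjnt_def)
  qed
  show "dist x y \<le> d" if "K \<in> \<K>" "x \<in> K" "y \<in> K" for K x y
   using that cell_diam by (auto simp: \<K>_def)
  show "\<Omega> \<subseteq> near_boundary \<delta> \<union> \<Union>\<K>"
  proof
   fix x assume x: "x \<in> \<Omega>"
   have xc: "x \<in> cell (\<kappa> x)" by (simp add: cell_iff)
   show "x \<in> near_boundary \<delta> \<union> \<Union>\<K>"
   proof (cases "cell (\<kappa> x) \<subseteq> \<Omega>")
    case True
    then show ?thesis using x xc by (auto simp: \<K>_def)
   next
    case False
    then have "cell (\<kappa> x) \<inter> frontier \<Omega> \<noteq> {}"
     using x xc by (intro connected_Int_frontier convex_connected cell_convex) auto
    then obtain z where "z \<in> cell (\<kappa> x)" "z \<in> frontier \<Omega>" by blast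
    then show ?thesis using cell_diam[OF _ xc, of z] \<delta> x by (auto simp: near_boundary_def intro!: bexI[of _ z])
   qed
  qed
 qed
qed

text \<open>Near the frontier the strip estimate leaves at most half of the integral plus a small
  gradient term; on the cells the Poincare inequality with small diameter leaves the averages. The
  half is absorbed on the left.\<close>

lemma interior_averages:
 assumes s: "1 \<le> s" and e: "0 < e"
 obtains \<K> C where "finite \<K>" "\<And>K. K \<in> \<K> \<Longrightarrow> convex_body K" "0 \<le> C"
  "\<And>\<phi>. smooth \<phi> \<Longrightarrow> absint L\<Omega> s \<phi>
   \<le> e * E s (grad \<phi>) + C * (\<Sum>K\<in>\<K>. \<bar>avg K \<phi>\<bar> powr s)"
proof -
 have s0: "0 < s" using s by simp
 obtain C0 h \<delta>0 where C0': "0 \<le> C0" "0 < h" "0 < \<delta>0" "\<And>\<delta> s \<phi>. 0 < \<delta> \<Longrightarrow> \<delta> \<le> \<delta>0 \<Longrightarrow> 1 \<le> s \<Longrightarrow> smooth \<phi> \<Longrightarrow>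
  h * (LINT x|L\<Omega>. indicator (near_boundary \<delta>) x * \<bar>\<phi> x\<bar> powr s) \<le> 2 powr (s - 1) * (C0 * \<delta>) *
   (absint L\<Omega> s \<phi> + h powr s * E s (grad \<phi>))"
  using strip_estimate by blast
 note C0 = C0'(1-3) C0'(4)[OF _ _ s]
 define M where "M = 2 powr (s - 1) * C0 / h"
 have M: "0 \<le> M" using C0 by (simp add: M_def)
 \<comment> \<open>Three demands: the range of the strip estimate,
   \<open>M * \<delta> \<le> 1 / 2\<close> for the absorption, and a share \<open>e / 4\<close> for
   the gradient term.\<close>
 define \<delta> where "\<delta> = min \<delta>0 (min (1 / (2 * (M + 1))) (e / (4 * (M + 1) * (h powr s + 1))))"
 have hp: "0 < h powr s + 1" by (simp add: add_nonneg_pos)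
 have \<delta>: "0 < \<delta>" "\<delta> \<le> \<delta>0" using C0 M e hp by (auto simp: \<delta>_def)
 have M\<delta>: "M * \<delta> \<le> 1 / 2" "M * \<delta> * h powr s \<le> e / 4"
 proof -
  have "M * \<delta> \<le> (M + 1) * (1 / (2 * (M + 1)))"
   using M \<delta> by (intro mult_mono) (auto simp: \<delta>_def)
  also have "\<dots> = 1 / 2"
  proof -
   have "M + 1 \<noteq> 0" using M by linarith
   then show ?thesis by (simp add: field_simps)
  qed
  finally show "M * \<delta> \<le> 1 / 2" .
  have "M * \<delta> * h powr s \<le> (M + 1) * (e / (4 * (M + 1) * (h powr s + 1))) * (h powr s + 1)"
   using M \<delta> e hp by (intro mult_mono) (auto simp: \<delta>_def)
  also have "\<dots> = e / 4"
  proof -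
   have "x * (e / (4 * x * y)) * y = e / 4" if "0 < x" "0 < y" for x y :: real
    using that by (simp add: field_simps)
   from this[of "M + 1", OF _ hp] show ?thesis using M by simp
  qed
  finally show "M * \<delta> * h powr s \<le> e / 4" .
 qed
 define c where "c = 2 powr (s - 1) * 2 ^ DIM('a)"
 have c: "0 < c" by (simp add: c_def)
 \<comment> \<open>Below \<delta> for the grid, and small enough that the gradient on a cell enters
   with a factor at most \<open>e / 4\<close>.\<close>
 define d where "d = min (\<delta> / 2) ((e / (4 * c)) powr (1 / s))"
 have d: "0 < d" "d < \<delta>" using \<delta> e c by (auto simp: d_def)
 have cd: "c * d powr s \<le> e / 4"
 proof -
  have "d powr s \<le> ((e / (4 * c)) powr (1 / s)) powr s"
   using d s by (intro powr_mono2) (auto simp: d_def)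
  also have "\<dots> = e / (4 * c)" using s e c by (simp add: powr_powr)
  finally show ?thesis using c by (simp add: field_simps)
 qed
 obtain \<K> where K: "finite \<K>" "\<And>K. K \<in> \<K> \<Longrightarrow> convex_body K" "pairwise disjnt \<K>"
  "\<And>K x y. K \<in> \<K> \<Longrightarrow> x \<in> K \<Longrightarrow> y \<in> K \<Longrightarrow> dist x y \<le> d" "\<Omega> \<subseteq> near_boundary \<delta> \<union> \<Union>\<K>"
  using grid[OF d] by metis
 define V where "V = measure L\<Omega> \<Omega>"
 \<comment> \<open>The measure \<open>V\<close> of \<Omega> is a crude bound for that of every cell;
   the leading \<open>2\<close> comes from absorbing half of the integral.\<close>
 define C where "C = 2 * (2 powr (s - 1) * V)"
 show thesis
 proof (rule that[OF K(1,2)])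
  show "0 \<le> C" by (simp add: C_def V_def)
  fix \<phi> :: "'a \<Rightarrow> real" assume \<phi>: "smooth \<phi>"
  define I where "I = absint L\<Omega> s \<phi>"
  define D where "D = E s (grad \<phi>)"
  have D0: "0 \<le> D" by (simp add: D_def)
  have iI: "integrable L\<Omega> (\<lambda>x. indicator A x * \<bar>\<phi> x\<bar> powr s)" if "A \<in> sets borel" for A
   using integrable_continuous(2)[OF smooth_powr_continuous(1)[OF \<phi> s0] that] by simp
  have iD: "integrable L\<Omega> (\<lambda>x. indicator A x * norm (grad \<phi> x) powr s)" if "A \<in> sets borel" for A
   using integrable_continuous(2)[OF smooth_powr_continuous(2)[OF \<phi> s0] that] by simp
  note Kb = convex_bodyD(1)[OF K(2)]
  let ?n = "LINT x|L\<Omega>. indicator (near_boundary \<delta>) x * \<bar>\<phi> x\<bar> powr s" and ?g = "\<lambda>K. LINT x|L\<Omega>. indicator K x * norm (grad \<phi> x) powr s"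
   and ?u = "\<lambda>x. \<Sum>K\<in>\<K>. indicator K x * \<bar>\<phi> x\<bar> powr s"
  have near: "?n \<le> I / 2 + e / 4 * D"
  proof -
   have "h * ?n \<le> h * (M * \<delta> * (I + h powr s * D))"
    using C0(4)[OF \<delta> \<phi>] C0(2) by (simp add: M_def I_def D_def)
   then have "?n \<le> M * \<delta> * (I + h powr s * D)"
    using C0(2) by simp
   also have "\<dots> = M * \<delta> * I + M * \<delta> * h powr s * D" by (simp add: algebra_simps)
   also have "\<dots> \<le> 1 / 2 * I + e / 4 * D"
    using M\<delta> D0 by (intro add_mono mult_right_mono) (auto simp: I_def)
   finally show ?thesis by simp
  qed
  have body: "(LINT x|L\<Omega>. indicator K x * \<bar>\<phi> x\<bar> powr s)
    \<le> e / 4 * ?g K + 2 powr (s - 1) * V * \<bar>avg K \<phi>\<bar> powr s" if k: "K \<in> \<K>" for K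
  proof -
   let ?a = "avg K \<phi>"
   have sm: "smooth (\<lambda>x. \<phi> x - ?a)" by (intro smooth_diff \<phi> smooth_const)
   have i1: "integrable L\<Omega> (\<lambda>x. indicator K x * \<bar>\<phi> x - ?a\<bar> powr s)"
    using integrable_continuous(2)[OF smooth_powr_continuous(1)[OF sm s0] Kb[OF k]] by simp
   have "(LINT x|L\<Omega>. indicator K x * \<bar>\<phi> x\<bar> powr s) \<le> (LINT x|L\<Omega>. 2 powr (s - 1) * (indicator K x * \<bar>\<phi> x - ?a\<bar> powr s + \<bar>?a\<bar> powr s))"
   proof (rule integral_mono[OF iI[OF Kb[OF k]]])
    show "integrable L\<Omega> (\<lambda>x. 2 powr (s - 1) * (indicator K x * \<bar>\<phi> x - ?a\<bar> powr s + \<bar>?a\<bar> powr s))"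
     using i1 integrable_continuous(1)[of "\<lambda>_. \<bar>?a\<bar> powr s" UNIV] by simp
    fix x
    show "indicator K x * \<bar>\<phi> x\<bar> powr s \<le> 2 powr (s - 1) * (indicator K x * \<bar>\<phi> x - ?a\<bar> powr s + \<bar>?a\<bar> powr s)"
     using powr_norm_add_le[OF s, of "\<phi> x - ?a" ?a] by (simp add: indicator_def)
   qed
   also have "\<dots> = 2 powr (s - 1) * (LINT x|L\<Omega>. indicator K x * \<bar>\<phi> x - ?a\<bar> powr s) + 2 powr (s - 1) * V * \<bar>?a\<bar> powr s"
    using Bochner_Integration.integral_add[OF i1 integrable_continuous(1)[of "\<lambda>_. \<bar>?a\<bar> powr s" UNIV]]
    by (subst integral_mult_right_zero) (simp add: V_def distrib_left)
   also have "\<dots> \<le> 2 powr (s - 1) * (2 ^ DIM('a) * d powr s * ?g K) + 2 powr (s - 1) * V * \<bar>?a\<bar> powr s"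
    using K(4)[OF k] d by (intro add_right_mono mult_left_mono body_poincare K(2)[OF k] \<phi> s) auto
   also have "\<dots> = c * d powr s * ?g K + 2 powr (s - 1) * V * \<bar>?a\<bar> powr s"
    by (simp add: c_def)
   also have "\<dots> \<le> e / 4 * ?g K + 2 powr (s - 1) * V * \<bar>?a\<bar> powr s"
    by (intro add_right_mono mult_right_mono cd) auto
   finally show ?thesis .
  qed
  have indK: "(\<Sum>K\<in>\<K>. indicator K x * t) \<le> t" if "0 \<le> t" for x and t :: real
  proof (cases "x \<in> \<Union>\<K>")
   case True
   then obtain K where k: "K \<in> \<K>" "x \<in> K" by blast
   have "(\<Sum>K\<in>\<K>. indicator K x * t) = (\<Sum>K'\<in>{K}. indicator K' x * t)"
    using k K(1,3) by (intro sum.mono_neutral_right) (auto simp: pairwise_def disjnt_def indicator_def)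
   then show ?thesis using k by simp
  next
   case False
   then have "(\<Sum>K\<in>\<K>. indicator K x * t) = 0" by (intro sum.neutral) (auto simp: indicator_def)
   then show ?thesis using that by simp
  qed
  have "I \<le> (LINT x|L\<Omega>. indicator (near_boundary \<delta>) x * \<bar>\<phi> x\<bar> powr s + ?u x)"
   unfolding I_def
  proof (rule integral_mono)
   show "integrable L\<Omega> (\<lambda>x. \<bar>\<phi> x\<bar> powr s)" using integrable_continuous(1)[OF smooth_powr_continuous(1)[OF \<phi> s0], of UNIV] by simp
   show "integrable L\<Omega> (\<lambda>x. indicator (near_boundary \<delta>) x * \<bar>\<phi> x\<bar> powr s + ?u x)"
    by (intro Bochner_Integration.integrable_add Bochner_Integration.integrable_sum iI Kb near_boundary_borel)
   fix x assume "x \<in> space L\<Omega>"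
   then consider "x \<in> near_boundary \<delta>" | K where "K \<in> \<K>" "x \<in> K" using K(5) by auto
   then show "\<bar>\<phi> x\<bar> powr s \<le> indicator (near_boundary \<delta>) x * \<bar>\<phi> x\<bar> powr s + ?u x"
   proof cases
    case 1
    then show ?thesis by (simp add: sum_nonneg)
   next
    case 2
    then have "\<bar>\<phi> x\<bar> powr s \<le> ?u x"
     using member_le_sum[of K \<K> "\<lambda>K. indicator K x * \<bar>\<phi> x\<bar> powr s"] K(1) by simp
    then show ?thesis by (simp add: add_increasing)
   qed
  qed
  also have "\<dots> = ?n + (\<Sum>K\<in>\<K>. LINT x|L\<Omega>. indicator K x * \<bar>\<phi> x\<bar> powr s)"
   using iI Kb by (simp add: Bochner_Integration.integral_add Bochner_Integration.integral_sum)
  also have "\<dots> \<le> (I / 2 + e / 4 * D) + (\<Sum>K\<in>\<K>. e / 4 * ?g K + 2 powr (s - 1) * V * \<bar>avg K \<phi>\<bar> powr s)"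
   by (intro add_mono near sum_mono body)
  also have "(\<Sum>K\<in>\<K>. e / 4 * ?g K + 2 powr (s - 1) * V * \<bar>avg K \<phi>\<bar> powr s)
    = e / 4 * (LINT x|L\<Omega>. (\<Sum>K\<in>\<K>. indicator K x * norm (grad \<phi> x) powr s)) + 2 powr (s - 1) * V * (\<Sum>K\<in>\<K>. \<bar>avg K \<phi>\<bar> powr s)"
   using iD Kb by (simp add: sum.distrib sum_distrib_left Bochner_Integration.integral_sum)
  also have "(LINT x|L\<Omega>. (\<Sum>K\<in>\<K>. indicator K x * norm (grad \<phi> x) powr s)) \<le> D"
   unfolding D_def
  proof (rule integral_mono)
   show "integrable L\<Omega> (\<lambda>x. \<Sum>K\<in>\<K>. indicator K x * norm (grad \<phi> x) powr s)"
    by (intro Bochner_Integration.integrable_sum iD Kb)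
   show "integrable L\<Omega> (\<lambda>x. norm (grad \<phi> x) powr s)"
    using integrable_continuous(1)[OF smooth_powr_continuous(2)[OF \<phi> s0], of UNIV] by simp
  qed (simp add: indK)
  finally have "I \<le> (I / 2 + e / 4 * D) + (e / 4 * D + 2 powr (s - 1) * V * (\<Sum>K\<in>\<K>. \<bar>avg K \<phi>\<bar> powr s))"
   using e by simp
  then show "absint L\<Omega> s \<phi> \<le> e * E s (grad \<phi>) + C * (\<Sum>K\<in>\<K>. \<bar>avg K \<phi>\<bar> powr s)"
   by (simp add: I_def[symmetric] D_def[symmetric] C_def algebra_simps)
 qed
qed

text \<open>A small \<open>h\<close> makes the gradient part of the trace small, which uses
  \<open>s > 1\<close>; the price \<open>M / h\<close> in front of the domain integral is paid by
  the finer accuracy \<open>e'\<close> there. Only finitely many averages remain, which is the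
  compactness of the embeddings into domain and boundary in quantitative form.\<close>

theorem compactness_inequality:
 assumes s: "1 < s" and e: "0 < e"
 obtains \<K> C where "finite \<K>" "\<And>K. K \<in> \<K> \<Longrightarrow> convex_body K" "0 \<le> C"
  "\<And>\<phi>. smooth \<phi> \<Longrightarrow> absint L\<Omega> s \<phi> + absint \<sigma> s \<phi>
   \<le> e * E s (grad \<phi>) + C * (\<Sum>K\<in>\<K>. \<bar>avg K \<phi>\<bar> powr s)"
proof -
 have s1: "1 \<le> s" using s by simp
 obtain C0 h0 where C0': "0 \<le> C0" "0 < h0" "\<And>h s \<phi>. 0 < h \<Longrightarrow> h \<le> h0 \<Longrightarrow> 1 \<le> s \<Longrightarrow> smooth \<phi> \<Longrightarrow>
  h * absint \<sigma> s \<phi> \<le> 2 powr (s - 1) * C0 *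
   (absint L\<Omega> s \<phi> + h powr s * E s (grad \<phi>))"
  using trace_estimate by blast
 note C0 = C0'(1,2) C0'(3)[OF _ _ s1]
 define M where "M = 2 powr (s - 1) * C0"
 have M: "0 \<le> M" using C0 by (simp add: M_def)
 define h where "h = min h0 ((e / (2 * (M + 1))) powr (1 / (s - 1)))"
 have h: "0 < h" "h \<le> h0" using C0 M e by (auto simp: h_def)
 have Mh: "M * h powr (s - 1) \<le> e / 2"
 proof -
  have "h powr (s - 1) \<le> ((e / (2 * (M + 1))) powr (1 / (s - 1))) powr (s - 1)"
   using h s by (intro powr_mono2) (auto simp: h_def)
  also have "\<dots> = e / (2 * (M + 1))" using s e M by (simp add: powr_powr)
  finally have "(M + 1) * h powr (s - 1) \<le> (M + 1) * (e / (2 * (M + 1)))" using M by (intro mult_left_mono) auto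
  also have "\<dots> = e / 2"
  proof -
   have "M + 1 \<noteq> 0" using M by linarith
   then show ?thesis by (simp add: field_simps)
  qed
  finally show ?thesis using powr_ge_zero[of h "s - 1"] unfolding distrib_right by linarith
 qed
 define e' where "e' = e / (2 * (1 + M / h))"
 have Mh0: "0 < 1 + M / h" using M h by (simp add: add_pos_nonneg)
 have e': "0 < e'" using e Mh0 by (simp add: e'_def)
 obtain \<K> C where K: "finite \<K>" "\<And>K. K \<in> \<K> \<Longrightarrow> convex_body K" "0 \<le> C"
  "\<And>\<phi>. smooth \<phi> \<Longrightarrow> absint L\<Omega> s \<phi>
   \<le> e' * E s (grad \<phi>) + C * (\<Sum>K\<in>\<K>. \<bar>avg K \<phi>\<bar> powr s)"
  using interior_averages[OF s1 e'] by metis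
 show thesis
 proof (rule that[OF K(1,2)])
  show "0 \<le> (1 + M / h) * C" using Mh0 K(3) by simp
  fix \<phi> :: "'a \<Rightarrow> real" assume \<phi>: "smooth \<phi>"
  define I where "I = absint L\<Omega> s \<phi>"
  define D where "D = E s (grad \<phi>)"
  define T where "T = absint \<sigma> s \<phi>"
  define S where "S = (\<Sum>K\<in>\<K>. \<bar>avg K \<phi>\<bar> powr s)"
  have D0: "0 \<le> D" by (simp add: D_def)
  have "h * T \<le> M * (I + h powr s * D)"
   using C0(3)[OF h \<phi>] by (simp add: T_def M_def I_def D_def)
  then have "T \<le> M * (I + h powr s * D) / h" using h by (simp add: pos_le_divide_eq mult.commute)
  also have "\<dots> = (M / h) * I + M * h powr (s - 1) * D" using h by (simp add: powr_diff field_simps)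
  also have "\<dots> \<le> (M / h) * I + e / 2 * D" by (intro add_left_mono mult_right_mono Mh D0)
  finally have "I + T \<le> (1 + M / h) * I + e / 2 * D" by (simp add: distrib_right)
  also have "(1 + M / h) * I \<le> (1 + M / h) * (e' * D + C * S)"
   using K(4)[OF \<phi>] Mh0 by (intro mult_left_mono) (auto simp: I_def D_def S_def)
  also have "\<dots> = e / 2 * D + (1 + M / h) * C * S"
  proof -
   have "k * (e / (2 * k) * D + C * S) = e / 2 * D + k * C * S" if "0 < k" for k
    using that by (simp add: field_simps)
   then show ?thesis unfolding e'_def using Mh0 by blast
  qed
  finally show "absint L\<Omega> s \<phi> + absint \<sigma> s \<phi>
   \<le> e * E s (grad \<phi>) + (1 + M / h) * C * (\<Sum>K\<in>\<K>. \<bar>avg K \<phi>\<bar> powr s)"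
   by (simp add: I_def[symmetric] D_def[symmetric] T_def[symmetric] S_def[symmetric] mult.commute[of e])
 qed
qed

end

section \<open>Traces and compactness\<close>

lemma Lnorm_convergent_Cauchy:
 assumes f: "\<And>n. f n \<in> Lp M s" "g \<in> Lp M s" "1 \<le> s" and lim: "Lp_tendsto M s f g" and e: "0 < e"
 shows "\<exists>K. \<forall>m\<ge>K. \<forall>n\<ge>K. Lnorm M s (\<lambda>x. f m x - f n x) \<le> e"
proof -
 obtain K where K: "\<And>n. n \<ge> K \<Longrightarrow> Lnorm M s (\<lambda>x. f n x - g x) < e / 2"
  using order_tendstoD(2)[OF lim, of "e / 2"] e by (auto simp: eventually_sequentially)
 have "Lnorm M s (\<lambda>x. f m x - f n x) \<le> e" if "m \<ge> K" "n \<ge> K" for m n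
  using Lnorm_triangle_via[OF f(1)[of m] f(2) f(1)[of n] f(3)] K[OF that(1)] K[OF that(2)]
  by (simp add: Lnorm_minus_commute[of M s g])
 then show ?thesis by blast
qed

lemma Lnorm_tendsto_mono_exponent:
 assumes "finite_measure M" "\<And>n. f n \<in> Lp M s" "g \<in> Lp M s" "1 \<le> r" "r \<le> s"
  "Lp_tendsto M s f g"
 shows "Lp_tendsto M r f g"
proof (rule tendsto_sandwich[OF _ _ tendsto_const])
 have s: "1 \<le> s" using assms by simp
 show "(\<lambda>n. (measure M (space M) + 1) powr (1 / r) * Lnorm M s (\<lambda>x. f n x - g x)) \<longlonglongrightarrow> 0"
  using tendsto_mult_left[OF assms(6)] by simp
 show "\<forall>\<^sub>F n in sequentially. Lnorm M r (\<lambda>x. f n x - g x) \<le> (measure M (space M) + 1) powr (1 / r) * Lnorm M s (\<lambda>x. f n x - g x)"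
  by (intro always_eventually allI Lnorm_mono_exponent[OF assms(1) Lp_diff[OF assms(2,3) s] assms(4,5)])
qed simp

section \<open>Traces as limits of smooth approximations\<close>

context smooth_domain
begin

lemma smooth_Lp:
 assumes "smooth \<phi>" "1 \<le> s"
 shows "\<phi> \<in> Lp L\<Omega> s" "grad \<phi> \<in> Lp L\<Omega> s" "\<phi> \<in> Lp \<sigma> s"
 using assms by (auto intro!: continuous_Lp continuous_Lp_\<sigma> smooth_continuous continuous_on_grad)

lemma smooth_lin: "smooth \<phi> \<Longrightarrow> smooth \<psi> \<Longrightarrow> smooth (\<lambda>x. \<phi> x + k * \<psi> x)"
 by (intro smooth_add smooth_cmult)

lemma grad_lin: "smooth \<phi> \<Longrightarrow> smooth \<psi> \<Longrightarrow> grad (\<lambda>x. \<phi> x + k * \<psi> x) = (\<lambda>x. grad \<phi> x + k *\<^sub>R grad \<psi> x)"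
 by (simp add: grad_add grad_cmult smooth_cmult fun_eq_iff)

lemma trace_norm:
 assumes s: "1 \<le> s"
 obtains K where "0 \<le> K" "\<And>\<phi>. smooth \<phi> \<Longrightarrow> Lnorm \<sigma> s \<phi> \<le> K * (Lnorm L\<Omega> s \<phi> + Lnorm L\<Omega> s (grad \<phi>))"
proof -
 have s0: "0 < s" using s by simp
 obtain C h where C: "0 \<le> C" "0 < h" "\<And>\<phi>. smooth \<phi> \<Longrightarrow> h * absint \<sigma> s \<phi> \<le> 2 powr (s - 1) * C *
   (absint L\<Omega> s \<phi> + h powr s * E s (grad \<phi>))"
  using trace_estimate s by (metis order_refl)
 define K where "K = 2 powr (s - 1) * C * (1 + h powr s) / h"
 have K: "0 \<le> K" using C by (simp add: K_def)
 show thesis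
 proof
  show "0 \<le> K powr (1 / s)" by simp
  fix \<phi> :: "'a \<Rightarrow> real" assume \<phi>: "smooth \<phi>"
  let ?A = "Lnorm L\<Omega> s \<phi>" and ?D = "Lnorm L\<Omega> s (grad \<phi>)"
  have "h * absint \<sigma> s \<phi> \<le> 2 powr (s - 1) * C * (?A powr s + h powr s * ?D powr s)"
   using C(3)[OF \<phi>] by (simp add: Lnorm_powr s0)
  also have "\<dots> \<le> 2 powr (s - 1) * C * ((1 + h powr s) * (?A powr s + ?D powr s))"
   using C(1) by (intro mult_left_mono) (auto simp: algebra_simps)
  also have "\<dots> \<le> 2 powr (s - 1) * C * ((1 + h powr s) * (?A + ?D) powr s)"
   using C(1) by (intro mult_left_mono powr_add_superadditive s) auto
  finally have "absint \<sigma> s \<phi> \<le> K * (?A + ?D) powr s"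
   using C(2) by (simp add: K_def field_simps)
  also have "\<dots> = (K powr (1 / s) * (?A + ?D)) powr s"
   using s0 K by (simp add: powr_mult powr_powr)
  finally show "Lnorm \<sigma> s \<phi> \<le> K powr (1 / s) * (?A + ?D)"
   by (subst Lnorm_le_iff) (use s0 in auto)
 qed
qed

text \<open>Whatever is continuous in the three norms passes from smooth functions to such triples,
  and \<open>is_trace\<close> is this notion with \<open>wgrad\<close> as gradient. Because a triple
  keeps its sequence, linear combinations of triples are triples again.\<close>

definition conv :: "real \<Rightarrow> (nat \<Rightarrow> 'a \<Rightarrow> real) \<Rightarrow> ('a \<Rightarrow> real) \<Rightarrow> ('a \<Rightarrow> 'a) \<Rightarrow> ('a \<Rightarrow> real) \<Rightarrow> bool" where
 "conv s \<phi> u g t \<longleftrightarrow> (\<forall>n. smooth (\<phi> n)) \<and> u \<in> Lp L\<Omega> s \<and> g \<in> Lp L\<Omega> s \<and> t \<in> Lp \<sigma> s \<and>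
   Lp_tendsto L\<Omega> s \<phi> u \<and>
   Lp_tendsto L\<Omega> s (\<lambda>n. grad (\<phi> n)) g \<and>
   Lp_tendsto \<sigma> s \<phi> t"

lemma convD:
 assumes "conv s \<phi> u g t"
 shows "smooth (\<phi> n)" "u \<in> Lp L\<Omega> s" "g \<in> Lp L\<Omega> s" "t \<in> Lp \<sigma> s"
  "Lp_tendsto L\<Omega> s \<phi> u"
  "Lp_tendsto L\<Omega> s (\<lambda>n. grad (\<phi> n)) g"
  "Lp_tendsto \<sigma> s \<phi> t"
 using assms by (auto simp: conv_def)

lemma conv_mono_exponent:
 assumes c: "conv s \<phi> u g t" and r: "1 \<le> r" "r \<le> s"
 shows "conv r \<phi> u g t"
proof -
 have s: "1 \<le> s" using r by simp
 note sm = smooth_Lp[OF convD(1)[OF c] s]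
 show ?thesis
  unfolding conv_def using convD(1)[OF c] Lp_mono_exponent(1)[OF finite_L\<Omega> convD(2)[OF c] r]
   Lp_mono_exponent(1)[OF finite_L\<Omega> convD(3)[OF c] r] Lp_mono_exponent(1)[OF finite_\<sigma> convD(4)[OF c] r]
   Lnorm_tendsto_mono_exponent[OF finite_L\<Omega> sm(1) convD(2)[OF c] r convD(5)[OF c]]
   Lnorm_tendsto_mono_exponent[OF finite_L\<Omega> sm(2) convD(3)[OF c] r convD(6)[OF c]]
   Lnorm_tendsto_mono_exponent[OF finite_\<sigma> sm(3) convD(4)[OF c] r convD(7)[OF c]] by blast
qed

lemma conv_Lnorm:
 assumes c: "conv s \<phi> u g t" and s: "1 \<le> s"
 shows "(\<lambda>n. Lnorm L\<Omega> s (\<phi> n)) \<longlonglongrightarrow> Lnorm L\<Omega> s u" "(\<lambda>n. Lnorm L\<Omega> s (grad (\<phi> n))) \<longlonglongrightarrow> Lnorm L\<Omega> s g"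
  "(\<lambda>n. Lnorm \<sigma> s (\<phi> n)) \<longlonglongrightarrow> Lnorm \<sigma> s t"
 using smooth_Lp[OF convD(1)[OF c] s]
 by (intro tendsto_Lnorm[OF _ _ s] convD[OF c]; simp)+

lemma conv_smooth: "smooth \<phi> \<Longrightarrow> 1 \<le> s \<Longrightarrow> conv s (\<lambda>_. \<phi>) \<phi> (grad \<phi>) \<phi>"
 using smooth_Lp by (simp add: conv_def)

lemma conv_lin:
 assumes c: "conv s \<phi> u g t" and c': "conv s \<psi> u' g' t'" and s: "1 \<le> s"
 shows "conv s (\<lambda>n x. \<phi> n x + k * \<psi> n x) (\<lambda>x. u x + k * u' x) (\<lambda>x. g x + k *\<^sub>R g' x) (\<lambda>x. t x + k * t' x)"
proof -
 note d = convD[OF c] and d' = convD[OF c']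
 note sm = smooth_Lp[OF d(1) s] and sm' = smooth_Lp[OF d'(1) s]
 have g: "grad (\<lambda>x. \<phi> n x + k * \<psi> n x) x = grad (\<phi> n) x + k *\<^sub>R grad (\<psi> n) x" for n x
  by (simp add: grad_lin[OF d(1) d'(1)])
 show ?thesis
  unfolding conv_def g
 proof (intro conjI allI)
  show "smooth (\<lambda>x. \<phi> n x + k * \<psi> n x)" for n by (rule smooth_lin[OF d(1) d'(1)])
  show "(\<lambda>x. u x + k * u' x) \<in> Lp L\<Omega> s" "(\<lambda>x. g x + k *\<^sub>R g' x) \<in> Lp L\<Omega> s" "(\<lambda>x. t x + k * t' x) \<in> Lp \<sigma> s"
   by (rule Lp_add[OF d(2) Lp_cmult[OF d'(2)] s] Lp_add[OF d(3) Lp_scaleR[OF d'(3)] s] Lp_add[OF d(4) Lp_cmult[OF d'(4)] s])+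
 qed (use Lnorm_lin_tendsto[OF sm(1) sm'(1) d(2) d'(2) s d(5) d'(5), of k]
   Lnorm_lin_tendsto[OF sm(2) sm'(2) d(3) d'(3) s d(6) d'(6), of k]
   Lnorm_lin_tendsto[OF sm(3) sm'(3) d(4) d'(4) s d(7) d'(7), of k] in \<open>simp_all only: real_scaleR_def\<close>)
qed

lemma conv_zero_trace:
 assumes c: "conv s \<phi> u g t" and s: "1 \<le> s" and z: "AE x in L\<Omega>. u x = 0" "AE x in L\<Omega>. g x = 0"
 shows "AE x in \<sigma>. t x = 0"
proof -
 have s0: "0 < s" using s by simp
 obtain K where K: "\<And>\<phi>. smooth \<phi> \<Longrightarrow> Lnorm \<sigma> s \<phi> \<le> K * (Lnorm L\<Omega> s \<phi> + Lnorm L\<Omega> s (grad \<phi>))"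
  using trace_norm[OF s] by metis
 have "Lnorm L\<Omega> s u = 0" "Lnorm L\<Omega> s g = 0"
  using Lnorm_cong_AE[OF LpD(1)[OF convD(2)[OF c]] _ z(1), of s] Lnorm_cong_AE[OF LpD(1)[OF convD(3)[OF c]] _ z(2), of s] s0 by auto
 then have "(\<lambda>n. K * (Lnorm L\<Omega> s (\<phi> n) + Lnorm L\<Omega> s (grad (\<phi> n)))) \<longlonglongrightarrow> 0"
  using tendsto_mult_left[OF tendsto_add[OF conv_Lnorm(1,2)[OF c s]], of K] by simp
 then have "Lnorm \<sigma> s t \<le> 0"
  by (rule LIMSEQ_le[OF conv_Lnorm(3)[OF c s]]) (use K convD(1)[OF c] in blast)
 then show ?thesis using Lnorm_eq_0[OF convD(4)[OF c] s0] by (simp add: order_antisym)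
qed

text \<open>The difference of the two triples has zero function and zero gradient, so its trace
  vanishes by the trace inequality. The trace thus depends neither on the sequence nor on
  representatives.\<close>

lemma conv_trace_unique:
 assumes c: "conv s \<phi> u g t" and c': "conv s \<psi> u' g' t'" and s: "1 \<le> s"
  and eq: "AE x in L\<Omega>. u x = u' x" "AE x in L\<Omega>. g x = g' x"
 shows "AE x in \<sigma>. t x = t' x"
proof -
 have "AE x in \<sigma>. t x + (-1) * t' x = 0"
  by (rule conv_zero_trace[OF conv_lin[OF c c' s] s]) (use eq in auto)
 then show ?thesis by simp
qed

text \<open>The trace inequality, applied to differences, turns convergence in the Sobolev norm into
  a Cauchy property on the boundary.\<close>

lemma conv_exists:
 assumes u: "u \<in> Sobolev \<Omega> s" and s: "1 \<le> s"
 shows "\<exists>\<phi> t. conv s \<phi> u (wgrad \<Omega> u) t"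
proof -
 obtain \<phi> where \<phi>: "\<And>n::nat. smooth (\<phi> n)" and lim: "Lp_tendsto L\<Omega> s \<phi> u"
  "Lp_tendsto L\<Omega> s (\<lambda>n. grad (\<phi> n)) (wgrad \<Omega> u)"
  using smooth_dense[OF u s] by (auto simp: approximable_def)
 obtain K where K: "0 \<le> K" "\<And>\<phi>. smooth \<phi> \<Longrightarrow> Lnorm \<sigma> s \<phi> \<le> K * (Lnorm L\<Omega> s \<phi> + Lnorm L\<Omega> s (grad \<phi>))"
  using trace_norm[OF s] by metis
 note sm = smooth_Lp[OF \<phi> s]
 note uL = Sobolev_Lp[OF u] Sobolev_wgrad(2)[OF u]
 have "\<exists>t\<in>Lp \<sigma> s. Lp_tendsto \<sigma> s \<phi> t"
 proof -
  have "\<exists>k. \<forall>m\<ge>k. \<forall>n\<ge>k. Lnorm \<sigma> s (\<lambda>x. \<phi> m x - \<phi> n x) \<le> e" if e: "0 < e" for e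
  proof -
   have e': "0 < e / (2 * (K + 1))" using e K by simp
   obtain k1 where k1: "\<forall>m\<ge>k1. \<forall>n\<ge>k1. Lnorm L\<Omega> s (\<lambda>x. \<phi> m x - \<phi> n x) \<le> e / (2 * (K + 1))"
    using Lnorm_convergent_Cauchy[OF sm(1) uL(1) s lim(1) e'] by blast
   obtain k2 where k2: "\<forall>m\<ge>k2. \<forall>n\<ge>k2. Lnorm L\<Omega> s (\<lambda>x. grad (\<phi> m) x - grad (\<phi> n) x) \<le> e / (2 * (K + 1))"
    using Lnorm_convergent_Cauchy[OF sm(2) uL(2) s lim(2) e'] by blast
   have "Lnorm \<sigma> s (\<lambda>x. \<phi> m x - \<phi> n x) \<le> e" if "m \<ge> max k1 k2" "n \<ge> max k1 k2" for m n
   proof -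
    have "Lnorm \<sigma> s (\<lambda>x. \<phi> m x - \<phi> n x) \<le> K * (Lnorm L\<Omega> s (\<lambda>x. \<phi> m x - \<phi> n x) + Lnorm L\<Omega> s (\<lambda>x. grad (\<phi> m) x - grad (\<phi> n) x))"
     using K(2)[OF smooth_diff[OF \<phi>[of m] \<phi>[of n]]] by (simp add: fun_eq_iff grad_diff[OF \<phi>[of m] \<phi>[of n], abs_def])
    also have "\<dots> \<le> (K + 1) * (e / (2 * (K + 1)) + e / (2 * (K + 1)))"
     using K(1) k1 k2 that by (intro mult_mono add_mono) auto
    also have "\<dots> = e"
    proof -
     have "k * (e / (2 * k) + e / (2 * k)) = e" if "k \<noteq> 0" for k using that by simp
     then show ?thesis using K(1) by (smt (verit))
    qed
    finally show ?thesis .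
   qed
   then show ?thesis by blast
  qed
  then show ?thesis by (rule Lp_complete[of \<phi>, OF sm(3) s]) blast+
 qed
 then show ?thesis using \<phi> lim uL by (auto simp: conv_def)
qed

lemma is_trace_iff: "1 \<le> s \<Longrightarrow> is_trace \<Omega> s u t \<longleftrightarrow> u \<in> Sobolev \<Omega> s \<and> (\<exists>\<phi>. conv s \<phi> u (wgrad \<Omega> u) t)"
 using Sobolev_Lp[of u s] Sobolev_wgrad(2)[of u s]
 by (auto simp: is_trace_def conv_def tendsto_Lnorm_iff)

lemma Sobolev_conv:
 assumes u: "u \<in> Sobolev \<Omega> s" and s: "1 \<le> s"
 shows "\<exists>\<phi>. conv s \<phi> u (wgrad \<Omega> u) (boundary_trace \<Omega> s u)"
proof -
 have "\<exists>t. is_trace \<Omega> s u t" using conv_exists[OF u s] u s by (auto simp: is_trace_iff)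
 then have "is_trace \<Omega> s u (boundary_trace \<Omega> s u)" unfolding boundary_trace_def by (rule someI_ex)
 then show ?thesis by (simp add: is_trace_iff s)
qed

text \<open>Weak gradients are stable under limits, so limits of smooth sequences are recognised as
  Sobolev functions; uniqueness makes the arbitrarily chosen \<open>wgrad\<close> and
  \<open>boundary_trace\<close> agree with the limits almost everywhere.\<close>

lemma conv_Sobolev:
 assumes c: "conv s \<phi> u g t" and s: "1 \<le> s"
 shows "u \<in> Sobolev \<Omega> s" "AE x in L\<Omega>. wgrad \<Omega> u x = g x" "AE x in \<sigma>. boundary_trace \<Omega> s u x = t x"
proof -
 note d = convD[OF c]
 have w: "weak_gradient \<Omega> u g"
  using smooth_weak_gradient[OF d(1)] smooth_Lp(1,2)[OF d(1) s] d(2,3) s d(5,6) by (rule weak_gradient_limit)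
 show u: "u \<in> Sobolev \<Omega> s" using d(2,3) w by (rule SobolevI)
 show g: "AE x in L\<Omega>. wgrad \<Omega> u x = g x" using u w by (rule wgrad_AE_eq)
 obtain \<psi> where "conv s \<psi> u (wgrad \<Omega> u) (boundary_trace \<Omega> s u)" using Sobolev_conv[OF u s] by blast
 then show "AE x in \<sigma>. boundary_trace \<Omega> s u x = t x" using c s by (rule conv_trace_unique) (use g in auto)
qed

section \<open>Compactness modulo constants\<close>

lemma avg_lin:
 assumes K: "convex_body K" and \<phi>: "smooth \<phi>" and \<psi>: "smooth \<psi>"
 shows "avg K (\<lambda>x. \<phi> x + k * \<psi> x) = avg K \<phi> + k * avg K \<psi>"
proof -
 note kb = convex_bodyD[OF K]
 have i: "integrable lborel (\<lambda>x. indicator K x * f x)" if f: "smooth f" for f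
 proof -
  have "integrable lborel (\<lambda>x. indicator K x *\<^sub>R (indicator (closure \<Omega>) x *\<^sub>R f x))"
   using bounded_\<Omega> by (intro integrable_mult_indicator borel_integrable_compact smooth_continuous f) (auto simp: kb(1))
  moreover have "(\<lambda>x. indicator K x *\<^sub>R (indicator (closure \<Omega>) x *\<^sub>R f x)) = (\<lambda>x. indicator K x * f x)"
   using kb(3) closure_subset[of \<Omega>] by (auto simp: indicator_def fun_eq_iff)
  ultimately show ?thesis by simp
 qed
 have "(\<lambda>x. indicator K x * (\<phi> x + k * \<psi> x)) = (\<lambda>x. indicator K x * \<phi> x + k * (indicator K x * \<psi> x))"
  by (simp add: algebra_simps)
 then show ?thesis using i[OF \<phi>] i[OF \<psi>] by (simp add: avg_def add_divide_distrib)
qed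

lemma avg_const: "convex_body K \<Longrightarrow> avg K (\<lambda>_. c) = c"
 using convex_bodyD[of K] by (simp add: avg_def)

text \<open>A fixed reference body: subtracting the average over it settles the additive constant of
  a function.\<close>

definition base :: "'a set" where "base = (SOME K. convex_body K)"

lemma base: "convex_body base"
proof -
 obtain x where "x \<in> \<Omega>" using nonempty_\<Omega> by blast
 then obtain r where "0 < r" "ball x r \<subseteq> \<Omega>" using open_\<Omega> open_contains_ball by blast
 then have "convex_body (ball x r)" by (rule convex_body_ball)
 then show ?thesis unfolding base_def by (rule someI)
qed

text \<open>With \<open>p = r\<close> this is a Poincare inequality including the boundary values; for \<open>p < r\<close> it
 is an Ehrling-type inequality.\<close>

lemma mean_inequality:
 assumes r: "1 < r" and p: "1 \<le> p" and e: "0 < e"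
 obtains C where "0 \<le> C" "\<And>\<phi>. smooth \<phi> \<Longrightarrow>
  (LINT x|L\<Omega>. \<bar>\<phi> x - avg base \<phi>\<bar> powr r) + (LINT x|\<sigma>. \<bar>\<phi> x - avg base \<phi>\<bar> powr r)
  \<le> e * E r (grad \<phi>) + C * E p (grad \<phi>) powr (r / p)"
proof (rule compactness_inequality[OF r e], goal_cases)
 case (1 \<K> C)
 note K = 1(2,3) and C = 1(4) and ineq = 1(5)
 \<comment> \<open>All averages that occur are compared with the one over \<open>base\<close> by
   means of the \<open>p\<close>-energy, although the inequality is for exponent \<open>r\<close>;
   this is where the power \<open>r / p\<close> comes from.\<close>
 have "\<forall>K\<in>\<K>. \<exists>c\<ge>0. \<forall>\<phi>. smooth \<phi> \<longrightarrow> \<bar>avg K \<phi> - avg base \<phi>\<bar> powr p \<le> c * E p (grad \<phi>)"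
  using linked_bodies[OF K(2) base p] by (simp add: linked_def)
 then obtain c where c: "\<And>K. K \<in> \<K> \<Longrightarrow> 0 \<le> c K" "\<And>K \<phi>. K \<in> \<K> \<Longrightarrow> smooth \<phi> \<Longrightarrow>
   \<bar>avg K \<phi> - avg base \<phi>\<bar> powr p \<le> c K * E p (grad \<phi>)"
  by metis
 show thesis
 proof (rule 1(1))
  show "0 \<le> C * (\<Sum>K\<in>\<K>. c K powr (r / p))" using C by (simp add: sum_nonneg)
  fix \<phi> :: "'a \<Rightarrow> real" assume \<phi>: "smooth \<phi>"
  define D where "D = E p (grad \<phi>)"
  let ?m = "avg base \<phi>"
  have g: "grad (\<lambda>x. \<phi> x - ?m) x = grad \<phi> x" for x
   by (simp add: grad_diff[OF \<phi> smooth_const])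
  have a: "avg K (\<lambda>x. \<phi> x - ?m) = avg K \<phi> - ?m" if "K \<in> \<K>" for K
   using avg_lin[OF K(2)[OF that] \<phi> smooth_const[of 1], of "- ?m"] avg_const[OF K(2)[OF that], of 1] by simp
  have "\<bar>avg K \<phi> - ?m\<bar> powr r \<le> c K powr (r / p) * D powr (r / p)" if k: "K \<in> \<K>" for K
  proof -
   have "\<bar>avg K \<phi> - ?m\<bar> powr r = (\<bar>avg K \<phi> - ?m\<bar> powr p) powr (r / p)" using p by (simp add: powr_powr)
   also have "\<dots> \<le> (c K * D) powr (r / p)"
    using c(2)[OF k \<phi>] r p by (intro powr_mono2) (auto simp: D_def)
   finally show ?thesis using c(1)[OF k] by (simp add: powr_mult D_def)
  qed
  then have "(\<Sum>K\<in>\<K>. \<bar>avg K \<phi> - ?m\<bar> powr r) \<le> (\<Sum>K\<in>\<K>. c K powr (r / p)) * D powr (r / p)"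
   by (simp add: sum_distrib_right sum_mono)
  then have "C * (\<Sum>K\<in>\<K>. \<bar>avg K \<phi> - ?m\<bar> powr r) \<le> C * (\<Sum>K\<in>\<K>. c K powr (r / p)) * D powr (r / p)"
   using mult_left_mono[OF _ C] by (fastforce simp: mult.assoc)
  then show "(LINT x|L\<Omega>. \<bar>\<phi> x - ?m\<bar> powr r) + (LINT x|\<sigma>. \<bar>\<phi> x - ?m\<bar> powr r)
    \<le> e * E r (grad \<phi>) + C * (\<Sum>K\<in>\<K>. c K powr (r / p)) * D powr (r / p)"
   using ineq[OF smooth_diff[OF \<phi> smooth_const[of ?m]]] by (simp add: g a)
 qed
qed

text \<open>For each accuracy \<open>1 / (k + 1)\<close> the compactness inequality involves
  finitely many averages, hence countably many altogether. They are bounded along the sequence and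
  converge simultaneously for a subsequence, which the inequality then makes Cauchy in both
  norms.\<close>

lemma rellich:
 assumes s: "1 < s" and \<phi>: "\<And>n::nat. smooth (\<phi> n)" "\<And>n. avg base (\<phi> n) = 0" and R: "\<And>n. Lnorm L\<Omega> s (grad (\<phi> n)) \<le> R"
 obtains r :: "nat \<Rightarrow> nat" where "strict_mono r"
  "\<And>e. 0 < e \<Longrightarrow> \<exists>k. \<forall>m\<ge>k. \<forall>n\<ge>k. Lnorm L\<Omega> s (\<lambda>x. \<phi> (r m) x - \<phi> (r n) x) \<le> e"
  "\<And>e. 0 < e \<Longrightarrow> \<exists>k. \<forall>m\<ge>k. \<forall>n\<ge>k. Lnorm \<sigma> s (\<lambda>x. \<phi> (r m) x - \<phi> (r n) x) \<le> e"
proof -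
 have s1: "1 \<le> s" and s0: "0 < s" using s by auto
 have R0: "0 \<le> R" using R[of 0] Lnorm_nonneg order_trans by blast
 have gR: "E s (grad (\<phi> n)) \<le> R powr s" for n
  using R[of n] Lnorm_le_iff[OF s0 R0] by blast
 have "\<forall>k::nat. \<exists>\<K> C. finite \<K> \<and> (\<forall>K\<in>\<K>. convex_body K) \<and> 0 \<le> C \<and> (\<forall>\<phi>. smooth \<phi> \<longrightarrow>
   absint L\<Omega> s \<phi> + absint \<sigma> s \<phi>
   \<le> inverse (Suc k) * E s (grad \<phi>) + C * (\<Sum>K\<in>\<K>. \<bar>avg K \<phi>\<bar> powr s))"
 proof (rule allI, goal_cases)
  case (1 k)
  have "0 < inverse (real (Suc k))" by simp
  then show ?case by (rule compactness_inequality[OF s]) blast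
 qed
 then obtain \<K> C where K: "\<And>k::nat. finite (\<K> k)" "\<And>k K. K \<in> \<K> k \<Longrightarrow> convex_body K" "\<And>k. 0 \<le> C k"
  and ineq: "\<And>k \<phi>. smooth \<phi> \<Longrightarrow> absint L\<Omega> s \<phi> + absint \<sigma> s \<phi>
   \<le> inverse (Suc k) * E s (grad \<phi>) + C k * (\<Sum>K\<in>\<K> k. \<bar>avg K \<phi>\<bar> powr s)"
  by metis
 define \<U> where "\<U> = insert base (\<Union>k. \<K> k)"
 have U: "countable \<U>" "\<U> \<noteq> {}" using K(1) by (auto simp: \<U>_def countable_finite)
 have Ub: "convex_body K" if "K \<in> \<U>" for K using that base K(2) by (auto simp: \<U>_def)
 define f where "f n j = avg (from_nat_into \<U> j) (\<phi> n)" for n j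
 have "\<exists>b. \<forall>n. \<bar>f n j\<bar> \<le> b" for j
 proof -
  obtain c where c: "\<And>\<phi>. smooth \<phi> \<Longrightarrow>
   \<bar>avg (from_nat_into \<U> j) \<phi> - avg base \<phi>\<bar> powr s \<le> c * E s (grad \<phi>)" "0 \<le> c"
   using linked_bodies[OF Ub[OF from_nat_into[OF U(2), of j]] base s1] by (auto simp: linked_def)
  have "\<bar>f n j\<bar> \<le> (c * R powr s) powr (1 / s)" for n
  proof -
   have "\<bar>f n j\<bar> powr s \<le> c * R powr s"
    using c(1)[OF \<phi>(1)[of n]] mult_left_mono[OF gR[of n] c(2)] by (simp add: f_def \<phi>(2))
   then have "(\<bar>f n j\<bar> powr s) powr (1 / s) \<le> (c * R powr s) powr (1 / s)" using s0 by (intro powr_mono2) auto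
   then show ?thesis using s0 by (simp add: powr_powr)
  qed
  then show ?thesis by blast
 qed
 then obtain b where b: "\<And>n j. \<bar>f n j\<bar> \<le> b j" by metis
 \<comment> \<open>Compactness of a countable product of intervals takes the place of a diagonal
   argument.\<close>
 have "compactin (product_topology (\<lambda>_. euclidean) UNIV) (PiE UNIV (\<lambda>j. cball (0::real) (b j)))"
  by (simp add: compactin_PiE)
 then have "seq_compact (PiE UNIV (\<lambda>j::nat. cball (0::real) (b j)))"
  by (simp add: euclidean_product_topology compact_eq_seq_compact_metric)
 moreover have "\<forall>n. f n \<in> PiE UNIV (\<lambda>j. cball 0 (b j))" using b by (auto simp: f_def)
 ultimately obtain l r where r: "strict_mono r" and l: "(f \<circ> r) \<longlonglongrightarrow> l"
  unfolding seq_compact_def by metis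
 have avg_lim: "\<exists>a. (\<lambda>n. avg K (\<phi> (r n))) \<longlonglongrightarrow> a" if "K \<in> \<U>" for K
 proof -
  from from_nat_into_surj[OF U(1) that] obtain j where j: "K = from_nat_into \<U> j" by blast
  have "(\<lambda>n. (f \<circ> r) n j) \<longlonglongrightarrow> l j"
   using continuous_on_tendsto_compose[OF continuous_on_product_coordinates l] by simp
  then show ?thesis by (auto simp: f_def j)
 qed
 let ?d = "\<lambda>m n x. \<phi> (r m) x - \<phi> (r n) x"
 have main: "\<exists>k. \<forall>m\<ge>k. \<forall>n\<ge>k. absint L\<Omega> s (?d m n) + absint \<sigma> s (?d m n) \<le> e powr s"
  if e: "0 < e" for e
 proof -
  obtain k where k: "inverse (Suc k) * (2 * R) powr s < e powr s / 2"
  proof -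
   have "0 < (e powr s / 2) / ((2 * R) powr s + 1)" using e by (auto intro!: divide_pos_pos add_nonneg_pos)
   then obtain k where k: "inverse (real (Suc k)) < (e powr s / 2) / ((2 * R) powr s + 1)"
    using reals_Archimedean by blast
   then have "inverse (real (Suc k)) * ((2 * R) powr s + 1) < e powr s / 2"
    by (subst (asm) pos_less_divide_eq) (auto intro: add_nonneg_pos)
   then have "inverse (real (Suc k)) * (2 * R) powr s < e powr s / 2"
    using inverse_nonnegative_iff_nonnegative[of "real (Suc k)"] unfolding distrib_left by linarith
   then show ?thesis by (rule that)
  qed
  \<comment> \<open>A limit over pairs of indices expresses that the averages of differences become
    small.\<close>
  have "((\<lambda>z. C k * (\<Sum>K\<in>\<K> k. \<bar>avg K (\<phi> (r (fst z))) - avg K (\<phi> (r (snd z)))\<bar> powr s)) \<longlongrightarrow> C k * (\<Sum>K\<in>\<K> k. 0)) (sequentially \<times>\<^sub>F sequentially)"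
  proof (intro tendsto_mult_left tendsto_sum)
   fix K assume "K \<in> \<K> k"
   then obtain a where a: "(\<lambda>n. avg K (\<phi> (r n))) \<longlonglongrightarrow> a" using avg_lim by (auto simp: \<U>_def)
   have "((\<lambda>z. \<bar>avg K (\<phi> (r (fst z))) - avg K (\<phi> (r (snd z)))\<bar> powr s) \<longlongrightarrow> \<bar>a - a\<bar> powr s) (sequentially \<times>\<^sub>F sequentially)"
    by (intro tendsto_powr2 tendsto_rabs tendsto_diff filterlim_compose[OF a filterlim_fst] filterlim_compose[OF a filterlim_snd] tendsto_const)
     (use s0 in auto)
   then show "((\<lambda>z. \<bar>avg K (\<phi> (r (fst z))) - avg K (\<phi> (r (snd z)))\<bar> powr s) \<longlongrightarrow> 0) (sequentially \<times>\<^sub>F sequentially)" by simp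
  qed
  then have "\<forall>\<^sub>F z in sequentially \<times>\<^sub>F sequentially. C k * (\<Sum>K\<in>\<K> k. \<bar>avg K (\<phi> (r (fst z))) - avg K (\<phi> (r (snd z)))\<bar> powr s) < e powr s / 2"
   by (rule order_tendstoD(2)) (use e in simp)
  then obtain n0 where n0: "\<And>m n. m \<ge> n0 \<Longrightarrow> n \<ge> n0 \<Longrightarrow> C k * (\<Sum>K\<in>\<K> k. \<bar>avg K (\<phi> (r m)) - avg K (\<phi> (r n))\<bar> powr s) < e powr s / 2"
   unfolding eventually_prod_sequentially by auto
  have "absint L\<Omega> s (?d m n) + absint \<sigma> s (?d m n) \<le> e powr s"
   if "m \<ge> n0" "n \<ge> n0" for m n
  proof -
   note sm = \<phi>(1)[of "r m"] \<phi>(1)[of "r n"]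
   have g: "grad (?d m n) x = grad (\<phi> (r m)) x - grad (\<phi> (r n)) x" for x
    by (rule grad_diff[OF sm])
   have a: "avg K (?d m n) = avg K (\<phi> (r m)) - avg K (\<phi> (r n))" if "K \<in> \<K> k" for K
    using avg_lin[OF K(2)[OF that] sm, of "-1"] by simp
   have "Lnorm L\<Omega> s (\<lambda>x. grad (\<phi> (r m)) x - grad (\<phi> (r n)) x) \<le> 2 * R"
    using Lnorm_triangle_diff[OF smooth_Lp(2)[OF sm(1) s1] smooth_Lp(2)[OF sm(2) s1] s1] R[of "r m"] R[of "r n"] by linarith
   then have "(LINT x|L\<Omega>. norm (grad (\<phi> (r m)) x - grad (\<phi> (r n)) x) powr s) \<le> (2 * R) powr s"
    using Lnorm_le_iff[OF s0, of "2 * R"] R0 by (metis mult_nonneg_nonneg zero_le_numeral)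
   then have "inverse (Suc k) * (LINT x|L\<Omega>. norm (grad (\<phi> (r m)) x - grad (\<phi> (r n)) x) powr s) \<le> inverse (Suc k) * (2 * R) powr s"
    by (intro mult_left_mono) auto
   moreover note ineq[OF smooth_diff[OF sm], of k, simplified g sum.cong[OF refl, of "\<K> k", OF arg_cong[where f = "\<lambda>t. \<bar>t\<bar> powr s", OF a]]]
   ultimately show ?thesis using n0[OF that] k by linarith
  qed
  then show ?thesis by blast
 qed
 have le: "Lnorm M s f \<le> e" if "0 < e" "(LINT x|M. norm (f x) powr s) + b \<le> e powr s" "0 \<le> b" for M :: "'a measure" and f :: "'a \<Rightarrow> real" and b e
  using that s0 by (subst Lnorm_le_iff) auto
 show thesis
 proof (rule that[OF r])
  fix e :: real assume e: "0 < e"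
  obtain k where k: "\<And>m n. m \<ge> k \<Longrightarrow> n \<ge> k \<Longrightarrow> absint L\<Omega> s (?d m n) + absint \<sigma> s (?d m n) \<le> e powr s"
   using main[OF e] by blast
  show "\<exists>k. \<forall>m\<ge>k. \<forall>n\<ge>k. Lnorm L\<Omega> s (?d m n) \<le> e"
   by (intro exI[of _ k] allI impI le[OF e, where b = "absint \<sigma> s (?d m n)" for m n])
    (use k in auto)
  show "\<exists>k. \<forall>m\<ge>k. \<forall>n\<ge>k. Lnorm \<sigma> s (?d m n) \<le> e"
   by (intro exI[of _ k] allI impI le[OF e, where b = "absint L\<Omega> s (?d m n)" for m n])
    (use k in \<open>auto simp: add.commute\<close>)
 qed
qed

end

section \<open>Distance to the constants\<close>

text \<open>Functions come in pairs, values in the domain and values on the boundary, for the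
  measures with densities \<open>a\<close> and \<open>b\<close>. The two are treated as unrelated,
  since the distance to the constants concerns only a product of two Lebesgue spaces.\<close>

locale two_measures =
 fixes M1 M2 :: "'a measure" and q :: real
 assumes fin: "finite_measure M1" "finite_measure M2" and q1: "1 < q"
  and nontrivial: "0 < measure M1 (space M1) + measure M2 (space M2)"
begin

definition Mass :: "('a \<Rightarrow> real) \<Rightarrow> ('a \<Rightarrow> real) \<Rightarrow> real" where
 "Mass f g = (LINT x|M1. \<bar>f x\<bar> powr q) + (LINT x|M2. \<bar>g x\<bar> powr q)"

definition N :: "('a \<Rightarrow> real) \<Rightarrow> ('a \<Rightarrow> real) \<Rightarrow> real" where
 "N f g = Mass f g powr (1 / q)"

definition m :: "('a \<Rightarrow> real) \<Rightarrow> ('a \<Rightarrow> real) \<Rightarrow> real" where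
 "m f g = (INF c. N (\<lambda>x. f x + c) (\<lambda>x. g x + c))"

definition B :: "('a \<Rightarrow> real) \<Rightarrow> ('a \<Rightarrow> real) \<Rightarrow> ('a \<Rightarrow> real) \<Rightarrow> ('a \<Rightarrow> real) \<Rightarrow> real" where
 "B f g h k = (LINT x|M1. dual_pow q (f x) * h x) + (LINT x|M2. dual_pow q (g x) * k x)"

abbreviation X :: "('a \<Rightarrow> real) \<Rightarrow> ('a \<Rightarrow> real) \<Rightarrow> bool" where
 "X f g \<equiv> f \<in> Lp M1 q \<and> g \<in> Lp M2 q"

lemma Mass_nonneg [simp]: "0 \<le> Mass f g" by (simp add: Mass_def)

lemma N_nonneg [simp]: "0 \<le> N f g" by (simp add: N_def)

lemma N_powr: "N f g powr q = Mass f g" using q1 by (simp add: N_def powr_powr)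

text \<open>The pair is measured by the two-point \<open>l^q\<close> norm of its two Lebesgue norms,
  so Minkowski's inequality on a counting measure completes the triangle inequality.\<close>

lemma N_Lnorm: "N f g = Lnorm (count_space UNIV) q (\<lambda>i. if i then Lnorm M1 q f else Lnorm M2 q g)"
 unfolding Lnorm_def[of "count_space UNIV"]
 using q1 by (simp add: N_def lebesgue_integral_count_space_finite UNIV_bool Lnorm_powr Mass_def add.commute)

lemma N_triangle:
 assumes "X f g" "X h k"
 shows "N (\<lambda>x. f x + h x) (\<lambda>x. g x + k x) \<le> N f g + N h k"
proof -
 let ?C = "count_space (UNIV :: bool set)"
 let ?L = "\<lambda>f g i. if i then Lnorm M1 q f else Lnorm M2 q g"
 have q: "1 \<le> q" using q1 by simp
 have L: "(u :: bool \<Rightarrow> real) \<in> Lp ?C q" for u by (simp add: Lp_def integrable_count_space)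
 have "N (\<lambda>x. f x + h x) (\<lambda>x. g x + k x) \<le> Lnorm ?C q (\<lambda>i. ?L f g i + ?L h k i)"
  using Lnorm_triangle[of f M1 q h] Lnorm_triangle[of g M2 q k] assms q
  unfolding N_Lnorm Lnorm_def[of ?C]
  by (intro powr_mono2 integral_mono integrable_count_space finite) auto
 also have "\<dots> \<le> N f g + N h k" unfolding N_Lnorm using Lnorm_triangle[OF L L q] .
 finally show ?thesis .
qed

lemma N_scale: "N (\<lambda>x. k * f x) (\<lambda>x. k * g x) = \<bar>k\<bar> * N f g"
proof -
 have "Mass (\<lambda>x. k * f x) (\<lambda>x. k * g x) = \<bar>k\<bar> powr q * Mass f g"
  by (simp add: Mass_def abs_mult powr_mult distrib_left)
 then show ?thesis using q1 by (simp add: N_def powr_mult powr_powr)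
qed

lemma X_const: "X (\<lambda>_. c) (\<lambda>_. c)"
 using q1 Lp_bounded[OF fin(1), of "\<lambda>_. c" "\<bar>c\<bar>" q] Lp_bounded[OF fin(2), of "\<lambda>_. c" "\<bar>c\<bar>" q] by simp

lemma X_lin: "X f g \<Longrightarrow> X h k \<Longrightarrow> X (\<lambda>x. f x + c * h x) (\<lambda>x. g x + c * k x)"
 using q1 by (simp add: Lp_add Lp_cmult)

lemma X_add: "X f g \<Longrightarrow> X h k \<Longrightarrow> X (\<lambda>x. f x + h x) (\<lambda>x. g x + k x)"
 using q1 by (simp add: Lp_add)

lemma X_diff: "X f g \<Longrightarrow> X h k \<Longrightarrow> X (\<lambda>x. f x - h x) (\<lambda>x. g x - k x)"
 using q1 by (simp add: Lp_diff)

lemma N_const: "N (\<lambda>_. c) (\<lambda>_. c) = \<bar>c\<bar> * N (\<lambda>_. 1) (\<lambda>_. 1)"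
 using N_scale[of c "\<lambda>_. 1" "\<lambda>_. 1"] by simp

lemma N_1: "0 < N (\<lambda>_. 1) (\<lambda>_. 1)"
 using nontrivial by (simp add: N_def Mass_def)

lemma m_le: "m f g \<le> N (\<lambda>x. f x + c) (\<lambda>x. g x + c)"
 unfolding m_def by (rule cINF_lower) (auto intro!: bdd_belowI[of _ 0])

lemma m_nonneg [simp]: "0 \<le> m f g"
 unfolding m_def by (rule cINF_greatest) auto

lemma N_diff_le:
 assumes "X f g" "X h k"
 shows "N f g \<le> N h k + N (\<lambda>x. f x - h x) (\<lambda>x. g x - k x)"
 using N_triangle[OF assms(2) X_diff[OF assms]] by simp

text \<open>As a function of \<open>c\<close> the norm is Lipschitz and, because the constant
  \<open>1\<close> has positive norm, it is at least its value at \<open>0\<close> outside a bounded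
  interval.\<close>

lemma m_attained:
 assumes X: "X f g"
 shows "\<exists>c. N (\<lambda>x. f x + c) (\<lambda>x. g x + c) = m f g"
proof -
 define h where "h c = N (\<lambda>x. f x + c) (\<lambda>x. g x + c)" for c
 let ?n = "N (\<lambda>_. 1) (\<lambda>_. 1)"
 have lip: "h c \<le> h d + \<bar>c - d\<bar> * ?n" for c d
  using N_diff_le[OF X_add[OF X X_const] X_add[OF X X_const], of c d] N_const[of "c - d"] by (simp add: h_def)
 define R where "R = 2 * h 0 / ?n"
 have far: "h 0 \<le> h c" if "R < \<bar>c\<bar>" for c
 proof -
  have "2 * h 0 < \<bar>c\<bar> * ?n" using that N_1 by (simp add: R_def pos_divide_less_eq)
  moreover have "\<bar>c\<bar> * ?n \<le> h c + h 0"
   using N_triangle[OF X_add[OF X X_const[of c]] X_lin[OF X_const[of 0] X, of "-1"]] N_scale[of "-1" f g] N_const[of c] by (simp add: h_def)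
  ultimately show ?thesis by linarith
 qed
 have "(?n)-lipschitz_on UNIV h"
 proof (rule lipschitz_onI)
  show "dist (h c) (h d) \<le> ?n * dist c d" for c d
   using lip[of c d] lip[of d c] by (simp add: dist_real_def abs_le_iff mult.commute abs_minus_commute)
 qed simp
 then have "continuous_on {-R..R} h" using lipschitz_on_continuous_on continuous_on_subset by blast
 moreover have "0 \<le> R" using N_1 by (simp add: R_def h_def)
 ultimately obtain c where c: "c \<in> {-R..R}" "\<And>d. d \<in> {-R..R} \<Longrightarrow> h c \<le> h d"
  using continuous_attains_inf[of "{-R..R}" h] by auto
 have "h c \<le> h d" for d
  using c(2)[of d] c(2)[of 0] far[of d] \<open>0 \<le> R\<close> by (smt (verit) atLeastAtMost_iff)
 then have "h c \<le> m f g" unfolding m_def h_def by (intro cINF_greatest) auto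
 then show ?thesis using m_le[of f g c] by (auto simp: h_def intro: order_antisym)
qed

text \<open>A constant optimal for one pair is a competitor for the other, so \<open>m\<close> is
  Lipschitz with respect to \<open>N\<close>.\<close>

lemma m_diff_le:
 assumes "X f g" "X h k"
 shows "m f g \<le> m h k + N (\<lambda>x. f x - h x) (\<lambda>x. g x - k x)"
proof -
 obtain c where c: "N (\<lambda>x. h x + c) (\<lambda>x. k x + c) = m h k" using m_attained[OF assms(2)] by blast
 have "m f g \<le> N (\<lambda>x. f x + c) (\<lambda>x. g x + c)" by (rule m_le)
 also have "\<dots> \<le> m h k + N (\<lambda>x. f x - h x) (\<lambda>x. g x - k x)"
  using N_diff_le[OF X_add[OF assms(1) X_const] X_add[OF assms(2) X_const], of c c] c by simp
 finally show ?thesis .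
qed

lemma m_N_tendsto:
 assumes X: "\<And>z. X (f z) (k z)" "X u t" and lim: "((\<lambda>z. N (\<lambda>x. f z x - u x) (\<lambda>x. k z x - t x)) \<longlongrightarrow> 0) \<F>"
 shows "((\<lambda>z. m (f z) (k z)) \<longlongrightarrow> m u t) \<F>" "((\<lambda>z. N (f z) (k z)) \<longlongrightarrow> N u t) \<F>"
proof -
 have comm: "N (\<lambda>x. u x - f z x) (\<lambda>x. t x - k z x) = N (\<lambda>x. f z x - u x) (\<lambda>x. k z x - t x)" for z
  by (simp add: N_def Mass_def abs_minus_commute)
 have L: "(h \<longlongrightarrow> L) \<F>" if "\<And>z. \<bar>h z - L\<bar> \<le> N (\<lambda>x. f z x - u x) (\<lambda>x. k z x - t x)" for h L
  using tendsto_sandwich[OF _ _ tendsto_const lim, of "\<lambda>z. \<bar>h z - L\<bar>"] that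
  by (simp add: tendsto_rabs_zero_iff LIM_zero_iff)
 show "((\<lambda>z. m (f z) (k z)) \<longlongrightarrow> m u t) \<F>"
  using m_diff_le[OF X] m_diff_le[OF X(2,1)] by (intro L) (simp add: abs_le_iff algebra_simps comm)
 show "((\<lambda>z. N (f z) (k z)) \<longlongrightarrow> N u t) \<F>"
  using N_diff_le[OF X] N_diff_le[OF X(2,1)] by (intro L) (simp add: abs_le_iff algebra_simps comm)
qed

lemma m_scale:
 assumes X: "X f g" and k: "0 < k"
 shows "m (\<lambda>x. k * f x) (\<lambda>x. k * g x) = k * m f g"
proof -
 have le: "m (\<lambda>x. k * f x) (\<lambda>x. k * g x) \<le> k * m f g" if X: "X f g" and k: "0 < k" for f g k
 proof -
  obtain c where c: "N (\<lambda>x. f x + c) (\<lambda>x. g x + c) = m f g" using m_attained[OF X] by blast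
  show ?thesis
   using m_le[of "\<lambda>x. k * f x" "\<lambda>x. k * g x" "k * c"] N_scale[of k "\<lambda>x. f x + c" "\<lambda>x. g x + c"] k
   by (simp add: c distrib_left)
 qed
 have "m f g \<le> (1 / k) * m (\<lambda>x. k * f x) (\<lambda>x. k * g x)"
  using le[of "\<lambda>x. k * f x" "\<lambda>x. k * g x" "1 / k"] X k by (simp add: Lp_cmult)
 then show ?thesis using le[OF X k] k by (simp add: field_simps)
qed

lemma m_shift: "m (\<lambda>x. f x + c) (\<lambda>x. g x + c) = m f g"
proof -
 have "m f g \<le> m (\<lambda>x. f x + c) (\<lambda>x. g x + c)" for f g c
  unfolding m_def[of "\<lambda>x. f x + c"]
 proof (rule cINF_greatest)
  show "m f g \<le> N (\<lambda>x. f x + c + d) (\<lambda>x. g x + c + d)" for d using m_le[of f g "c + d"] by (simp add: add.assoc)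
 qed simp
 from this[of f g c] this[of "\<lambda>x. f x + c" "\<lambda>x. g x + c" "- c"] show ?thesis by simp
qed

lemma Mass_tangent:
 assumes X: "X f g" "X h k"
 shows "Mass f g + q * B f g (\<lambda>x. h x - f x) (\<lambda>x. k x - g x) \<le> Mass h k"
proof -
 have q: "1 \<le> q" using q1 by simp
 have *: "(LINT x|M. \<bar>f x\<bar> powr q) + q * (LINT x|M. dual_pow q (f x) * (h x - f x)) \<le> (LINT x|M. \<bar>h x\<bar> powr q)"
  if f: "f \<in> Lp M q" and h: "h \<in> Lp M q" for M :: "'a measure" and f h :: "'a \<Rightarrow> real"
 proof -
  have i: "integrable M (\<lambda>x. \<bar>f x\<bar> powr q)" "integrable M (\<lambda>x. \<bar>h x\<bar> powr q)" "integrable M (\<lambda>x. dual_pow q (f x) * (h x - f x))"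
   using LpD(2)[OF f] LpD(2)[OF h] integrable_dual_pow_inner[OF f Lp_diff[OF h f q] q] by auto
  have "(LINT x|M. \<bar>f x\<bar> powr q + q * (dual_pow q (f x) * (h x - f x))) \<le> (LINT x|M. \<bar>h x\<bar> powr q)"
   using powr_ge_tangent[OF q, of "f _" "h _"] i by (intro integral_mono) auto
  then show ?thesis using i by simp
 qed
 show ?thesis using *[of f M1 h] *[of g M2 k] X by (simp add: Mass_def B_def distrib_left)
qed

lemma B_lin:
 assumes "X f g" "X h k" "X h' k'"
 shows "B f g (\<lambda>x. h x + c * h' x) (\<lambda>x. k x + c * k' x) = B f g h k + c * B f g h' k'"
proof -
 have q: "1 \<le> q" using q1 by simp
 have i: "integrable M (\<lambda>x. dual_pow q (f x) * h x)" if "f \<in> Lp M q" "h \<in> Lp M q" for M :: "'a measure" and f h :: "'a \<Rightarrow> real"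
  using integrable_dual_pow_inner[OF that q] by simp
 have "(LINT x|M. dual_pow q (f x) * (h x + c * h' x)) = (LINT x|M. dual_pow q (f x) * h x) + c * (LINT x|M. dual_pow q (f x) * h' x)"
  if "f \<in> Lp M q" "h \<in> Lp M q" "h' \<in> Lp M q" for M :: "'a measure" and f h h' :: "'a \<Rightarrow> real"
 proof -
  have "(LINT x|M. dual_pow q (f x) * (h x + c * h' x)) = (LINT x|M. dual_pow q (f x) * h x + c * (dual_pow q (f x) * h' x))"
   by (simp add: algebra_simps)
  then show ?thesis using i that by simp
 qed
 then show ?thesis using assms by (simp add: B_def algebra_simps)
qed

text \<open>Adding a constant changes \<open>Mass\<close> by a convex function of the constant,
  whose derivative at \<open>0\<close> is \<open>q\<close> times the left side; a critical point of
  a convex function is a minimum, and conversely.\<close>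

lemma critical_iff:
 assumes X: "X f g"
 shows "B f g (\<lambda>_. 1) (\<lambda>_. 1) = 0 \<longleftrightarrow> N f g = m f g"
proof
 assume z: "B f g (\<lambda>_. 1) (\<lambda>_. 1) = 0"
 have "N f g \<le> N (\<lambda>x. f x + c) (\<lambda>x. g x + c)" for c
 proof -
  have "B f g (\<lambda>x. f x + c - f x) (\<lambda>x. g x + c - g x) = 0"
   using B_lin[OF X X_const[of 0] X_const[of 1], of c] z by (simp add: B_def)
  then have "Mass f g \<le> Mass (\<lambda>x. f x + c) (\<lambda>x. g x + c)"
   using Mass_tangent[OF X X_add[OF X X_const], of c] by simp
  then show ?thesis using q1 unfolding N_def by (intro powr_mono2) auto
 qed
 then have "N f g \<le> m f g" unfolding m_def by (intro cINF_greatest) auto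
 then show "N f g = m f g" using m_le[of f g 0] by simp
next
 assume N: "N f g = m f g"
 have "((\<lambda>t. LINT x|M1. \<bar>f x + t\<bar> powr q) has_real_derivative q * (LINT x|M1. dual_pow q (f x))) (at 0)"
  "((\<lambda>t. LINT x|M2. \<bar>g x + t\<bar> powr q) has_real_derivative q * (LINT x|M2. dual_pow q (g x))) (at 0)"
  using has_derivative_integral_norm_powr[of f M1 q "\<lambda>_. 1"] has_derivative_integral_norm_powr[of g M2 q "\<lambda>_. 1"] X X_const[of 1] q1 by simp_all
 then have "((\<lambda>t. Mass (\<lambda>x. f x + t) (\<lambda>x. g x + t)) has_real_derivative q * B f g (\<lambda>_. 1) (\<lambda>_. 1)) (at 0)"
  using DERIV_add by (fastforce simp: Mass_def B_def distrib_left)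
 moreover have "Mass (\<lambda>x. f x + 0) (\<lambda>x. g x + 0) \<le> Mass (\<lambda>x. f x + t) (\<lambda>x. g x + t)" for t
  using powr_mono2[OF _ m_nonneg m_le[of f g t], of q] q1 N[symmetric] by (simp add: N_powr)
 ultimately have "q * B f g (\<lambda>_. 1) (\<lambda>_. 1) = 0" by (intro DERIV_local_min[of _ _ 0 1]) auto
 then show "B f g (\<lambda>_. 1) (\<lambda>_. 1) = 0" using q1 by simp
qed

text \<open>The mean-free condition at \<open>(f, g)\<close> removes the contribution of the optimal constant, so
 that the distance to the constants has the derivative of \<open>Mass\<close> there.\<close>

lemma m_tangent:
 assumes X: "X f g" "X h k" and N: "N f g = m f g"
 shows "Mass f g + q * t * B f g h k \<le> m (\<lambda>x. f x + t * h x) (\<lambda>x. g x + t * k x) powr q"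
proof -
 note X' = X_lin[OF X, of t]
 \<comment> \<open>\<open>c\<close> is optimal for the perturbed pair; in the tangent inequality at
   \<open>(f, g)\<close> it enters only through the pairing of \<open>(f, g)\<close> with constants,
   which is \<open>0\<close>.\<close>
 obtain c where c: "N (\<lambda>x. f x + t * h x + c) (\<lambda>x. g x + t * k x + c) = m (\<lambda>x. f x + t * h x) (\<lambda>x. g x + t * k x)"
  using m_attained[OF X'] by blast
 have "B f g (\<lambda>x. f x + t * h x + c - f x) (\<lambda>x. g x + t * k x + c - g x) = B f g (\<lambda>x. (0 + t * h x) + c * 1) (\<lambda>x. (0 + t * k x) + c * 1)"
  by (simp add: algebra_simps)
 also have "\<dots> = t * B f g h k"
  unfolding B_lin[OF X(1) X_lin[OF X_const[of 0] X(2), of t] X_const[of 1], of c]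
   B_lin[OF X(1) X_const[of 0] X(2), of t] using N critical_iff[OF X(1)] by (simp add: B_def)
 finally show ?thesis
  using Mass_tangent[OF X(1) X_add[OF X' X_const], of c] by (simp add: c[symmetric] N_powr)
qed

end

section \<open>The variational problem\<close>

lemma Lp_density:
 assumes M: "finite_measure M" and w: "w \<in> Linf M" "AE x in M. 0 \<le> w x"
 obtains A :: real where "0 < A" "\<And>s f. f \<in> Lp M s \<Longrightarrow> f \<in> Lp (density M w) s \<and>
  (LINT x|density M w. \<bar>f x\<bar> powr s) \<le> A * (LINT x|M. \<bar>f x :: real\<bar> powr s)"
proof -
 have [measurable]: "w \<in> borel_measurable M" using w(1) by (simp add: Linf_def)
 obtain A where A: "AE x in M. \<bar>w x\<bar> \<le> A" using w(1) by (auto simp: Linf_def)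
 show thesis
 proof
  show "0 < \<bar>A\<bar> + 1" by simp
  fix s and f :: "'a \<Rightarrow> real" assume f: "f \<in> Lp M s"
  note [measurable] = LpD(1)[OF f]
  have i: "integrable M (\<lambda>x. (\<bar>A\<bar> + 1) * \<bar>f x\<bar> powr s)" using LpD(2)[OF f] by simp
  have le: "AE x in M. w x * \<bar>f x\<bar> powr s \<le> (\<bar>A\<bar> + 1) * \<bar>f x\<bar> powr s"
   using A by eventually_elim (auto intro!: mult_right_mono)
  have iw: "integrable M (\<lambda>x. w x * \<bar>f x\<bar> powr s)"
   by (rule Bochner_Integration.integrable_bound[OF i]) (use w(2) le in \<open>auto elim!: eventually_elim2\<close>)
  have "(LINT x|density M w. \<bar>f x\<bar> powr s) \<le> (\<bar>A\<bar> + 1) * (LINT x|M. \<bar>f x\<bar> powr s)"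
   using integral_mono_AE[OF iw i le] by (subst integral_density) (auto simp: w(2))
  moreover have "f \<in> Lp (density M w) s"
   using iw w(2) by (intro LpI) (auto simp: integrable_density)
  ultimately show "f \<in> Lp (density M w) s \<and>
    (LINT x|density M w. \<bar>f x\<bar> powr s) \<le> (\<bar>A\<bar> + 1) * (LINT x|M. \<bar>f x\<bar> powr s)" by blast
 qed
qed

locale eigenvalue_problem = smooth_domain \<Omega> for \<Omega> :: "'a::euclidean_space set" +
 fixes p q :: real and a b :: "'a \<Rightarrow> real"
 assumes dim: "2 \<le> DIM('a)" and p1: "1 < p" and q2: "2 < q" and pq: "p \<noteq> q"
  and a: "a \<in> Linf L\<Omega>" "AE x in L\<Omega>. 0 \<le> a x" and b: "b \<in> Linf \<sigma>" "AE x in \<sigma>. 0 \<le> b x"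
  and pos: "0 < (LINT x|L\<Omega>. a x) + (LINT x|\<sigma>. b x)"
begin

section \<open>The weighted measures and the energy inequalities\<close>

abbreviation "s \<equiv> max p q"
abbreviation "Ma \<equiv> density L\<Omega> (\<lambda>x. ennreal (a x))"
abbreviation "Mb \<equiv> density \<sigma> (\<lambda>x. ennreal (b x))"

lemma exponents: "1 < q" "1 \<le> q" "0 < q" "0 < p" "1 \<le> p" "1 < s" "1 \<le> s" "p \<le> s" "q \<le> s"
 using p1 q2 by auto

lemma weights_measurable [measurable]: "a \<in> borel_measurable L\<Omega>" "b \<in> borel_measurable \<sigma>"
 using a(1) b(1) by (auto simp: Linf_def)

lemma LINT_weights:
 "f \<in> borel_measurable L\<Omega> \<Longrightarrow> (LINT x|Ma. f x) = (LINT x|L\<Omega>. a x * (f x :: real))"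
 "f \<in> borel_measurable \<sigma> \<Longrightarrow> (LINT x|Mb. f x) = (LINT x|\<sigma>. b x * (f x :: real))"
 using a(2) b(2) by (simp_all add: integral_density)

lemma finite_density:
 assumes "finite_measure M" "w \<in> Linf M" "AE x in M. 0 \<le> w x"
 shows "finite_measure (density M (\<lambda>x. ennreal (w x)))"
proof -
 interpret finite_measure M by fact
 obtain A :: real where A: "AE x in M. \<bar>w x\<bar> \<le> A" using assms(2) by (auto simp: Linf_def)
 have [measurable]: "w \<in> borel_measurable M" using assms(2) by (simp add: Linf_def)
 have "emeasure (density M (\<lambda>x. ennreal (w x))) (space M) = (\<integral>\<^sup>+x. ennreal (w x) * indicator (space M) x \<partial>M)"
  by (rule emeasure_density) auto
 also have "\<dots> \<le> (\<integral>\<^sup>+x. ennreal A \<partial>M)"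
  using A by (intro nn_integral_mono_AE) (auto elim!: eventually_mono intro!: ennreal_leI simp: indicator_def)
 also have "\<dots> < \<infinity>" by (simp add: ennreal_mult_eq_top_iff less_top[symmetric])
 finally show ?thesis by (intro finite_measureI) simp
qed

sublocale two_measures Ma Mb q
proof (rule two_measures.intro)
 show "finite_measure Ma" "finite_measure Mb"
  by (intro finite_density finite_L\<Omega> finite_\<sigma> a b)+
 have "(LINT x|Ma. 1) = (LINT x|L\<Omega>. a x)" "(LINT x|Mb. 1) = (LINT x|\<sigma>. b x)"
  using LINT_weights(1)[of "\<lambda>_. 1"] LINT_weights(2)[of "\<lambda>_. 1"] by simp_all
 then show "0 < measure Ma (space Ma) + measure Mb (space Mb)" using pos by simp
qed (rule exponents)

lemma Mass_bound:
 obtains A where "0 < A" "\<And>f g. f \<in> Lp L\<Omega> q \<Longrightarrow> g \<in> Lp \<sigma> q \<Longrightarrow> X f g \<and>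
  Mass f g \<le> A * (absint L\<Omega> q f + absint \<sigma> q g)"
proof (rule Lp_density[OF finite_L\<Omega> a], rule Lp_density[OF finite_\<sigma> b], goal_cases)
 case (1 A A')
 show thesis
 proof (rule 1(1)[of "max A A'"])
  fix f g :: "'a \<Rightarrow> real" assume f: "f \<in> Lp L\<Omega> q" and g: "g \<in> Lp \<sigma> q"
  have "(LINT x|Ma. \<bar>f x\<bar> powr q) \<le> max A A' * absint L\<Omega> q f"
   using 1(3)[OF f] by (rule conjunct2[THEN order_trans]) (intro mult_right_mono; simp)
  moreover have "(LINT x|Mb. \<bar>g x\<bar> powr q) \<le> max A A' * absint \<sigma> q g"
   using 1(5)[OF g] by (rule conjunct2[THEN order_trans]) (intro mult_right_mono; simp)
  ultimately show "X f g \<and> Mass f g \<le> max A A' * (absint L\<Omega> q f + absint \<sigma> q g)"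
   using 1(3)[OF f] 1(5)[OF g] by (simp add: Mass_def distrib_left)
 qed (use 1(2) in simp)
qed

lemma XI: "f \<in> Lp L\<Omega> q \<Longrightarrow> g \<in> Lp \<sigma> q \<Longrightarrow> X f g"
 by (rule Mass_bound) blast

lemma X_smooth: "smooth \<phi> \<Longrightarrow> X \<phi> \<phi>"
 using smooth_Lp exponents by (intro XI) auto

lemma convq: "conv s \<phi> u g t \<Longrightarrow> conv q \<phi> u g t"
 by (rule conv_mono_exponent) (use exponents in auto)

lemma X_conv: "conv s \<phi> u g t \<Longrightarrow> X u t"
 using convD(2,4)[OF convq] by (intro XI)

lemma N_tendsto:
 assumes \<phi>: "\<And>n. smooth (\<phi> n)" and ut: "u \<in> Lp L\<Omega> s" "t \<in> Lp \<sigma> s"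
  and lim: "Lp_tendsto L\<Omega> s \<phi> u" "Lp_tendsto \<sigma> s \<phi> t"
 shows "(\<lambda>n. N (\<lambda>x. \<phi> n x - u x) (\<lambda>x. \<phi> n x - t x)) \<longlonglongrightarrow> 0"
proof -
 note ss = smooth_Lp[OF \<phi> exponents(7)] and sm = smooth_Lp[OF \<phi> exponents(2)]
 note l = Lnorm_tendsto_mono_exponent[OF finite_L\<Omega> ss(1) ut(1) exponents(2,9) lim(1), unfolded tendsto_Lnorm_iff[OF exponents(3)]]
  Lnorm_tendsto_mono_exponent[OF finite_\<sigma> ss(3) ut(2) exponents(2,9) lim(2), unfolded tendsto_Lnorm_iff[OF exponents(3)]]
 note utq = Lp_mono_exponent(1)[OF finite_L\<Omega> ut(1) exponents(2,9)] Lp_mono_exponent(1)[OF finite_\<sigma> ut(2) exponents(2,9)]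
 obtain A where A: "0 < A" "\<And>f g. f \<in> Lp L\<Omega> q \<Longrightarrow> g \<in> Lp \<sigma> q \<Longrightarrow> X f g \<and>
  Mass f g \<le> A * (absint L\<Omega> q f + absint \<sigma> q g)"
  using Mass_bound by blast
 let ?M = "\<lambda>n. Mass (\<lambda>x. \<phi> n x - u x) (\<lambda>x. \<phi> n x - t x)"
 let ?I = "\<lambda>n. A * ((LINT x|L\<Omega>. \<bar>\<phi> n x - u x\<bar> powr q) + (LINT x|\<sigma>. \<bar>\<phi> n x - t x\<bar> powr q))"
 have "?M \<longlonglongrightarrow> 0"
 proof (rule tendsto_sandwich[OF _ _ tendsto_const])
  show "\<forall>\<^sub>F n in sequentially. ?M n \<le> ?I n"
   using A(2)[OF Lp_diff[OF sm(1) utq(1) exponents(2)] Lp_diff[OF sm(3) utq(2) exponents(2)]] by simp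
  show "?I \<longlonglongrightarrow> 0" using tendsto_mult_left[OF tendsto_add[OF l], of A] by simp
 qed simp
 then have "(\<lambda>n. ?M n powr (1 / q)) \<longlonglongrightarrow> 0 powr (1 / q)"
  by (rule tendsto_powr2[OF _ tendsto_const]) (use exponents in auto)
 then show ?thesis by (simp add: N_def)
qed

lemma conv_limits:
 assumes c: "conv s \<phi> u g t"
 shows "(\<lambda>n. m (\<phi> n) (\<phi> n)) \<longlonglongrightarrow> m u t" "(\<lambda>n. N (\<phi> n) (\<phi> n)) \<longlonglongrightarrow> N u t"
  "1 \<le> r \<Longrightarrow> r \<le> s \<Longrightarrow> (\<lambda>n. E r (grad (\<phi> n))) \<longlonglongrightarrow> E r g"
proof -
 have "(\<lambda>n. N (\<lambda>x. \<phi> n x - u x) (\<lambda>x. \<phi> n x - t x)) \<longlonglongrightarrow> 0"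
  by (rule N_tendsto) (rule convD[OF c])+
 then show "(\<lambda>n. m (\<phi> n) (\<phi> n)) \<longlonglongrightarrow> m u t" "(\<lambda>n. N (\<phi> n) (\<phi> n)) \<longlonglongrightarrow> N u t"
  by (rule m_N_tendsto[OF X_smooth[OF convD(1)[OF c]] X_conv[OF c]])+
 assume r: "1 \<le> r" "r \<le> s"
 have "(\<lambda>n. Lnorm L\<Omega> r (grad (\<phi> n)) powr r) \<longlonglongrightarrow> Lnorm L\<Omega> r g powr r"
  by (rule tendsto_powr2[OF conv_Lnorm(2)[OF conv_mono_exponent[OF c r] r(1)] tendsto_const]) (use r in auto)
 then show "(\<lambda>n. E r (grad (\<phi> n))) \<longlonglongrightarrow> E r g" using r by (simp add: Lnorm_powr)
qed

lemma m_mean: "smooth \<phi> \<Longrightarrow> m \<phi> \<phi> powr q \<le> Mass (\<lambda>x. \<phi> x - c) (\<lambda>x. \<phi> x - c)"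
 using powr_mono2[OF _ m_nonneg m_le[of \<phi> \<phi> "- c"], of q] exponents by (simp add: N_powr)

text \<open>Bounded weights control \<open>Mass\<close> of the centred function, and with it
  \<open>m powr q\<close>, by the unweighted integrals to which \<open>mean_inequality\<close>
  applies. Listing three quantities in a set lets one constant serve all of them.\<close>

lemma mean_estimate:
 assumes r: "1 \<le> r" and \<epsilon>: "0 < \<epsilon>"
 obtains C where "0 < C" "\<And>\<phi> I. smooth \<phi> \<Longrightarrow>
  I \<in> {absint L\<Omega> q (\<lambda>x. \<phi> x - avg base \<phi>), Mass (\<lambda>x. \<phi> x - avg base \<phi>) (\<lambda>x. \<phi> x - avg base \<phi>), m \<phi> \<phi> powr q} \<Longrightarrow>
  I \<le> \<epsilon> * E q (grad \<phi>) + C * E r (grad \<phi>) powr (q / r)"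
proof -
 obtain A where A: "0 < A" "\<And>f g. f \<in> Lp L\<Omega> q \<Longrightarrow> g \<in> Lp \<sigma> q \<Longrightarrow> X f g \<and>
  Mass f g \<le> A * (absint L\<Omega> q f + absint \<sigma> q g)"
  using Mass_bound by blast
 \<comment> \<open>The division prepares for the factor \<open>A\<close> from the weights;
   \<open>A + 1\<close> also covers the unweighted integral.\<close>
 have "0 < \<epsilon> / (A + 1)" using A \<epsilon> by simp
 then obtain C where C: "0 \<le> C" "\<And>\<phi>. smooth \<phi> \<Longrightarrow>
  absint L\<Omega> q (\<lambda>x. \<phi> x - avg base \<phi>) + absint \<sigma> q (\<lambda>x. \<phi> x - avg base \<phi>)
  \<le> \<epsilon> / (A + 1) * E q (grad \<phi>) + C * E r (grad \<phi>) powr (q / r)"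
  using mean_inequality[OF exponents(1) r] by blast
 show thesis
 proof
  show "0 < (A + 1) * C + 1" using A C by (simp add: add_nonneg_pos)
  fix \<phi> :: "'a \<Rightarrow> real" and I assume \<phi>: "smooth \<phi>"
   and I: "I \<in> {absint L\<Omega> q (\<lambda>x. \<phi> x - avg base \<phi>), Mass (\<lambda>x. \<phi> x - avg base \<phi>) (\<lambda>x. \<phi> x - avg base \<phi>), m \<phi> \<phi> powr q}"
  define c where "c = avg base \<phi>"
  define S where "S = absint L\<Omega> q (\<lambda>x. \<phi> x - c) + absint \<sigma> q (\<lambda>x. \<phi> x - c)"
  note sm = smooth_Lp[OF smooth_diff[OF \<phi> smooth_const[of c]] exponents(2)]
  have "absint L\<Omega> q (\<lambda>x. \<phi> x - c) \<le> S" "0 \<le> S" "0 \<le> A * S" using A(1) by (simp_all add: S_def)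
  then have "I \<le> (A + 1) * S"
   using I A(2)[OF sm(1,3)] m_mean[OF \<phi>, of c]
   unfolding S_def[symmetric] c_def[symmetric] by (auto simp: distrib_right)
  also have "\<dots> \<le> (A + 1) * (\<epsilon> / (A + 1) * E q (grad \<phi>) + C * E r (grad \<phi>) powr (q / r))"
   using C(2)[OF \<phi>] A(1) by (intro mult_left_mono) (auto simp: S_def c_def)
  also have "\<dots> \<le> \<epsilon> * E q (grad \<phi>) + ((A + 1) * C + 1) * E r (grad \<phi>) powr (q / r)"
  proof -
   have "k * (\<epsilon> / k * e + C * d) = \<epsilon> * e + k * C * d" if "k \<noteq> 0" for k e d
    using that by (simp add: distrib_left)
   note this[of "A + 1"]
   then show ?thesis using A(1) by (simp add: distrib_right[of "(A + 1) * C"])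
  qed
  finally show "I \<le> \<epsilon> * E q (grad \<phi>) + ((A + 1) * C + 1) * E r (grad \<phi>) powr (q / r)" .
 qed
qed

text \<open>Accuracy \<open>1 / (2 * \<mu>)\<close> leaves half of the \<open>q\<close>-energy. As a
  consequence \<open>F \<ge> 1\<close> keeps \<open>E p\<close> away from \<open>0\<close> and
  bounds the \<open>q\<close>-energy by a power of the \<open>p\<close>-energy.\<close>

lemma coercive:
 assumes \<mu>: "0 < \<mu>"
 obtains C where "0 < C" "\<And>\<phi>. smooth \<phi> \<Longrightarrow> \<mu> * m \<phi> \<phi> powr q \<le> E q (grad \<phi>) / 2 + C * E p (grad \<phi>) powr (q / p)"
proof -
 have "0 < 1 / (2 * \<mu>)" using \<mu> by simp
 then obtain C where C: "0 < C" "\<And>\<phi>. smooth \<phi> \<Longrightarrow> m \<phi> \<phi> powr q \<le> 1 / (2 * \<mu>) * E q (grad \<phi>) + C * E p (grad \<phi>) powr (q / p)"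
  by (rule mean_estimate[OF exponents(5)]) blast
 show thesis
 proof
  show "0 < \<mu> * C" using \<mu> C by simp
  have "\<mu> * (1 / (2 * \<mu>) * e + C * d) = e / 2 + \<mu> * C * d" for e d using \<mu> by (simp add: field_simps)
  then show "\<mu> * m \<phi> \<phi> powr q \<le> E q (grad \<phi>) / 2 + \<mu> * C * E p (grad \<phi>) powr (q / p)" if "smooth \<phi>" for \<phi>
   using mult_left_mono[OF C(2)[OF that] less_imp_le[OF \<mu>]] by metis
 qed
qed

text \<open>With exponent \<open>q\<close> in both energies the mean estimate becomes a Poincare
  inequality for \<open>m\<close>, and it passes to limits; it yields the lower bound for
  \<open>lambda1\<close>.\<close>

lemma m_poincare:
 obtains K where "0 < K" "\<And>\<phi> u g t. conv s \<phi> u g t \<Longrightarrow> m u t powr q \<le> K * E q g"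
proof -
 obtain C where C: "0 < C" "\<And>\<phi>. smooth \<phi> \<Longrightarrow> m \<phi> \<phi> powr q \<le> 1 * E q (grad \<phi>) + C * E q (grad \<phi>) powr (q / q)"
  by (rule mean_estimate[OF exponents(2) zero_less_one]) blast
 show thesis
 proof
  show "0 < 1 + C" using C by simp
  fix \<phi> u g t assume c: "conv s \<phi> u g t"
  have "(\<lambda>n. m (\<phi> n) (\<phi> n) powr q) \<longlonglongrightarrow> m u t powr q"
   by (rule tendsto_powr2[OF conv_limits(1)[OF c] tendsto_const]) (use exponents in auto)
  moreover have "(\<lambda>n. (1 + C) * E q (grad (\<phi> n))) \<longlonglongrightarrow> (1 + C) * E q g"
   by (intro tendsto_mult_left conv_limits(3)[OF c] exponents)
  ultimately show "m u t powr q \<le> (1 + C) * E q g"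
   by (rule LIMSEQ_le) (use C(2)[OF convD(1)[OF c]] exponents(3) in \<open>simp add: distrib_right\<close>)
 qed
qed

text \<open>For smooth functions the remainder after subtracting the average is controlled by the
  gradient, and the average by \<open>N\<close>, since constants have positive \<open>N\<close>. In
  the limit both terms are \<open>0\<close>: positivity of the total weight rules out nonzero
  constants.\<close>

lemma zero_of_null_energy:
 assumes c: "conv s \<phi> u g t" and z: "E q g = 0" "Mass u t = 0"
 shows "AE x in L\<Omega>. u x = 0"
proof -
 obtain C where C: "0 < C" "\<And>\<phi> I. smooth \<phi> \<Longrightarrow>
  I \<in> {absint L\<Omega> q (\<lambda>x. \<phi> x - avg base \<phi>), Mass (\<lambda>x. \<phi> x - avg base \<phi>) (\<lambda>x. \<phi> x - avg base \<phi>), m \<phi> \<phi> powr q} \<Longrightarrow>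
  I \<le> 1 * E q (grad \<phi>) + C * E q (grad \<phi>) powr (q / q)"
  by (rule mean_estimate[OF exponents(2) zero_less_one]) blast
 let ?n = "N (\<lambda>_. 1) (\<lambda>_. 1)" and ?L = "Lnorm L\<Omega> q (\<lambda>_. 1 :: real)"
 let ?e = "\<lambda>\<phi>. ((1 + C) * E q (grad \<phi>)) powr (1 / q)"
 let ?R = "\<lambda>e k. ((1 + C) * e) powr (1 / q) + (k + ((1 + C) * e) powr (1 / q)) / ?n * ?L"
 have *: "Lnorm L\<Omega> q \<phi> \<le> ?R (E q (grad \<phi>)) (N \<phi> \<phi>)" if \<phi>: "smooth \<phi>" for \<phi>
 proof -
  let ?c = "avg base \<phi>"
  note s1 = smooth_Lp[OF smooth_diff[OF \<phi> smooth_const[of ?c]] exponents(2)]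
   and s2 = smooth_Lp[OF smooth_const[of ?c] exponents(2)]
  have "absint L\<Omega> q (\<lambda>x. \<phi> x - ?c) \<le> (1 + C) * E q (grad \<phi>)" "Mass (\<lambda>x. \<phi> x - ?c) (\<lambda>x. \<phi> x - ?c) \<le> (1 + C) * E q (grad \<phi>)"
   using C(2)[OF \<phi>] exponents(3) by (simp_all add: distrib_right)
  then have l: "Lnorm L\<Omega> q (\<lambda>x. \<phi> x - ?c) \<le> ?e \<phi>" "N (\<lambda>x. \<phi> x - ?c) (\<lambda>x. \<phi> x - ?c) \<le> ?e \<phi>"
   unfolding Lnorm_def N_def using exponents(3) by (auto intro!: powr_mono2)
  have "\<bar>?c\<bar> * ?n \<le> N \<phi> \<phi> + N (\<lambda>x. \<phi> x - ?c) (\<lambda>x. \<phi> x - ?c)"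
   using N_diff_le[OF X_const[of ?c] X_smooth[OF \<phi>]] N_const[of ?c] by (simp add: N_def Mass_def abs_minus_commute)
  then have "\<bar>?c\<bar> \<le> (N \<phi> \<phi> + ?e \<phi>) / ?n" using l(2) N_1 by (simp add: pos_le_divide_eq)
  then have "\<bar>?c\<bar> * ?L \<le> (N \<phi> \<phi> + ?e \<phi>) / ?n * ?L" by (rule mult_right_mono) simp
  moreover have "Lnorm L\<Omega> q (\<lambda>_. ?c) = \<bar>?c\<bar> * ?L"
   using Lnorm_scaleR[OF exponents(2), of L\<Omega> ?c "\<lambda>_. 1 :: real"] by simp
  moreover have "Lnorm L\<Omega> q \<phi> \<le> Lnorm L\<Omega> q (\<lambda>x. \<phi> x - ?c) + Lnorm L\<Omega> q (\<lambda>_. ?c)"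
   using Lnorm_triangle[OF s1(1) s2(1) exponents(2)] by simp
  ultimately show ?thesis using l(1) by linarith
 qed
 have "(\<lambda>n. ?R (E q (grad (\<phi> n))) (N (\<phi> n) (\<phi> n))) \<longlonglongrightarrow> ?R (E q g) (N u t)"
  by (intro tendsto_intros tendsto_powr2 conv_limits[OF c] exponents) (use C exponents N_1 in auto)
 then have "Lnorm L\<Omega> q u \<le> ?R (E q g) (N u t)"
  by (rule LIMSEQ_le[OF conv_Lnorm(1)[OF convq[OF c] exponents(2)]]) (use *[OF convD(1)[OF c]] in blast)
 then have "Lnorm L\<Omega> q u = 0" using z by (simp add: N_def order_antisym)
 then show ?thesis by (rule Lnorm_eq_0[OF convD(2)[OF convq[OF c]] exponents(3)])
qed

text \<open>Built from \<open>m\<close> instead of \<open>Mass\<close>, it is invariant under adding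
  constants and positively homogeneous of degree \<open>q\<close>. Function, trace and gradient are
  separate arguments so that it applies to limits.\<close>

definition F :: "real \<Rightarrow> ('a \<Rightarrow> real) \<Rightarrow> ('a \<Rightarrow> real) \<Rightarrow> ('a \<Rightarrow> 'a) \<Rightarrow> real" where
 "F \<mu> u t g = \<mu> * m u t powr q - E q g"

abbreviation "J \<mu> \<phi> \<equiv> F \<mu> \<phi> \<phi> (grad \<phi>)"

lemma F_conv:
 assumes c: "conv s \<phi> u g t"
 shows "(\<lambda>n. J \<mu> (\<phi> n)) \<longlonglongrightarrow> F \<mu> u t g"
 unfolding F_def
 by (intro tendsto_intros tendsto_powr2[OF conv_limits(1)[OF c] tendsto_const] conv_limits(3)[OF c] exponents) (use exponents in auto)

lemma scale_energies:
 assumes \<phi>: "smooth \<phi>" and k: "0 < k"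
 shows "smooth (\<lambda>x. k * \<phi> x)" "E r (grad (\<lambda>x. k * \<phi> x)) = k powr r * E r (grad \<phi>)"
  "F \<mu> (\<lambda>x. k * \<phi> x) (\<lambda>x. k * \<phi> x) (grad (\<lambda>x. k * \<phi> x)) = k powr q * J \<mu> \<phi>"
proof -
 show "smooth (\<lambda>x. k * \<phi> x)" by (rule smooth_cmult[OF \<phi>])
 show e: "E r (grad (\<lambda>x. k * \<phi> x)) = k powr r * E r (grad \<phi>)" for r
  using k by (simp add: grad_cmult[OF \<phi>] powr_mult)
 show "F \<mu> (\<lambda>x. k * \<phi> x) (\<lambda>x. k * \<phi> x) (grad (\<lambda>x. k * \<phi> x)) = k powr q * J \<mu> \<phi>"
  using k by (simp add: F_def e m_scale[OF X_smooth[OF \<phi>]] powr_mult algebra_simps)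
qed

lemma grad_shift: "smooth \<phi> \<Longrightarrow> grad (\<lambda>x. \<phi> x + c) = grad \<phi>"
 by (rule ext) (simp add: grad_add smooth_const)

section \<open>The constrained minimisation problem\<close>

lemma integrable_E: "g \<in> Lp L\<Omega> s \<Longrightarrow> 1 \<le> r \<Longrightarrow> r \<le> s \<Longrightarrow> integrable L\<Omega> (\<lambda>x. norm (g x) powr r)"
 using LpD(2)[OF Lp_mono_exponent(1)[OF finite_L\<Omega>]] by blast

lemma E_midpoint:
 assumes g: "g \<in> Lp L\<Omega> s" "h \<in> Lp L\<Omega> s" and r: "1 \<le> r" "r \<le> s"
 shows "E r (\<lambda>x. (1/2) *\<^sub>R (g x + h x)) \<le> (E r g + E r h) / 2"
  and "2 \<le> r \<Longrightarrow> E r (\<lambda>x. (1/2) *\<^sub>R (g x + h x)) + E r (\<lambda>x. (1/2) *\<^sub>R (g x - h x)) \<le> (E r g + E r h) / 2"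
proof -
 note i = integrable_E[OF g(1) r] integrable_E[OF g(2) r]
  integrable_E[OF Lp_scaleR[OF Lp_add[OF g exponents(7)], of "1/2"] r] integrable_E[OF Lp_scaleR[OF Lp_diff[OF g exponents(7)], of "1/2"] r]
 have "E r (\<lambda>x. (1/2) *\<^sub>R (g x + h x)) \<le> (LINT x|L\<Omega>. (norm (g x) powr r + norm (h x) powr r) / 2)"
  using i by (intro integral_mono powr_norm_midpoint r) auto
 then show "E r (\<lambda>x. (1/2) *\<^sub>R (g x + h x)) \<le> (E r g + E r h) / 2" using i by simp
 assume r2: "2 \<le> r"
 have "(LINT x|L\<Omega>. norm ((1/2) *\<^sub>R (g x + h x)) powr r + norm ((1/2) *\<^sub>R (g x - h x)) powr r) \<le> (LINT x|L\<Omega>. (norm (g x) powr r + norm (h x) powr r) / 2)"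
  using i by (intro integral_mono clarkson r2 Bochner_Integration.integrable_add) auto
 then show "E r (\<lambda>x. (1/2) *\<^sub>R (g x + h x)) + E r (\<lambda>x. (1/2) *\<^sub>R (g x - h x)) \<le> (E r g + E r h) / 2" using i by simp
qed

text \<open>If \<open>P0\<close> is the infimum of the \<open>p\<close>-energy under \<open>F \<ge> 1\<close>, homogeneity turns the constraint
 into the inequality \<open>P0 * F powr (p / q) \<le> E p\<close>.\<close>

definition optimal :: "real \<Rightarrow> real \<Rightarrow> bool" where
 "optimal \<mu> P0 \<longleftrightarrow> (\<forall>\<phi>. smooth \<phi> \<longrightarrow> 0 < J \<mu> \<phi> \<longrightarrow> P0 * J \<mu> \<phi> powr (p / q) \<le> E p (grad \<phi>))"

text \<open>Both sides are continuous along the approximating sequence, and positivity of the limit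
  of \<open>F\<close> makes the inequality for smooth functions available eventually.\<close>

lemma optimal_conv:
 assumes P0: "optimal \<mu> P0" and c: "conv s \<phi> u g t" and F: "0 < F \<mu> u t g"
 shows "P0 * F \<mu> u t g powr (p / q) \<le> E p g"
proof -
 have "(\<lambda>n. P0 * J \<mu> (\<phi> n) powr (p / q)) \<longlonglongrightarrow> P0 * F \<mu> u t g powr (p / q)"
  by (intro tendsto_mult_left tendsto_powr F_conv[OF c] tendsto_const) (use F in auto)
 then show ?thesis
 proof (rule tendsto_le[OF sequentially_bot conv_limits(3)[OF c exponents(5,8)]])
  show "\<forall>\<^sub>F n in sequentially. P0 * J \<mu> (\<phi> n) powr (p / q) \<le> E p (grad (\<phi> n))"
   using order_tendstoD(1)[OF F_conv[OF c, of \<mu>] F] by eventually_elim (use P0 convD(1)[OF c] in \<open>auto simp: optimal_def\<close>)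
 qed
qed

text \<open>\<open>P0\<close> is the infimum of \<open>E p\<close> over smooth functions with
  \<open>J \<mu> \<phi> \<ge> 1\<close>; coercivity makes it positive, and scaling gives
  \<open>optimal\<close>. Adding a constant changes neither energy nor constraint, so the average
  over \<open>base\<close> can be made \<open>0\<close>, as the compactness lemma asks.\<close>

lemma minimizing_sequence:
 assumes \<mu>: "0 < \<mu>" and \<phi>0: "smooth \<phi>0" "0 < J \<mu> \<phi>0"
 obtains P0 R \<phi> where "0 < P0" "optimal \<mu> P0" "\<And>n::nat. smooth (\<phi> n)" "\<And>n. avg base (\<phi> n) = 0"
  "\<And>n. 1 \<le> J \<mu> (\<phi> n)" "\<And>n. E p (grad (\<phi> n)) \<le> P0 + inverse (Suc n)"
  "\<And>n. Lnorm L\<Omega> s (grad (\<phi> n)) \<le> R"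
proof -
 obtain C where C: "0 < C" "\<And>\<phi>. smooth \<phi> \<Longrightarrow> \<mu> * m \<phi> \<phi> powr q \<le> E q (grad \<phi>) / 2 + C * E p (grad \<phi>) powr (q / p)"
  using coercive[OF \<mu>] by blast
 have Enn: "0 \<le> E r g" for r g by simp
 have bound: "1 + E q (grad \<phi>) / 2 \<le> C * E p (grad \<phi>) powr (q / p)" if "smooth \<phi>" "1 \<le> J \<mu> \<phi>" for \<phi>
  using C(2)[OF that(1)] that(2) by (simp add: F_def)
 define S where "S = {E p (grad \<phi>) |\<phi>. smooth \<phi> \<and> 1 \<le> J \<mu> \<phi>}"
 define P0 where "P0 = Inf S"
 have normalize: "J \<mu> \<phi> powr (- p / q) * E p (grad \<phi>) \<in> S" if \<phi>: "smooth \<phi>" "0 < J \<mu> \<phi>" for \<phi>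
 proof -
  \<comment> \<open>The scale at which the constraint value becomes exactly
    \<open>1\<close>.\<close>
  define k where "k = J \<mu> \<phi> powr (- 1 / q)"
  have k: "0 < k" using \<phi>(2) by (simp add: k_def)
  have "k powr q = J \<mu> \<phi> powr - 1" using exponents(3) by (simp add: k_def powr_powr)
  then have "k powr q * J \<mu> \<phi> = 1" using \<phi>(2) by (simp add: powr_minus)
  moreover have "k powr p = J \<mu> \<phi> powr (- p / q)" by (simp add: k_def powr_powr)
  ultimately show ?thesis unfolding S_def using scale_energies[OF \<phi>(1) k] by (intro CollectI exI[of _ "\<lambda>x. k * \<phi> x"]) simp
 qed
 have S: "S \<noteq> {}" "bdd_below S" using normalize[OF \<phi>0] by (auto simp: S_def intro!: bdd_belowI[of _ 0])
 have lower: "(1 / C) powr (p / q) \<le> e" if e: "e \<in> S" for e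
 proof -
  obtain \<phi> where \<phi>: "smooth \<phi>" "1 \<le> J \<mu> \<phi>" "e = E p (grad \<phi>)" using e by (auto simp: S_def)
  have "1 \<le> C * e powr (q / p)" using bound[OF \<phi>(1,2)] Enn[where r = q and g = "grad \<phi>"] unfolding \<phi>(3) by linarith
  then have "1 / C \<le> e powr (q / p)" using C(1) by (simp add: pos_divide_le_eq mult.commute)
  then have "(1 / C) powr (p / q) \<le> (e powr (q / p)) powr (p / q)" using C exponents by (intro powr_mono2) auto
  then show ?thesis using exponents \<phi>(3) by (simp add: powr_powr)
 qed
 have "(1 / C) powr (p / q) \<le> P0" unfolding P0_def using S(1) lower by (rule cInf_greatest)
 then have P0: "0 < P0" using C(1) by (smt (verit) powr_gt_zero zero_less_divide_1_iff)
 have opt: "optimal \<mu> P0"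
  unfolding optimal_def
 proof (intro allI impI)
  fix \<phi> :: "'a \<Rightarrow> real" assume \<phi>: "smooth \<phi>" "0 < J \<mu> \<phi>"
  have "P0 \<le> J \<mu> \<phi> powr (- p / q) * E p (grad \<phi>)"
   unfolding P0_def by (rule cInf_lower[OF normalize[OF \<phi>] S(2)])
  then show "P0 * J \<mu> \<phi> powr (p / q) \<le> E p (grad \<phi>)"
   using \<phi>(2) by (simp add: powr_minus field_simps)
 qed
 have "\<exists>\<phi>. smooth \<phi> \<and> avg base \<phi> = 0 \<and> 1 \<le> J \<mu> \<phi> \<and> E p (grad \<phi>) \<le> P0 + inverse (Suc n)" for n :: nat
 proof -
  have "Inf S < P0 + inverse (Suc n)" by (simp add: P0_def)
  then obtain \<psi> where \<psi>: "smooth \<psi>" "1 \<le> J \<mu> \<psi>" "E p (grad \<psi>) < P0 + inverse (Suc n)"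
   using cInf_lessD[OF S(1)] by (auto simp: S_def)
  let ?\<phi> = "\<lambda>x. \<psi> x + - avg base \<psi>"
  have "smooth ?\<phi>" by (intro smooth_add \<psi>(1) smooth_const)
  moreover have "avg base ?\<phi> = 0"
   using avg_lin[OF base \<psi>(1) smooth_const[of 1], of "- avg base \<psi>"] avg_const[OF base, of 1] by simp
  moreover have "J \<mu> ?\<phi> = J \<mu> \<psi>" "grad ?\<phi> = grad \<psi>"
   unfolding F_def m_shift grad_shift[OF \<psi>(1)] by simp_all
  ultimately show ?thesis using \<psi> by (intro exI[of _ ?\<phi>]) auto
 qed
 then obtain \<phi> where \<phi>: "\<And>n::nat. smooth (\<phi> n)" "\<And>n. avg base (\<phi> n) = 0"
  "\<And>n. 1 \<le> J \<mu> (\<phi> n)" "\<And>n. E p (grad (\<phi> n)) \<le> P0 + inverse (Suc n)"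
  by metis
 have P1: "E p (grad (\<phi> n)) \<le> P0 + 1" for n
  using \<phi>(4)[of n] inverse_le_1_iff[of "real (Suc n)"] by auto
 \<comment> \<open>If \<open>p < q\<close>, coercivity bounds the \<open>q\<close>-energy; otherwise
   \<open>s = p\<close> and the minimised energy is itself bounded.\<close>
 have "E s (grad (\<phi> n)) \<le> max (P0 + 1) (2 * C * (P0 + 1) powr (q / p))" for n
 proof (cases "p < q")
  case True
  have "E p (grad (\<phi> n)) powr (q / p) \<le> (P0 + 1) powr (q / p)" using P1[of n] exponents by (intro powr_mono2) auto
  then have "C * E p (grad (\<phi> n)) powr (q / p) \<le> C * (P0 + 1) powr (q / p)" using C(1) by simp
  then have "E q (grad (\<phi> n)) \<le> 2 * C * (P0 + 1) powr (q / p)" using bound[OF \<phi>(1,3), of n] by linarith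
  then show ?thesis using True by (simp add: max_def)
 next
  case False
  then have "s = p" by simp
  then show ?thesis using order_trans[OF P1[of n] max.cobounded1] by simp
 qed
 then have "Lnorm L\<Omega> s (grad (\<phi> n)) \<le> max (P0 + 1) (2 * C * (P0 + 1) powr (q / p)) powr (1 / s)" for n
  unfolding Lnorm_def using exponents by (intro powr_mono2) auto
 then show thesis by (rule that[OF P0 opt \<phi>])
qed

text \<open>For a midpoint of two members of the sequence, \<open>optimal\<close> leaves no room for
  the extra term in Clarkson's inequality: for \<open>p < q\<close> this term raises the constraint
  value, for \<open>p > q\<close> it lowers the energy. Either way the energy of the half difference
  is bounded by a quantity tending to \<open>0\<close>.\<close>

lemma minimizer:
 assumes \<mu>: "0 < \<mu>" and \<phi>0: "smooth \<phi>0" "0 < J \<mu> \<phi>0"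
 obtains P0 \<phi> u g t where "0 < P0" "optimal \<mu> P0" "conv s \<phi> u g t" "E p g \<le> P0" "1 \<le> F \<mu> u t g"
proof (rule minimizing_sequence[OF \<mu> \<phi>0])
 fix P0 R and \<phi>' :: "nat \<Rightarrow> 'a \<Rightarrow> real"
 assume P0: "0 < P0" "optimal \<mu> P0" and \<phi>': "\<And>n. smooth (\<phi>' n)" "\<And>n. avg base (\<phi>' n) = 0"
  "\<And>n. 1 \<le> J \<mu> (\<phi>' n)" "\<And>n. E p (grad (\<phi>' n)) \<le> P0 + inverse (Suc n)"
  "\<And>n. Lnorm L\<Omega> s (grad (\<phi>' n)) \<le> R"
 show thesis
 proof (rule rellich[OF exponents(6) \<phi>'(1,2,5)])
  fix r :: "nat \<Rightarrow> nat"
  assume r: "strict_mono r"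
   and C1: "\<And>e. 0 < e \<Longrightarrow> \<exists>k. \<forall>m\<ge>k. \<forall>n\<ge>k. Lnorm L\<Omega> s (\<lambda>x. \<phi>' (r m) x - \<phi>' (r n) x) \<le> e"
   and C2: "\<And>e. 0 < e \<Longrightarrow> \<exists>k. \<forall>m\<ge>k. \<forall>n\<ge>k. Lnorm \<sigma> s (\<lambda>x. \<phi>' (r m) x - \<phi>' (r n) x) \<le> e"
  define \<phi> where "\<phi> n = \<phi>' (r n)" for n
  note \<phi> = \<phi>'(1)[of "r _", folded \<phi>_def]
  note sm = smooth_Lp[OF \<phi> exponents(7)]
  obtain u where u: "u \<in> Lp L\<Omega> s" "Lp_tendsto L\<Omega> s \<phi> u"
   by (rule Lp_complete[of \<phi>, OF sm(1) exponents(7)]) (use C1 in \<open>auto simp: \<phi>_def\<close>)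
  obtain t where t: "t \<in> Lp \<sigma> s" "Lp_tendsto \<sigma> s \<phi> t"
   by (rule Lp_complete[of \<phi>, OF sm(3) exponents(7)]) (use C2 in \<open>auto simp: \<phi>_def\<close>)
  have F1: "1 \<le> J \<mu> (\<phi> n)" for n using \<phi>'(3) by (simp add: \<phi>_def)
  have EP: "(\<lambda>n. E p (grad (\<phi> n))) \<longlonglongrightarrow> P0"
  proof (rule tendsto_sandwich[OF _ _ tendsto_const])
   have "P0 \<le> E p (grad (\<phi> n))" for n
   proof -
    have "P0 * 1 \<le> P0 * J \<mu> (\<phi> n) powr (p / q)"
     using P0(1) F1[of n] exponents by (intro mult_left_mono ge_one_powr_ge_zero) auto
    also have "\<dots> \<le> E p (grad (\<phi> n))" using P0(2) F1[of n] \<phi> by (auto simp: optimal_def)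
    finally show ?thesis by simp
   qed
   then show "\<forall>\<^sub>F n in sequentially. P0 \<le> E p (grad (\<phi> n))" by simp
   have "E p (grad (\<phi> n)) \<le> P0 + inverse (Suc n)" for n
   proof -
    have "inverse (real (Suc (r n))) \<le> inverse (real (Suc n))"
     using strict_mono_imp_increasing[OF r, of n] by (intro le_imp_inverse_le) auto
    then show ?thesis using \<phi>'(4)[of "r n"] unfolding \<phi>_def by linarith
   qed
   then show "\<forall>\<^sub>F n in sequentially. E p (grad (\<phi> n)) \<le> P0 + inverse (Suc n)" by simp
   show "(\<lambda>n. P0 + inverse (real (Suc n))) \<longlonglongrightarrow> P0" using tendsto_add[OF tendsto_const LIMSEQ_inverse_real_of_nat] by simp
  qed
  have ut: "X u t"
   by (intro XI Lp_mono_exponent(1)[OF finite_L\<Omega> u(1)] Lp_mono_exponent(1)[OF finite_\<sigma> t(1)] exponents)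
  have N0: "(\<lambda>n. N (\<lambda>x. \<phi> n x - u x) (\<lambda>x. \<phi> n x - t x)) \<longlonglongrightarrow> 0" by (rule N_tendsto[OF \<phi> u(1) t(1) u(2) t(2)])
  \<comment> \<open>Limits over pairs of indices, so that being Cauchy is convergence along
    \<F>.\<close>
  define \<F> where "\<F> = (sequentially \<times>\<^sub>F sequentially :: (nat \<times> nat) filter)"
  have fst: "((\<lambda>z. h (fst z)) \<longlongrightarrow> l) \<F>" and snd: "((\<lambda>z. h (snd z)) \<longlongrightarrow> l) \<F>" if "h \<longlonglongrightarrow> l" for h :: "nat \<Rightarrow> real" and l
   unfolding \<F>_def by (rule filterlim_compose[OF that filterlim_fst] filterlim_compose[OF that filterlim_snd])+
  define w where "w z = (\<lambda>x. (1/2) * (\<phi> (fst z) x + \<phi> (snd z) x))" for z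
  have w: "smooth (w z)" for z unfolding w_def by (intro smooth_cmult smooth_add \<phi>)
  have gw: "grad (w z) = (\<lambda>x. (1/2) *\<^sub>R (grad (\<phi> (fst z)) x + grad (\<phi> (snd z)) x))" for z
   unfolding w_def by (rule ext) (simp only: grad_cmult[OF smooth_add[OF \<phi> \<phi>]] grad_add[OF \<phi> \<phi>])
  have mw: "((\<lambda>z. m (w z) (w z)) \<longlongrightarrow> m u t) \<F>"
  proof (rule m_N_tendsto(1)[OF X_smooth[OF w] ut])
   let ?N = "\<lambda>n. N (\<lambda>x. \<phi> n x - u x) (\<lambda>x. \<phi> n x - t x)"
   have le: "N (\<lambda>x. w z x - u x) (\<lambda>x. w z x - t x) \<le> (?N (fst z) + ?N (snd z)) / 2" for z
   proof -
    have "N (\<lambda>x. w z x - u x) (\<lambda>x. w z x - t x)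
      = N (\<lambda>x. (1/2) * ((\<phi> (fst z) x - u x) + (\<phi> (snd z) x - u x))) (\<lambda>x. (1/2) * ((\<phi> (fst z) x - t x) + (\<phi> (snd z) x - t x)))"
     by (rule arg_cong2[of _ _ _ _ N]) (auto simp: w_def field_simps)
    also have "\<dots> \<le> (?N (fst z) + ?N (snd z)) / 2"
     unfolding N_scale using N_triangle[OF X_diff[OF X_smooth[OF \<phi>] ut] X_diff[OF X_smooth[OF \<phi>] ut], of "fst z" "snd z"] by simp
    finally show ?thesis .
   qed
   have lim: "((\<lambda>z. (?N (fst z) + ?N (snd z)) / 2) \<longlongrightarrow> 0) \<F>"
    using tendsto_divide[OF tendsto_add[OF fst[OF N0] snd[OF N0]] tendsto_const[of 2]]
    by simp
   show "((\<lambda>z. N (\<lambda>x. w z x - u x) (\<lambda>x. w z x - t x)) \<longlongrightarrow> 0) \<F>"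
    by (rule tendsto_sandwich[OF _ always_eventually[OF allI[OF le]] tendsto_const lim]) simp
  qed
  let ?mq = "\<lambda>n. m (\<phi> n) (\<phi> n) powr q" and ?d = "\<lambda>z x. (1/2) *\<^sub>R (grad (\<phi> (fst z)) x - grad (\<phi> (snd z)) x)"
  \<comment> \<open>The defect at the midpoint of the positive part of \<open>F\<close>. Convexity
    gives it the unfavourable sign, but it tends to \<open>0\<close>, since \<open>m\<close> is
    continuous under the convergence already obtained.\<close>
  define \<delta> where "\<delta> z = \<mu> * m (w z) (w z) powr q - \<mu> * (?mq (fst z) + ?mq (snd z)) / 2" for z
  define A where "A z = (E p (grad (\<phi> (fst z))) + E p (grad (\<phi> (snd z)))) / 2" for z
  have mq: "?mq \<longlonglongrightarrow> m u t powr q"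
   by (rule tendsto_powr2[OF m_N_tendsto(1)[OF X_smooth[OF \<phi>] ut N0] tendsto_const]) (use exponents in auto)
  have "((\<lambda>z. \<mu> * m (w z) (w z) powr q - \<mu> * (?mq (fst z) + ?mq (snd z)) / 2)
    \<longlongrightarrow> \<mu> * m u t powr q - \<mu> * (m u t powr q + m u t powr q) / 2) \<F>"
   by (intro tendsto_intros fst[OF mq] snd[OF mq] tendsto_powr2[OF mw]) (use exponents in auto)
  then have \<delta>: "(\<delta> \<longlongrightarrow> 0) \<F>" by (simp add: \<delta>_def[abs_def])
  have A: "(A \<longlongrightarrow> P0) \<F>"
   using tendsto_divide[OF tendsto_add[OF fst[OF EP] snd[OF EP]] tendsto_const[of 2]] by (simp add: A_def[abs_def])
  have \<delta>1: "\<forall>\<^sub>F z in \<F>. -1 < \<delta> z" using order_tendstoD(1)[OF \<delta>, of "-1"] by simp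
  \<comment> \<open>The constraint value at the midpoint is at least \<open>1\<close>, plus the
    defect, plus the amount by which the \<open>q\<close>-energy of the midpoint falls below the
    mean.\<close>
  have Fw: "1 + \<delta> z + ((E q (grad (\<phi> (fst z))) + E q (grad (\<phi> (snd z)))) / 2 - E q (grad (w z))) \<le> J \<mu> (w z)" for z
   using F1[of "fst z"] F1[of "snd z"] by (simp add: F_def \<delta>_def field_simps)
  have opt: "P0 * c powr (p / q) \<le> E p (grad (w z))" if "0 < c" "c \<le> J \<mu> (w z)" for c z
  proof -
   have "P0 * c powr (p / q) \<le> P0 * J \<mu> (w z) powr (p / q)"
    using that P0(1) exponents by (intro mult_left_mono powr_mono2) auto
   also have "\<dots> \<le> E p (grad (w z))" using P0(2) w that by (auto simp: optimal_def)
   finally show ?thesis .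
  qed
  note mid = E_midpoint[OF sm(2) sm(2)]
  have "\<exists>\<tau>. (\<tau> \<longlongrightarrow> 0) \<F> \<and> (\<forall>\<^sub>F z in \<F>. E s (?d z) \<le> \<tau> z)"
  proof (cases "p < q")
   case True
   then have sq: "s = q" by simp
   have "E s (?d z) \<le> (A z / P0) powr (q / p) - 1 - \<delta> z" if d: "-1 < \<delta> z" for z
   proof -
    \<comment> \<open>Clarkson's inequality for the \<open>q\<close>-energy puts the half difference
      into the constraint value, whose power \<open>optimal\<close> bounds by the mean
      \<open>p\<close>-energy, and that tends to \<open>P0\<close>.\<close>
    let ?c = "1 + \<delta> z + E q (?d z)"
    have c: "0 < ?c" "?c \<le> J \<mu> (w z)"
    proof -
     have "0 < 1 + \<delta> z" using d by simp
     then show "0 < ?c" by (rule add_pos_nonneg) simp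
     show "?c \<le> J \<mu> (w z)"
      using Fw[of z] mid(2)[OF exponents(2,9) less_imp_le[OF q2], of "fst z" "snd z"] unfolding gw by linarith
    qed
    have "P0 * ?c powr (p / q) \<le> A z"
     using opt[OF c] mid(1)[OF exponents(5,8), of "fst z" "snd z"] by (simp add: gw A_def)
    then have "?c powr (p / q) \<le> A z / P0" using P0(1) by (simp add: pos_le_divide_eq mult.commute)
    then have "(?c powr (p / q)) powr (q / p) \<le> (A z / P0) powr (q / p)" using exponents by (intro powr_mono2) auto
    then show ?thesis using c(1) exponents unfolding sq by (simp add: powr_powr)
   qed
   then have "\<forall>\<^sub>F z in \<F>. E s (?d z) \<le> (A z / P0) powr (q / p) - 1 - \<delta> z" using \<delta>1 by (rule eventually_mono[rotated])
   moreover have "((\<lambda>z. (A z / P0) powr (q / p) - 1 - \<delta> z) \<longlongrightarrow> (P0 / P0) powr (q / p) - 1 - 0) \<F>"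
    by (intro tendsto_intros A \<delta>) (use P0 in auto)
   ultimately show ?thesis using P0(1) by (intro exI[of _ "\<lambda>z. (A z / P0) powr (q / p) - 1 - \<delta> z"]) simp
  next
   case False
   then have sp: "s = p" and p2: "2 \<le> p" using q2 pq by auto
   \<comment> \<open>Here convexity of the \<open>q\<close>-energy keeps the constraint value above
     \<open>1 + \<delta> z\<close>, and Clarkson's inequality acts on the minimised
     \<open>p\<close>-energy, which \<open>optimal\<close> bounds from below.\<close>
   have "E s (?d z) \<le> A z - P0 * (1 + \<delta> z) powr (p / q)" if d: "-1 < \<delta> z" for z
   proof -
    have "0 < 1 + \<delta> z" "1 + \<delta> z \<le> J \<mu> (w z)"
     using d Fw[of z] mid(1)[OF exponents(2,9), of "fst z" "snd z"] unfolding gw by linarith+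
    from opt[OF this] show ?thesis
     using mid(2)[OF exponents(5,8) p2, of "fst z" "snd z"] unfolding sp gw A_def by linarith
   qed
   then have "\<forall>\<^sub>F z in \<F>. E s (?d z) \<le> A z - P0 * (1 + \<delta> z) powr (p / q)" using \<delta>1 by (rule eventually_mono[rotated])
   moreover have "((\<lambda>z. A z - P0 * (1 + \<delta> z) powr (p / q)) \<longlongrightarrow> P0 - P0 * (1 + 0) powr (p / q)) \<F>"
    by (intro tendsto_intros A \<delta>) auto
   ultimately show ?thesis by (intro exI[of _ "\<lambda>z. A z - P0 * (1 + \<delta> z) powr (p / q)"]) simp
  qed
  then obtain \<tau> where \<tau>: "(\<tau> \<longlongrightarrow> 0) \<F>" "\<forall>\<^sub>F z in \<F>. E s (?d z) \<le> \<tau> z" by blast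
  have "\<exists>k. \<forall>i\<ge>k. \<forall>j\<ge>k. Lnorm L\<Omega> s (\<lambda>x. grad (\<phi> i) x - grad (\<phi> j) x) \<le> e" if e: "0 < e" for e
  proof -
   have "\<forall>\<^sub>F z in \<F>. \<tau> z < (e / 2) powr s" by (rule order_tendstoD(2)[OF \<tau>(1)]) (use e in simp)
   then have "\<forall>\<^sub>F z in \<F>. Lnorm L\<Omega> s (\<lambda>x. grad (\<phi> (fst z)) x - grad (\<phi> (snd z)) x) \<le> e"
    using \<tau>(2)
   proof eventually_elim
    case (elim z)
    then have "Lnorm L\<Omega> s (?d z) \<le> e / 2" using e exponents by (subst Lnorm_le_iff) auto
    then show ?case unfolding Lnorm_scaleR[OF exponents(7)] by simp
   qed
   then show ?thesis unfolding \<F>_def eventually_prod_sequentially by auto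
  qed
  then obtain g where g: "g \<in> Lp L\<Omega> s" "Lp_tendsto L\<Omega> s (\<lambda>n. grad (\<phi> n)) g"
   using Lp_complete[of "\<lambda>n. grad (\<phi> n)", OF sm(2) exponents(7)] by blast
  have c: "conv s \<phi> u g t" using \<phi> u t g by (simp add: conv_def)
  have "E p g = P0" using LIMSEQ_unique[OF conv_limits(3)[OF c exponents(5,8)] EP] .
  moreover have "1 \<le> F \<mu> u t g" by (rule LIMSEQ_le_const[OF F_conv[OF c]]) (use F1 in blast)
  ultimately show thesis using that[OF P0 c] by simp
 qed
qed

section \<open>The Euler equation\<close>

abbreviation A :: "real \<Rightarrow> ('a \<Rightarrow> 'a) \<Rightarrow> ('a \<Rightarrow> 'a) \<Rightarrow> real" where
 "A r g h \<equiv> LINT x|L\<Omega>. dual_pow r (g x) \<bullet> h x"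

lemma Mass_pos: "Mass f g \<noteq> 0 \<Longrightarrow> 0 < Mass f g"
 by (simp add: less_le)

text \<open>Since \<open>F\<close> along a line is bounded below by a function with the derivative of
 \<open>\<mu> * Mass - E q\<close> (lemma \<open>m_tangent\<close>), no Lagrange multiplier is needed: the infimum \<open>P0\<close> appears
 as a factor and is scaled away at the end.\<close>

lemma euler_unscaled:
 assumes P0: "0 < P0" "optimal \<mu> P0" and c: "conv s \<phi> u g t" and N: "N u t = m u t"
  and opt: "E p g \<le> P0" "1 \<le> F \<mu> u t g" and c': "conv s \<psi> v h r" and \<mu>: "0 < \<mu>"
 shows "A p g h + P0 * A q g h = P0 * \<mu> * B u t v r"
proof -
 note pq0 = exponents(3,4)
 \<comment> \<open>A larger constraint value would force \<open>E p g\<close> above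
   \<open>P0\<close>.\<close>
 have le1: "F \<mu> u t g \<le> 1"
 proof (rule ccontr)
  assume "\<not> F \<mu> u t g \<le> 1"
  then have "1 < F \<mu> u t g powr (p / q)" using pq0 by simp
  moreover have "P0 * F \<mu> u t g powr (p / q) \<le> P0 * 1" using optimal_conv[OF P0(2) c] opt by simp
  ultimately show False using P0(1) by simp
 qed
 then have F1: "F \<mu> u t g = 1" using opt by simp
 have EP: "E p g = P0" using optimal_conv[OF P0(2) c] opt F1 by simp
 define G where "G \<tau> = \<mu> * (Mass u t + q * \<tau> * B u t v r) - E q (\<lambda>x. g x + \<tau> *\<^sub>R h x)" for \<tau>
 \<comment> \<open>Along the line \<open>D\<close> is smallest at \<open>0\<close>, where its value
   is \<open>0\<close>: \<open>G\<close> is a minorant of \<open>F\<close> with only the mass part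
   linearised, and \<open>optimal\<close> applies to \<open>F\<close>. The vanishing derivative of
   \<open>D\<close> is the equation with the factor \<open>P0\<close>.\<close>
 define D where "D \<tau> = E p (\<lambda>x. g x + \<tau> *\<^sub>R h x) - P0 * G \<tau> powr (p / q)" for \<tau>
 have G0: "G 0 = 1" using F1 N by (simp add: G_def F_def flip: N_powr)
 have dE: "((\<lambda>\<tau>. E k (\<lambda>x. g x + \<tau> *\<^sub>R h x)) has_real_derivative k * A k g h) (at 0)" if "1 < k" "k \<le> s" for k
  by (rule has_derivative_integral_norm_powr[OF Lp_mono_exponent(1)[OF finite_L\<Omega> convD(3)[OF c] less_imp_le[OF that(1)] that(2)]
     Lp_mono_exponent(1)[OF finite_L\<Omega> convD(3)[OF c'] less_imp_le[OF that(1)] that(2)] that(1)])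
 have dG: "(G has_real_derivative \<mu> * (q * B u t v r) - q * A q g h) (at 0)"
 proof -
  have "((\<lambda>\<tau>. \<mu> * (M + q * \<tau> * b)) has_real_derivative \<mu> * (q * b)) (at 0)" for M b
   by (auto intro!: derivative_eq_intros)
  then show ?thesis unfolding G_def by (rule DERIV_diff[OF _ dE[OF exponents(1,9)]])
 qed
 have dD: "(D has_real_derivative p * A p g h - P0 * (p / q * (\<mu> * (q * B u t v r) - q * A q g h))) (at 0)"
  unfolding D_def using DERIV_fun_powr[OF dG, of "p / q"] G0 p1
  by (intro DERIV_diff dE DERIV_cmult) auto
 have "\<forall>\<^sub>F \<tau> in at 0. 0 < G \<tau>"
  using order_tendstoD(1)[OF DERIV_isCont[OF dG, unfolded isCont_def]] G0 by simp
 then obtain d where d: "0 < d" "\<And>\<tau>. \<tau> \<noteq> 0 \<Longrightarrow> \<bar>\<tau>\<bar> < d \<Longrightarrow> 0 < G \<tau>" by (auto simp: eventually_at)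
 have "D 0 \<le> D \<tau>" if "\<bar>0 - \<tau>\<bar> < d" for \<tau>
 proof -
  have G: "0 < G \<tau>" using d(2)[of \<tau>] that G0 by (cases "\<tau> = 0") auto
  have le: "G \<tau> \<le> F \<mu> (\<lambda>x. u x + \<tau> * v x) (\<lambda>x. t x + \<tau> * r x) (\<lambda>x. g x + \<tau> *\<^sub>R h x)"
   using m_tangent[OF X_conv[OF c] X_conv[OF c'] N, of \<tau>] \<mu> by (simp add: G_def F_def)
  have "P0 * G \<tau> powr (p / q) \<le> P0 * F \<mu> (\<lambda>x. u x + \<tau> * v x) (\<lambda>x. t x + \<tau> * r x) (\<lambda>x. g x + \<tau> *\<^sub>R h x) powr (p / q)"
   using le G P0(1) pq0 by (intro mult_left_mono powr_mono2) auto
  also have "\<dots> \<le> E p (\<lambda>x. g x + \<tau> *\<^sub>R h x)"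
   using optimal_conv[OF P0(2) conv_lin[OF c c' exponents(7), of \<tau>]] le G by linarith
  finally show ?thesis using G0 EP by (simp add: D_def)
 qed
 then have d0: "p * A p g h - P0 * (p / q * (\<mu> * (q * B u t v r) - q * A q g h)) = 0"
  using DERIV_local_min[OF dD d(1)] by blast
 have eq: "p / q * (\<mu> * (q * y) - q * z) = p * (\<mu> * y - z)" for y z
  using pq0 by (simp add: field_simps)
 have "p * (A p g h + P0 * A q g h - P0 * \<mu> * B u t v r) = 0"
  using d0 unfolding eq by (simp add: algebra_simps)
 then show ?thesis using pq0 by simp
qed

text \<open>An optimal constant is added so that \<open>N\<close> equals \<open>m\<close>, which
  changes neither the gradient nor \<open>F\<close>. Scaling by \<open>k\<close> multiplies the
  \<open>p\<close>-term by \<open>k powr (p - 1)\<close> and the others by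
  \<open>k powr (q - 1)\<close>, so the factor \<open>P0\<close> disappears for
  \<open>k powr (q - p) = P0\<close>, solvable since \<open>p \<noteq> q\<close>.\<close>

lemma euler:
 assumes \<mu>: "0 < \<mu>" and \<phi>0: "smooth \<phi>0" "0 < J \<mu> \<phi>0"
 obtains \<phi> u g t where "conv s \<phi> u g t" "0 < Mass u t"
  "\<And>\<psi> v h r. conv s \<psi> v h r \<Longrightarrow> A p g h + A q g h = \<mu> * B u t v r"
proof (rule minimizer[OF \<mu> \<phi>0])
 fix P0 \<phi> u g t
 assume P0: "0 < P0" "optimal \<mu> P0" and c: "conv s \<phi> u g t" and opt: "E p g \<le> P0" "1 \<le> F \<mu> u t g"
 obtain c0 where c0: "N (\<lambda>x. u x + c0) (\<lambda>x. t x + c0) = m u t" using m_attained[OF X_conv[OF c]] by blast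
 let ?u = "\<lambda>x. u x + c0" and ?t = "\<lambda>x. t x + c0"
 have cu: "conv s (\<lambda>n x. \<phi> n x + c0) ?u g ?t"
  using conv_lin[OF c conv_smooth[OF smooth_const[of c0] exponents(7)] exponents(7), of 1] by simp
 have Nu: "N ?u ?t = m ?u ?t" using c0 by (simp add: m_shift)
 have Fu: "1 \<le> F \<mu> ?u ?t g" using opt(2) by (simp add: F_def m_shift)
 have "0 < m ?u ?t powr q"
 proof -
  have "0 \<le> E q g" by simp
  then have "0 < \<mu> * m ?u ?t powr q" using Fu unfolding F_def by linarith
  then show ?thesis using \<mu> by (simp add: zero_less_mult_iff)
 qed
 then have Mu: "0 < Mass ?u ?t" using Nu by (simp flip: N_powr)
 define k where "k = P0 powr (1 / (q - p))"
 have k: "0 < k" using P0(1) by (simp add: k_def)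
 have kP: "k powr (p - 1) * P0 = k powr (q - 1)"
 proof -
  have "P0 = k powr (q - p)" using P0(1) pq by (simp add: k_def powr_powr)
  then have "k powr (p - 1) * P0 = k powr (p - 1) * k powr (q - p)" by simp
  then show ?thesis by (simp flip: powr_add)
 qed
 have ck: "conv s (\<lambda>n x. k * (\<phi> n x + c0)) (\<lambda>x. k * ?u x) (\<lambda>x. k *\<^sub>R g x) (\<lambda>x. k * ?t x)"
  using conv_lin[OF conv_smooth[OF smooth_const[of 0] exponents(7)] cu exponents(7), of k] by simp
 show thesis
 proof (rule that[OF ck])
  show "0 < Mass (\<lambda>x. k * ?u x) (\<lambda>x. k * ?t x)"
   using Mu k N_scale[of k ?u ?t] by (simp add: powr_mult flip: N_powr)
  fix \<psi> v h r assume c': "conv s \<psi> v h r"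
  have Ak: "A e (\<lambda>x. k *\<^sub>R g x) h = k powr (e - 1) * A e g h" for e
   using k by (simp add: dual_pow_scaleR)
  have Bk: "B (\<lambda>x. k * ?u x) (\<lambda>x. k * ?t x) v r = k powr (q - 1) * B ?u ?t v r"
   unfolding B_def dual_pow_scaleR[OF k, of q "_ :: real", unfolded real_scaleR_def] by (simp add: mult.assoc distrib_left)
  have "k powr (p - 1) * (A p g h + P0 * A q g h) = k powr (p - 1) * (P0 * \<mu> * B ?u ?t v r)"
   using euler_unscaled[OF P0 cu Nu opt(1) Fu c' \<mu>] by simp
  then have "k powr (p - 1) * A p g h + (k powr (p - 1) * P0) * A q g h = \<mu> * ((k powr (p - 1) * P0) * B ?u ?t v r)"
   by (simp add: algebra_simps)
  then show "A p (\<lambda>x. k *\<^sub>R g x) h + A q (\<lambda>x. k *\<^sub>R g x) h = \<mu> * B (\<lambda>x. k * ?u x) (\<lambda>x. k * ?t x) v r"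
   unfolding Ak Bk kP .
 qed
qed

section \<open>The eigenvalue problem in the Sobolev space\<close>

abbreviation "W \<equiv> Sobolev \<Omega> s"
abbreviation "T \<equiv> boundary_trace \<Omega> s"

lemma W_conv: "u \<in> W \<Longrightarrow> \<exists>\<phi>. conv s \<phi> u (wgrad \<Omega> u) (T u)"
 by (rule Sobolev_conv[OF _ exponents(7)])

lemma W_Lp:
 assumes "u \<in> W" shows "u \<in> Lp L\<Omega> s" "wgrad \<Omega> u \<in> Lp L\<Omega> s" "T u \<in> Lp \<sigma> s" "X u (T u)"
 using W_conv[OF assms] convD(2-4) X_conv by blast+

lemma AE_weights:
 "AE x in L\<Omega>. P x \<Longrightarrow> AE x in Ma. P x" "AE x in \<sigma>. P x \<Longrightarrow> AE x in Mb. P x"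
 by (auto simp: AE_density elim!: eventually_mono)

lemma trace_cong:
 assumes "AE x in \<sigma>. t x = t' x" "t \<in> borel_measurable \<sigma>" "t' \<in> borel_measurable \<sigma>"
 shows "Mass f t = Mass f t'" "m f t = m f t'" "h \<in> borel_measurable \<sigma> \<Longrightarrow> B f t k h = B f t' k h"
  "h \<in> borel_measurable \<sigma> \<Longrightarrow> B k h f t = B k h f t'"
proof -
 note [measurable] = assms(2,3)
 note ae = AE_weights(2)[OF assms(1)]
 have "Mass f (\<lambda>x. t x + c) = Mass f (\<lambda>x. t' x + c)" for f c
  unfolding Mass_def using ae by (intro arg_cong2[where f = "(+)"] integral_cong_AE refl) auto
 from this[of _ 0] this show "Mass f t = Mass f t'" "m f t = m f t'" by (simp_all add: m_def N_def)
 assume [measurable]: "h \<in> borel_measurable \<sigma>"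
 show "B f t k h = B f t' k h" "B k h f t = B k h f t'"
  unfolding B_def using ae by (intro arg_cong2[where f = "(+)"] integral_cong_AE refl; auto)+
qed

lemma weighted_mass_eq: "u \<in> W \<Longrightarrow> weighted_mass \<Omega> p q a b u = Mass u (T u)"
 using LpD(1)[OF W_Lp(1)] LpD(1)[OF W_Lp(3)] by (simp add: weighted_mass_def Mass_def LINT_weights)

lemma B_eq:
 assumes [measurable]: "f \<in> borel_measurable L\<Omega>" "g \<in> borel_measurable \<sigma>" "h \<in> borel_measurable L\<Omega>" "k \<in> borel_measurable \<sigma>"
 shows "(LINT x|L\<Omega>. a x * \<bar>f x\<bar> powr (q - 2) * f x * h x) + (LINT x|\<sigma>. b x * \<bar>g x\<bar> powr (q - 2) * g x * k x) = B f g h k"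
proof -
 have "(LINT x|Ma. dual_pow q (f x) * h x) = (LINT x|L\<Omega>. a x * (dual_pow q (f x) * h x))"
  "(LINT x|Mb. dual_pow q (g x) * k x) = (LINT x|\<sigma>. b x * (dual_pow q (g x) * k x))"
  by (rule LINT_weights; measurable)+
 then show ?thesis by (simp add: B_def dual_pow_def mult.assoc)
qed

lemma constraint_iff: "u \<in> constraint_set \<Omega> p q a b \<longleftrightarrow> u \<in> W \<and> N u (T u) = m u (T u)"
proof (cases "u \<in> W")
 case True
 have "(LINT x|L\<Omega>. a x * \<bar>u x\<bar> powr (q - 2) * u x * 1) + (LINT x|\<sigma>. b x * \<bar>T u x\<bar> powr (q - 2) * T u x * 1)
   = B u (T u) (\<lambda>_. 1) (\<lambda>_. 1)"
  by (rule B_eq[OF LpD(1)[OF W_Lp(1)[OF True]] LpD(1)[OF W_Lp(3)[OF True]]]) auto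
 then have "u \<in> constraint_set \<Omega> p q a b \<longleftrightarrow> B u (T u) (\<lambda>_. 1) (\<lambda>_. 1) = 0"
  using True unfolding constraint_set_def mult_1_right by simp
 then show ?thesis unfolding critical_iff[OF W_Lp(4)[OF True]] using True by blast
qed (simp add: constraint_set_def)

text \<open>Splitting the integral of the sum of the two fluxes requires each to be integrable; this
  holds because on a finite measure space gradients with exponent \<open>s\<close> also have the
  exponents \<open>p\<close> and \<open>q\<close>.\<close>

lemma eigenvalue_iff: "eigenvalue \<Omega> p q a b \<mu> \<longleftrightarrow> (\<exists>u\<in>W. \<not> ae_zero_on \<Omega> u \<and>
 (\<forall>v\<in>W. A p (wgrad \<Omega> u) (wgrad \<Omega> v) + A q (wgrad \<Omega> u) (wgrad \<Omega> v) = \<mu> * B u (T u) v (T v)))"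
proof -
 have "(LINT x|L\<Omega>. (norm (wgrad \<Omega> u x) powr (p - 2) + norm (wgrad \<Omega> u x) powr (q - 2)) * (wgrad \<Omega> u x \<bullet> wgrad \<Omega> v x))
   = A p (wgrad \<Omega> u) (wgrad \<Omega> v) + A q (wgrad \<Omega> u) (wgrad \<Omega> v)" if "u \<in> W" "v \<in> W" for u v
 proof -
  have i: "integrable L\<Omega> (\<lambda>x. dual_pow r (wgrad \<Omega> u x) \<bullet> wgrad \<Omega> v x)" if "1 \<le> r" "r \<le> s" for r
   using Lp_mono_exponent(1)[OF finite_L\<Omega> W_Lp(2)[OF \<open>u \<in> W\<close>] that] Lp_mono_exponent(1)[OF finite_L\<Omega> W_Lp(2)[OF \<open>v \<in> W\<close>] that] that(1)
   by (rule integrable_dual_pow_inner)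
  show ?thesis
   unfolding Bochner_Integration.integral_add[OF i[OF exponents(5,8)] i[OF exponents(2,9)], symmetric]
   by (intro Bochner_Integration.integral_cong refl) (simp add: dual_pow_def distrib_right)
 qed
 then show ?thesis
  unfolding eigenvalue_def
  by (intro bex_cong conj_cong ball_cong refl arg_cong2[where f = "(=)"] arg_cong2[where f = "(*)"] B_eq LpD(1)[OF W_Lp(1)] LpD(1)[OF W_Lp(3)])
qed

lemma W_smooth:
 assumes "smooth \<phi>"
 shows "\<phi> \<in> W" "AE x in L\<Omega>. wgrad \<Omega> \<phi> x = grad \<phi> x" "AE x in \<sigma>. T \<phi> x = \<phi> x"
 using conv_Sobolev[OF conv_smooth[OF assms exponents(7)] exponents(7)] by blast+

lemma trace_smooth:
 assumes "smooth \<phi>"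
 shows "Mass f (T \<phi>) = Mass f \<phi>" "m f (T \<phi>) = m f \<phi>" "u \<in> W \<Longrightarrow> B u (T u) f (T \<phi>) = B u (T u) f \<phi>"
 using trace_cong[OF W_smooth(3)[OF assms] LpD(1)[OF W_Lp(3)[OF W_smooth(1)[OF assms]]] LpD(1)[OF smooth_Lp(3)[OF assms exponents(7)]]]
  LpD(1)[OF W_Lp(3)] by blast+

text \<open>A null function has null gradient, hence null trace. Read backwards, a positive weighted
  mass certifies that a function is nonzero in the domain, even if all the weight sits on the
  boundary.\<close>

lemma ae_zero:
 assumes u: "u \<in> W" and z: "ae_zero_on \<Omega> u"
 shows "Mass u (T u) = 0"
proof -
 have z: "AE x in L\<Omega>. u x = 0" using z by (simp add: ae_zero_on_def)
 have "weak_gradient \<Omega> u (\<lambda>_. 0)"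
  by (rule weak_gradient_cong_AE[OF smooth_weak_gradient[OF smooth_const[of 0]] W_Lp(1)[OF u] _ exponents(7)])
   (use z LpD(1) smooth_Lp(2)[OF smooth_const[of 0] exponents(7)] in \<open>auto simp: Lp_def\<close>)
 then have g: "AE x in L\<Omega>. wgrad \<Omega> u x = 0" by (rule wgrad_AE_eq[OF u])
 obtain \<phi> where "conv s \<phi> u (wgrad \<Omega> u) (T u)" using W_conv[OF u] by blast
 then have "AE x in \<sigma>. T u x = 0" using exponents(7) z g by (rule conv_zero_trace)
 from AE_weights(1)[OF z] AE_weights(2)[OF this]
 have "(LINT x|Ma. \<bar>u x\<bar> powr q) = 0" "(LINT x|Mb. \<bar>T u x\<bar> powr q) = 0"
  by (auto intro!: integral_eq_zero_AE elim!: eventually_mono)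
 then show ?thesis by (simp add: Mass_def)
qed

text \<open>Constants have zero gradient, and the constant \<open>1\<close> is not a null function
  because its weighted mass is positive.\<close>

lemma eigenvalue_zero: "eigenvalue \<Omega> p q a b 0"
 unfolding eigenvalue_iff
proof (intro bexI conjI ballI)
 note one = smooth_const[of 1]
 have "Mass (\<lambda>_. 1) (T (\<lambda>_. 1)) \<noteq> 0" using N_1 by (simp add: trace_smooth(1)[OF one] N_def)
 then show "\<not> ae_zero_on \<Omega> (\<lambda>_. 1)" using ae_zero[OF W_smooth(1)[OF one]] by blast
 show "(\<lambda>_. 1) \<in> W" by (rule W_smooth(1)[OF one])
 have "AE x in L\<Omega>. wgrad \<Omega> (\<lambda>_. 1) x = 0" using W_smooth(2)[OF one] by simp
 then have "A r (wgrad \<Omega> (\<lambda>_. 1)) h = 0" for r h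
  by (intro integral_eq_zero_AE) (auto elim!: eventually_mono)
 then show "A p (wgrad \<Omega> (\<lambda>_. 1)) (wgrad \<Omega> v) + A q (wgrad \<Omega> (\<lambda>_. 1)) (wgrad \<Omega> v) = 0 * B (\<lambda>_. 1) (T (\<lambda>_. 1)) v (T v)" for v
  by simp
qed

lemma lambda1_le:
 assumes "u \<in> W" "N u (T u) = m u (T u)" "Mass u (T u) \<noteq> 0"
 shows "lambda1 \<Omega> p q a b \<le> ereal (E q (wgrad \<Omega> u) / Mass u (T u))"
 using assms ae_zero unfolding lambda1_def
 by (intro INF_lower2[of u]) (auto simp: constraint_iff rayleigh_quotient_def weighted_mass_eq)

text \<open>If \<open>\<mu> \<le> lambda1\<close>, the test with \<open>u\<close> gives
  \<open>E p + E q = \<mu> * Mass \<le> E q\<close>, so the gradient vanishes; as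
  \<open>\<mu> \<noteq> 0\<close>, so does the mass, and \<open>u\<close> with it. Negative \<mu>
  are covered by the same chain.\<close>

lemma eigenvalue_above:
 assumes "eigenvalue \<Omega> p q a b \<mu>" "\<mu> \<noteq> 0"
 shows "lambda1 \<Omega> p q a b < ereal \<mu>"
proof (rule ccontr)
 assume "\<not> lambda1 \<Omega> p q a b < ereal \<mu>"
 then have le: "ereal \<mu> \<le> lambda1 \<Omega> p q a b" by simp
 obtain u where u: "u \<in> W" "\<not> ae_zero_on \<Omega> u"
  and eq: "\<And>v. v \<in> W \<Longrightarrow> A p (wgrad \<Omega> u) (wgrad \<Omega> v) + A q (wgrad \<Omega> u) (wgrad \<Omega> v) = \<mu> * B u (T u) v (T v)"
  using assms(1) unfolding eigenvalue_iff by blast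
 obtain \<phi> where c: "conv s \<phi> u (wgrad \<Omega> u) (T u)" using W_conv[OF u(1)] by blast
 note one = smooth_const[of 1]
 have "AE x in L\<Omega>. wgrad \<Omega> (\<lambda>_. 1) x = 0" using W_smooth(2)[OF one] by simp
 then have "A r g (wgrad \<Omega> (\<lambda>_. 1)) = 0" for r g
  by (intro integral_eq_zero_AE) (auto elim!: eventually_mono)
 then have "B u (T u) (\<lambda>_. 1) (\<lambda>_. 1) = 0"
  using eq[OF W_smooth(1)[OF one]] assms(2) by (simp add: trace_smooth(3)[OF one u(1)])
 then have N: "N u (T u) = m u (T u)" by (simp add: critical_iff[OF W_Lp(4)[OF u(1)]])
 have "B u (T u) u (T u) = Mass u (T u)" using dual_pow_inner_self[of q "_ :: real"] by (simp add: B_def Mass_def)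
 then have PQ: "E p (wgrad \<Omega> u) + E q (wgrad \<Omega> u) = \<mu> * Mass u (T u)"
  using eq[OF u(1)] by (simp add: dual_pow_inner_self)
 have nn: "0 \<le> E p (wgrad \<Omega> u)" "0 \<le> E q (wgrad \<Omega> u)" by simp_all
 have "\<mu> * Mass u (T u) \<le> E q (wgrad \<Omega> u)"
 proof (cases "Mass u (T u) = 0")
  case False
  then have "0 < Mass u (T u)" by (rule Mass_pos)
  then show ?thesis using order_trans[OF le lambda1_le[OF u(1) N False]] by (simp add: pos_le_divide_eq)
 qed (use nn in simp)
 then have Ep: "E p (wgrad \<Omega> u) = 0" using PQ nn by linarith
 have "AE x in L\<Omega>. wgrad \<Omega> u x = 0"
  by (rule Lnorm_eq_0[OF Lp_mono_exponent(1)[OF finite_L\<Omega> W_Lp(2)[OF u(1)] exponents(5,8)] exponents(4)])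
   (simp add: Lnorm_def Ep)
 then have Eq: "E q (wgrad \<Omega> u) = 0" by (intro integral_eq_zero_AE) (auto elim!: eventually_mono)
 then have "Mass u (T u) = 0" using PQ Ep assms(2) by simp
 then have "AE x in L\<Omega>. u x = 0" by (rule zero_of_null_energy[OF c Eq])
 then show False using u(2) by (simp add: ae_zero_on_def)
qed

text \<open>On the constraint set \<open>Mass\<close> equals \<open>m powr q\<close>, so the
  Poincare inequality for \<open>m\<close> bounds every quotient from below by
  \<open>1 / K\<close>.\<close>

lemma lambda1_pos: "0 < lambda1 \<Omega> p q a b"
proof -
 obtain K where K: "0 < K" "\<And>\<phi> u g t. conv s \<phi> u g t \<Longrightarrow> m u t powr q \<le> K * E q g"
  using m_poincare by blast
 have "ereal (1 / K) \<le> lambda1 \<Omega> p q a b"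
  unfolding lambda1_def
 proof (rule INF_greatest)
  fix w assume "w \<in> {w \<in> constraint_set \<Omega> p q a b. \<not> ae_zero_on \<Omega> w}"
  then have w: "w \<in> W" "N w (T w) = m w (T w)" by (auto simp: constraint_iff)
  have le: "Mass w (T w) \<le> K * E q (wgrad \<Omega> w)" using K(2) W_conv[OF w(1)] N_powr[of w "T w"] w(2) by metis
  show "ereal (1 / K) \<le> rayleigh_quotient \<Omega> p q a b w"
  proof (cases "Mass w (T w) = 0")
   case False
   then have "0 < Mass w (T w)" by (rule Mass_pos)
   then have "1 / K \<le> E q (wgrad \<Omega> w) / Mass w (T w)" using le K(1) by (simp add: field_simps)
   then show ?thesis using False by (simp add: rayleigh_quotient_def weighted_mass_eq[OF w(1)])
  qed (simp add: rayleigh_quotient_def weighted_mass_eq[OF w(1)])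
 qed
 then show ?thesis using K(1) by (smt (verit) ereal_less(2) less_le_trans zero_less_divide_1_iff)
qed

text \<open>A competitor with quotient below \<mu> has positive \<open>F\<close>, and so has a
  smooth function close to it, which starts the minimisation. The resulting triple is matched with
  the chosen representatives of gradient and trace.\<close>

lemma eigenvalue_existence:
 assumes "lambda1 \<Omega> p q a b < ereal \<mu>"
 shows "eigenvalue \<Omega> p q a b \<mu>"
proof -
 have \<mu>: "0 < \<mu>" using less_trans[OF lambda1_pos assms] by simp
 obtain w where "w \<in> constraint_set \<Omega> p q a b" and r: "rayleigh_quotient \<Omega> p q a b w < ereal \<mu>"
  using assms unfolding lambda1_def INF_less_iff by auto
 then have w: "w \<in> W" "N w (T w) = m w (T w)" by (auto simp: constraint_iff)
 have M: "0 < Mass w (T w)" "E q (wgrad \<Omega> w) < \<mu> * Mass w (T w)"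
 proof -
  have "Mass w (T w) \<noteq> 0" using r by (auto simp: rayleigh_quotient_def weighted_mass_eq[OF w(1)])
  then show p: "0 < Mass w (T w)" by (rule Mass_pos)
  then show "E q (wgrad \<Omega> w) < \<mu> * Mass w (T w)"
   using r by (simp add: rayleigh_quotient_def weighted_mass_eq[OF w(1)] pos_divide_less_eq)
 qed
 obtain \<phi> where c: "conv s \<phi> w (wgrad \<Omega> w) (T w)" using W_conv[OF w(1)] by blast
 have "0 < F \<mu> w (T w) (wgrad \<Omega> w)" using M w(2) by (simp add: F_def flip: N_powr)
 then obtain n where n: "0 < J \<mu> (\<phi> n)"
  using eventually_happens[OF order_tendstoD(1)[OF F_conv[OF c]]] by auto
 obtain \<psi> u g t where u: "conv s \<psi> u g t" "0 < Mass u t"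
  and eq: "\<And>\<psi> v h r. conv s \<psi> v h r \<Longrightarrow> A p g h + A q g h = \<mu> * B u t v r"
  using euler[OF \<mu> convD(1)[OF c] n] by blast
 note W = conv_Sobolev[OF u(1) exponents(7)]
 note tm = LpD(1)[OF convD(4)[OF u(1)]] LpD(1)[OF W_Lp(3)[OF W(1)]]
 note [measurable] = LpD(1)[OF convD(3)[OF u(1)]] LpD(1)[OF W_Lp(2)[OF W(1)]]
 show ?thesis
  unfolding eigenvalue_iff
 proof (intro bexI conjI ballI)
  show "u \<in> W" by (rule W(1))
  have "Mass u (T u) = Mass u t" by (rule trace_cong(1)[OF W(3) tm(2,1)])
  then show "\<not> ae_zero_on \<Omega> u" using ae_zero[OF W(1)] u(2) by auto
  fix v assume v: "v \<in> W"
  note [measurable] = LpD(1)[OF W_Lp(2)[OF v]]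
  have A: "A r (wgrad \<Omega> u) (wgrad \<Omega> v) = A r g (wgrad \<Omega> v)" for r
   using W(2) by (intro integral_cong_AE) auto
  have "B u (T u) v (T v) = B u t v (T v)"
   by (rule trace_cong(3)[OF W(3) tm(2,1) LpD(1)[OF W_Lp(3)[OF v]]])
  then show "A p (wgrad \<Omega> u) (wgrad \<Omega> v) + A q (wgrad \<Omega> u) (wgrad \<Omega> v) = \<mu> * B u (T u) v (T v)"
   using W_conv[OF v] eq by (auto simp: A)
 qed
qed

text \<open>Sets of diameter \<open>0\<close> cost nothing in Hausdorff measure of dimension
  \<open>DIM('a) - 1\<close>, which is at least \<open>1\<close> here; in dimension \<open>0\<close>
  a point would have positive mass because \<open>0 ^ 0 = 1\<close>.\<close>

lemma AE_not_point: "AE x in L\<Omega>. x \<noteq> z" "AE x in \<sigma>. x \<noteq> z"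
proof -
 have "AE x in lborel. x \<noteq> z" by (rule AE_lborel_singleton)
 then show "AE x in L\<Omega>. x \<noteq> z" by (auto simp: AE_lebesgue_on_iff elim!: eventually_mono)
 have "hausdorff_pre (DIM('a) - 1) \<delta> {z} = 0" if "0 < \<delta>" for \<delta>
  using hausdorff_pre_le_finite_cover[of "{()}" "{z}" "\<lambda>_. {z}" 0 \<delta> "DIM('a) - 1"] that dim by (simp add: power_0_left)
 then have "emeasure H {z} = 0"
  using emeasure_hausdorff_le[of "DIM('a) - 1" "{z}"] by (simp add: hausdorff_outer_def SUP_constant)
 then have "(\<integral>\<^sup>+x. indicator {z} x \<partial>H) = 0" by (subst nn_integral_indicator) (simp_all add: sets_hausdorff)
 moreover have "(\<integral>\<^sup>+x. indicator {z} x \<partial>\<sigma>) \<le> (\<integral>\<^sup>+x. indicator {z} x \<partial>H)"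
  unfolding nn_integral_\<sigma> by (intro nn_integral_mono) (auto simp: indicator_def)
 ultimately have "(\<integral>\<^sup>+x. indicator {z} x \<partial>\<sigma>) = 0" by simp
 then have "AE x in \<sigma>. indicator {z} x = (0 :: ennreal)"
  by (subst (asm) nn_integral_0_iff_AE) (auto intro!: borel_measurable_\<sigma>I)
 then show "AE x in \<sigma>. x \<noteq> z" by (auto elim!: eventually_mono)
qed

text \<open>If all coordinate functions were constant almost everywhere for both weighted measures,
 these would be concentrated at a single point.\<close>

lemma coordinate_not_constant: "\<exists>i\<in>Basis. 0 < m (\<lambda>x. x \<bullet> i) (\<lambda>x. x \<bullet> i)"
proof (rule ccontr)
 assume neg: "\<not> ?thesis"
 have m0: "m (\<lambda>x. x \<bullet> i) (\<lambda>x. x \<bullet> i) = 0" if i: "i \<in> Basis" for i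
 proof -
  have "\<not> 0 < m (\<lambda>x. x \<bullet> i) (\<lambda>x. x \<bullet> i)" using neg i by blast
  then show ?thesis by (simp add: less_le)
 qed
 have "\<forall>i\<in>Basis. \<exists>c. (AE x in Ma. x \<bullet> i = c) \<and> (AE x in Mb. x \<bullet> i = c)"
 proof
  fix i :: 'a assume i: "i \<in> Basis"
  obtain c where c: "N (\<lambda>x. x \<bullet> i + c) (\<lambda>x. x \<bullet> i + c) = 0"
   using m_attained[OF X_smooth[OF smooth_inner[of i]]] m0[OF i] by auto
  note X = X_smooth[OF smooth_add[OF smooth_inner[of i] smooth_const[of c]]]
  have "Mass (\<lambda>x. x \<bullet> i + c) (\<lambda>x. x \<bullet> i + c) = 0" using N_powr[of "\<lambda>x. x \<bullet> i + c" "\<lambda>x. x \<bullet> i + c"] c by simp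
  then have "(LINT x|Ma. \<bar>x \<bullet> i + c\<bar> powr q) = 0" "(LINT x|Mb. \<bar>x \<bullet> i + c\<bar> powr q) = 0"
   unfolding Mass_def by (smt (verit) integral_nonneg_AE always_eventually powr_ge_zero)+
  then have "AE x in Ma. x \<bullet> i + c = 0" "AE x in Mb. x \<bullet> i + c = 0"
   using Lnorm_eq_0[OF conjunct1[OF X] exponents(3)] Lnorm_eq_0[OF conjunct2[OF X] exponents(3)] by (auto simp: Lnorm_def)
  then show "\<exists>c. (AE x in Ma. x \<bullet> i = c) \<and> (AE x in Mb. x \<bullet> i = c)"
   by (intro exI[of _ "- c"]) (auto elim!: eventually_mono)
 qed
 then obtain c where c: "\<And>i. i \<in> Basis \<Longrightarrow> AE x in Ma. x \<bullet> i = c i" "\<And>i. i \<in> Basis \<Longrightarrow> AE x in Mb. x \<bullet> i = c i" by metis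
 define z :: 'a where "z = (\<Sum>i\<in>Basis. c i *\<^sub>R i)"
 have z: "x = z" if "\<forall>i\<in>Basis. x \<bullet> i = c i" for x
  using that by (auto simp: z_def intro: euclidean_eqI)
 have "AE x in Ma. \<forall>i\<in>Basis. x \<bullet> i = c i" "AE x in Mb. \<forall>i\<in>Basis. x \<bullet> i = c i"
  by (rule AE_finite_allI[OF finite_Basis c(1)] AE_finite_allI[OF finite_Basis c(2)]; assumption)+
 then have "AE x in Ma. False" "AE x in Mb. False"
  using AE_weights(1)[OF AE_not_point(1)[of z]] AE_weights(2)[OF AE_not_point(2)[of z]] z by (auto elim: eventually_elim2)
 then have "ae_filter Ma = bot" "ae_filter Mb = bot" unfolding trivial_limit_def .
 then have "emeasure Ma (space Ma) = 0" "emeasure Mb (space Mb) = 0" unfolding ae_filter_eq_bot_iff .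
 then show False using nontrivial by (simp add: measure_def)
qed

text \<open>A suitable coordinate function, shifted by its optimal constant, is smooth, satisfies
  the constraint and has positive mass, so it is a competitor with a finite quotient.\<close>

lemma lambda1_finite: "lambda1 \<Omega> p q a b < \<infinity>"
proof -
 obtain i where i: "0 < m (\<lambda>x. x \<bullet> i) (\<lambda>x. x \<bullet> i)" using coordinate_not_constant by blast
 obtain c where c: "N (\<lambda>x. x \<bullet> i + c) (\<lambda>x. x \<bullet> i + c) = m (\<lambda>x. x \<bullet> i) (\<lambda>x. x \<bullet> i)"
  using m_attained[OF X_smooth[OF smooth_inner[of i]]] by blast
 let ?w = "\<lambda>x. x \<bullet> i + c"
 have w: "smooth ?w" by (intro smooth_add smooth_inner smooth_const)
 have "lambda1 \<Omega> p q a b \<le> ereal (E q (wgrad \<Omega> ?w) / Mass ?w (T ?w))"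
 proof (rule lambda1_le[OF W_smooth(1)[OF w]])
  show "N ?w (T ?w) = m ?w (T ?w)" unfolding N_def trace_smooth[OF w] using c by (simp add: N_def m_shift)
  show "Mass ?w (T ?w) \<noteq> 0" unfolding trace_smooth[OF w] using c i N_powr[of ?w ?w] by auto
 qed
 then show ?thesis by (rule le_less_trans) simp
qed

end

theorem theorem3p1:
  fixes \<Omega> :: "(real ^ 'n) set"
    and p q :: real
    and a b :: "real ^ 'n \<Rightarrow> real"
  assumes "CARD('n) \<ge> 2"
    and "bounded_smooth_domain \<Omega>"
    and "1 < p" and "2 < q" and "p \<noteq> q"
    and "a \<in> Linf (lebesgue_on \<Omega>)" and "AE x in lebesgue_on \<Omega>. 0 \<le> a x"
    and "b \<in> Linf (surface_measure \<Omega>)" and "AE x in surface_measure \<Omega>. 0 \<le> b x"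
    and "(LINT x|lebesgue_on \<Omega>. a x) + (LINT x|surface_measure \<Omega>. b x) > 0"
  shows "0 < lambda1 \<Omega> p q a b \<and> lambda1 \<Omega> p q a b < \<infinity> \<and>
         {\<mu>. eigenvalue \<Omega> p q a b \<mu>} = {0} \<union> {\<mu>. lambda1 \<Omega> p q a b < ereal \<mu>}"
proof -
 interpret eigenvalue_problem \<Omega> p q a b
  by unfold_locales (use assms in \<open>simp_all add: bounded_smooth_domain_def\<close>)
 show ?thesis
  using lambda1_pos lambda1_finite eigenvalue_zero eigenvalue_above eigenvalue_existence by auto
qed

end
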